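(* Let $m,n\in\mathbb{N}$ and assume that $F\in L^\infty(\mathbb{R}^n,\mathbb{C}^{m\times m})$. Then the following conditions (i) and (ii) are equivalent: (i) $F(-i\nabla)|_{C_0^\infty(\mathbb{R}^n,\mathbb{C}^{m\times m})}$ can be extended to a bounded operator (denoted by the same symbol) $F(-i\nabla)\in\mathcal{B}\big(L^1(\mathbb{R}^n,\mathbb{C}^{m\times m})\big)$. (ii) There exists a measure $\mu\in\mathcal{M}(\mathbb{R}^n,\mathbb{C}^{m\times m})$ such that $F(x)=\mu^\wedge(x)$, $x\in\mathbb{R}^n$ (as elements of $L^\infty(\mathbb{R}^n,\mathbb{C}^{m\times m})$). In addition, if one of conditions (i) or (ii) holds, then $$(2\pi)^{-n/2}N(\mu)\le\|F(-i\nabla)\|_{\mathcal{B}((L^1(\mathbb{R}^n,\mathbb{C}^{m\times m}),\,|||\cdot|||_{1,m}))}\le m(2\pi)^{-n/2}N(\mu).$$ Both of these estimates are sharp (that is, the constants $(2\pi)^{-n/2}$ and $m(2\pi)^{-n/2}$ are best possible).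
   Context: $L^1(\mathbb{R}^n,\mathbb{C}^{m\times m})$ and $L^\infty(\mathbb{R}^n,\mathbb{C}^{m\times m})$ are the spaces of (a.e. equivalence classes of) measurable $\mathbb{C}^{m\times m}$-valued functions with $\|f\|_{1,m}=\int_{\mathbb{R}^n}\|f(x)\|_{\mathcal{B}(\mathbb{C}^m)}\,d^nx<\infty$, respectively $\|f\|_{\infty,m}=\operatorname{ess\,sup}_x\|f(x)\|_{\mathcal{B}(\mathbb{C}^m)}<\infty$ ($\|\cdot\|_{\mathcal{B}(\mathbb{C}^m)}$ the operator norm). An equivalent norm on $L^1(\mathbb{R}^n,\mathbb{C}^{m\times m})$ is $|||f|||_{1,m}=\sum_{j,k=1}^m\|f_{j,k}\|_{L^1(\mathbb{R}^n)}$. $\mathcal{M}(\mathbb{R}^n,\mathbb{C}^{m\times m})$ is the set of countably additive $\mu=\{\mu_{j,k}\}_{1\le j,k\le m}\colon\{\text{Borel sets of }\mathbb{R}^n\}\to\mathbb{C}^{m\times m}$ (i.e., each $\mu_{j,k}$ is a finite complex measure), and $N(\mu)=\max_{1\le j,k\le m}|\mu_{j,k}|(\mathbb{R}^n)$, with $|\mu_{j,k}|$ the total variation measure. Its Fourier transform is $\mu^\wedge(x)=(2\pi)^{-n/2}\int_{\mathbb{R}^n}e^{-ix\cdot\xi}\,d\mu(\xi)$ (entrywise). Fourier transforms of functions (entrywise): $f^\wedge(y)=(2\pi)^{-n/2}\int e^{-iy\cdot x}f(x)\,d^nx$, $g^\vee(x)=(2\pi)^{-n/2}\int e^{ix\cdot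 y}g(y)\,d^ny$. For $F\in L^\infty(\mathbb{R}^n,\mathbb{C}^{m\times m})$, $F(-i\nabla)f=(f^\wedge F)^\vee$, where $f^\wedge F$ is the pointwise matrix product with $F$ on the right. *)

theory Defs
  imports "HOL-Analysis.Analysis" "HOL-Probability.Essential_Supremum"
begin

section \<open>Spaces of matrix-valued functions\<close>

text \<open>
  Functions are kept as representatives; two functions describe the same element of
  \<open>L\<^sup>1\<close> or \<open>L\<^sup>\<infinity>\<close> iff they agree almost everywhere for Lebesgue measure.
\<close>

definition mat_opnorm :: "complex^'m^'m \<Rightarrow> real" where
  "mat_opnorm A = onorm (\<lambda>v. A *v v)"

definition L1_space :: "(real^'n \<Rightarrow> complex^'m^'m) set" where
  "L1_space = {f \<in> borel_measurable lebesgue. integrable lebesgue (\<lambda>x. mat_opnorm (f x))}"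

definition L1_norm :: "(real^'n \<Rightarrow> complex^'m^'m) \<Rightarrow> real" where
  "L1_norm f = (LINT x|lebesgue. mat_opnorm (f x))"

text \<open>The equivalent norm \<open>|||f|||\<close>, the sum of the \<open>L\<^sup>1\<close>-norms of the entries.\<close>

definition L1_entry_norm :: "(real^'n \<Rightarrow> complex^'m^'m) \<Rightarrow> real" where
  "L1_entry_norm f = (\<Sum>j\<in>UNIV. \<Sum>k\<in>UNIV. LINT x|lebesgue. cmod (f x $ j $ k))"

definition Linfty_space :: "(real^'n \<Rightarrow> complex^'m^'m) set" where
  "Linfty_space = {F \<in> borel_measurable lebesgue.
     esssup lebesgue (\<lambda>x. ereal (mat_opnorm (F x))) < \<infinity>}"

text \<open>A function is \<open>C\<^sup>k\<^sup>+\<^sup>1\<close> iff it is differentiable and its partial derivatives are \<open>C\<^sup>k\<close>.\<close>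

primrec C_k :: "nat \<Rightarrow> (real^'n \<Rightarrow> 'b::real_normed_vector) \<Rightarrow> bool" where
  "C_k 0 f \<longleftrightarrow> continuous_on UNIV f"
| "C_k (Suc k) f \<longleftrightarrow> f differentiable_on UNIV \<and>
     (\<forall>i. C_k k (\<lambda>x. frechet_derivative f (at x) (axis i 1)))"

definition C0_infty :: "(real^'n \<Rightarrow> complex^'m^'m) set" where
  "C0_infty = {f. (\<forall>k. C_k k f) \<and> compact (closure {x. f x \<noteq> 0})}"

section \<open>Complex measures on the Borel sets\<close>

text \<open>Only the values on Borel sets are relevant.\<close>

definition complex_measure :: "('a::topological_space set \<Rightarrow> complex) \<Rightarrow> bool" where
  "complex_measure \<nu> \<longleftrightarrow>
     \<nu> {} = 0 \<and>
     (\<forall>A :: nat \<Rightarrow> 'a set. range A \<subseteq> sets borel \<longrightarrow> disjoint_family A \<longrightarrow>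
        (\<lambda>i. \<nu> (A i)) sums \<nu> (\<Union>i. A i))"

definition total_variation :: "('a::topological_space set \<Rightarrow> complex) \<Rightarrow> 'a set \<Rightarrow> ennreal" where
  "total_variation \<nu> E =
     (SUP A \<in> {A :: nat \<Rightarrow> 'a set. range A \<subseteq> sets borel \<and> disjoint_family A \<and> (\<Union>i. A i) = E}.
        \<Sum>i. ennreal (cmod (\<nu> (A i))))"

text \<open>
  For a finite real-valued countably additive \<open>\<nu>\<close>, the positive part \<open>\<nu>\<^sup>+\<close> of its Jordan
  decomposition is \<open>\<nu>\<^sup>+ E = sup {\<nu> B | B \<subseteq> E Borel}\<close>, and \<open>\<nu>\<^sup>- = (- \<nu>)\<^sup>+\<close>. Negative values of
  \<open>\<nu> B\<close>, which \<open>ennreal\<close> sends to \<open>0\<close>, do not affect the supremum since \<open>\<nu> {} = 0\<close>.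
\<close>

definition positive_part :: "('a::topological_space set \<Rightarrow> real) \<Rightarrow> 'a measure" where
  "positive_part \<nu> = measure_of UNIV (sets borel)
     (\<lambda>E. SUP B \<in> {B \<in> sets borel. B \<subseteq> E}. ennreal (\<nu> B))"

definition complex_measure_integral ::
    "('a::topological_space set \<Rightarrow> complex) \<Rightarrow> ('a \<Rightarrow> complex) \<Rightarrow> complex" where
  "complex_measure_integral \<nu> f =
     ((LINT x|positive_part (\<lambda>E. Re (\<nu> E)). f x) - (LINT x|positive_part (\<lambda>E. - Re (\<nu> E)). f x))
     + \<i> * ((LINT x|positive_part (\<lambda>E. Im (\<nu> E)). f x) - (LINT x|positive_part (\<lambda>E. - Im (\<nu> E)). f x))"

definition matrix_measures :: "((real^'n) set \<Rightarrow> complex^'m^'m) set" where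
  "matrix_measures = {\<mu>. \<forall>j k. complex_measure (\<lambda>E. \<mu> E $ j $ k)}"

text \<open>\<open>enn2real\<close> is harmless: the total variation of a complex measure is finite.\<close>

definition measure_N :: "((real^'n) set \<Rightarrow> complex^'m^'m) \<Rightarrow> real" where
  "measure_N \<mu> = Max (range (\<lambda>(j, k). enn2real (total_variation (\<lambda>E. \<mu> E $ j $ k) UNIV)))"

section \<open>Fourier transforms\<close>

definition fourier_const :: "'n::finite itself \<Rightarrow> real" where
  "fourier_const _ = (2 * pi) powr (- real CARD('n) / 2)"

definition fourier :: "(real^'n \<Rightarrow> complex^'m^'m) \<Rightarrow> real^'n \<Rightarrow> complex^'m^'m" where
  "fourier f y = (\<chi> j k. of_real (fourier_const TYPE('n)) *
     (LINT x|lebesgue. exp (- \<i> * of_real (y \<bullet> x)) * f x $ j $ k))"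

definition inverse_fourier :: "(real^'n \<Rightarrow> complex^'m^'m) \<Rightarrow> real^'n \<Rightarrow> complex^'m^'m" where
  "inverse_fourier g x = (\<chi> j k. of_real (fourier_const TYPE('n)) *
     (LINT y|lebesgue. exp (\<i> * of_real (x \<bullet> y)) * g y $ j $ k))"

definition measure_fourier :: "((real^'n) set \<Rightarrow> complex^'m^'m) \<Rightarrow> real^'n \<Rightarrow> complex^'m^'m" where
  "measure_fourier \<mu> x = (\<chi> j k. of_real (fourier_const TYPE('n)) *
     complex_measure_integral (\<lambda>E. \<mu> E $ j $ k) (\<lambda>\<xi>. exp (- \<i> * of_real (x \<bullet> \<xi>))))"

section \<open>Multipliers and bounded operators on \<open>L\<^sup>1\<close>\<close>

definition multiplier ::
    "(real^'n \<Rightarrow> complex^'m^'m) \<Rightarrow> (real^'n \<Rightarrow> complex^'m^'m) \<Rightarrow> real^'n \<Rightarrow> complex^'m^'m" where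
  "multiplier F f = inverse_fourier (\<lambda>y. fourier f y ** F y)"

text \<open>
  Bounded complex-linear operators on \<open>L\<^sup>1\<close>, acting on representatives. Additivity and
  boundedness imply that such an operator respects equality almost everywhere.
\<close>

definition bounded_operator_L1 ::
    "((real^'n \<Rightarrow> complex^'m^'m) \<Rightarrow> (real^'n \<Rightarrow> complex^'m^'m)) \<Rightarrow> bool" where
  "bounded_operator_L1 T \<longleftrightarrow>
     (\<forall>f\<in>L1_space. T f \<in> L1_space) \<and>
     (\<forall>f\<in>L1_space. \<forall>g\<in>L1_space. AE x in lebesgue. T (\<lambda>x. f x + g x) x = T f x + T g x) \<and>
     (\<forall>c :: complex. \<forall>f\<in>L1_space.
        AE x in lebesgue. T (\<lambda>x. \<chi> j k. c * f x $ j $ k) x = (\<chi> j k. c * T f x $ j $ k)) \<and>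
     (\<exists>B. \<forall>f\<in>L1_space. L1_norm (T f) \<le> B * L1_norm f)"

definition bounded_extension_L1 ::
    "(real^'n \<Rightarrow> complex^'m^'m) \<Rightarrow>
     ((real^'n \<Rightarrow> complex^'m^'m) \<Rightarrow> (real^'n \<Rightarrow> complex^'m^'m)) \<Rightarrow> bool" where
  "bounded_extension_L1 F T \<longleftrightarrow> bounded_operator_L1 T \<and>
     (\<forall>f\<in>C0_infty. AE x in lebesgue. T f x = multiplier F f x)"

text \<open>
  The operator norm with respect to \<open>|||\<cdot>|||\<close>. As in \<open>onorm\<close>, functions of norm \<open>0\<close>
  contribute \<open>0\<close> because \<open>x / 0 = 0\<close>.
\<close>

definition L1_entry_onorm ::
    "((real^'n \<Rightarrow> complex^'m^'m) \<Rightarrow> (real^'n \<Rightarrow> complex^'m^'m)) \<Rightarrow> real" where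
  "L1_entry_onorm T = (SUP f\<in>L1_space. L1_entry_norm (T f) / L1_entry_norm f)"

end

theory Submission
  imports Defs "HOL-Real_Asymp.Real_Asymp" "HOL-Probability.Characteristic_Functions" "HOL-Probability.Sinc_Integral"
    "HOL-Complex_Analysis.Great_Picard" "HOL-Probability.Projective_Limit"
begin

text \<open>Every entry of \<open>\<mu>\<close> has a polar decomposition \<open>s d|\<mu>\<^sub>l\<^sub>k|\<close> with \<open>|s| = 1\<close>.

  For (ii) \<open>\<Longrightarrow>\<close> (i), Fourier inversion on test functions turns the multiplier into convolution:
  \<open>F(-i\<nabla>) f = (2\<pi>)\<^sup>-\<^sup>n\<^sup>/\<^sup>2 f * \<mu>\<close> with the row-by-column product, which is bounded on \<open>L\<^sup>1\<close>. Approximating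
  a point mass in row \<open>l\<close> shows that its norm for \<open>|||\<cdot>|||\<close> is \<open>(2\<pi>)\<^sup>-\<^sup>n\<^sup>/\<^sup>2 max\<^sub>l \<Sum>\<^sub>k |\<mu>\<^sub>l\<^sub>k|(\<real>\<^sup>n)\<close>, which lies
  between the two bounds and attains each of them for suitable point masses.

  For (i) \<open>\<Longrightarrow>\<close> (ii), apply the operator to a mollifier in a single entry. The images are bounded in
  \<open>L\<^sup>1\<close>, hence have a subsequence that converges vaguely to a complex measure, and testing with
  Fourier transforms of bumps identifies the transform of the limit with the entry of \<open>F\<close>.\<close>

section \<open>Jordan and polar decomposition of complex measures\<close>

text \<open>The unit ball of \<open>L^1\<close> is not weakly compact, so the images of mollifiers
  are followed into the finite measures. Mass may escape to infinity there, but the test functions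
  are Fourier transforms of smooth compactly supported functions, whose decay makes escaping mass
  invisible. The integral against a complex measure is defined through four Jordan parts, while
  computations use a density against one finite measure; both are shown to agree for every density.
  The multiplier has \<open>F\<close> on the right of the transform, so the rows of \<open>f\<close>
  do not interact: entry \<open>(j, l)\<close> reaches only the entries \<open>(j, k)\<close>, with
  weights the total masses of the entries \<open>(l, k)\<close> of the measure. Hence the norm is a
  maximum of row sums, and the factor \<open>m\<close> counts the terms of a row. Functions are
  representatives for Lebesgue measure, whereas the measure may charge Lebesgue null sets, so
  convolutions are formed with Borel versions. As test functions are dense, bounded extensions agree
  almost everywhere, and estimates for the convolution operator hold for every extension.\<close>

locale signed_measure =
  fixes \<nu> :: "'a::topological_space set \<Rightarrow> real"
  assumes empty: "\<nu> {} = 0"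
    and sums: "\<And>A :: nat \<Rightarrow> 'a set. range A \<subseteq> sets borel \<Longrightarrow> disjoint_family A \<Longrightarrow>
      (\<lambda>i. \<nu> (A i)) sums \<nu> (\<Union>i. A i)"
begin

lemma union:
  assumes "A \<in> sets borel" "B \<in> sets borel" "A \<inter> B = {}"
  shows "\<nu> (A \<union> B) = \<nu> A + \<nu> B"
proof -
  have "(\<lambda>i. \<nu> (binaryset A B i)) sums \<nu> (\<Union>i. binaryset A B i)"
    using assms by (intro sums) (auto simp: range_binaryset_eq disjoint_family_on_def binaryset_def)
  then show ?thesis
    using binaryset_sums[of \<nu> A B] empty by (simp add: UN_binaryset_eq sums_unique2)
qed

lemma diff:
  assumes "A \<in> sets borel" "B \<in> sets borel" "B \<subseteq> A"
  shows "\<nu> (A - B) = \<nu> A - \<nu> B"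
  using union[of "A - B" B] assms by (simp add: Un_absorb2 Diff_disjoint inf_commute)

text \<open>The set function behind \<open>positive_part\<close>, named separately because
  \<open>measure_of\<close> reproduces it only once countable additivity is proved.\<close>

definition pos :: "'a set \<Rightarrow> ennreal" where
  "pos E = (SUP B \<in> {B \<in> sets borel. B \<subseteq> E}. ennreal (\<nu> B))"

lemma le_pos: "B \<in> sets borel \<Longrightarrow> B \<subseteq> E \<Longrightarrow> ennreal (\<nu> B) \<le> pos E"
  unfolding pos_def by (rule SUP_upper) auto

lemma pos_mono: "A \<subseteq> E \<Longrightarrow> pos A \<le> pos E"
  unfolding pos_def by (rule SUP_subset_mono) auto

text \<open>Borel sets \<open>C \<subseteq> A\<close> and \<open>D \<subseteq> B\<close> are
  disjoint, so their values add up to the value of a competitor for the union. Taking suprema over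
  \<open>C\<close> and \<open>D\<close> in turn gives the claim.\<close>

lemma pos_union_ge:
  assumes "A \<in> sets borel" "B \<in> sets borel" "A \<inter> B = {}"
  shows "pos A + pos B \<le> pos (A \<union> B)"
proof -
  have ne: "{B \<in> sets borel. B \<subseteq> E} \<noteq> {}" for E :: "'a set" by auto
  have 1: "ennreal (\<nu> C) + ennreal (\<nu> D) \<le> pos (A \<union> B)"
    if "C \<in> sets borel" "C \<subseteq> A" "D \<in> sets borel" "D \<subseteq> B" for C D
  proof -
    have "C \<inter> D = {}" using that assms by auto
    then have u: "\<nu> (C \<union> D) = \<nu> C + \<nu> D" using union that by auto
    have l: "ennreal (\<nu> (C \<union> D)) \<le> pos (A \<union> B)" "ennreal (\<nu> C) \<le> pos (A \<union> B)"
      "ennreal (\<nu> D) \<le> pos (A \<union> B)" using that by (auto intro!: le_pos)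
    show ?thesis
    \<comment> \<open>A negative value becomes 0 under \<open>ennreal\<close>; then the sum is at
      most the other summand alone.\<close>
    proof (cases "\<nu> C \<ge> 0 \<and> \<nu> D \<ge> 0")
      case True
      then show ?thesis using l u by (simp add: ennreal_plus)
    next
      case False
      then show ?thesis using l by (auto simp: ennreal_neg)
    qed
  qed
  have "ennreal (\<nu> C) + pos B \<le> pos (A \<union> B)" if "C \<in> sets borel" "C \<subseteq> A" for C
    unfolding pos_def[of B] ennreal_SUP_add_right[OF ne] using 1 that by (intro SUP_least) auto
  then show ?thesis
    unfolding pos_def[of A] by (subst ennreal_SUP_add_left[OF ne, symmetric]) (intro SUP_least, auto)
qed

text \<open>A competitor \<open>B\<close> for the union is cut along the \<open>A i\<close>. The
  partial sums of the pieces converge to \<open>\<nu> B\<close>, and raising negative pieces to 0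
  leaves terms bounded by \<open>pos (A i)\<close>.\<close>

lemma pos_UN_le:
  assumes A: "range A \<subseteq> sets borel" "disjoint_family A"
  shows "pos (\<Union>i. A i) \<le> (\<Sum>i. pos (A i))"
  unfolding pos_def[of "\<Union>i. A i"]
proof (rule SUP_least)
  fix B assume B: "B \<in> {B \<in> sets borel. B \<subseteq> (\<Union>i. A i)}"
  have "(\<lambda>i. \<nu> (B \<inter> A i)) sums \<nu> (\<Union>i. B \<inter> A i)"
    using A B by (intro sums) (auto simp: disjoint_family_on_def)
  moreover have "(\<Union>i. B \<inter> A i) = B" using B by auto
  ultimately have "(\<lambda>n. ennreal (\<Sum>i<n. \<nu> (B \<inter> A i))) \<longlonglongrightarrow> ennreal (\<nu> B)"
    by (auto simp: sums_def)
  moreover have "ennreal (\<Sum>i<n. \<nu> (B \<inter> A i)) \<le> (\<Sum>i. pos (A i))" for n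
  proof -
    have "ennreal (\<Sum>i<n. \<nu> (B \<inter> A i)) \<le> ennreal (\<Sum>i<n. max 0 (\<nu> (B \<inter> A i)))"
      by (intro ennreal_leI sum_mono) auto
    also have "\<dots> = (\<Sum>i<n. ennreal (max 0 (\<nu> (B \<inter> A i))))" by (simp add: sum_ennreal)
    also have "\<dots> \<le> (\<Sum>i<n. pos (A i))"
      using A B by (intro sum_mono) (auto simp: max_def ennreal_neg intro!: le_pos)
    also have "\<dots> \<le> (\<Sum>i. pos (A i))" by (rule sum_le_suminf) auto
    finally show ?thesis .
  qed
  ultimately show "ennreal (\<nu> B) \<le> (\<Sum>i. pos (A i))" by (intro LIMSEQ_le_const2) auto
qed

lemma pos_union_le:
  assumes "A \<in> sets borel" "B \<in> sets borel" "A \<inter> B = {}"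
  shows "pos (A \<union> B) \<le> pos A + pos B"
proof -
  have e: "pos {} = 0" using empty by (simp add: pos_def)
  have "pos (\<Union>i. binaryset A B i) \<le> (\<Sum>i. pos (binaryset A B i))"
    using assms by (intro pos_UN_le) (auto simp: range_binaryset_eq disjoint_family_on_def binaryset_def)
  then show ?thesis
    using binaryset_sums[of pos A B, THEN sums_unique] e by (simp add: UN_binaryset_eq)
qed

text \<open>If the positive variation were infinite, one could split off infinitely many disjoint
  sets of measure at least one in absolute value.\<close>

lemma pos_finite: "pos UNIV < \<infinity>"
proof (rule ccontr)
  assume "\<not> pos UNIV < \<infinity>"
  then have top: "pos UNIV = \<infinity>" by (simp add: not_less top_unique)
  have step: "\<exists>E'. (E' \<in> sets borel \<and> pos E' = \<infinity>) \<and> E' \<subseteq> E \<and> 1 \<le> \<bar>\<nu> (E - E')\<bar>"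
    if E: "E \<in> sets borel \<and> pos E = \<infinity>" for E
  proof -
    \<comment> \<open>The bound \<open>1 + \<bar>\<nu> E\<bar>\<close> forces both \<open>B\<close>
      and \<open>E - B\<close> to have values of modulus at least 1, so whichever of them keeps
      infinite variation, the removed one is large.\<close>
    have "ennreal (1 + \<bar>\<nu> E\<bar>) < pos E" using E by simp
    then obtain B where B: "B \<in> sets borel" "B \<subseteq> E" "ennreal (1 + \<bar>\<nu> E\<bar>) < ennreal (\<nu> B)"
      unfolding pos_def less_SUP_iff by auto
    then have gt: "1 + \<bar>\<nu> E\<bar> < \<nu> B" by (subst (asm) ennreal_less_iff) auto
    have "pos E \<le> pos B + pos (E - B)"
    proof -
      have "B \<union> (E - B) = E" using B by blast
      then show ?thesis using pos_union_le[of B "E - B"] B E by auto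
    qed
    then consider "pos B = \<infinity>" | "pos (E - B) = \<infinity>" using E by (auto simp: top_unique)
    then show ?thesis
    proof cases
      case 1
      have "1 \<le> \<bar>\<nu> (E - B)\<bar>" using diff[of E B] B E gt by auto
      then show ?thesis using B 1 by blast
    next
      case 2
      have "E - (E - B) = B" using B by auto
      then have "1 \<le> \<bar>\<nu> (E - (E - B))\<bar>" using gt by simp
      then show ?thesis using B E 2 by (intro exI[of _ "E - B"]) auto
    qed
  qed
  have "\<exists>E. \<forall>n. (E n \<in> sets borel \<and> pos (E n) = \<infinity>) \<and>
      (E (Suc n) \<subseteq> E n \<and> 1 \<le> \<bar>\<nu> (E n - E (Suc n))\<bar>)"
    by (rule dependent_nat_choice[OF _ step]) (use top in auto)
  then obtain E where E: "\<And>n. E n \<in> sets borel \<and> pos (E n) = \<infinity>"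
      "\<And>n. E (Suc n) \<subseteq> E n \<and> 1 \<le> \<bar>\<nu> (E n - E (Suc n))\<bar>" by blast
  have dec: "E n \<subseteq> E m" if "m \<le> n" for m n
    using lift_Suc_antimono_le[of E, OF _ that] E(2) by auto
  have "disjoint_family (\<lambda>n. E n - E (Suc n))"
    unfolding disjoint_family_on_def
  proof (intro ballI impI)
    fix m n :: nat assume "m \<noteq> n"
    then consider "Suc m \<le> n" | "Suc n \<le> m" by linarith
    then show "(E m - E (Suc m)) \<inter> (E n - E (Suc n)) = {}"
    proof cases
      case 1
      show ?thesis using dec[OF 1] by blast
    next
      case 2
      show ?thesis using dec[OF 2] by blast
    qed
  qed
  then have "(\<lambda>n. \<nu> (E n - E (Suc n))) sums \<nu> (\<Union>n. E n - E (Suc n))"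
    using E by (intro sums) auto
  \<comment> \<open>Countable additivity makes this a convergent series, whose terms cannot stay at
    least 1 in absolute value.\<close>
  then have "(\<lambda>n. \<nu> (E n - E (Suc n))) \<longlonglongrightarrow> 0"
    by (intro summable_LIMSEQ_zero) (auto simp: sums_iff)
  then have "eventually (\<lambda>n. \<bar>\<nu> (E n - E (Suc n))\<bar> < 1) sequentially"
    using tendstoD[of "\<lambda>n. \<nu> (E n - E (Suc n))" 0 sequentially 1] by simp
  then obtain n where "\<bar>\<nu> (E n - E (Suc n))\<bar> < 1"
    by (auto simp: eventually_sequentially)
  then show False using E(2)[of n] by linarith
qed

lemma pos_sum_le:
  assumes A: "range A \<subseteq> sets borel" "disjoint_family A"
  shows "(\<Sum>i<(n::nat). pos (A i)) \<le> pos (\<Union>i<n. A i)"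
proof (induction n)
  case (Suc n)
  have "A i \<inter> A n = {}" if "i < n" for i
    using disjoint_family_onD[OF A(2), of i n] that by simp
  then have d: "(\<Union>i<n. A i) \<inter> A n = {}" by blast
  have "(\<Sum>i<Suc n. pos (A i)) \<le> pos (\<Union>i<n. A i) + pos (A n)"
    using Suc by (simp add: add_right_mono)
  also have "\<dots> \<le> pos ((\<Union>i<n. A i) \<union> A n)"
    using A(1) d by (intro pos_union_ge) auto
  also have "(\<Union>i<n. A i) \<union> A n = (\<Union>i<Suc n. A i)" by (auto simp: less_Suc_eq)
  finally show ?case .
qed simp

lemma sets_positive_part: "sets (positive_part \<nu>) = sets borel"
  unfolding positive_part_def using sets.sets_measure_of_eq[of "borel :: 'a measure"] by simp

text \<open>\<open>measure_of\<close> yields a given set function only if that is countably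
  additive: subadditivity is \<open>pos_UN_le\<close>, and superadditivity on finite disjoint unions
  passes to the supremum of the partial sums.\<close>

lemma emeasure_positive_part:
  assumes "E \<in> sets borel"
  shows "emeasure (positive_part \<nu>) E = pos E"
proof (rule emeasure_measure_of)
  show "positive_part \<nu> = measure_of UNIV (sets borel) pos"
    by (simp add: positive_part_def pos_def[abs_def])
  show "sets borel \<subseteq> Pow UNIV" by simp
  show "E \<in> sets (positive_part \<nu>)" using assms sets_positive_part by simp
  show "positive (sets (positive_part \<nu>)) pos"
    using empty by (simp add: positive_def pos_def)
  show "countably_additive (sets (positive_part \<nu>)) pos"
    unfolding countably_additive_def sets_positive_part
  proof (intro allI impI antisym)
    fix A :: "nat \<Rightarrow> 'a set" assume A: "range A \<subseteq> sets borel" "disjoint_family A"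
    show "pos (\<Union>i. A i) \<le> (\<Sum>i. pos (A i))" using A by (rule pos_UN_le)
    show "(\<Sum>i. pos (A i)) \<le> pos (\<Union>i. A i)"
      unfolding suminf_eq_SUP
    proof (rule SUP_least)
      fix n
      have "(\<Sum>i<n. pos (A i)) \<le> pos (\<Union>i<n. A i)" by (rule pos_sum_le[OF A])
      also have "\<dots> \<le> pos (\<Union>i. A i)" by (rule pos_mono) auto
      finally show "(\<Sum>i<n. pos (A i)) \<le> pos (\<Union>i. A i)" .
    qed
  qed
qed

lemma finite_positive_part: "finite_measure (positive_part \<nu>)"
proof (rule finite_measureI)
  have "space (positive_part \<nu>) = UNIV" using sets_eq_imp_space_eq[OF sets_positive_part] by simp
  then show "emeasure (positive_part \<nu>) (space (positive_part \<nu>)) \<noteq> \<infinity>"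
    using pos_finite by (simp add: emeasure_positive_part less_top[symmetric])
qed

lemma pos_real: "E \<in> sets borel \<Longrightarrow> \<exists>r\<ge>0. pos E = ennreal r \<and> (\<forall>B\<in>sets borel. B \<subseteq> E \<longrightarrow> \<nu> B \<le> r)"
proof -
  assume E: "E \<in> sets borel"
  have "pos E < \<infinity>" using pos_finite pos_mono[of E UNIV] by (simp add: le_less_trans)
  then obtain r where r: "pos E = ennreal r" "r \<ge> 0" by (cases "pos E") auto
  have "\<nu> B \<le> r" if "B \<in> sets borel" "B \<subseteq> E" for B
    using le_pos[OF that] r by (simp add: ennreal_le_iff)
  then show ?thesis using r by blast
qed

end

lemma signed_measure_uminus: "signed_measure \<nu> \<Longrightarrow> signed_measure (\<lambda>E. - \<nu> E)"
  unfolding signed_measure_def by (auto intro!: sums_minus)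

text \<open>Writing \<open>\<nu> B = \<nu> E - \<nu> (E - B)\<close> turns a bound on
  \<open>- \<nu>\<close> into one on \<open>\<nu>\<close>: every \<open>\<nu> B\<close> is at most
  \<open>\<nu> E + q\<close>, so \<open>p \<le> \<nu> E + q\<close>. The same with signs exchanged
  gives equality.\<close>

lemma (in signed_measure) Jordan_decomposition:
  assumes E: "E \<in> sets borel"
  shows "\<nu> E = measure (positive_part \<nu>) E - measure (positive_part (\<lambda>E. - \<nu> E)) E"
proof -
  interpret n: signed_measure "\<lambda>E. - \<nu> E" by (rule signed_measure_uminus) (rule signed_measure_axioms)
  obtain p where p: "p \<ge> 0" "pos E = ennreal p" "\<And>B. B \<in> sets borel \<Longrightarrow> B \<subseteq> E \<Longrightarrow> \<nu> B \<le> p"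
    using pos_real[OF E] by blast
  obtain q where q: "q \<ge> 0" "n.pos E = ennreal q" "\<And>B. B \<in> sets borel \<Longrightarrow> B \<subseteq> E \<Longrightarrow> - \<nu> B \<le> q"
    using n.pos_real[OF E] by blast
  have "ennreal p \<le> ennreal (\<nu> E + q)"
    unfolding p(2)[symmetric] pos_def
  proof (rule SUP_least)
    fix B assume B: "B \<in> {B \<in> sets borel. B \<subseteq> E}"
    show "ennreal (\<nu> B) \<le> ennreal (\<nu> E + q)"
    proof (rule ennreal_leI)
      have "- \<nu> (E - B) \<le> q" using B E by (intro q(3)) auto
      then show "\<nu> B \<le> \<nu> E + q" using diff[of E B] B E by simp
    qed
  qed
  \<comment> \<open>Lets the comparison return to real numbers, since \<open>ennreal\<close>
    truncates below 0.\<close>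
  moreover have "0 \<le> \<nu> E + q" using q(3)[of E] E by auto
  ultimately have 1: "p \<le> \<nu> E + q" by (simp add: ennreal_le_iff)
  have "ennreal q \<le> ennreal (p - \<nu> E)"
    unfolding q(2)[symmetric] n.pos_def
  proof (rule SUP_least)
    fix B assume B: "B \<in> {B \<in> sets borel. B \<subseteq> E}"
    show "ennreal (- \<nu> B) \<le> ennreal (p - \<nu> E)"
    proof (rule ennreal_leI)
      have "\<nu> (E - B) \<le> p" using B E by (intro p(3)) auto
      then show "- \<nu> B \<le> p - \<nu> E" using diff[of E B] B E by simp
    qed
  qed
  moreover have "0 \<le> p - \<nu> E" using p(3)[of E] E by auto
  ultimately have 2: "q \<le> p - \<nu> E" by (simp add: ennreal_le_iff)
  show ?thesis
    unfolding measure_def emeasure_positive_part[OF E] n.emeasure_positive_part[OF E]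
    using 1 2 p(1,2) q(1,2) by simp
qed

lemma complex_measure_signed_measure:
  assumes "complex_measure \<nu>"
  shows "signed_measure (\<lambda>E. Re (\<nu> E))" "signed_measure (\<lambda>E. Im (\<nu> E))"
  using assms unfolding complex_measure_def signed_measure_def
  by (auto intro!: sums_Re sums_Im)

section \<open>Common densities for several finite measures\<close>

lemma add_finite_measures:
  fixes M N :: "'a::topological_space measure"
  assumes M: "finite_measure M" "sets M = sets borel" and N: "finite_measure N" "sets N = sets borel"
  shows "\<exists>L. finite_measure L \<and> sets L = sets borel \<and>
    (\<forall>E\<in>sets borel. emeasure L E = emeasure M E + emeasure N E)"
proof (intro exI conjI ballI)
  define L where "L = measure_of UNIV (sets borel) (\<lambda>E. emeasure M E + emeasure N E)"
  show sets: "sets L = sets borel"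
    unfolding L_def using sets.sets_measure_of_eq[of "borel :: 'a measure"] by simp
  show em: "emeasure L E = emeasure M E + emeasure N E" if "E \<in> sets borel" for E
  proof (rule emeasure_measure_of[OF L_def])
    show "sets borel \<subseteq> Pow UNIV" by simp
    show "E \<in> sets L" using that sets by simp
    show "positive (sets L) (\<lambda>E. emeasure M E + emeasure N E)" by (simp add: positive_def)
    show "countably_additive (sets L) (\<lambda>E. emeasure M E + emeasure N E)"
      unfolding countably_additive_def sets
    proof (intro allI impI)
      fix A :: "nat \<Rightarrow> 'a set" assume A: "range A \<subseteq> sets borel" "disjoint_family A"
      have "(\<Sum>i. emeasure M (A i) + emeasure N (A i)) = (\<Sum>i. emeasure M (A i)) + (\<Sum>i. emeasure N (A i))"
        by (rule suminf_add[symmetric]) auto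
      then show "(\<Sum>i. emeasure M (A i) + emeasure N (A i)) = emeasure M (\<Union>i. A i) + emeasure N (\<Union>i. A i)"
        using A M(2) N(2) by (simp add: suminf_emeasure)
    qed
  qed
  have "emeasure M UNIV \<noteq> \<infinity>" "emeasure N UNIV \<noteq> \<infinity>"
    using finite_measure.emeasure_finite[OF M(1)] finite_measure.emeasure_finite[OF N(1)] by auto
  then show "finite_measure L"
    using sets_eq_imp_space_eq[OF sets] by (intro finite_measureI) (simp add: em)
qed

text \<open>Domination gives absolute continuity, so Radon-Nikodym applies; finiteness of
  \<open>N\<close> makes the derivative real-valued and integrable.\<close>

lemma finite_measure_density_real:
  fixes L N :: "'a::topological_space measure"
  assumes L: "finite_measure L" "sets L = sets borel" and N: "finite_measure N" "sets N = sets borel"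
    and le: "\<And>E. E \<in> sets borel \<Longrightarrow> emeasure N E \<le> emeasure L E"
  shows "\<exists>D. integrable L D \<and> (\<forall>x. 0 \<le> D x) \<and> density L (\<lambda>x. ennreal (D x)) = N"
proof -
  interpret L: finite_measure L by fact
  interpret N: finite_measure N by fact
  have ac: "absolutely_continuous L N"
    unfolding absolutely_continuous_def
  proof
    fix E assume "E \<in> null_sets L"
    then show "E \<in> null_sets N" using le[of E] L(2) N(2) by (auto simp: null_sets_def)
  qed
  have sNL: "sets N = sets L" using L(2) N(2) by simp
  obtain D where D: "D \<in> borel_measurable L" "AE x in L. RN_deriv L N x = ennreal (D x)"
      "\<And>x. 0 \<le> D x"
    by (rule L.real_RN_deriv[OF N(1) ac sNL]) blast
  have eq: "density L (\<lambda>x. ennreal (D x)) = N"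
    using L.density_RN_deriv[OF ac sNL] density_cong[OF _ _ D(2)] D(1) by simp
  \<comment> \<open>Integrability of \<open>D\<close> against \<open>L\<close> is that of the
    constant 1 against \<open>N\<close>.\<close>
  have i1: "integrable N (\<lambda>x. 1::real)" by simp
  have "integrable (density L (\<lambda>x. ennreal (D x))) (\<lambda>x. 1::real)" using i1 unfolding eq .
  then have int: "integrable L D"
    using D by (subst (asm) integrable_density) auto
  then show ?thesis using D(3) eq by blast
qed

text \<open>The sum of the four measures dominates each of them, so all have densities against it
  and the complex combination becomes one integrand \<open>h\<close>. It serves both for the Jordan
  parts of a complex measure and for four vague limits.\<close>

lemma combine_finite_measures:
  fixes P1 P2 P3 P4 :: "'a::topological_space measure"
  assumes f: "finite_measure P1" "finite_measure P2" "finite_measure P3" "finite_measure P4"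
    and s: "sets P1 = sets borel" "sets P2 = sets borel" "sets P3 = sets borel" "sets P4 = sets borel"
  shows "\<exists>L h. finite_measure L \<and> sets L = sets borel \<and> integrable L h \<and>
    (\<forall>(\<psi> :: 'a \<Rightarrow> complex) B. \<psi> \<in> borel_measurable borel \<longrightarrow> (\<forall>x. cmod (\<psi> x) \<le> B) \<longrightarrow>
      (LINT x|L. \<psi> x * h x) = ((LINT x|P1. \<psi> x) - (LINT x|P2. \<psi> x)) + \<i> * ((LINT x|P3. \<psi> x) - (LINT x|P4. \<psi> x)))"
proof -
  obtain A where A: "finite_measure A" "sets A = sets borel"
    "\<And>E. E \<in> sets borel \<Longrightarrow> emeasure A E = emeasure P1 E + emeasure P2 E"
    using add_finite_measures[OF f(1) s(1) f(2) s(2)] by blast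
  obtain B where B: "finite_measure B" "sets B = sets borel"
    "\<And>E. E \<in> sets borel \<Longrightarrow> emeasure B E = emeasure P3 E + emeasure P4 E"
    using add_finite_measures[OF f(3) s(3) f(4) s(4)] by blast
  obtain L where L: "finite_measure L" "sets L = sets borel"
    "\<And>E. E \<in> sets borel \<Longrightarrow> emeasure L E = emeasure A E + emeasure B E"
    using add_finite_measures[OF A(1,2) B(1,2)] by blast
  have le: "emeasure P1 E \<le> emeasure L E" "emeasure P2 E \<le> emeasure L E"
    "emeasure P3 E \<le> emeasure L E" "emeasure P4 E \<le> emeasure L E" if "E \<in> sets borel" for E
    using A(3)[OF that] B(3)[OF that] L(3)[OF that]
    by (auto intro: add_increasing add_increasing2)
  obtain D1 where D1: "integrable L D1" "\<And>x. 0 \<le> D1 x" "density L (\<lambda>x. ennreal (D1 x)) = P1"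
    using finite_measure_density_real[OF L(1,2) f(1) s(1) le(1)] by blast
  obtain D2 where D2: "integrable L D2" "\<And>x. 0 \<le> D2 x" "density L (\<lambda>x. ennreal (D2 x)) = P2"
    using finite_measure_density_real[OF L(1,2) f(2) s(2) le(2)] by blast
  obtain D3 where D3: "integrable L D3" "\<And>x. 0 \<le> D3 x" "density L (\<lambda>x. ennreal (D3 x)) = P3"
    using finite_measure_density_real[OF L(1,2) f(3) s(3) le(3)] by blast
  obtain D4 where D4: "integrable L D4" "\<And>x. 0 \<le> D4 x" "density L (\<lambda>x. ennreal (D4 x)) = P4"
    using finite_measure_density_real[OF L(1,2) f(4) s(4) le(4)] by blast
  define h where "h x = complex_of_real (D1 x - D2 x) + \<i> * complex_of_real (D3 x - D4 x)" for x
  have ih: "integrable L h"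
    unfolding h_def using D1(1) D2(1) D3(1) D4(1) by auto
  have "(LINT x|L. \<psi> x * h x) = ((LINT x|P1. \<psi> x) - (LINT x|P2. \<psi> x)) + \<i> * ((LINT x|P3. \<psi> x) - (LINT x|P4. \<psi> x))"
    if \<psi>: "\<psi> \<in> borel_measurable borel" "\<And>x. cmod (\<psi> x) \<le> C" for \<psi> :: "'a \<Rightarrow> complex" and C
  proof -
    have \<psi>m: "\<psi> \<in> borel_measurable L" using \<psi>(1) L(2) measurable_cong_sets by blast
    have e: "(LINT x|P. \<psi> x) = (LINT x|L. D x *\<^sub>R \<psi> x)"
      if "integrable L D" "\<And>x. 0 \<le> D x" "density L (\<lambda>x. ennreal (D x)) = P" for D P
      unfolding that(3)[symmetric] using that(1,2) \<psi>m by (intro integral_density) auto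
    have i: "integrable L (\<lambda>x. D x *\<^sub>R \<psi> x)" if "integrable L D" for D :: "'a \<Rightarrow> real"
    proof (rule Bochner_Integration.integrable_bound[OF integrable_mult_right[OF that, of "\<bar>C\<bar>"]])
      show "(\<lambda>x. D x *\<^sub>R \<psi> x) \<in> borel_measurable L" using that \<psi>m by measurable
      have "cmod (\<psi> x) \<le> \<bar>C\<bar>" for x using \<psi>(2)[of x] by linarith
      then show "AE x in L. norm (D x *\<^sub>R \<psi> x) \<le> norm (\<bar>C\<bar> * D x)"
        by (intro AE_I2) (simp add: abs_mult mult_right_mono mult.commute[of "\<bar>D _\<bar>"])
    qed
    note i' = i[OF D1(1)] i[OF D2(1)] i[OF D3(1)] i[OF D4(1)]
    have "(LINT x|L. \<psi> x * h x) = (LINT x|L. (D1 x *\<^sub>R \<psi> x - D2 x *\<^sub>R \<psi> x) + \<i> * (D3 x *\<^sub>R \<psi> x - D4 x *\<^sub>R \<psi> x))"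
      by (intro Bochner_Integration.integral_cong) (auto simp: h_def scaleR_conv_of_real algebra_simps)
    also have "\<dots> = ((LINT x|L. D1 x *\<^sub>R \<psi> x) - (LINT x|L. D2 x *\<^sub>R \<psi> x))
        + \<i> * ((LINT x|L. D3 x *\<^sub>R \<psi> x) - (LINT x|L. D4 x *\<^sub>R \<psi> x))"
      unfolding integral_mult_right_zero[symmetric] Bochner_Integration.integral_diff[OF i'(1,2), symmetric]
        Bochner_Integration.integral_diff[OF i'(3,4), symmetric]
      using i' by (intro Bochner_Integration.integral_add Bochner_Integration.integrable_diff integrable_mult_right)
    finally show ?thesis unfolding e[OF D1] e[OF D2] e[OF D3] e[OF D4] .
  qed
  then show ?thesis using L ih by blast
qed

text \<open>Testing \<open>combine_finite_measures\<close> with the indicator of \<open>E\<close>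
  recovers the Jordan decompositions of the real and imaginary parts of
  \<open>\<nu> E\<close>.\<close>

lemma complex_measure_ex_density:
  fixes \<nu> :: "'a::topological_space set \<Rightarrow> complex"
  assumes "complex_measure \<nu>"
  shows "\<exists>L h. finite_measure L \<and> sets L = sets borel \<and> integrable L h \<and>
    (\<forall>E\<in>sets borel. \<nu> E = (LINT x:E|L. h x))"
proof -
  interpret r: signed_measure "\<lambda>E. Re (\<nu> E)" by (rule complex_measure_signed_measure[OF assms])
  interpret i: signed_measure "\<lambda>E. Im (\<nu> E)" by (rule complex_measure_signed_measure[OF assms])
  interpret r': signed_measure "\<lambda>E. - Re (\<nu> E)" by (rule signed_measure_uminus) (rule r.signed_measure_axioms)
  interpret i': signed_measure "\<lambda>E. - Im (\<nu> E)" by (rule signed_measure_uminus) (rule i.signed_measure_axioms)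
  let ?P1 = "positive_part (\<lambda>E. Re (\<nu> E))" and ?P2 = "positive_part (\<lambda>E. - Re (\<nu> E))"
  let ?P3 = "positive_part (\<lambda>E. Im (\<nu> E))" and ?P4 = "positive_part (\<lambda>E. - Im (\<nu> E))"
  note f = r.finite_positive_part r'.finite_positive_part i.finite_positive_part i'.finite_positive_part
  note s = r.sets_positive_part r'.sets_positive_part i.sets_positive_part i'.sets_positive_part
  obtain L h where L: "finite_measure L" "sets L = sets borel" "integrable L h"
    and eq: "\<And>(\<psi> :: 'a \<Rightarrow> complex) B. \<psi> \<in> borel_measurable borel \<Longrightarrow> (\<forall>x. cmod (\<psi> x) \<le> B) \<Longrightarrow>
      (LINT x|L. \<psi> x * h x) = ((LINT x|?P1. \<psi> x) - (LINT x|?P2. \<psi> x)) + \<i> * ((LINT x|?P3. \<psi> x) - (LINT x|?P4. \<psi> x))"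
    using combine_finite_measures[OF f s] by blast
  have "\<nu> E = (LINT x:E|L. h x)" if E: "E \<in> sets borel" for E
  proof -
    have m: "(LINT x|P. complex_of_real (indicator E x)) = complex_of_real (measure P E)"
      if "finite_measure P" "sets P = sets borel" for P
    proof -
      have "(LINT x|P. complex_of_real (indicator E x)) = complex_of_real (LINT x|P. indicator E x)"
        by (rule integral_complex_of_real)
      then show ?thesis using E that sets_eq_imp_space_eq[OF that(2)] by simp
    qed
    have "(LINT x:E|L. h x) = (LINT x|L. complex_of_real (indicator E x) * h x)"
      by (simp add: set_lebesgue_integral_def scaleR_conv_of_real)
    also have "\<dots> = complex_of_real (measure ?P1 E - measure ?P2 E) + \<i> * complex_of_real (measure ?P3 E - measure ?P4 E)"
    proof -
      have "(\<lambda>x. complex_of_real (indicator E x)) \<in> borel_measurable borel" using E by measurable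
      from eq[OF this, of 1] show ?thesis
        unfolding m[OF f(1) s(1)] m[OF f(2) s(2)] m[OF f(3) s(3)] m[OF f(4) s(4)] by (simp add: indicator_def)
    qed
    also have "\<dots> = \<nu> E"
      unfolding r.Jordan_decomposition[OF E, symmetric] i.Jordan_decomposition[OF E, symmetric]
      by (simp add: complex_eq_iff)
    finally show ?thesis by simp
  qed
  then show ?thesis using L by blast
qed

text \<open>\<open>M\<close> is the total variation measure of \<open>\<nu>\<close> and
  \<open>s\<close> its phase. Modulus 1 is imposed at every point rather than almost everywhere, so
  that bounds involving \<open>s\<close> hold without exceptional sets.\<close>

locale polar_decomposition = finite_measure M
  for \<nu> :: "'a::topological_space set \<Rightarrow> complex" and M :: "'a measure" and s :: "'a \<Rightarrow> complex" +
  assumes sets_eq [measurable_cong, simp]: "sets M = sets borel"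
    and s_measurable [measurable]: "s \<in> borel_measurable borel"
    and norm_s [simp]: "cmod (s x) = 1"
    and eq: "E \<in> sets borel \<Longrightarrow> \<nu> E = (LINT x:E|M. s x)"
begin

lemma space_eq [simp]: "space M = UNIV"
  using sets_eq_imp_space_eq[OF sets_eq] by simp

lemma borel_measurable_iff [simp]: "borel_measurable M = borel_measurable borel"
  by (rule measurable_cong_sets) auto

lemma integrable_bounded:
  fixes f :: "'a \<Rightarrow> 'b::{banach, second_countable_topology}"
  assumes "f \<in> borel_measurable borel" "\<And>x. norm (f x) \<le> B"
  shows "integrable M f"
  using assms by (intro integrable_const_bound[of _ B]) auto

end

text \<open>The modulus of a density \<open>h\<close> is moved into the measure, leaving the phase
  \<open>h / cmod h\<close>. Where \<open>h\<close> vanishes the phase is set to 1; that set has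
  measure 0 under \<open>M\<close>.\<close>

lemma complex_measure_ex_polar:
  assumes "complex_measure \<nu>"
  shows "\<exists>M s. polar_decomposition \<nu> M s"
proof -
  obtain L h where L: "finite_measure L" "sets L = sets borel" "integrable L h"
     "\<And>E. E \<in> sets borel \<Longrightarrow> \<nu> E = (LINT x:E|L. h x)"
    using complex_measure_ex_density[OF assms] by blast
  have mL: "borel_measurable L = (borel_measurable borel :: ('a \<Rightarrow> 'x::topological_space) set)"
    using L(2) by (intro measurable_cong_sets) auto
  have hm[measurable]: "h \<in> borel_measurable borel" using L(3) mL by (metis borel_measurable_integrable)
  note [measurable_cong] = L(2)
  define s where "s x = (if h x = 0 then 1 else h x / cmod (h x))" for x
  have sm[measurable]: "s \<in> borel_measurable borel" unfolding s_def by measurable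
  define M where "M = density L (\<lambda>x. ennreal (cmod (h x)))"
  have sM: "sets M = sets borel" using L(2) by (simp add: M_def)
  have "emeasure M (space M) = (\<integral>\<^sup>+ x. ennreal (cmod (h x)) \<partial>L)"
    unfolding M_def by (subst emeasure_density) (auto intro!: nn_integral_cong)
  also have "\<dots> < \<infinity>" using L(3) by (simp add: integrable_iff_bounded)
  finally have fin: "finite_measure M" by (intro finite_measureI) simp
  have "\<nu> E = (LINT x:E|M. s x)" if E[measurable]: "E \<in> sets borel" for E
  proof -
    have "(LINT x:E|M. s x) = (LINT x|L. cmod (h x) *\<^sub>R (indicator E x *\<^sub>R s x))"
      unfolding M_def set_lebesgue_integral_def by (subst integral_density) (use E sm hm mL L(2) in auto)
    also have "\<dots> = (LINT x:E|L. h x)"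
      unfolding set_lebesgue_integral_def
      by (intro Bochner_Integration.integral_cong) (auto simp: s_def scaleR_conv_of_real indicator_def)
    finally show ?thesis using L(4)[OF E] by simp
  qed
  then have "polar_decomposition \<nu> M s"
    using fin sM sm
    by (intro polar_decomposition.intro polar_decomposition_axioms.intro) (auto simp: s_def norm_divide)
  then show ?thesis by blast
qed

text \<open>Countable additivity is dominated convergence: partial sums of indicators of disjoint
  sets stay below 1, so \<open>cmod h\<close> dominates.\<close>

lemma complex_measureI_density:
  assumes L: "finite_measure L" "sets L = sets borel" and h: "integrable L h"
    and eq: "\<And>E. E \<in> sets borel \<Longrightarrow> \<nu> E = (LINT x:E|L. h x)"
  shows "complex_measure \<nu>"
  unfolding complex_measure_def
proof (intro conjI allI impI)
  show "\<nu> {} = 0" by (simp add: eq set_lebesgue_integral_def)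
  fix A :: "nat \<Rightarrow> 'a set" assume A: "range A \<subseteq> sets borel" "disjoint_family A"
  have [measurable]: "A i \<in> sets L" for i using A L by auto
  have hm[measurable]: "h \<in> borel_measurable L" using h by simp
  have si: "integrable L (\<lambda>x. indicat_real (A i) x *\<^sub>R h x)" for i
    by (intro integrable_mult_indicator h) measurable
  have d: "i \<noteq> j \<Longrightarrow> A i \<inter> A j = {}" for i j using disjoint_family_onD[OF A(2), of i j] by simp
  have sm: "(\<lambda>i. indicat_real (A i) x) sums indicat_real (\<Union>i. A i) x" for x
    by (rule indicator_sums) (rule d)
  have "(\<lambda>n. LINT x|L. (\<Sum>i<n. indicat_real (A i) x) *\<^sub>R h x) \<longlonglongrightarrow>
     (LINT x|L. indicat_real (\<Union>i. A i) x *\<^sub>R h x)"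
  proof (rule integral_dominated_convergence[where w = "\<lambda>x. cmod (h x)"])
    show "integrable L (\<lambda>x. cmod (h x))" using h by simp
    show "AE x in L. (\<lambda>n. (\<Sum>i<n. indicat_real (A i) x) *\<^sub>R h x) \<longlonglongrightarrow> indicat_real (\<Union>i. A i) x *\<^sub>R h x"
      using sm by (intro AE_I2 tendsto_scaleR tendsto_const) (auto simp: sums_def)
    have b: "(\<Sum>i<n. indicat_real (A i) x) \<le> 1" for n x
    proof -
      have "(\<Sum>i<n. indicat_real (A i) x) \<le> (\<Sum>i. indicat_real (A i) x)"
        by (rule sum_le_suminf[OF sums_summable[OF sm]]) auto
      also have "\<dots> = indicat_real (\<Union>i. A i) x" by (rule sums_unique[OF sm, symmetric])
      also have "\<dots> \<le> 1" by (simp add: indicator_def)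
      finally show ?thesis .
    qed
    show "AE x in L. norm ((\<Sum>i<n. indicat_real (A i) x) *\<^sub>R h x) \<le> cmod (h x)" for n
      using b by (intro AE_I2) (auto simp: sum_nonneg intro!: mult_left_le_one_le)
  qed measurable
  moreover have "(LINT x|L. (\<Sum>i<n. indicat_real (A i) x) *\<^sub>R h x) = (\<Sum>i<n. \<nu> (A i))" for n
  proof -
    have e: "\<nu> (A i) = (LINT x|L. indicat_real (A i) x *\<^sub>R h x)" for i
      using A(1) by (simp add: eq set_lebesgue_integral_def image_subset_iff)
    show ?thesis
      unfolding scaleR_sum_left e by (rule Bochner_Integration.integral_sum) (rule si)
  qed
  moreover have "(\<Union>i. A i) \<in> sets borel" using A by auto
  ultimately show "(\<lambda>i. \<nu> (A i)) sums \<nu> (\<Union>i. A i)"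
    by (simp add: sums_def eq set_lebesgue_integral_def)
qed

text \<open>The supremum over Borel subsets of \<open>E\<close> is attained at the part of
  \<open>E\<close> where \<open>g \<ge> 0\<close>. Truncation by \<open>ennreal\<close> makes the
  density see only the positive part of \<open>g\<close>.\<close>

lemma positive_part_eq_density:
  assumes "signed_measure \<nu>" and L: "finite_measure L" "sets L = sets borel" and g: "integrable L g"
    and eq: "\<And>E. E \<in> sets borel \<Longrightarrow> \<nu> E = (LINT x:E|L. g x)"
  shows "positive_part \<nu> = density L (\<lambda>x. ennreal (g x))"
proof (rule measure_eqI)
  interpret signed_measure \<nu> by fact
  show "sets (positive_part \<nu>) = sets (density L (\<lambda>x. ennreal (g x)))"
    using L by (simp add: sets_positive_part)
  have gm[measurable]: "g \<in> borel_measurable L" using g by simp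
  fix E assume "E \<in> sets (positive_part \<nu>)"
  then have E: "E \<in> sets borel" by (simp add: sets_positive_part)
  note [measurable_cong] = L(2)
  have [measurable]: "E \<in> sets L" using E L by simp
  have ig: "integrable L (\<lambda>x. indicat_real B x *\<^sub>R g x)" if "B \<in> sets borel" for B
    using that L by (intro integrable_mult_indicator g) auto
  have "pos E = (\<integral>\<^sup>+ x. ennreal (g x) * indicator E x \<partial>L)"
  proof (rule antisym)
    show "pos E \<le> (\<integral>\<^sup>+ x. ennreal (g x) * indicator E x \<partial>L)"
      unfolding pos_def
    proof (rule SUP_least)
      fix B assume "B \<in> {B \<in> sets borel. B \<subseteq> E}"
      then have B: "B \<in> sets borel" "B \<subseteq> E" by auto
      have i: "integrable L (\<lambda>x. max 0 (indicat_real B x *\<^sub>R g x))"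
        using ig[OF B(1)] by (intro integrable_max) auto
      have "ennreal (\<nu> B) \<le> ennreal (LINT x|L. max 0 (indicat_real B x *\<^sub>R g x))"
        unfolding eq[OF B(1)] set_lebesgue_integral_def
        by (intro ennreal_leI integral_mono ig B i) auto
      also have "\<dots> = (\<integral>\<^sup>+ x. ennreal (max 0 (indicat_real B x *\<^sub>R g x)) \<partial>L)"
        using i by (subst nn_integral_eq_integral) auto
      also have "\<dots> \<le> (\<integral>\<^sup>+ x. ennreal (g x) * indicator E x \<partial>L)"
        using B by (intro nn_integral_mono) (auto simp: indicator_def max_def ennreal_neg)
      finally show "ennreal (\<nu> B) \<le> (\<integral>\<^sup>+ x. ennreal (g x) * indicator E x \<partial>L)" .
    qed
    define B where "B = E \<inter> {x \<in> space L. 0 \<le> g x}"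
    have BL: "B \<in> sets L" unfolding B_def by measurable
    then have B: "B \<in> sets borel" using L by simp
    have "(\<integral>\<^sup>+ x. ennreal (g x) * indicator E x \<partial>L) = (\<integral>\<^sup>+ x. ennreal (indicat_real B x *\<^sub>R g x) \<partial>L)"
      by (intro nn_integral_cong) (auto simp: B_def indicator_def ennreal_neg)
    also have "\<dots> = ennreal (\<nu> B)"
      unfolding eq[OF B] set_lebesgue_integral_def
      by (intro nn_integral_eq_integral ig B AE_I2) (auto simp: B_def indicator_def)
    also have "\<dots> \<le> pos E" using B by (intro le_pos) (auto simp: B_def)
    finally show "(\<integral>\<^sup>+ x. ennreal (g x) * indicator E x \<partial>L) \<le> pos E" .
  qed
  then show "emeasure (positive_part \<nu>) E = emeasure (density L (\<lambda>x. ennreal (g x))) E"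
    using E by (simp add: emeasure_positive_part emeasure_density)
qed

text \<open>Reconciles the definition by four Jordan parts with an arbitrary density: for
  \<open>r\<close> the real or imaginary part, the Jordan parts have densities
  \<open>max 0 (r h)\<close> and \<open>max 0 (- r h)\<close>, whose difference is
  \<open>r h\<close>. In this generality it covers the polar form as well as the limit measures
  obtained from compactness.\<close>

lemma complex_measure_integral_density:
  assumes L: "finite_measure L" "sets L = sets borel" and h: "integrable L h"
    and eq: "\<And>E. E \<in> sets borel \<Longrightarrow> \<nu> E = (LINT x:E|L. h x)"
    and f: "f \<in> borel_measurable borel" "\<And>x. cmod (f x) \<le> B"
  shows "complex_measure_integral \<nu> f = (LINT x|L. f x * h x)"
proof -
  have cm: "complex_measure \<nu>" by (rule complex_measureI_density[OF L h eq])
  note sm = complex_measure_signed_measure[OF cm]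
  have hm[measurable]: "h \<in> borel_measurable L" using h by simp
  have fm[measurable]: "f \<in> borel_measurable L" using f L measurable_cong_sets by blast
  have ig: "integrable L (\<lambda>x. indicat_real E x *\<^sub>R h x)" if "E \<in> sets borel" for E
    using that L by (intro integrable_mult_indicator h) auto
  \<comment> \<open>\<open>integral_density\<close> wants a nonnegative real density, so the
    truncation hidden in \<open>ennreal\<close> is made explicit.\<close>
  have ennreal_max: "ennreal (max 0 r) = ennreal r" for r :: real
    by (cases "0 \<le> r") (auto simp: max_def ennreal_neg)
  have fB: "cmod (f x) \<le> \<bar>B\<bar>" for x using f(2)[of x] by linarith
  have part: "(LINT x|positive_part (\<lambda>E. r (\<nu> E)). f x) - (LINT x|positive_part (\<lambda>E. - r (\<nu> E)). f x)
      = (LINT x|L. r (h x) *\<^sub>R f x)"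
    if r: "bounded_linear r" and sg: "signed_measure (\<lambda>E. r (\<nu> E))" for r :: "complex \<Rightarrow> real"
  proof -
    interpret r: bounded_linear r by fact
    have ir: "integrable L (\<lambda>x. r (h x))" by (rule integrable_bounded_linear[OF r h])
    have rm[measurable]: "(\<lambda>x. r (h x)) \<in> borel_measurable L" using ir by simp
    have e: "r (\<nu> E) = (LINT x:E|L. r (h x))" if "E \<in> sets borel" for E
      unfolding eq[OF that] set_lebesgue_integral_def
      by (subst integral_bounded_linear[OF r ig[OF that], symmetric]) (simp add: r.scaleR)
    have p: "positive_part (\<lambda>E. r (\<nu> E)) = density L (\<lambda>x. ennreal (max 0 (r (h x))))"
      using positive_part_eq_density[OF sg L ir e] unfolding ennreal_max .
    have "positive_part (\<lambda>E. - r (\<nu> E)) = density L (\<lambda>x. ennreal (- r (h x)))"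
      by (intro positive_part_eq_density[OF signed_measure_uminus[OF sg] L])
        (use ir e in \<open>auto simp: set_lebesgue_integral_def\<close>)
    then have n: "positive_part (\<lambda>E. - r (\<nu> E)) = density L (\<lambda>x. ennreal (max 0 (- r (h x))))"
      unfolding ennreal_max .
    have i: "integrable L (\<lambda>x. max 0 (r (h x)) *\<^sub>R f x)" "integrable L (\<lambda>x. max 0 (- r (h x)) *\<^sub>R f x)"
    proof -
      show "integrable L (\<lambda>x. max 0 (r (h x)) *\<^sub>R f x)"
        using ir by (rule Bochner_Integration.integrable_bound[OF integrable_mult_right[of B]])
          (auto intro!: AE_I2 mult_mono simp: abs_mult mult.commute[of B] fB)
      show "integrable L (\<lambda>x. max 0 (- r (h x)) *\<^sub>R f x)"
        using ir by (rule Bochner_Integration.integrable_bound[OF integrable_mult_right[of B]])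
          (auto intro!: AE_I2 mult_mono simp: abs_mult mult.commute[of B] fB)
    qed
    have "(LINT x|positive_part (\<lambda>E. r (\<nu> E)). f x) - (LINT x|positive_part (\<lambda>E. - r (\<nu> E)). f x)
       = (LINT x|L. max 0 (r (h x)) *\<^sub>R f x - max 0 (- r (h x)) *\<^sub>R f x)"
      unfolding p n by (subst (1 2) integral_density) (auto simp: i)
    also have "\<dots> = (LINT x|L. r (h x) *\<^sub>R f x)"
      by (intro Bochner_Integration.integral_cong) (auto simp: max_def)
    finally show ?thesis .
  qed
  have b: "integrable L (\<lambda>x. r (h x) *\<^sub>R f x)" if r: "bounded_linear r" for r :: "complex \<Rightarrow> real"
    using integrable_bounded_linear[OF r h]
    by (rule Bochner_Integration.integrable_bound[OF integrable_mult_right[of B]])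
      (use integrable_bounded_linear[OF r h] in \<open>auto intro!: AE_I2 mult_mono simp: abs_mult mult.commute[of B] fB\<close>)
  have "complex_measure_integral \<nu> f = (LINT x|L. Re (h x) *\<^sub>R f x) + \<i> * (LINT x|L. Im (h x) *\<^sub>R f x)"
    unfolding complex_measure_integral_def
    using part[OF bounded_linear_Re sm(1)] part[OF bounded_linear_Im sm(2)] by simp
  also have "\<dots> = (LINT x|L. Re (h x) *\<^sub>R f x + \<i> * (Im (h x) *\<^sub>R f x))"
  proof -
    have "integrable L (\<lambda>x. \<i> * (Im (h x) *\<^sub>R f x))" using b[OF bounded_linear_Im] by (rule integrable_mult_right)
    from Bochner_Integration.integral_add[OF b[OF bounded_linear_Re] this] show ?thesis
      unfolding integral_mult_right_zero by (rule sym)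
  qed
  also have "\<dots> = (LINT x|L. f x * h x)"
    by (intro Bochner_Integration.integral_cong) (auto simp: complex_eq_iff algebra_simps)
  finally show ?thesis .
qed

context polar_decomposition
begin

lemma complex_measure_integral_eq:
  assumes "f \<in> borel_measurable borel" "\<And>x. cmod (f x) \<le> B"
  shows "complex_measure_integral \<nu> f = (LINT x|M. f x * s x)"
  using assms by (intro complex_measure_integral_density eq integrable_bounded[of _ 1] finite_measure_axioms) auto

text \<open>Since \<open>s\<close> has modulus 1, no partition exceeds the mass of \<open>M\<close>.
  Conversely, partitioning by the approximate value of the phase makes \<open>s\<close> nearly
  constant on each piece, so that the modulus of \<open>\<nu> (A i)\<close> nearly equals the mass
  of \<open>A i\<close>.\<close>

lemma total_variation_eq: "total_variation \<nu> UNIV = emeasure M UNIV"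
proof (rule antisym)
  show "total_variation \<nu> UNIV \<le> emeasure M UNIV"
    unfolding total_variation_def
  proof (rule SUP_least)
    fix A :: "nat \<Rightarrow> 'a set"
    assume "A \<in> {A. range A \<subseteq> sets borel \<and> disjoint_family A \<and> (\<Union>i. A i) = UNIV}"
    then have A: "range A \<subseteq> sets borel" "disjoint_family A" "(\<Union>i. A i) = UNIV" by auto
    have [measurable]: "A i \<in> sets borel" for i using A by auto
    have "cmod (\<nu> (A i)) \<le> measure M (A i)" for i
    proof -
      have "cmod (\<nu> (A i)) \<le> (LINT x|M. norm (indicat_real (A i) x *\<^sub>R s x))"
        unfolding eq[OF \<open>A i \<in> sets borel\<close>] set_lebesgue_integral_def by (rule integral_norm_bound)
      also have "\<dots> = measure M (A i)" by simp
      finally show ?thesis .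
    qed
    then have "(\<Sum>i. ennreal (cmod (\<nu> (A i)))) \<le> (\<Sum>i. emeasure M (A i))"
      by (intro suminf_le) (auto simp: emeasure_eq_measure)
    also have "\<dots> = emeasure M UNIV" using A by (subst suminf_emeasure) auto
    finally show "(\<Sum>i. ennreal (cmod (\<nu> (A i)))) \<le> emeasure M UNIV" .
  qed
next
  obtain D :: "complex set" where D: "countable D" "\<And>X. open X \<Longrightarrow> X \<noteq> {} \<Longrightarrow> \<exists>d\<in>D. d \<in> X"
    by (rule countable_dense_setE) blast
  have "D \<noteq> {}" using D(2)[of UNIV] by auto
  define q where "q = from_nat_into D"
  have q: "range q = D" unfolding q_def using D(1) \<open>D \<noteq> {}\<close> by (rule range_from_nat_into[rotated])
  have bound: "ennreal ((1 - 2 * \<epsilon>) * measure M UNIV) \<le> total_variation \<nu> UNIV" if e: "0 < \<epsilon>" "\<epsilon> < 1/2" for \<epsilon>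
  proof -
    \<comment> \<open>\<open>q\<close> runs through a countable dense set, so these sets cover the
      space; making them disjoint gives a Borel partition.\<close>
    define B where "B i = {x. cmod (s x - q i) < \<epsilon>}" for i
    have Bm: "B i \<in> sets borel" for i
    proof -
      have "{x \<in> space borel. cmod (s x - q i) < \<epsilon>} \<in> sets borel" by measurable
      then show ?thesis by (simp add: B_def)
    qed
    define A where "A = disjointed B"
    have Am[measurable]: "A i \<in> sets borel" for i
      using sets.range_disjointed_sets[of B borel] Bm unfolding A_def by auto
    have "\<exists>i. x \<in> B i" for x
    proof -
      obtain d where "d \<in> D" "d \<in> ball (s x) \<epsilon>" using D(2)[of "ball (s x) \<epsilon>"] e by auto
      then show ?thesis using q by (auto simp: B_def dist_norm)
    qed
    then have UA: "(\<Union>i. A i) = UNIV" unfolding A_def UN_disjointed_eq by auto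
    have dA: "disjoint_family A" unfolding A_def by (rule disjoint_family_disjointed)
    \<comment> \<open>One \<epsilon> is lost by replacing \<open>s\<close> with the constant
      \<open>q i\<close>, the other because \<open>cmod (q i)\<close> is only known to be at least
      \<open>1 - \<epsilon>\<close>.\<close>
    have "(1 - 2 * \<epsilon>) * measure M (A i) \<le> cmod (\<nu> (A i))" for i
    proof (cases "A i = {}")
      case False
      then obtain x where "x \<in> A i" by auto
      have AB: "A i \<subseteq> B i" unfolding A_def by (rule disjointed_subset)
      have "norm (q i) \<ge> 1 - \<epsilon>"
        using \<open>x \<in> A i\<close> AB norm_triangle_ineq2[of "s x" "q i"] by (auto simp: B_def)
      have ia: "integrable M (\<lambda>x. indicat_real (A i) x *\<^sub>R s x)"
        by (intro integrable_bounded[of _ 1]) (auto simp: indicator_def)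
      have iq: "integrable M (\<lambda>x. indicat_real (A i) x *\<^sub>R q i)"
        by (intro integrable_bounded[of _ "cmod (q i)"]) (auto simp: indicator_def)
      have "cmod (measure M (A i) *\<^sub>R q i - \<nu> (A i)) = cmod (LINT x|M. indicat_real (A i) x *\<^sub>R q i - indicat_real (A i) x *\<^sub>R s x)"
        unfolding eq[OF Am] set_lebesgue_integral_def
        unfolding Bochner_Integration.integral_diff[OF iq ia] by (subst integral_scaleR_left) (auto intro!: integrable_bounded[of _ 1] simp: indicator_def)
      also have "\<dots> \<le> (LINT x|M. norm (indicat_real (A i) x *\<^sub>R q i - indicat_real (A i) x *\<^sub>R s x))"
        by (rule integral_norm_bound)
      also have "\<dots> \<le> (LINT x|M. \<epsilon> * indicat_real (A i) x)"
      proof (rule integral_mono)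
        show "integrable M (\<lambda>x. norm (indicat_real (A i) x *\<^sub>R q i - indicat_real (A i) x *\<^sub>R s x))"
          using ia iq by auto
        show "norm (indicat_real (A i) x *\<^sub>R q i - indicat_real (A i) x *\<^sub>R s x) \<le> \<epsilon> * indicat_real (A i) x" for x
          using AB by (auto simp: indicator_def B_def norm_minus_commute less_imp_le)
        show "integrable M (\<lambda>x. \<epsilon> * indicat_real (A i) x)"
          by (intro integrable_bounded[of _ \<epsilon>]) (use e in \<open>auto simp: indicator_def\<close>)
      qed
      also have "\<dots> = \<epsilon> * measure M (A i)" by simp
      finally have "cmod (measure M (A i) *\<^sub>R q i) - cmod (\<nu> (A i)) \<le> \<epsilon> * measure M (A i)"
        using norm_triangle_ineq2 order.trans by blast
      moreover have "(1 - \<epsilon>) * measure M (A i) \<le> cmod (measure M (A i) *\<^sub>R q i)"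
        using mult_right_mono[OF \<open>norm (q i) \<ge> 1 - \<epsilon>\<close>, of "measure M (A i)"] by (simp add: mult.commute)
      ultimately show ?thesis by (simp add: algebra_simps)
    qed simp
    then have "(\<Sum>i. ennreal ((1 - 2 * \<epsilon>) * measure M (A i))) \<le> (\<Sum>i. ennreal (cmod (\<nu> (A i))))"
      by (intro suminf_le ennreal_leI) auto
    also have "\<dots> \<le> total_variation \<nu> UNIV"
      unfolding total_variation_def by (rule SUP_upper) (use UA dA Am in auto)
    finally have "(\<Sum>i. ennreal ((1 - 2 * \<epsilon>) * measure M (A i))) \<le> total_variation \<nu> UNIV" .
    moreover have "(\<Sum>i. ennreal ((1 - 2 * \<epsilon>) * measure M (A i))) = ennreal ((1 - 2 * \<epsilon>) * measure M UNIV)"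
    proof -
      have "(\<Sum>i. ennreal ((1 - 2 * \<epsilon>) * measure M (A i))) = (\<Sum>i. ennreal (1 - 2 * \<epsilon>) * emeasure M (A i))"
        using e by (intro suminf_cong) (simp add: ennreal_mult emeasure_eq_measure)
      also have "\<dots> = ennreal (1 - 2 * \<epsilon>) * emeasure M UNIV"
        using UA dA Am by (subst ennreal_suminf_cmult, subst suminf_emeasure) auto
      finally show ?thesis using e by (simp add: ennreal_mult emeasure_eq_measure)
    qed
    ultimately show ?thesis by simp
  qed
  \<comment> \<open>The offset 3 keeps \<open>1 / (n + 3)\<close> strictly below 1/2 already for
    \<open>n = 0\<close>.\<close>
  have "(\<lambda>n. 1 - 2 * (1 / real (n + 3))) \<longlonglongrightarrow> 1" by real_asymp
  from tendsto_mult[OF this tendsto_const[of "measure M UNIV"]]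
  have "(\<lambda>n. ennreal ((1 - 2 * (1 / real (n + 3))) * measure M UNIV)) \<longlonglongrightarrow> ennreal (measure M UNIV)"
    by (intro tendsto_ennrealI) simp
  then have "ennreal (measure M UNIV) \<le> total_variation \<nu> UNIV"
  proof (rule LIMSEQ_le_const2, intro exI allI impI)
    show "ennreal ((1 - 2 * (1 / real (n + 3))) * measure M UNIV) \<le> total_variation \<nu> UNIV" for n
      by (rule bound) auto
  qed
  then show "emeasure M UNIV \<le> total_variation \<nu> UNIV" by (simp add: emeasure_eq_measure)
qed

end

section \<open>Smooth bump functions\<close>

text \<open>The derivative is existentially quantified and smoothness asks for each finite order
  separately, so that products and affine substitutions follow by induction on \<open>k\<close>.
  \<open>smooth_tower\<close> recovers one coherent sequence of derivatives.\<close>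

primrec diff_k :: "nat \<Rightarrow> (real \<Rightarrow> real) \<Rightarrow> bool" where
  "diff_k 0 f \<longleftrightarrow> True"
| "diff_k (Suc k) f \<longleftrightarrow> (\<exists>f'. (\<forall>x. (f has_real_derivative f' x) (at x)) \<and> diff_k k f')"

definition smooth :: "(real \<Rightarrow> real) \<Rightarrow> bool" where
  "smooth f \<longleftrightarrow> (\<forall>k. diff_k k f)"

lemma diff_k_le: "diff_k (Suc k) f \<Longrightarrow> diff_k k f"
  by (induction k arbitrary: f) auto

lemma diff_k_add: "diff_k k f \<Longrightarrow> diff_k k g \<Longrightarrow> diff_k k (\<lambda>x. f x + g x)"
proof (induction k arbitrary: f g)
  case (Suc k)
  then obtain f' g' where
    "\<forall>x. (f has_real_derivative f' x) (at x)" "diff_k k f'"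
    "\<forall>x. (g has_real_derivative g' x) (at x)" "diff_k k g'" by auto
  with Suc.IH[of f' g'] show ?case
    by (auto intro!: exI[of _ "\<lambda>x. f' x + g' x"] DERIV_add)
qed simp

lemma diff_k_mult: "diff_k k f \<Longrightarrow> diff_k k g \<Longrightarrow> diff_k k (\<lambda>x. f x * g x)"
proof (induction k arbitrary: f g)
  case (Suc k)
  from Suc.prems obtain f' g' where d:
    "\<And>x. (f has_real_derivative f' x) (at x)" "diff_k k f'"
    "\<And>x. (g has_real_derivative g' x) (at x)" "diff_k k g'" by auto
  have "diff_k k (\<lambda>x. f' x * g x + g' x * f x)"
    by (rule diff_k_add[OF Suc.IH[OF d(2) diff_k_le[OF Suc.prems(2)]] Suc.IH[OF d(4) diff_k_le[OF Suc.prems(1)]]])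
  moreover have "((\<lambda>x. f x * g x) has_real_derivative f' x * g x + g' x * f x) (at x)" for x
    using DERIV_mult[OF d(1) d(3)] by simp
  ultimately show ?case by (auto intro!: exI[of _ "\<lambda>x. f' x * g x + g' x * f x"])
qed simp

text \<open>The factor \<open>c\<close> is part of the statement because each differentiation
  produces a further factor \<open>a\<close>.\<close>

lemma diff_k_affine: "diff_k k f \<Longrightarrow> diff_k k (\<lambda>x. c * f (a * x + b))"
proof (induction k arbitrary: f c)
  case (Suc k)
  from Suc.prems obtain f' where d: "\<And>x. (f has_real_derivative f' x) (at x)" "diff_k k f'" by auto
  have "((\<lambda>x. c * f (a * x + b)) has_real_derivative (c * a) * f' (a * x + b)) (at x)" for x
    by (auto intro!: derivative_eq_intros DERIV_chain2[OF d(1)])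
  then show ?case
    using Suc.IH[OF d(2), of "c * a"] by (auto intro!: exI[of _ "\<lambda>x. (c * a) * f' (a * x + b)"])
qed simp

lemma smooth_mult: "smooth f \<Longrightarrow> smooth g \<Longrightarrow> smooth (\<lambda>x. f x * g x)"
  unfolding smooth_def using diff_k_mult by blast

lemma smooth_affine: "smooth f \<Longrightarrow> smooth (\<lambda>x. f (a * x + b))"
  unfolding smooth_def using diff_k_affine[of _ f 1 a b] by simp

text \<open>The standard flat function \<open>exp (-1/t)\<close>; its derivatives are polynomials in \<open>1/t\<close> times
  \<open>exp (-1/t)\<close>, whence the generality of the next definition.\<close>

definition flat :: "real poly \<Rightarrow> real \<Rightarrow> real" where
  "flat p t = (if t \<le> 0 then 0 else poly p (1 / t) * exp (- (1 / t)))"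

lemma poly_times_exp_tendsto_0: "((\<lambda>x. poly p x * exp (- x)) \<longlongrightarrow> (0::real)) at_top"
proof -
  have "((\<lambda>x. \<Sum>i\<le>degree p. coeff p i * (x ^ i / exp x)) \<longlongrightarrow> (\<Sum>i\<le>degree p. coeff p i * 0)) at_top"
    by (intro tendsto_sum tendsto_mult tendsto_const tendsto_power_div_exp_0)
  then show ?thesis
    by (simp add: poly_altdef exp_minus divide_inverse sum_distrib_right mult.assoc)
qed

text \<open>With \<open>u = 1 / t\<close>, differentiating \<open>p(u) exp(-u)\<close> in
  \<open>t\<close> gives \<open>u^2 (p - p')(u) exp(-u)\<close>, so the family is closed under
  differentiation. At 0 the difference quotient vanishes because the exponential beats every
  polynomial.\<close>

lemma flat_has_derivative:
  "(flat p has_real_derivative flat ([:0, 0, 1:] * (p - pderiv p)) t) (at t)"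
proof -
  let ?q = "[:0, 0, 1:] * (p - pderiv p)"
  consider "t < 0" | "t > 0" | "t = 0" by linarith
  then show ?thesis
  proof cases
    case 1
    have "((\<lambda>_. 0) has_real_derivative flat ?q t) (at t)" using 1 by (simp add: flat_def)
    then show ?thesis
    proof (rule has_field_derivative_transform_within_open[where S = "{..<0}"])
    qed (use 1 in \<open>auto simp: flat_def\<close>)
  next
    case 2
    have "((\<lambda>t. poly p (1 / t) * exp (- (1 / t))) has_real_derivative flat ?q t) (at t)"
      using 2 by (auto intro!: derivative_eq_intros DERIV_chain2[OF poly_DERIV] simp: flat_def field_simps power2_eq_square)
    then show ?thesis
    proof (rule has_field_derivative_transform_within_open[where S = "{0<..}"])
    qed (use 2 in \<open>auto simp: flat_def\<close>)
  next
    case 3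
    have r: "((\<lambda>y. flat p y / y) \<longlongrightarrow> 0) (at_right 0)"
    proof -
      \<comment> \<open>Dividing by \<open>y\<close> multiplies the polynomial in
        \<open>1 / y\<close> by its variable.\<close>
      have "((\<lambda>y. poly ([:0, 1:] * p) (inverse y) * exp (- inverse y)) \<longlongrightarrow> 0) (at_right 0)"
        by (rule filterlim_compose[OF poly_times_exp_tendsto_0 filterlim_inverse_at_top_right])
      then show ?thesis
        by (rule tendsto_cong[THEN iffD1, rotated])
          (auto simp: eventually_at_filter flat_def divide_inverse intro!: always_eventually)
    qed
    have l: "((\<lambda>y. flat p y / y) \<longlongrightarrow> 0) (at_left 0)"
      by (rule tendsto_cong[THEN iffD1, OF _ tendsto_const])
        (auto simp: eventually_at_filter flat_def intro!: always_eventually)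
    have "((\<lambda>y. flat p y / y) \<longlongrightarrow> 0) (at 0)" using l r by (simp add: filterlim_split_at_real)
    then have "((\<lambda>y. (flat p y - flat p 0) / (y - 0)) \<longlongrightarrow> 0) (at 0)" by (simp add: flat_def)
    then show ?thesis unfolding 3 has_field_derivative_iff by (simp add: flat_def)
  qed
qed

lemma smooth_flat: "smooth (flat p)"
proof -
  have "diff_k k (flat p)" for k
    by (induction k arbitrary: p) (auto intro: flat_has_derivative)
  then show ?thesis by (simp add: smooth_def)
qed

text \<open>Increasing \<open>k\<close> steepens both flanks without enlarging the support, so the
  functions approach the indicator of the open interval from below.\<close>

definition bump1 :: "nat \<Rightarrow> real \<Rightarrow> real \<Rightarrow> real \<Rightarrow> real" where
  "bump1 k a b t = flat 1 (real k * (t - a)) * flat 1 (real k * (b - t))"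

lemma smooth_bump1: "smooth (bump1 k a b)"
proof -
  have "smooth (\<lambda>t. flat 1 (real k * t + (- real k * a)) * flat 1 (- real k * t + real k * b))"
    by (intro smooth_mult smooth_affine smooth_flat)
  then show ?thesis by (simp add: bump1_def[abs_def] algebra_simps)
qed

lemma flat_1_nonneg: "0 \<le> flat 1 t" and flat_1_le_1: "flat 1 t \<le> 1"
  by (auto simp: flat_def)

lemma bump1_nonneg: "0 \<le> bump1 k a b t"
  by (simp add: bump1_def flat_1_nonneg)

lemma bump1_le: "bump1 k a b t \<le> indicator {a<..<b} t"
proof (cases "a < t \<and> t < b")
  case True
  then show ?thesis
    by (simp add: bump1_def mult_le_one flat_1_nonneg flat_1_le_1)
next
  case False
  then have "real k * (t - a) \<le> 0 \<or> real k * (b - t) \<le> 0"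
    by (auto simp: mult_le_0_iff)
  then show ?thesis by (auto simp: bump1_def flat_def)
qed

lemma bump1_pos: "k > 0 \<Longrightarrow> a < t \<Longrightarrow> t < b \<Longrightarrow> 0 < bump1 k a b t"
  by (simp add: bump1_def flat_def mult_le_0_iff not_le)

lemma flat_1_tendsto: "t > 0 \<Longrightarrow> (\<lambda>k. flat 1 (real k * t)) \<longlonglongrightarrow> 1"
proof -
  assume t: "t > 0"
  have "(\<lambda>k. exp (- (1 / (real k * t)))) \<longlonglongrightarrow> 1" using t by real_asymp
  then show ?thesis
    by (rule tendsto_cong[THEN iffD1, rotated])
      (use t in \<open>auto simp: flat_def mult_le_0_iff intro!: eventually_sequentiallyI[of 1]\<close>)
qed

lemma bump1_tendsto: "(\<lambda>k. bump1 k a b t) \<longlonglongrightarrow> indicator {a<..<b} t"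
proof (cases "a < t \<and> t < b")
  case True
  then show ?thesis
    unfolding bump1_def using tendsto_mult[OF flat_1_tendsto[of "t - a"] flat_1_tendsto[of "b - t"]] by simp
next
  case False
  then have "bump1 k a b t = 0" for k
    using bump1_le[of k a b t] bump1_nonneg[of k a b t] by (auto simp: indicator_def)
  then show ?thesis using False by (auto simp: indicator_def)
qed

definition bump :: "nat \<Rightarrow> real^'n \<Rightarrow> real^'n \<Rightarrow> real^'n \<Rightarrow> real" where
  "bump k a b x = (\<Prod>i\<in>UNIV. bump1 k (a $ i) (b $ i) (x $ i))"

lemma bump_nonneg: "0 \<le> bump k a b x"
  by (simp add: bump_def prod_nonneg bump1_nonneg)

lemma indicator_box_vec: "indicator (box a b) x = (\<Prod>i\<in>UNIV. indicator {a $ i<..<b $ i} (x $ i) :: real)"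
  for a b x :: "real^'n"
  by (auto simp: indicator_def mem_box_cart prod_eq_1_iff)

lemma bump_le: "bump k a b x \<le> indicator (box a b) x"
  unfolding bump_def indicator_box_vec by (intro prod_mono) (auto simp: bump1_nonneg bump1_le)

lemma bump_pos: "k > 0 \<Longrightarrow> x \<in> box a b \<Longrightarrow> 0 < bump k a b x"
  unfolding bump_def by (intro prod_pos) (auto simp: mem_box_cart bump1_pos)

lemma bump_tendsto: "(\<lambda>k. bump k a b x) \<longlonglongrightarrow> indicator (box a b) x"
  unfolding bump_def indicator_box_vec by (intro tendsto_prod bump1_tendsto)

text \<open>For each order \<open>diff_k\<close> may choose its own first derivative; uniqueness of
  derivatives identifies these choices, so the derivative is smooth again and the step can be
  iterated.\<close>

lemma smooth_tower:
  assumes "smooth f"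
  shows "\<exists>D. D 0 = f \<and> (\<forall>k x. (D k has_real_derivative D (Suc k) x) (at x))"
proof -
  have "\<exists>g. (\<forall>x. (f has_real_derivative g x) (at x)) \<and> smooth g" if f: "smooth f" for f
  proof -
    obtain g where g: "\<And>x. (f has_real_derivative g x) (at x)"
      using f[unfolded smooth_def, rule_format, of "Suc 0"] by auto
    have "diff_k k g" for k
    proof -
      obtain h where h: "\<And>x. (f has_real_derivative h x) (at x)" "diff_k k h"
        using f[unfolded smooth_def, rule_format, of "Suc k"] by auto
      have "h = g" using DERIV_unique[OF h(1) g] by auto
      then show ?thesis using h by simp
    qed
    then show ?thesis using g by (auto simp: smooth_def)
  qed
  then have "\<exists>D. \<forall>n. (smooth (D n) \<and> (n = 0 \<longrightarrow> D n = f)) \<and> (\<forall>x. (D n has_real_derivative D (Suc n) x) (at x))"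
    using assms by (intro dependent_nat_choice) auto
  then show ?thesis by blast
qed

lemma continuous_bump: "continuous_on UNIV (bump k a b)"
  for a b :: "real^'n"
proof -
  have "continuous_on UNIV (bump1 k a b)" for a b
    using smooth_tower[OF smooth_bump1[of k a b]]
    by (metis DERIV_isCont continuous_at_imp_continuous_on)
  then have "continuous_on UNIV (\<lambda>x::real^'n. bump1 k (a $ i) (b $ i) (x $ i))" for i
    by (rule continuous_on_compose2) (auto intro: continuous_intros)
  then show ?thesis unfolding bump_def[abs_def] by (intro continuous_intros)
qed

text \<open>A product of one-variable functions has partial derivatives of the same form, so it is
  enough to keep track of the order of differentiation in each variable.\<close>

lemma C_k_prod:
  fixes D :: "'n::finite \<Rightarrow> nat \<Rightarrow> real \<Rightarrow> real" and A :: "'b::real_normed_vector"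
  assumes D: "\<And>i k x. (D i k has_real_derivative D i (Suc k) x) (at x)"
  shows "C_k k (\<lambda>x::real^'n. (\<Prod>i\<in>UNIV. D i (\<kappa> i) (x $ i)) *\<^sub>R A)"
proof (induction k arbitrary: \<kappa>)
  case 0
  have "continuous_on UNIV (D i k)" for i k
    using D by (auto intro!: continuous_at_imp_continuous_on DERIV_isCont)
  then have "continuous_on UNIV (\<lambda>x::real^'n. D i k (x $ i))" for i k
    by (rule continuous_on_compose2) (auto intro: continuous_intros)
  then show ?case by (auto intro!: continuous_intros)
next
  case (Suc k)
  have der: "((\<lambda>x::real^'n. (\<Prod>i\<in>UNIV. D i (\<kappa> i) (x $ i)) *\<^sub>R A) has_derivative
      (\<lambda>v. (\<Sum>i\<in>UNIV. (v $ i * D i (Suc (\<kappa> i)) (x $ i)) * (\<Prod>j\<in>UNIV - {i}. D j (\<kappa> j) (x $ j))) *\<^sub>R A)) (at x)"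
    for x
  proof -
    have "((\<lambda>x::real^'n. D i (\<kappa> i) (x $ i)) has_derivative (\<lambda>v. v $ i * D i (Suc (\<kappa> i)) (x $ i))) (at x)" for i
    proof -
      have "((\<lambda>x::real^'n. x $ i) has_derivative (\<lambda>v. v $ i)) (at x)"
        by (rule bounded_linear_imp_has_derivative[OF bounded_linear_vec_nth])
      from has_derivative_compose[OF this D[of i "\<kappa> i" "x $ i", unfolded has_field_derivative_def]]
      show ?thesis by (simp add: mult.commute)
    qed
    then show ?thesis
      by (intro has_derivative_scaleR_left has_derivative_prod)
  qed
  have fd: "frechet_derivative (\<lambda>x::real^'n. (\<Prod>i\<in>UNIV. D i (\<kappa> i) (x $ i)) *\<^sub>R A) (at x) (axis i 1)
      = (\<Prod>j\<in>UNIV. D j ((\<kappa>(i := Suc (\<kappa> i))) j) (x $ j)) *\<^sub>R A" for x i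
  proof -
    have "(\<Sum>l\<in>UNIV. (axis i 1 $ l * D l (Suc (\<kappa> l)) (x $ l)) * (\<Prod>j\<in>UNIV - {l}. D j (\<kappa> j) (x $ j)))
       = D i (Suc (\<kappa> i)) (x $ i) * (\<Prod>j\<in>UNIV - {i}. D j (\<kappa> j) (x $ j))"
      by (subst sum.remove[of UNIV i]) (auto simp: axis_def intro!: sum.neutral)
    also have "\<dots> = (\<Prod>j\<in>UNIV. D j ((\<kappa>(i := Suc (\<kappa> i))) j) (x $ j))"
      by (subst prod.remove[of UNIV i]) (auto intro!: prod.cong)
    finally show ?thesis
      unfolding frechet_derivative_at[OF der, symmetric] by simp
  qed
  show ?case
    unfolding C_k.simps
  proof (intro conjI allI)
    show "(\<lambda>x::real^'n. (\<Prod>i\<in>UNIV. D i (\<kappa> i) (x $ i)) *\<^sub>R A) differentiable_on UNIV"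
      unfolding differentiable_on_def differentiable_def using der by blast
    show "C_k k (\<lambda>x. frechet_derivative (\<lambda>x::real^'n. (\<Prod>i\<in>UNIV. D i (\<kappa> i) (x $ i)) *\<^sub>R A) (at x) (axis i 1))"
      for i unfolding fd by (rule Suc)
  qed
qed

lemma C_k_bump:
  fixes A :: "'b::real_normed_vector" and a b :: "real^'n"
  shows "C_k l (\<lambda>x. bump k a b x *\<^sub>R A)"
proof -
  have "\<forall>i. \<exists>D. D 0 = bump1 k (a $ i) (b $ i) \<and> (\<forall>k x. (D k has_real_derivative D (Suc k) x) (at x))"
    by (intro allI smooth_tower smooth_bump1)
  then obtain D where D: "\<And>i. D i 0 = bump1 k (a $ i) (b $ i)"
    "\<And>i k x. (D i k has_real_derivative D i (Suc k) x) (at x)" by metis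
  show ?thesis
    using C_k_prod[of D l "\<lambda>_. 0" A, OF D(2)] by (simp add: D(1) bump_def)
qed

lemma bump_eq_0: "x \<notin> cbox a b \<Longrightarrow> bump k a b x = 0"
proof -
  assume "x \<notin> cbox a b"
  then have "x \<notin> box a b" using box_subset_cbox[of a b] by auto
  then show ?thesis using bump_le[of k a b x] bump_nonneg[of k a b x] by simp
qed

lemma C0_infty_bump: "(\<lambda>x. bump k a b x *\<^sub>R A) \<in> C0_infty"
  unfolding C0_infty_def
proof (intro CollectI conjI allI)
  show "C_k l (\<lambda>x. bump k a b x *\<^sub>R A)" for l by (rule C_k_bump)
  have "{x. bump k a b x *\<^sub>R A \<noteq> 0} \<subseteq> cbox a b" using bump_eq_0[of _ a b k] by auto
  then show "compact (closure {x. bump k a b x *\<^sub>R A \<noteq> 0})"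
    using bounded_subset[OF bounded_cbox] compact_closure by blast
qed

section \<open>Approximation of integrable functions by bumps\<close>

lemma box_generates_borel:
  "sets (borel :: (real^'n) measure) = sigma_sets UNIV (range (\<lambda>(a, b). box a b))"
  unfolding borel_eq_box by (rule sets_measure_of) simp

lemma Int_stable_boxes: "Int_stable (range (\<lambda>(a, b). box a b :: (real^'n) set))"
  unfolding Int_stable_def by (auto simp: box_Int_box)

text \<open>Functional monotone class argument: the bumps approximate indicators of boxes, which
  generate the Borel sets.\<close>

lemma integrable_induct_bump [consumes 2, case_names bump add mult lim]:
  fixes f :: "real^'n \<Rightarrow> complex" and P :: "(real^'n \<Rightarrow> complex) \<Rightarrow> bool"
  assumes sets: "sets M = sets borel" and f: "integrable M f"
  assumes bump: "\<And>k a b. k > 0 \<Longrightarrow> P (\<lambda>x. complex_of_real (bump k a b x))"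
    and add: "\<And>f g. integrable M f \<Longrightarrow> integrable M g \<Longrightarrow> P f \<Longrightarrow> P g \<Longrightarrow> P (\<lambda>x. f x + g x)"
    and mult: "\<And>c f. integrable M f \<Longrightarrow> P f \<Longrightarrow> P (\<lambda>x. c * f x)"
    and lim: "\<And>f s. integrable M f \<Longrightarrow> (\<And>i. integrable M (s i)) \<Longrightarrow> (\<And>i. P (s i)) \<Longrightarrow>
       (\<lambda>i. LINT x|M. cmod (s i x - f x)) \<longlonglongrightarrow> 0 \<Longrightarrow> P f"
    and fin: "\<And>a b. emeasure M (box a b) < \<infinity>"
  shows "P f"
proof -
  note [measurable_cong] = sets
  have space: "space M = UNIV" using sets_eq_imp_space_eq[OF sets] by simp
  \<comment> \<open>The pointwise limits taken here have an integrable majorant; dominated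
    convergence turns them into the convergence in mean that \<open>lim\<close> expects.\<close>
  have dom: "P f" if "integrable M w" "\<And>i. s i \<in> borel_measurable M" "f \<in> borel_measurable M"
    "\<And>i. P (s i)" "\<And>x. (\<lambda>i. s i x) \<longlonglongrightarrow> f x" "\<And>i x. cmod (s i x) \<le> w x"
    for f :: "real^'n \<Rightarrow> complex" and s w
  proof (rule lim)
    have w: "0 \<le> w x" for x using that(6)[of 0 x] norm_ge_zero order.trans by blast
    have b: "cmod (f x) \<le> w x" for x
      by (rule LIMSEQ_le_const2[OF tendsto_norm[OF that(5)]]) (use that(6) in auto)
    show "integrable M f"
      by (rule Bochner_Integration.integrable_bound[OF that(1) that(3)]) (use b w in auto)
    show "integrable M (s i)" for i
      by (rule Bochner_Integration.integrable_bound[OF that(1) that(2)]) (use that(6) w in auto)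
    show "P (s i)" for i by fact
    have "(\<lambda>i. LINT x|M. cmod (s i x - f x)) \<longlonglongrightarrow> (LINT x|M. 0)"
    proof (rule integral_dominated_convergence[where w = "\<lambda>x. 2 * w x"])
      show "AE x in M. (\<lambda>i. cmod (s i x - f x)) \<longlonglongrightarrow> 0"
        using that(5) by (intro AE_I2) (simp add: tendsto_norm_zero LIM_zero)
      show "AE x in M. norm (cmod (s i x - f x)) \<le> 2 * w x" for i
      proof (rule AE_I2)
        fix x show "norm (cmod (s i x - f x)) \<le> 2 * w x"
          using norm_triangle_ineq4[of "s i x" "f x"] that(6)[of i x] b[of x] by simp
      qed
      show "(\<lambda>x. cmod (s i x - f x)) \<in> borel_measurable M" for i
        using that(2,3) by measurable
    qed (use that in auto)
    then show "(\<lambda>i. LINT x|M. cmod (s i x - f x)) \<longlonglongrightarrow> 0" by simp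
  qed
  have bm: "bump k a b \<in> borel_measurable borel" for k and a b :: "real^'n"
    by (intro borel_measurable_continuous_onI continuous_bump)
  have ib: "integrable M (\<lambda>x. indicat_real (box a b) x)" for a b
    using fin[of a b] sets by (intro integrable_real_indicator) auto
  have box: "P (\<lambda>x. complex_of_real (indicator (box a b) x))" for a b
  proof (rule dom[OF ib[of a b]])
    show "P (\<lambda>x. complex_of_real (bump (Suc i) a b x))" for i by (rule bump) simp
    show "(\<lambda>i. complex_of_real (bump (Suc i) a b x)) \<longlonglongrightarrow> complex_of_real (indicator (box a b) x)" for x
      by (intro tendsto_of_real LIMSEQ_Suc[OF bump_tendsto])
    show "cmod (complex_of_real (bump (Suc i) a b x)) \<le> indicator (box a b) x" for i x
      using bump_le[of "Suc i" a b x] bump_nonneg[of "Suc i" a b x] by simp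
  qed (use bm sets in auto)
  have pw: "range (\<lambda>(a, b). box a b :: (real^'n) set) \<subseteq> Pow UNIV" by simp
  \<comment> \<open>Intersecting with a box keeps complements integrable, since \<open>M\<close> is
    only known to be finite on boxes. The boxes form an intersection-stable generator of the Borel
    sets.\<close>
  have bounded_set: "P (\<lambda>x. complex_of_real (indicator (A \<inter> box a b) x))"
    if A: "A \<in> sets borel" for A a b
  proof -
    have "A \<in> sigma_sets UNIV (range (\<lambda>(a, b). box a b))"
      using A unfolding box_generates_borel .
    from Int_stable_boxes pw this show ?thesis
    proof (induction rule: sigma_sets_induct_disjoint)
      case (basic A)
      then obtain c d where "A = box c d" by auto
      moreover obtain e g where "box c d \<inter> box a b = box e g" unfolding box_Int_box by blast
      ultimately show ?case using box by metis
    next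
      case empty
      show ?case using mult[of "\<lambda>x. complex_of_real (indicator (box 0 0) x)" 0] box[of 0 0] ib[of 0 0] by simp
    next
      case (compl A)
      have Ab: "A \<in> sets borel" using compl unfolding box_generates_borel by simp
      have i: "integrable M (\<lambda>x. complex_of_real (indicator (A \<inter> box a b) x))"
        by (intro integrable_of_real Bochner_Integration.integrable_bound[OF ib[of a b]])
          (use Ab sets in \<open>auto simp: indicator_def\<close>)
      have "P (\<lambda>x. complex_of_real (indicator (box a b) x) + (-1) * complex_of_real (indicator (A \<inter> box a b) x))"
        using i ib[of a b] by (intro add mult box compl) auto
      also have "(\<lambda>x. complex_of_real (indicator (box a b) x) + (-1) * complex_of_real (indicator (A \<inter> box a b) x))
         = (\<lambda>x. complex_of_real (indicator ((UNIV - A) \<inter> box a b) x))"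
        by (auto simp: indicator_def)
      finally show ?case .
    next
      case (union A)
      have Ab: "A i \<in> sets borel" for i using union unfolding box_generates_borel by auto
      have i: "integrable M (\<lambda>x. complex_of_real (indicator (C \<inter> box a b) x))" if "C \<in> sets borel" for C
        by (intro integrable_of_real Bochner_Integration.integrable_bound[OF ib[of a b]])
          (use that sets in \<open>auto simp: indicator_def\<close>)
      have d: "i \<noteq> j \<Longrightarrow> A i \<inter> A j = {}" for i j using disjoint_family_onD[OF union(1), of i j] by simp
      have s: "P (\<lambda>x. complex_of_real (indicator ((\<Union>i<n. A i) \<inter> box a b) x))" for n :: nat
      proof (induction n)
        case 0
        then show ?case using mult[of "\<lambda>x. complex_of_real (indicator (box 0 0) x)" 0] box[of 0 0] ib[of 0 0] by simp
      next
        case (Suc n)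
        have "P (\<lambda>x. complex_of_real (indicator ((\<Union>i<n. A i) \<inter> box a b) x) + complex_of_real (indicator (A n \<inter> box a b) x))"
          by (intro add i Suc union) (use Ab in auto)
        also have "(\<lambda>x. complex_of_real (indicator ((\<Union>i<n. A i) \<inter> box a b) x) + complex_of_real (indicator (A n \<inter> box a b) x))
          = (\<lambda>x. complex_of_real (indicator ((\<Union>i<Suc n. A i) \<inter> box a b) x))"
        proof
          fix x
          show "complex_of_real (indicator ((\<Union>i<n. A i) \<inter> box a b) x) + complex_of_real (indicator (A n \<inter> box a b) x)
            = complex_of_real (indicator ((\<Union>i<Suc n. A i) \<inter> box a b) x)"
          proof (cases "x \<in> A n")
            case True
            then have "x \<notin> A m" if "m < n" for m using d[of n m] that by auto
            then show ?thesis using True by (auto simp: indicator_def less_Suc_eq)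
          qed (auto simp: indicator_def less_Suc_eq)
        qed
        finally show ?case .
      qed
      show ?case
      proof (rule dom[OF ib[of a b]])
        show "(\<lambda>n. complex_of_real (indicator ((\<Union>i<n. A i) \<inter> box a b) x))
            \<longlonglongrightarrow> complex_of_real (indicator (\<Union> (range A) \<inter> box a b) x)" for x
        proof (cases "x \<in> \<Union> (range A)")
          case True
          then obtain i where "x \<in> A i" by auto
          then have "\<forall>\<^sub>F n in sequentially. complex_of_real (indicator ((\<Union>i<n. A i) \<inter> box a b) x)
              = complex_of_real (indicator (\<Union> (range A) \<inter> box a b) x)"
            by (intro eventually_sequentiallyI[of "Suc i"]) (auto simp: indicator_def)
          then show ?thesis by (rule tendsto_eventually)
        qed (auto simp: indicator_def)
        show "P (\<lambda>x. complex_of_real (indicator ((\<Union>i<n. A i) \<inter> box a b) x))" for n by (rule s)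
      qed (use Ab sets in \<open>auto simp: indicator_def\<close>)
    qed
  qed
  have set: "P (\<lambda>x. complex_of_real (indicator A x))" if A: "A \<in> sets borel" "emeasure M A < \<infinity>" for A
  proof (rule dom)
    show "integrable M (indicat_real A)" using A sets by (intro integrable_real_indicator) auto
    show "P (\<lambda>x. complex_of_real (indicator (A \<inter> box (\<chi> j. - real i) (\<chi> j. real i)) x))" for i
      by (rule bounded_set[OF A(1)])
    show "(\<lambda>i. complex_of_real (indicator (A \<inter> box (\<chi> j. - real i) (\<chi> j. real i)) x))
       \<longlonglongrightarrow> complex_of_real (indicator A x)" for x
    proof -
      have "x \<in> box (\<chi> j. - real i) (\<chi> j. real i)" if "norm x < real i" for i
      proof -
        have "\<bar>x $ j\<bar> < real i" for j using component_le_norm_cart[of x j] that by linarith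
        then show ?thesis by (auto simp: mem_box_cart abs_less_iff minus_less_iff)
      qed
      moreover have "norm x < real i" if "nat \<lceil>norm x\<rceil> + 1 \<le> i" for i
        using that by linarith
      ultimately have "\<forall>\<^sub>F i in sequentially. complex_of_real (indicator (A \<inter> box (\<chi> j. - real i) (\<chi> j. real i)) x)
           = complex_of_real (indicator A x)"
        by (intro eventually_sequentiallyI[of "nat \<lceil>norm x\<rceil> + 1"]) (simp add: indicator_def)
      then show ?thesis by (rule tendsto_eventually)
    qed
  qed (use A sets in \<open>auto simp: indicator_def\<close>)
  show "P f"
    using f
  proof (induction rule: integrable_induct)
    case (base A c)
    have "P (\<lambda>x. c * complex_of_real (indicator A x))"
      using base sets by (intro mult set integrable_of_real integrable_real_indicator) auto
    then show ?case by (simp add: scaleR_conv_of_real mult.commute)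
  next
    case (add f g)
    then show ?case using assms(4) by blast
  next
    case (lim f s)
    show ?case
    proof (rule dom[of "\<lambda>x. 2 * cmod (f x)" s])
      show "integrable M (\<lambda>x. 2 * cmod (f x))" using lim by auto
    qed (use lim space in auto)
  qed
qed

section \<open>Fourier inversion for test functions\<close>

text \<open>A product majorant gives integrability for the product measure at once, and it is in
  this form that the applications supply their bounds.\<close>

lemma Fubini_product_bound:
  fixes f :: "'a \<Rightarrow> 'b \<Rightarrow> complex"
  assumes M: "sigma_finite_measure M" "sigma_finite_measure N"
    and f: "case_prod f \<in> borel_measurable (M \<Otimes>\<^sub>M N)"
    and g: "integrable M g" and h: "integrable N h"
    and le: "\<And>x y. cmod (f x y) \<le> g x * h y"
  shows "(LINT x|M. LINT y|N. f x y) = (LINT y|N. LINT x|M. f x y)"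
    and "integrable M (\<lambda>x. LINT y|N. f x y)" and "integrable N (\<lambda>y. LINT x|M. f x y)"
proof -
  interpret P: pair_sigma_finite M N using M by (simp add: pair_sigma_finite_def)
  have [measurable]: "g \<in> borel_measurable M" "h \<in> borel_measurable N" using g h by auto
  have i1: "integrable (M \<Otimes>\<^sub>M N) (\<lambda>p. g (fst p) * h (snd p))"
  proof (rule P.Fubini_integrable)
    show "(\<lambda>p. g (fst p) * h (snd p)) \<in> borel_measurable (M \<Otimes>\<^sub>M N)" by measurable
    have "integrable M (\<lambda>x. norm (g x) * (LINT y|N. norm (h y)))" using g by auto
    then show "integrable M (\<lambda>x. LINT y|N. norm (g (fst (x, y)) * h (snd (x, y))))" by (simp add: abs_mult)
    show "AE x in M. integrable N (\<lambda>y. g (fst (x, y)) * h (snd (x, y)))" using h by auto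
  qed
  have i: "integrable (M \<Otimes>\<^sub>M N) (case_prod f)"
    by (rule Bochner_Integration.integrable_bound[OF i1 f])
      (auto intro!: AE_I2 order.trans[OF le] simp: abs_mult[symmetric])
  show "(LINT x|M. LINT y|N. f x y) = (LINT y|N. LINT x|M. f x y)"
    using P.Fubini_integral[OF i] by simp
  show "integrable M (\<lambda>x. LINT y|N. f x y)" using P.integrable_fst'[OF i] by simp
  show "integrable N (\<lambda>y. LINT x|M. f x y)"
    using P.integrable_snd[OF i] by simp
qed

section \<open>Lebesgue measure as a product, and affine substitutions\<close>

lemma lborel_vec_eq: "(lborel :: (real^'n) measure) = distr (\<Pi>\<^sub>M i\<in>UNIV. lborel) borel (\<lambda>f. \<chi> i. f i)"
proof (rule lborel_eqI)
  interpret product_sigma_finite "\<lambda>_::'n. lborel :: real measure" by standard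
  fix l u :: "real^'n" assume le: "\<And>b. b \<in> Basis \<Longrightarrow> l \<bullet> b \<le> u \<bullet> b"
  have le': "l $ i \<le> u $ i" for i
  proof -
    have "axis i 1 \<in> (Basis :: (real^'n) set)" by (auto simp: Basis_vec_def)
    then show ?thesis using le[of "axis i 1"] by (simp add: inner_axis)
  qed
  have m: "(\<lambda>f. \<chi> i. f i) \<in> measurable (\<Pi>\<^sub>M i\<in>UNIV. lborel) (borel :: (real^'n) measure)"
    by (subst borel_measurable_euclidean_space) (auto simp: Basis_vec_def inner_axis)
  have "(\<lambda>f. \<chi> i. f i) -` box l u \<inter> space (\<Pi>\<^sub>M i\<in>UNIV. lborel) = (\<Pi>\<^sub>E i\<in>UNIV. {l $ i<..<u $ i})"
    by (auto simp: mem_box_cart space_PiM PiE_def Pi_def)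
  then have "emeasure (distr (\<Pi>\<^sub>M i\<in>UNIV. lborel) borel (\<lambda>f. \<chi> i. f i)) (box l u)
     = (\<Prod>i\<in>UNIV. emeasure lborel {l $ i<..<u $ i})"
    by (simp add: emeasure_distr[OF m] emeasure_PiM)
  also have "\<dots> = ennreal (\<Prod>i\<in>UNIV. u $ i - l $ i)"
    using le' by (simp add: prod_ennreal)
  also have "(\<Prod>i\<in>UNIV. u $ i - l $ i) = (\<Prod>b\<in>Basis. (u - l) \<bullet> b)"
  proof -
    have B: "(Basis :: (real^'n) set) = (\<lambda>i. axis i 1) ` UNIV" by (auto simp: Basis_vec_def)
    have "inj (\<lambda>i::'n. axis i (1::real))" by (auto simp: inj_on_def axis_eq_axis)
    then show ?thesis unfolding B by (simp add: prod.reindex inner_axis)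
  qed
  finally show "emeasure (distr (\<Pi>\<^sub>M i\<in>UNIV. lborel) borel (\<lambda>f. \<chi> i. f i)) (box l u) = ennreal (\<Prod>b\<in>Basis. (u - l) \<bullet> b)" .
qed simp

lemma
  fixes f :: "'n::finite \<Rightarrow> real \<Rightarrow> 'b::{real_normed_field,banach,second_countable_topology}"
  assumes f: "\<And>i. integrable lborel (f i)"
  shows integrable_lborel_prod: "integrable lborel (\<lambda>x::real^'n. \<Prod>i\<in>UNIV. f i (x $ i))"
    and integral_lborel_prod: "(LINT x|lborel. (\<Prod>i\<in>UNIV. f i (x $ i :: real))) = (\<Prod>i\<in>UNIV. (LINT t|lborel. f i t))"
proof -
  interpret product_sigma_finite "\<lambda>_::'n. lborel :: real measure" by standard
  have m: "(\<lambda>f. \<chi> i. f i) \<in> measurable (\<Pi>\<^sub>M i\<in>UNIV. lborel) (borel :: (real^'n) measure)"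
    by (subst borel_measurable_euclidean_space) (auto simp: Basis_vec_def inner_axis)
  have [measurable]: "f i \<in> borel_measurable borel" for i using f[of i] borel_measurable_integrable by fastforce
  have fm: "(\<lambda>x::real^'n. \<Prod>i\<in>UNIV. f i (x $ i)) \<in> borel_measurable borel"
    by measurable
  show "integrable lborel (\<lambda>x::real^'n. \<Prod>i\<in>UNIV. f i (x $ i))"
    unfolding lborel_vec_eq using product_integrable_prod[OF _ f, of UNIV]
    by (subst integrable_distr_eq[OF m fm]) simp
  show "(LINT x|lborel. (\<Prod>i\<in>UNIV. f i (x $ i :: real))) = (\<Prod>i\<in>UNIV. (LINT t|lborel. f i t))"
    unfolding lborel_vec_eq using product_integral_prod[OF _ f, of UNIV]
    by (subst integral_distr[OF m fm]) simp
qed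

lemma lborel_integral_affine:
  fixes f :: "'a::euclidean_space \<Rightarrow> 'b::{banach,second_countable_topology}"
  assumes f[measurable]: "f \<in> borel_measurable borel" and c: "c \<noteq> 0"
  shows "(LINT x|lborel. f x) = \<bar>c\<bar> ^ DIM('a) *\<^sub>R (LINT x|lborel. f (t + c *\<^sub>R x))"
proof -
  have "(LINT x|lborel. f x) = (LINT x|density (distr lborel borel (\<lambda>x. t + c *\<^sub>R x)) (\<lambda>_. ennreal (\<bar>c\<bar> ^ DIM('a))). f x)"
    by (simp only: lborel_affine[OF c, of t, symmetric])
  also have "\<dots> = (LINT x|distr lborel borel (\<lambda>x. t + c *\<^sub>R x). \<bar>c\<bar> ^ DIM('a) *\<^sub>R f x)"
    by (rule integral_density) auto
  also have "\<dots> = (LINT x|lborel. \<bar>c\<bar> ^ DIM('a) *\<^sub>R f (t + c *\<^sub>R x))"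
    by (rule integral_distr) measurable
  finally show ?thesis by simp
qed

lemma lborel_integral_translation:
  fixes f :: "'a::euclidean_space \<Rightarrow> 'b::{banach,second_countable_topology}"
  assumes "f \<in> borel_measurable borel"
  shows "(LINT x|lborel. f (t + x)) = (LINT x|lborel. f x)"
  using lborel_integral_affine[OF assms, of 1 t] by simp

lemma lborel_integrable_translation:
  fixes f :: "'a::euclidean_space \<Rightarrow> 'b::{banach,second_countable_topology}"
  assumes f: "integrable lborel f"
  shows "integrable lborel (\<lambda>x. f (t + x))"
proof -
  have [measurable]: "f \<in> borel_measurable borel" using f borel_measurable_integrable by fastforce
  have "integrable (distr lborel borel ((+) t)) f" using f by (simp add: lborel_distr_plus)
  then show ?thesis by (subst (asm) integrable_distr_eq) auto
qed

section \<open>Gaussian integrals\<close>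

lemma cis_sum: "finite A \<Longrightarrow> cis (sum f A) = (\<Prod>i\<in>A. cis (f i))"
  by (induction A rule: finite_induct) (auto simp: cis_mult[symmetric])

lemma cis_borel_measurable [measurable]: "cis \<in> borel_measurable borel"
  by (intro borel_measurable_continuous_onI continuous_intros)

text \<open>This is the characteristic function of the standard normal distribution, rescaled by
  \<open>s = t / c\<close>.\<close>

lemma gaussian_integral:
  assumes c: "c > 0"
  shows "integrable lborel (\<lambda>t. exp (- (t / c)\<^sup>2 / 2))"
    and "(LINT t|lborel. cis (t * a) * complex_of_real (exp (- (t / c)\<^sup>2 / 2)))
      = complex_of_real (sqrt (2 * pi) * c * exp (- (c * a)\<^sup>2 / 2))"
proof -
  have i0: "integrable lborel (\<lambda>t. sqrt (2 * pi) * std_normal_density t)"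
    using integrable_std_normal_moment[of 0] by (intro integrable_mult_right) simp
  have e: "(\<lambda>t::real. sqrt (2 * pi) * std_normal_density t) = (\<lambda>t. exp (- t\<^sup>2 / 2))"
    by (auto simp: std_normal_density_def fun_eq_iff)
  have i1: "integrable lborel (\<lambda>t::real. exp (- t\<^sup>2 / 2))" using i0 unfolding e .
  show "integrable lborel (\<lambda>t. exp (- (t / c)\<^sup>2 / 2))"
    using lborel_integrable_real_affine[OF i1, of "1 / c" 0] c by simp
  let ?f = "\<lambda>s. cis (s * (c * a)) * complex_of_real (exp (- s\<^sup>2 / 2))"
  have "(CLINT s|density lborel std_normal_density. iexp ((c * a) * s)) = complex_of_real (exp (- (c * a)\<^sup>2 / 2))"
    using fun_cong[OF char_std_normal_distribution, of "c * a"] by (simp add: char_def)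
  also have "(CLINT s|density lborel std_normal_density. iexp ((c * a) * s))
     = (LINT s|lborel. std_normal_density s *\<^sub>R iexp ((c * a) * s))"
    by (rule integral_density) auto
  also have "\<dots> = (LINT s|lborel. complex_of_real (1 / sqrt (2 * pi)) * ?f s)"
    by (intro Bochner_Integration.integral_cong)
      (auto simp: std_normal_density_def cis_conv_exp scaleR_conv_of_real mult_ac)
  finally have "complex_of_real (1 / sqrt (2 * pi)) * (LINT s|lborel. ?f s) = complex_of_real (exp (- (c * a)\<^sup>2 / 2))"
    by simp
  then have 1: "(LINT s|lborel. ?f s) = complex_of_real (sqrt (2 * pi) * exp (- (c * a)\<^sup>2 / 2))"
    by (simp add: field_simps)
  have "(LINT s|lborel. ?f s) = \<bar>1 / c\<bar> *\<^sub>R (LINT t|lborel. ?f (0 + 1 / c * t))"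
    using c by (intro lborel_integral_real_affine) auto
  also have "(\<lambda>t. ?f (0 + 1 / c * t)) = (\<lambda>t. cis (t * a) * complex_of_real (exp (- (t / c)\<^sup>2 / 2)))"
    using c by (auto simp: fun_eq_iff)
  finally have "(LINT t|lborel. cis (t * a) * complex_of_real (exp (- (t / c)\<^sup>2 / 2))) = c *\<^sub>R (LINT s|lborel. ?f s)"
    using c by simp
  then show "(LINT t|lborel. cis (t * a) * complex_of_real (exp (- (t / c)\<^sup>2 / 2)))
      = complex_of_real (sqrt (2 * pi) * c * exp (- (c * a)\<^sup>2 / 2))"
    unfolding 1 by (simp add: scaleR_conv_of_real mult_ac)
qed

lemma exp_norm_vec: "exp (- (norm y / c)\<^sup>2 / 2) = (\<Prod>i\<in>UNIV. exp (- (y $ i / c)\<^sup>2 / 2))" for y :: "real^'n"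
proof -
  have "(norm y)\<^sup>2 = (\<Sum>i\<in>UNIV. (y $ i)\<^sup>2)"
    by (simp add: norm_vec_def L2_set_def sum_nonneg)
  then have "- (norm y / c)\<^sup>2 / 2 = (\<Sum>i\<in>UNIV. - (y $ i / c)\<^sup>2 / 2)"
    by (simp add: power_divide sum_divide_distrib sum_negf)
  then show ?thesis by (simp add: exp_sum)
qed

lemma gaussian_integral_vec:
  fixes z :: "real^'n"
  assumes c: "c > 0"
  shows "integrable lborel (\<lambda>y::real^'n. exp (- (norm y / c)\<^sup>2 / 2))"
    and "(LINT y|lborel. cis (y \<bullet> z) * complex_of_real (exp (- (norm y / c)\<^sup>2 / 2)))
      = complex_of_real ((sqrt (2 * pi) * c) ^ CARD('n) * exp (- (c * norm z)\<^sup>2 / 2))"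
proof -
  show "integrable lborel (\<lambda>y::real^'n. exp (- (norm y / c)\<^sup>2 / 2))"
    unfolding exp_norm_vec by (intro integrable_lborel_prod gaussian_integral c)
  have "cis (y \<bullet> z) * complex_of_real (exp (- (norm y / c)\<^sup>2 / 2))
     = (\<Prod>i\<in>UNIV. cis (y $ i * z $ i) * complex_of_real (exp (- (y $ i / c)\<^sup>2 / 2)))" for y
    unfolding exp_norm_vec by (simp add: inner_vec_def cis_sum prod.distrib)
  then have "(LINT y|lborel. cis (y \<bullet> z) * complex_of_real (exp (- (norm y / c)\<^sup>2 / 2)))
    = (LINT y|lborel. (\<Prod>i\<in>UNIV. cis (y $ i * z $ i) * complex_of_real (exp (- (y $ i / c)\<^sup>2 / 2))))"
    by simp
  also have "\<dots> = (\<Prod>i\<in>UNIV. (LINT t|lborel. cis (t * z $ i) * complex_of_real (exp (- (t / c)\<^sup>2 / 2))))"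
  proof (rule integral_lborel_prod)
    show "integrable lborel (\<lambda>t. cis (t * z $ i) * complex_of_real (exp (- (t / c)\<^sup>2 / 2)))" for i
      by (rule Bochner_Integration.integrable_bound[OF gaussian_integral(1)[OF c]]) (auto simp: norm_mult)
  qed
  also have "\<dots> = (\<Prod>i\<in>UNIV. complex_of_real (sqrt (2 * pi) * c * exp (- (z $ i / (1 / c))\<^sup>2 / 2)))"
    unfolding gaussian_integral(2)[OF c] by (simp add: mult.commute)
  also have "\<dots> = complex_of_real ((sqrt (2 * pi) * c) ^ CARD('n) * exp (- (norm z / (1 / c))\<^sup>2 / 2))"
    unfolding exp_norm_vec by (simp add: prod.distrib power_mult_distrib)
  finally show "(LINT y|lborel. cis (y \<bullet> z) * complex_of_real (exp (- (norm y / c)\<^sup>2 / 2)))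
      = complex_of_real ((sqrt (2 * pi) * c) ^ CARD('n) * exp (- (c * norm z)\<^sup>2 / 2))"
    by (simp add: mult.commute)
qed

text \<open>The unnormalised scalar transform, taken with respect to \<open>lborel\<close>; the
  powers of \<open>2 * pi\<close> are restored in \<open>multiplier_entry\<close>.\<close>

definition ft :: "(real^'n \<Rightarrow> complex) \<Rightarrow> real^'n \<Rightarrow> complex" where
  "ft f y = (LINT x|lborel. cis (- (y \<bullet> x)) * f x)"

lemma integrable_cis_mult:
  fixes M :: "(real^'n) measure"
  assumes M: "sets M = sets borel" and f: "integrable M f" and g: "g \<in> borel_measurable borel"
  shows "integrable M (\<lambda>x. cis (g x) * f x)"
proof -
  note [measurable_cong] = M
  have [measurable]: "f \<in> borel_measurable M" "g \<in> borel_measurable borel" using f g by auto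
  show ?thesis
    by (rule Bochner_Integration.integrable_bound[OF integrable_norm[OF f]]) (auto simp: norm_mult)
qed

lemma norm_ft_le: "cmod (ft f y) \<le> (LINT x|lborel. cmod (f x))"
proof -
  have "cmod (ft f y) \<le> (LINT x|lborel. cmod (cis (- (y \<bullet> x)) * f x))"
    unfolding ft_def by (rule integral_norm_bound)
  then show ?thesis by (simp add: norm_mult)
qed

lemma continuous_ft:
  assumes f: "integrable lborel f"
  shows "continuous_on UNIV (ft f)"
proof -
  have "isCont (ft f) y" for y
    unfolding continuous_at_sequentially o_def
  proof (intro allI impI)
    fix u assume u: "u \<longlonglongrightarrow> y"
    have fm[measurable]: "f \<in> borel_measurable borel" using borel_measurable_integrable[OF f] by simp
    show "(\<lambda>n. ft f (u n)) \<longlonglongrightarrow> ft f y"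
      unfolding ft_def
    proof (rule integral_dominated_convergence[where w = "\<lambda>x. cmod (f x)"])
      show "AE x in lborel. (\<lambda>n. cis (- (u n \<bullet> x)) * f x) \<longlonglongrightarrow> cis (- (y \<bullet> x)) * f x"
        using u by (intro AE_I2 tendsto_intros)
    qed (use f in \<open>auto simp: norm_mult\<close>)
  qed
  then show ?thesis by (simp add: continuous_on_eq_continuous_at)
qed

text \<open>Gaussian summation. Damping the transform by a Gaussian of width \<open>c\<close> and
  exchanging the integrals turns the left side into an average of \<open>f\<close> around
  \<open>x\<close> at scale \<open>1 / c\<close>. As \<open>c\<close> grows, the damped integral
  tends to the undamped one and the average to \<open>f x\<close> times the mass of the
  Gaussian.\<close>

lemma fourier_inversion:
  fixes f :: "real^'n \<Rightarrow> complex"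
  assumes f: "continuous_on UNIV f" "\<And>x. cmod (f x) \<le> B" "integrable lborel f"
    and ff: "integrable lborel (ft f)"
  shows "(LINT y|lborel. cis (x \<bullet> y) * ft f y) = complex_of_real ((2 * pi) ^ CARD('n)) * f x"
proof -
  have fm[measurable]: "f \<in> borel_measurable borel" using f(1) by (rule borel_measurable_continuous_onI)
  have ffm[measurable]: "ft f \<in> borel_measurable borel" using borel_measurable_integrable[OF ff] by simp
  define G where "G c y = complex_of_real (exp (- (norm y / c)\<^sup>2 / 2))" for c and y :: "real^'n"
  have Gm[measurable]: "G c \<in> borel_measurable borel" for c unfolding G_def[abs_def] by measurable
  define s where "s = sqrt (2 * pi)"
  have s: "s * s = 2 * pi" by (simp add: s_def)
  define A where "A k = (LINT y|lborel. cis (x \<bullet> y) * ft f y * G (real (Suc k)) y)" for k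
  have "A \<longlonglongrightarrow> (LINT y|lborel. cis (x \<bullet> y) * ft f y)"
    unfolding A_def
  proof (rule integral_dominated_convergence[where w = "\<lambda>y. cmod (ft f y)"])
    show "AE y in lborel. (\<lambda>k. cis (x \<bullet> y) * ft f y * G (real (Suc k)) y) \<longlonglongrightarrow> cis (x \<bullet> y) * ft f y"
    proof (rule AE_I2)
      fix y :: "real^'n"
      have "(\<lambda>k. 1 / real (Suc k)) \<longlonglongrightarrow> 0" by real_asymp
      then have "(\<lambda>k. exp (- (norm y * (1 / real (Suc k)))\<^sup>2 / 2)) \<longlonglongrightarrow> exp (- (norm y * 0)\<^sup>2 / 2)"
        by (intro tendsto_intros) auto
      then have "(\<lambda>k. exp (- (norm y / real (Suc k))\<^sup>2 / 2)) \<longlonglongrightarrow> 1" by simp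
      from tendsto_mult[OF tendsto_const tendsto_of_real[OF this], of "cis (x \<bullet> y) * ft f y"]
      show "(\<lambda>k. cis (x \<bullet> y) * ft f y * G (real (Suc k)) y) \<longlonglongrightarrow> cis (x \<bullet> y) * ft f y"
        by (simp add: G_def)
    qed
  qed (use ff in \<open>auto simp: norm_mult G_def mult_left_le\<close>)
  moreover have Ak: "A k = complex_of_real (s ^ CARD('n)) * (LINT v|lborel. f (x + (1 / real (Suc k)) *\<^sub>R v) * G 1 v)" for k
  proof -
    define c where "c = real (Suc k)"
    have c: "c > 0" by (simp add: c_def)
    have gi: "integrable lborel (\<lambda>y::real^'n. exp (- (norm y / c)\<^sup>2 / 2))" by (rule gaussian_integral_vec[OF c])
    have "A k = (LINT y|lborel. LINT u|lborel. cis (y \<bullet> (x - u)) * G c y * f u)"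
      unfolding A_def ft_def c_def[symmetric]
    proof (intro Bochner_Integration.integral_cong refl)
      fix y
      have "cis (y \<bullet> (x - u)) = cis (x \<bullet> y) * cis (- (y \<bullet> u))" for u
        unfolding inner_commute[of x y] by (simp add: inner_diff_right cis_mult)
      then have "(LINT u|lborel. cis (y \<bullet> (x - u)) * G c y * f u)
          = (LINT u|lborel. (cis (x \<bullet> y) * G c y) * (cis (- (y \<bullet> u)) * f u))"
        by (simp add: mult_ac)
      also have "\<dots> = (cis (x \<bullet> y) * G c y) * (LINT u|lborel. cis (- (y \<bullet> u)) * f u)"
        by (rule integral_mult_right_zero)
      finally show "cis (x \<bullet> y) * (LINT u|lborel. cis (- (y \<bullet> u)) * f u) * G c y
        = (LINT u|lborel. cis (y \<bullet> (x - u)) * G c y * f u)" by (simp add: mult_ac)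
    qed
    also have "\<dots> = (LINT u|lborel. LINT y|lborel. cis (y \<bullet> (x - u)) * G c y * f u)"
    proof (rule Fubini_product_bound(1)[OF lborel.sigma_finite_measure_axioms lborel.sigma_finite_measure_axioms _ gi integrable_norm[OF f(3)]])
      show "cmod (cis (y \<bullet> (x - u)) * G c y * f u) \<le> exp (- (norm y / c)\<^sup>2 / 2) * cmod (f u)" for y u
        by (simp add: norm_mult G_def)
    qed measurable
    also have "\<dots> = (LINT u|lborel. complex_of_real ((s * c) ^ CARD('n) * exp (- (c * norm (x - u))\<^sup>2 / 2)) * f u)"
      unfolding G_def s_def integral_mult_left_zero gaussian_integral_vec(2)[OF c] ..
    \<comment> \<open>The substitution \<open>u = x + v / c\<close> removes \<open>c\<close> from
      the Gaussian; its Jacobian cancels the power of \<open>c\<close> in the transform of the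
      damping factor.\<close>
    also have "\<dots> = \<bar>1 / c\<bar> ^ DIM(real^'n) *\<^sub>R (LINT v|lborel. complex_of_real ((s * c) ^ CARD('n)
        * exp (- (c * norm (x - (x + (1 / c) *\<^sub>R v)))\<^sup>2 / 2)) * f (x + (1 / c) *\<^sub>R v))"
      using c by (intro lborel_integral_affine) auto
    also have "\<dots> = (1 / c) ^ CARD('n) *\<^sub>R (LINT v|lborel. complex_of_real ((s * c) ^ CARD('n))
        * (f (x + (1 / c) *\<^sub>R v) * G 1 v))"
    proof -
      have n: "c * norm (x - (x + (1 / c) *\<^sub>R v)) = norm v" for v using c by simp
      have "\<bar>1 / c\<bar> = 1 / c" using c by simp
      then show ?thesis unfolding n by (simp add: G_def mult_ac)
    qed
    also have "\<dots> = complex_of_real ((1 / c) ^ CARD('n) * (s * c) ^ CARD('n)) * (LINT v|lborel. f (x + (1 / c) *\<^sub>R v) * G 1 v)"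
      unfolding integral_mult_right_zero scaleR_conv_of_real of_real_mult by (simp only: mult.assoc)
    also have "(1 / c) ^ CARD('n) * (s * c) ^ CARD('n) = s ^ CARD('n)"
      using c by (simp add: power_mult_distrib[symmetric])
    finally show ?thesis by (simp add: c_def)
  qed
  moreover have lim: "(\<lambda>k. LINT v|lborel. f (x + (1 / real (Suc k)) *\<^sub>R v) * G 1 v) \<longlonglongrightarrow> (LINT v|lborel. f x * G 1 v)"
  proof (rule integral_dominated_convergence[where w = "\<lambda>v. B * exp (- (norm v / 1)\<^sup>2 / 2)"])
    show "integrable lborel (\<lambda>v::real^'n. B * exp (- (norm v / 1)\<^sup>2 / 2))"
      by (intro integrable_mult_right gaussian_integral_vec) simp
    show "AE v in lborel. (\<lambda>k. f (x + (1 / real (Suc k)) *\<^sub>R v) * G 1 v) \<longlonglongrightarrow> f x * G 1 v"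
    proof (rule AE_I2)
      fix v :: "real^'n"
      have "(\<lambda>k. 1 / real (Suc k)) \<longlonglongrightarrow> 0" by real_asymp
      then have "(\<lambda>k. x + (1 / real (Suc k)) *\<^sub>R v) \<longlonglongrightarrow> x + 0 *\<^sub>R v"
        by (intro tendsto_intros)
      moreover have "isCont f x" using f(1) by (simp add: continuous_on_eq_continuous_at)
      ultimately have "(\<lambda>k. f (x + (1 / real (Suc k)) *\<^sub>R v)) \<longlonglongrightarrow> f x"
        using isCont_tendsto_compose[of x f "\<lambda>k. x + (1 / real (Suc k)) *\<^sub>R v" sequentially]
        by (simp only: scaleR_zero_left add_0_right)
      then show "(\<lambda>k. f (x + (1 / real (Suc k)) *\<^sub>R v) * G 1 v) \<longlonglongrightarrow> f x * G 1 v"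
        by (intro tendsto_intros)
    qed
    show "AE v in lborel. norm (f (x + (1 / real (Suc k)) *\<^sub>R v) * G 1 v) \<le> B * exp (- (norm v / 1)\<^sup>2 / 2)" for k
      by (intro AE_I2) (auto simp: norm_mult G_def intro!: mult_right_mono f)
  qed measurable
  \<comment> \<open>The mass of the Gaussian at unit scale supplies a second factor
    \<open>s ^ n\<close>; since \<open>s * s = 2 * pi\<close>, both together give
    \<open>(2 * pi) ^ n\<close>.\<close>
  moreover have e: "(LINT v|lborel. f x * G 1 v) = f x * complex_of_real (s ^ CARD('n))"
    using gaussian_integral_vec(2)[of 1 "0::real^'n"] by (simp add: G_def s_def)
  ultimately have "A \<longlonglongrightarrow> complex_of_real (s ^ CARD('n)) * (f x * complex_of_real (s ^ CARD('n)))"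
    using tendsto_mult[OF tendsto_const lim, of "complex_of_real (s ^ CARD('n))"] unfolding Ak[symmetric] e by simp
  then have "(LINT y|lborel. cis (x \<bullet> y) * ft f y) = complex_of_real (s ^ CARD('n)) * (f x * complex_of_real (s ^ CARD('n)))"
    using \<open>A \<longlonglongrightarrow> (LINT y|lborel. cis (x \<bullet> y) * ft f y)\<close> LIMSEQ_unique by blast
  also have "\<dots> = complex_of_real ((s * s) ^ CARD('n)) * f x" by (simp add: power_mult_distrib)
  finally show ?thesis unfolding s .
qed

section \<open>Calculus of compactly supported functions\<close>

lemma continuous_support_bound:
  fixes g :: "real^'n \<Rightarrow> complex"
  assumes g: "continuous_on UNIV g" and supp: "\<And>x. R < norm x \<Longrightarrow> g x = 0"
  shows "\<exists>C\<ge>0. \<forall>x. cmod (g x) \<le> C * indicator (cball 0 R) x"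
proof -
  have "continuous_on (cball 0 R) g" using continuous_on_subset[OF g] by simp
  then have "compact (g ` cball 0 R)" by (intro compact_continuous_image) auto
  then have "bounded (g ` cball 0 R)" by (rule compact_imp_bounded)
  then obtain C where C: "\<forall>y\<in>g ` cball 0 R. norm y \<le> C" unfolding bounded_iff by blast
  have "cmod (g x) \<le> max C 0 * indicator (cball 0 R) x" for x
  proof (cases "R < norm x")
    case False
    then have "cmod (g x) \<le> C" using C by simp
    then show ?thesis using False by (simp add: indicator_def le_max_iff_disj)
  qed (use supp in simp)
  then show ?thesis by (intro exI[of _ "max C 0"]) auto
qed

lemma integrable_indicator_cball: "integrable lborel (\<lambda>x::real^'n. C * indicator (cball 0 R) x :: real)"
  using emeasure_bounded_finite[of "cball (0::real^'n) R"]
  by (intro integrable_mult_right integrable_real_indicator) auto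

lemma continuous_support_integrable:
  fixes g :: "real^'n \<Rightarrow> complex"
  assumes g: "continuous_on UNIV g" and supp: "\<And>x. R < norm x \<Longrightarrow> g x = 0"
  shows "integrable lborel g"
proof -
  obtain C where C: "C \<ge> 0" "\<And>x. cmod (g x) \<le> C * indicator (cball 0 R) x"
    using continuous_support_bound[OF g supp] by blast
  show ?thesis
  proof (rule Bochner_Integration.integrable_bound[OF integrable_indicator_cball[of C R]])
    show "g \<in> borel_measurable lborel" using borel_measurable_continuous_onI[OF g] by simp
    show "AE x in lborel. norm (g x) \<le> norm (C * indicator (cball 0 R) x :: real)"
      using C by (intro AE_I2) simp
  qed
qed

text \<open>Difference quotients in direction \<open>e\<close> integrate to 0 by translation
  invariance and converge to \<open>d\<close>. The mean value inequality bounds them by a bound for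
  \<open>d\<close>, and steps of length at most 1 keep their supports inside one ball.\<close>

lemma integral_partial_derivative_zero:
  fixes g d :: "real^'n \<Rightarrow> complex"
  assumes der: "\<And>x. ((\<lambda>s. g (x + s *\<^sub>R e)) has_vector_derivative d x) (at 0)"
    and g: "continuous_on UNIV g" and d: "continuous_on UNIV d"
    and supp: "\<And>x. R < norm x \<Longrightarrow> g x = 0 \<and> d x = 0"
  shows "(LINT x|lborel. d x) = 0"
proof -
  have gm[measurable]: "g \<in> borel_measurable borel" using g by (rule borel_measurable_continuous_onI)
  have dm[measurable]: "d \<in> borel_measurable borel" using d by (rule borel_measurable_continuous_onI)
  obtain K' where K': "K' \<ge> 0" "\<And>x. cmod (d x) \<le> K' * indicator (cball 0 R) x"
    using continuous_support_bound[OF d, of R] supp by blast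
  have dK: "cmod (d x) \<le> K'" for x
    using K'(2)[of x] mult_left_le[of "indicator (cball 0 R) x" K'] K'(1) by (auto simp: indicator_def split: if_splits)
  define \<tau> where "\<tau> k = 1 / real (Suc k)" for k
  have \<tau>: "0 < \<tau> k" "\<tau> k \<le> 1" for k by (auto simp: \<tau>_def)
  have \<tau>0: "\<tau> \<longlonglongrightarrow> 0" unfolding \<tau>_def by real_asymp
  define h where "h k x = (g (x + \<tau> k *\<^sub>R e) - g x) /\<^sub>R \<tau> k" for k x
  have lip: "cmod (g (x + t *\<^sub>R e) - g x) \<le> K' * t" if t: "0 \<le> t" for x t
  proof -
    have dd: "((\<lambda>s. g (x + s *\<^sub>R e)) has_derivative (\<lambda>h. h *\<^sub>R d (x + s *\<^sub>R e))) (at s within {0..t})" for s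
    proof -
      have "((\<lambda>u. u - s) has_vector_derivative 1) (at s)"
        by (auto intro!: derivative_eq_intros)
      from vector_diff_chain_at[OF this, of "\<lambda>r. g (x + s *\<^sub>R e + r *\<^sub>R e)" "d (x + s *\<^sub>R e)"] der[of "x + s *\<^sub>R e"]
      have "((\<lambda>u. g (x + s *\<^sub>R e + (u - s) *\<^sub>R e)) has_vector_derivative d (x + s *\<^sub>R e)) (at s)"
        by (simp add: o_def)
      moreover have "x + s *\<^sub>R e + (u - s) *\<^sub>R e = x + u *\<^sub>R e" for u by (simp add: algebra_simps)
      ultimately show ?thesis
        by (auto simp: has_vector_derivative_def intro: has_derivative_at_withinI)
    qed
    have on: "onorm (\<lambda>h. h *\<^sub>R d (x + s *\<^sub>R e)) \<le> K'" for s
    proof (rule onorm_le)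
      show "norm (h *\<^sub>R d (x + s *\<^sub>R e)) \<le> K' * norm h" for h
        using mult_left_mono[OF dK[of "x + s *\<^sub>R e"], of "\<bar>h\<bar>"] by (simp add: mult.commute)
    qed
    have "norm (g (x + t *\<^sub>R e) - g (x + 0 *\<^sub>R e)) \<le> K' * norm (t - 0)"
      by (rule differentiable_bound[OF convex_real_interval(5) dd on, where y = 0 and x = t]) (use t in auto)
    then show ?thesis using t by simp
  qed
  have "(\<lambda>k. LINT x|lborel. h k x) \<longlonglongrightarrow> (LINT x|lborel. d x)"
  proof (rule integral_dominated_convergence[where w = "\<lambda>x. K' * indicator (cball 0 (R + norm e)) x"])
    show "integrable lborel (\<lambda>x::real^'n. K' * indicator (cball 0 (R + norm e)) x)"
      by (rule integrable_indicator_cball)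
    show "AE x in lborel. (\<lambda>k. h k x) \<longlonglongrightarrow> d x"
    proof (rule AE_I2)
      fix x
      have "((\<lambda>y. norm (g (x + y *\<^sub>R e) - g x - y *\<^sub>R d x) / norm y) \<longlongrightarrow> 0) (at 0)"
        using der[of x] unfolding has_vector_derivative_def has_derivative_at by simp
      moreover have "filterlim \<tau> (at 0) sequentially"
        using \<tau>0 \<tau>(1) by (auto simp: filterlim_at intro!: always_eventually less_imp_neq[symmetric])
      ultimately have "(\<lambda>k. norm (g (x + \<tau> k *\<^sub>R e) - g x - \<tau> k *\<^sub>R d x) / norm (\<tau> k)) \<longlonglongrightarrow> 0"
        by (rule filterlim_compose)
      moreover have "norm (g (x + \<tau> k *\<^sub>R e) - g x - \<tau> k *\<^sub>R d x) / norm (\<tau> k) = norm (h k x - d x)" for k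
      proof -
        have "h k x - d x = (g (x + \<tau> k *\<^sub>R e) - g x - \<tau> k *\<^sub>R d x) /\<^sub>R \<tau> k"
          using \<tau>(1)[of k] by (simp add: h_def scaleR_diff_right)
        then show ?thesis using \<tau>(1)[of k] by (simp add: divide_inverse mult.commute)
      qed
      ultimately have "(\<lambda>k. norm (h k x - d x)) \<longlonglongrightarrow> 0" by simp
      then show "(\<lambda>k. h k x) \<longlonglongrightarrow> d x" by (simp add: tendsto_norm_zero_iff LIM_zero_iff)
    qed
    show "AE x in lborel. norm (h k x) \<le> K' * indicator (cball 0 (R + norm e)) x" for k
    proof (rule AE_I2)
      fix x :: "real^'n"
      show "norm (h k x) \<le> K' * indicator (cball 0 (R + norm e)) x"
      proof (cases "norm x \<le> R + norm e")
        case True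
        have "norm (h k x) = cmod (g (x + \<tau> k *\<^sub>R e) - g x) / \<tau> k"
          using \<tau>(1)[of k] by (simp add: h_def divide_inverse mult.commute)
        also have "\<dots> \<le> K'" using lip[of "\<tau> k" x] \<tau>(1)[of k] by (simp add: divide_le_eq)
        finally show ?thesis using True by simp
      next
        case False
        have "norm (\<tau> k *\<^sub>R e) \<le> norm e" using \<tau>[of k] by (simp add: mult_left_le_one_le)
        then have "R < norm (x + \<tau> k *\<^sub>R e)"
          using False norm_triangle_ineq4[of "x + \<tau> k *\<^sub>R e" "\<tau> k *\<^sub>R e"] by simp
        moreover have "R < norm x" using False norm_ge_zero[of e] by linarith
        ultimately show ?thesis using supp False by (simp add: h_def)
      qed
    qed
    show "h k \<in> borel_measurable lborel" for k unfolding h_def by measurable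
  qed measurable
  moreover have "(LINT x|lborel. h k x) = 0" for k
  proof -
    have "integrable lborel g" using continuous_support_integrable[OF g] supp by blast
    then have "(LINT x|lborel. g (\<tau> k *\<^sub>R e + x) - g x) = 0"
      using lborel_integral_translation[OF gm, of "\<tau> k *\<^sub>R e"] lborel_integrable_translation[of g "\<tau> k *\<^sub>R e"]
      by (subst Bochner_Integration.integral_diff) auto
    then show ?thesis unfolding h_def by (simp add: add.commute)
  qed
  ultimately have "(\<lambda>k::nat. 0) \<longlonglongrightarrow> (LINT x|lborel. d x)" by simp
  then show ?thesis by (rule LIMSEQ_unique[OF _ tendsto_const])
qed

definition test_fun :: "(real^'n \<Rightarrow> complex) \<Rightarrow> bool" where
  "test_fun f \<longleftrightarrow> (\<forall>k. C_k k f) \<and> compact (closure {x. f x \<noteq> 0})"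

definition pderiv_vec :: "'n \<Rightarrow> (real^'n \<Rightarrow> 'b::real_normed_vector) \<Rightarrow> real^'n \<Rightarrow> 'b" where
  "pderiv_vec i f x = frechet_derivative f (at x) (axis i 1)"

lemma C_k_Suc: "C_k (Suc k) f \<longleftrightarrow> f differentiable_on UNIV \<and> (\<forall>i. C_k k (pderiv_vec i f))"
  by (simp add: pderiv_vec_def[abs_def])

lemma frechet_derivative_worksI:
  "f differentiable_on UNIV \<Longrightarrow> (f has_derivative frechet_derivative f (at x)) (at x)"
  using frechet_derivative_works unfolding differentiable_on_def by blast

text \<open>Taking an entry of a matrix is a bounded linear map, so this transfers smoothness from
  matrix-valued functions to their entries.\<close>

lemma C_k_bounded_linear:
  assumes L: "bounded_linear L"
  shows "C_k k f \<Longrightarrow> C_k k (\<lambda>x. L (f x))"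
proof (induction k arbitrary: f)
  case 0
  then show ?case using bounded_linear.continuous_on[OF L] by simp
next
  case (Suc k)
  then have f: "f differentiable_on UNIV" "\<And>i. C_k k (pderiv_vec i f)" unfolding C_k_Suc by auto
  have d: "((\<lambda>x. L (f x)) has_derivative (\<lambda>v. L (frechet_derivative f (at x) v))) (at x)" for x
    by (rule bounded_linear.has_derivative[OF L frechet_derivative_worksI[OF f(1)]])
  have "pderiv_vec i (\<lambda>x. L (f x)) = (\<lambda>x. L (pderiv_vec i f x))" for i
    unfolding pderiv_vec_def[abs_def] frechet_derivative_at[OF d, symmetric] ..
  then show ?case
    unfolding C_k_Suc using d f(2) Suc.IH by (auto simp: differentiable_on_def differentiable_def)
qed

lemma C_k_diff: "C_k k f \<Longrightarrow> C_k k g \<Longrightarrow> C_k k (\<lambda>x. f x - g x)"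
proof (induction k arbitrary: f g)
  case 0
  then show ?case by (auto intro!: continuous_intros)
next
  case (Suc k)
  then have f: "f differentiable_on UNIV" "\<And>i. C_k k (pderiv_vec i f)"
    and g: "g differentiable_on UNIV" "\<And>i. C_k k (pderiv_vec i g)" unfolding C_k_Suc by auto
  have d: "((\<lambda>x. f x - g x) has_derivative
    (\<lambda>v. frechet_derivative f (at x) v - frechet_derivative g (at x) v)) (at x)" for x
    by (intro has_derivative_diff frechet_derivative_worksI f g)
  have "pderiv_vec i (\<lambda>x. f x - g x) = (\<lambda>x. pderiv_vec i f x - pderiv_vec i g x)" for i
    unfolding pderiv_vec_def[abs_def] frechet_derivative_at[OF d, symmetric] ..
  then show ?case
    unfolding C_k_Suc using d f(2) g(2) Suc.IH by (auto simp: differentiable_on_def differentiable_def)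
qed

text \<open>The complement of the closed support is open, so the derivatives vanish there along with
  \<open>f\<close>.\<close>

lemma test_fun_support:
  assumes "test_fun f"
  shows "\<exists>R>0. \<forall>x. R < norm x \<longrightarrow> f x = 0 \<and> (\<forall>i. pderiv_vec i f x = 0)"
proof -
  let ?S = "closure {x. f x \<noteq> 0}"
  have "bounded ?S" using assms compact_imp_bounded by (auto simp: test_fun_def)
  then obtain R where R: "R > 0" "\<And>x. x \<in> ?S \<Longrightarrow> norm x \<le> R" by (auto simp: bounded_pos)
  have "f x = 0 \<and> (\<forall>i. pderiv_vec i f x = 0)" if "R < norm x" for x
  proof
    have x: "x \<in> - ?S" using R(2)[of x] that by auto
    then show "f x = 0" using closure_subset[of "{x. f x \<noteq> 0}"] by auto
    have "((\<lambda>_. 0) has_derivative (\<lambda>_. 0)) (at x)" by simp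
    then have "(f has_derivative (\<lambda>_. 0)) (at x)"
    proof (rule has_derivative_transform_within_open)
      show "open (- ?S)" by (intro open_Compl closed_closure)
      show "\<And>y. y \<in> - ?S \<Longrightarrow> 0 = f y" using closure_subset[of "{x. f x \<noteq> 0}"] by auto
    qed (rule x)
    then show "\<forall>i. pderiv_vec i f x = 0"
      by (auto simp: pderiv_vec_def frechet_derivative_at[symmetric])
  qed
  then show ?thesis using R(1) by blast
qed

lemma test_funI:
  assumes "\<And>k. C_k k f" "\<And>x. R < norm x \<Longrightarrow> f x = 0"
  shows "test_fun f"
  unfolding test_fun_def
proof
  have "{x. f x \<noteq> 0} \<subseteq> cball 0 R" using assms(2) by (auto simp: not_less[symmetric])
  then show "compact (closure {x. f x \<noteq> 0})" using bounded_subset[OF bounded_cball] compact_closure by blast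
qed (use assms in blast)

lemma test_fun_pderiv: "test_fun f \<Longrightarrow> test_fun (pderiv_vec i f)"
proof -
  assume f: "test_fun f"
  obtain R where "\<forall>x. R < norm x \<longrightarrow> f x = 0 \<and> (\<forall>i. pderiv_vec i f x = 0)" using test_fun_support[OF f] by blast
  moreover have "C_k k (pderiv_vec i f)" for k
    using f[unfolded test_fun_def] C_k_Suc[of k f] by blast
  ultimately show ?thesis by (intro test_funI[of _ R]) auto
qed

lemma test_fun_diff: "test_fun f \<Longrightarrow> test_fun g \<Longrightarrow> test_fun (\<lambda>x. f x - g x)"
proof -
  assume f: "test_fun f" and g: "test_fun g"
  obtain R S where "\<forall>x. R < norm x \<longrightarrow> f x = 0" "\<forall>x. S < norm x \<longrightarrow> g x = 0"
    using test_fun_support[OF f] test_fun_support[OF g] by blast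
  then show ?thesis
    using f g by (intro test_funI[of _ "max R S"] C_k_diff) (auto simp: test_fun_def)
qed

lemma test_fun_continuous: "test_fun f \<Longrightarrow> continuous_on UNIV f"
  unfolding test_fun_def using C_k.simps(1)[of f] by blast

lemma test_fun_differentiable: "test_fun f \<Longrightarrow> f differentiable_on UNIV"
  unfolding test_fun_def using C_k.simps(2)[of 0 f] by blast

lemma test_fun_bounded: "test_fun f \<Longrightarrow> \<exists>C. \<forall>x. cmod (f x) \<le> C"
proof -
  assume f: "test_fun f"
  obtain R where R: "\<forall>x. R < norm x \<longrightarrow> f x = 0" using test_fun_support[OF f] by blast
  then obtain C where C: "C \<ge> 0" "\<forall>x. cmod (f x) \<le> C * indicator (cball 0 R) x"
    using continuous_support_bound[OF test_fun_continuous[OF f]] by blast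
  have "cmod (f x) \<le> C" for x
    using C(2)[rule_format, of x] mult_left_le[of "indicator (cball 0 R) x" C] C(1) by (auto simp: indicator_def split: if_splits)
  then show ?thesis by blast
qed

lemma test_fun_integrable: "test_fun f \<Longrightarrow> integrable lborel f"
proof -
  assume f: "test_fun f"
  obtain R where "\<forall>x. R < norm x \<longrightarrow> f x = 0" using test_fun_support[OF f] by blast
  then show ?thesis using continuous_support_integrable[OF test_fun_continuous[OF f], of R] by blast
qed

lemma ft_pderiv:
  fixes f :: "real^'n \<Rightarrow> complex"
  assumes f: "test_fun f"
  shows "ft (pderiv_vec i f) y = \<i> * complex_of_real (y $ i) * ft f y"
proof -
  obtain R where R: "\<And>x. R < norm x \<Longrightarrow> f x = 0" "\<And>x. R < norm x \<Longrightarrow> pderiv_vec i f x = 0"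
    using test_fun_support[OF f] by blast
  note p = test_fun_pderiv[OF f, of i]
  \<comment> \<open>\<open>d\<close> is the \<open>i\<close>-th partial derivative of
    \<open>cis (- (y \<bullet> x)) * f x\<close>, whose integral vanishes; this is integration by
    parts.\<close>
  define d where "d x = cis (- (y \<bullet> x)) * pderiv_vec i f x - \<i> * complex_of_real (y $ i) * (cis (- (y \<bullet> x)) * f x)" for x
  have "(LINT x|lborel. d x) = 0"
  proof (rule integral_partial_derivative_zero)
    fix x :: "real^'n"
    have 1: "((\<lambda>s. x + s *\<^sub>R axis i 1) has_derivative (\<lambda>h. h *\<^sub>R axis i 1)) (at 0)"
      by (auto intro!: derivative_eq_intros)
    have "(f has_derivative frechet_derivative f (at x)) (at (x + 0 *\<^sub>R axis i 1))"
      using frechet_derivative_worksI[OF test_fun_differentiable[OF f]] by simp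
    from has_derivative_compose[OF 1 this]
    have 2: "((\<lambda>s. f (x + s *\<^sub>R axis i 1)) has_vector_derivative pderiv_vec i f x) (at 0)"
      unfolding has_vector_derivative_def pderiv_vec_def
      using linear_cmul[OF has_derivative_linear[OF frechet_derivative_worksI[OF test_fun_differentiable[OF f]]]] by simp
    have "((\<lambda>s. cis (- (y \<bullet> (x + s *\<^sub>R axis i 1)))) has_vector_derivative
        (- (y $ i)) *\<^sub>R (\<i> * cis (- (y \<bullet> x)))) (at 0)"
    proof -
      have a: "((\<lambda>s. - (y \<bullet> x) + s * (- (y $ i))) has_vector_derivative (- (y $ i))) (at 0)"
        by (auto intro!: derivative_eq_intros)
      have b: "(cis has_vector_derivative (\<i> * cis t)) (at t)" for t
        by (auto intro!: derivative_eq_intros simp: has_vector_derivative_def scaleR_conv_of_real)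
      from vector_diff_chain_at[OF a b[of "- (y \<bullet> x) + 0 * (- (y $ i))"]]
      show ?thesis by (simp add: o_def inner_add_right inner_axis mult.commute)
    qed
    from has_vector_derivative_mult[OF this 2]
    show "((\<lambda>s. cis (- (y \<bullet> (x + s *\<^sub>R axis i 1))) * f (x + s *\<^sub>R axis i 1)) has_vector_derivative d x) (at 0)"
      by (simp add: d_def scaleR_conv_of_real mult_ac)
  next
    show "continuous_on UNIV (\<lambda>x. cis (- (y \<bullet> x)) * f x)"
      by (intro continuous_intros test_fun_continuous f)
    show "continuous_on UNIV d"
      unfolding d_def by (intro continuous_intros test_fun_continuous f p)
    show "cis (- (y \<bullet> x)) * f x = 0 \<and> d x = 0" if "R < norm x" for x
      using R that by (simp add: d_def)
  qed
  moreover have "integrable lborel (\<lambda>x. cis (- (y \<bullet> x)) * pderiv_vec i f x)"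
    by (intro integrable_cis_mult test_fun_integrable p) auto
  moreover have "integrable lborel (\<lambda>x. cis (- (y \<bullet> x)) * f x)"
    by (intro integrable_cis_mult test_fun_integrable f) auto
  ultimately show ?thesis
    by (simp add: d_def ft_def)
qed

lemma ft_diff:
  assumes "integrable lborel f" "integrable lborel g"
  shows "ft (\<lambda>x. f x - g x) y = ft f y - ft g y"
  unfolding ft_def right_diff_distrib using assms
  by (intro Bochner_Integration.integral_diff integrable_cis_mult) auto

text \<open>\<open>\<Prod>\<^sub>i (1 + y\<^sub>i\<^sup>2)\<close> is the symbol of \<open>\<Prod>\<^sub>i (1 - \<partial>\<^sub>i\<^sup>2)\<close>.\<close>

lemma ft_test_fun_decay:
  fixes f :: "real^'n \<Rightarrow> complex"
  assumes f: "test_fun f"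
  shows "\<exists>C\<ge>0. \<forall>y. cmod (ft f y) \<le> C * (\<Prod>i\<in>UNIV. inverse (1 + (y $ i)\<^sup>2))"
proof -
  \<comment> \<open>The operators \<open>1 - \<partial>_i^2\<close> are applied one coordinate at a
    time. For the full index set, the bounded transform of the test function \<open>g\<close>
    controls \<open>ft f\<close> in all coordinates at once.\<close>
  have "\<exists>g. test_fun g \<and> (\<forall>y. ft g y = complex_of_real (\<Prod>i\<in>I. 1 + (y $ i)\<^sup>2) * ft f y)" if "finite I" for I :: "'n set"
    using that
  proof (induction I rule: finite_induct)
    case empty
    then show ?case using f by (intro exI[of _ f]) auto
  next
    case (insert i I)
    then obtain g where g: "test_fun g" "\<And>y. ft g y = complex_of_real (\<Prod>i\<in>I. 1 + (y $ i)\<^sup>2) * ft f y" by blast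
    let ?g = "\<lambda>x. g x - pderiv_vec i (pderiv_vec i g) x"
    have "ft ?g y = complex_of_real (1 + (y $ i)\<^sup>2) * ft g y" for y
      using g(1) by (simp add: ft_diff ft_pderiv test_fun_integrable test_fun_pderiv power2_eq_square algebra_simps)
    moreover have "test_fun ?g" by (intro test_fun_diff test_fun_pderiv g)
    ultimately show ?case
      using insert g(2) by (intro exI[of _ ?g]) (simp add: mult_ac)
  qed
  from this[of UNIV] obtain g where g: "test_fun g"
    "\<And>y. ft g y = complex_of_real (\<Prod>i\<in>UNIV. 1 + (y $ i)\<^sup>2) * ft f y" by auto
  define C where "C = (LINT x|lborel. cmod (g x))"
  have "cmod (ft f y) \<le> C * (\<Prod>i\<in>UNIV. inverse (1 + (y $ i)\<^sup>2))" for y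
  proof -
    let ?w = "\<Prod>i\<in>UNIV. 1 + (y $ i)\<^sup>2"
    have w: "?w > 0" by (intro prod_pos) (auto intro: add_pos_nonneg)
    have "?w * cmod (ft f y) = cmod (ft g y)" using w by (simp add: g(2) norm_mult del: of_real_prod)
    also have "\<dots> \<le> C" unfolding C_def by (rule norm_ft_le)
    finally have "cmod (ft f y) \<le> C / ?w" using w by (simp add: pos_le_divide_eq mult.commute)
    then show ?thesis by (simp add: divide_inverse prod_inversef[symmetric] o_def)
  qed
  then show ?thesis by (intro exI[of _ C]) (auto simp: C_def)
qed

lemma integrable_prod_inverse: "integrable lborel (\<lambda>y::real^'n. \<Prod>i\<in>UNIV. inverse (1 + (y $ i)\<^sup>2))"
proof (rule integrable_lborel_prod)
  have "set_integrable lborel (einterval (-\<infinity>) \<infinity>) (\<lambda>x. inverse (1 + x^2))"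
    by (rule integrable_inverse_1_plus_square)
  then show "integrable lborel (\<lambda>t::real. inverse (1 + t\<^sup>2))"
    by (simp add: set_integrable_def)
qed

lemma ft_test_fun_integrable:
  fixes f :: "real^'n \<Rightarrow> complex"
  assumes f: "test_fun f"
  shows "integrable lborel (ft f)"
proof -
  obtain C where C: "C \<ge> 0" "\<And>y. cmod (ft f y) \<le> C * (\<Prod>i\<in>UNIV. inverse (1 + (y $ i)\<^sup>2))"
    using ft_test_fun_decay[OF f] by blast
  show ?thesis
  proof (rule Bochner_Integration.integrable_bound[OF integrable_mult_right[OF integrable_prod_inverse, of C]])
    show "ft f \<in> borel_measurable lborel"
      using borel_measurable_continuous_onI[OF continuous_ft[OF test_fun_integrable[OF f]]] by simp
    show "AE y in lborel. norm (ft f y) \<le> norm (C * (\<Prod>i\<in>UNIV. inverse (1 + (y $ i)\<^sup>2)))"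
      by (intro AE_I2 order.trans[OF C(2)]) auto
  qed
qed

text \<open>Vague convergence is tested only against functions vanishing at infinity, and transforms
  of test functions must qualify. The largest coordinate modulus \<open>a\<close> suffices for the
  estimate, because \<open>1 / (1 + a^2) \<le> 1 / a\<close> and
  \<open>norm y \<le> n * a\<close>.\<close>

lemma ft_test_fun_tendsto_0:
  fixes f :: "real^'n \<Rightarrow> complex"
  assumes f: "test_fun f"
  shows "(ft f \<longlongrightarrow> 0) at_infinity"
proof -
  obtain C where C: "C \<ge> 0" "\<And>y. cmod (ft f y) \<le> C * (\<Prod>i\<in>UNIV. inverse (1 + (y $ i)\<^sup>2))"
    using ft_test_fun_decay[OF f] by blast
  have bound: "cmod (ft f y) \<le> C * real CARD('n) * inverse (norm y)" if "y \<noteq> 0" for y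
  proof -
    define a where "a = Max (range (\<lambda>i. \<bar>y $ i\<bar>))"
    have "a \<in> range (\<lambda>i. \<bar>y $ i\<bar>)" unfolding a_def by (intro Max_in) auto
    then obtain j where j: "a = \<bar>y $ j\<bar>" by auto
    have le: "\<bar>y $ i\<bar> \<le> a" for i unfolding a_def by (intro Max_ge) auto
    have "norm y \<le> (\<Sum>i\<in>UNIV. \<bar>y $ i\<bar>)" by (rule norm_le_l1_cart)
    also have "\<dots> \<le> (\<Sum>i\<in>(UNIV :: 'n set). a)" by (intro sum_mono le)
    finally have ny: "norm y \<le> real CARD('n) * a" by simp
    have "0 < norm y" using that by simp
    then have "0 < real CARD('n) * a" using ny by linarith
    then have a_pos: "0 < a" by (simp add: zero_less_mult_iff)
    have "(\<Prod>i\<in>UNIV. inverse (1 + (y $ i)\<^sup>2)) = inverse (1 + (y $ j)\<^sup>2) * (\<Prod>i\<in>UNIV - {j}. inverse (1 + (y $ i)\<^sup>2))"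
      by (rule prod.remove) auto
    also have "\<dots> \<le> inverse (1 + (y $ j)\<^sup>2) * 1"
      by (intro mult_left_mono prod_le_1) (auto intro!: inverse_le_1_iff[THEN iffD2])
    also have "\<dots> \<le> inverse a"
    proof -
      note a_pos
      moreover have "a \<le> 1 + (y $ j)\<^sup>2"
        unfolding j using sum_squares_bound[of 1 "\<bar>y $ j\<bar>"] by (simp add: power2_eq_square)
      ultimately show ?thesis by (simp add: le_imp_inverse_le)
    qed
    also have "\<dots> \<le> real CARD('n) * inverse (norm y)"
    proof -
      note a_pos
      then show ?thesis using ny that by (simp add: field_simps)
    qed
    finally have "C * (\<Prod>i\<in>UNIV. inverse (1 + (y $ i)\<^sup>2)) \<le> C * (real CARD('n) * inverse (norm y))"
      using C(1) by (intro mult_left_mono) auto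
    then show ?thesis using C(2)[of y] by (simp add: mult.assoc)
  qed
  have "((\<lambda>y::real^'n. C * real CARD('n) * inverse (norm y)) \<longlongrightarrow> C * real CARD('n) * 0) at_infinity"
    by (intro tendsto_mult tendsto_const tendsto_inverse_0_at_top filterlim_at_infinity_imp_norm_at_top filterlim_ident)
  then have "((\<lambda>y::real^'n. C * real CARD('n) * inverse (norm y)) \<longlongrightarrow> 0) at_infinity" by simp
  then show ?thesis
  proof (rule Lim_null_comparison[rotated])
    show "\<forall>\<^sub>F y in at_infinity. norm (ft f y) \<le> C * real CARD('n) * inverse (norm y)"
      unfolding eventually_at_infinity by (intro exI[of _ 1]) (auto intro!: bound)
  qed
qed

lemma test_fun_inversion:
  fixes f :: "real^'n \<Rightarrow> complex"
  assumes f: "test_fun f"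
  shows "(LINT y|lborel. cis (x \<bullet> y) * ft f y) = complex_of_real ((2 * pi) ^ CARD('n)) * f x"
proof -
  obtain C where "\<And>x. cmod (f x) \<le> C" using test_fun_bounded[OF f] by blast
  then show ?thesis
    by (intro fourier_inversion test_fun_continuous test_fun_integrable ft_test_fun_integrable f)
qed

section \<open>Vague compactness of finite measures\<close>

text \<open>A finite set \<open>J\<close> of coordinates has finitely many joint values, and there
  are countably many pairs of such a set and a value. A diagonal subsequence thus makes all point
  probabilities converge. As all sums are finite, total mass and consistency survive the limit, and
  Kolmogorov's theorem applies.\<close>

lemma finite_valued_process_limit:
  fixes N :: "nat \<Rightarrow> 'b measure" and q :: "nat \<Rightarrow> 'b \<Rightarrow> 'a::polish_space" and W :: "nat \<Rightarrow> 'a set"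
  assumes prob: "\<And>i. prob_space (N i)"
    and q: "\<And>i k. q k \<in> borel_measurable (N i)"
    and W: "\<And>k. finite (W k)" "\<And>i k x. x \<in> space (N i) \<Longrightarrow> q k x \<in> W k"
  shows "\<exists>r L. strict_mono r \<and> prob_space L \<and> sets L = sets (PiM UNIV (\<lambda>_. borel)) \<and>
    (\<forall>J A. finite J \<longrightarrow> A \<in> sets (PiM J (\<lambda>_. borel)) \<longrightarrow>
      (\<lambda>i. measure (N (r i)) {x \<in> space (N (r i)). (\<lambda>j\<in>J. q j x) \<in> A}) \<longlonglongrightarrow> measure L {\<omega>. restrict \<omega> J \<in> A})"
proof -
  define E where "E J = PiE J W" for J
  define m where "m i p = measure (N i) {x \<in> space (N i). (\<lambda>j\<in>fst p. q j x) = snd p}" for i p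
  have finE: "finite (E J)" if "finite J" for J using that W(1) by (auto simp: E_def intro: finite_PiE)
  have "countable (Collect (finite :: nat set \<Rightarrow> bool))" by (rule countable_Collect_finite)
  then have cs: "countable (SIGMA J:Collect finite. E J)"
    by (intro countable_SIGMA) (auto intro: countable_finite finE)
  have nm: "norm (m i p) \<le> 1" for i p
    using prob_space.prob_le_1[OF prob] by (simp add: m_def)
  obtain r where r: "strict_mono r"
    "\<And>p. p \<in> (SIGMA J:Collect finite. E J) \<Longrightarrow> \<exists>l. (\<lambda>n. m (r n) p) \<longlonglongrightarrow> l"
    using function_convergent_subsequence[of "SIGMA J:Collect finite. E J" m 1] cs nm by metis
  define \<rho> where "\<rho> J \<omega> = lim (\<lambda>n. m (r n) (J, \<omega>))" for J \<omega>
  have \<rho>: "(\<lambda>n. m (r n) (J, \<omega>)) \<longlonglongrightarrow> \<rho> J \<omega>" if "finite J" "\<omega> \<in> E J" for J \<omega>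
    using r(2)[of "(J, \<omega>)"] that unfolding \<rho>_def convergent_def[symmetric] convergent_LIMSEQ_iff by simp
  have \<rho>_nonneg: "0 \<le> \<rho> J \<omega>" if "finite J" "\<omega> \<in> E J" for J \<omega>
    by (rule LIMSEQ_le_const[OF \<rho>[OF that]]) (auto simp: m_def)
  \<comment> \<open>The limiting point masses live on the finite set \<open>E J\<close>; the
    push-forward under the identity places them on the full Borel product.\<close>
  define P where "P J = distr (point_measure (E J) (\<lambda>\<omega>. ennreal (\<rho> J \<omega>))) (PiM J (\<lambda>_. borel)) (\<lambda>\<omega>. \<omega>)" for J
  have sP[simp]: "sets (P J) = sets (PiM J (\<lambda>_. borel))" for J by (simp add: P_def)
  have mid: "(\<lambda>\<omega>. \<omega>) \<in> measurable (point_measure (E J) (\<lambda>\<omega>. ennreal (\<rho> J \<omega>))) (PiM J (\<lambda>_. borel :: 'a measure))" for J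
    by (auto simp: measurable_point_measure_eq1 E_def space_PiM)
  have eP: "emeasure (P J) A = ennreal (\<Sum>\<omega>\<in>A \<inter> E J. \<rho> J \<omega>)"
    if "finite J" "A \<in> sets (PiM J (\<lambda>_. borel))" for J A
  proof -
    have "emeasure (P J) A = emeasure (point_measure (E J) (\<lambda>\<omega>. ennreal (\<rho> J \<omega>))) (A \<inter> E J)"
      unfolding P_def using that by (subst emeasure_distr[OF mid]) (auto simp: space_point_measure)
    also have "\<dots> = (\<Sum>\<omega>\<in>A \<inter> E J. ennreal (\<rho> J \<omega>))"
      by (intro emeasure_point_measure_finite finE that) auto
    also have "\<dots> = ennreal (\<Sum>\<omega>\<in>A \<inter> E J. \<rho> J \<omega>)"
      by (intro sum_ennreal) (auto intro: \<rho>_nonneg that)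
    finally show ?thesis .
  qed
  have mP: "measure (P J) A = (\<Sum>\<omega>\<in>A \<inter> E J. \<rho> J \<omega>)"
    if "finite J" "A \<in> sets (PiM J (\<lambda>_. borel))" for J A
  proof -
    have "0 \<le> (\<Sum>\<omega>\<in>A \<inter> E J. \<rho> J \<omega>)" by (intro sum_nonneg \<rho>_nonneg) (use that in auto)
    then show ?thesis unfolding measure_def eP[OF that] by (rule enn2real_ennreal)
  qed
  have QE: "(\<lambda>j\<in>J. q j x) \<in> E J" if "x \<in> space (N i)" for i x J
    using W(2)[OF that] by (auto simp: E_def)
  have Q: "(\<lambda>i. measure (N (r i)) {x \<in> space (N (r i)). (\<lambda>j\<in>J. q j x) \<in> A}) \<longlonglongrightarrow> measure (P J) A"
    if J: "finite J" and A: "A \<in> sets (PiM J (\<lambda>_. borel))" for J A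
  proof -
    have "measure (N i) {x \<in> space (N i). (\<lambda>j\<in>J. q j x) \<in> A} = (\<Sum>\<omega>\<in>A \<inter> E J. m i (J, \<omega>))" for i
    proof -
      interpret prob_space "N i" by (rule prob)
      have [measurable]: "q k \<in> borel_measurable (N i)" for k by (rule q)
      have ms: "{x \<in> space (N i). (\<lambda>j\<in>J. q j x) = \<omega>} \<in> sets (N i)" if "\<omega> \<in> E J" for \<omega>
      proof -
        have "{x \<in> space (N i). (\<lambda>j\<in>J. q j x) = \<omega>} = {x \<in> space (N i). \<forall>j\<in>J. q j x = \<omega> j}"
          using that by (auto simp: E_def fun_eq_iff PiE_def extensional_def restrict_def)
        also have "\<dots> \<in> sets (N i)" using J by measurable
        finally show ?thesis .
      qed
      have "{x \<in> space (N i). (\<lambda>j\<in>J. q j x) \<in> A} = (\<Union>\<omega>\<in>A \<inter> E J. {x \<in> space (N i). (\<lambda>j\<in>J. q j x) = \<omega>})"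
        using QE by blast
      also have "measure (N i) \<dots> = (\<Sum>\<omega>\<in>A \<inter> E J. measure (N i) {x \<in> space (N i). (\<lambda>j\<in>J. q j x) = \<omega>})"
        using ms finE[OF J] by (intro finite_measure_finite_Union) (auto simp: disjoint_family_on_def)
      finally show ?thesis unfolding m_def fst_conv snd_conv .
    qed
    moreover have "(\<lambda>i. \<Sum>\<omega>\<in>A \<inter> E J. m (r i) (J, \<omega>)) \<longlonglongrightarrow> (\<Sum>\<omega>\<in>A \<inter> E J. \<rho> J \<omega>)"
      using J by (intro tendsto_sum \<rho>) auto
    ultimately show ?thesis using mP[OF J A] by simp
  qed
  have pP: "prob_space (P J)" if J: "finite J" for J
  proof
    have "(\<lambda>i. measure (N (r i)) {x \<in> space (N (r i)). (\<lambda>j\<in>J. q j x) \<in> space (PiM J (\<lambda>_. borel))}) \<longlonglongrightarrow> measure (P J) (space (PiM J (\<lambda>_. borel)))"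
      by (rule Q[OF J]) auto
    moreover have "{x \<in> space (N (r i)). (\<lambda>j\<in>J. q j x) \<in> space (PiM J (\<lambda>_. borel))} = space (N (r i))" for i
      by (auto simp: space_PiM)
    ultimately have "(\<lambda>i::nat. 1) \<longlonglongrightarrow> measure (P J) (space (PiM J (\<lambda>_. borel)))"
      by (simp add: prob_space.prob_space[OF prob])
    then have "measure (P J) (space (PiM J (\<lambda>_. borel))) = 1"
      using LIMSEQ_unique tendsto_const by blast
    moreover have "space (P J) = space (PiM J (\<lambda>_. borel))" by (rule sets_eq_imp_space_eq) simp
    moreover have "emeasure (P J) (space (PiM J (\<lambda>_. borel))) \<noteq> \<infinity>"
      by (simp add: eP[OF J])
    ultimately show "emeasure (P J) (space (P J)) = 1"
      by (simp add: emeasure_eq_ennreal_measure)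
  qed
  have "projective_family UNIV P (\<lambda>_. borel)"
  proof (rule projective_family.intro)
    fix J H :: "nat set" assume JH: "J \<subseteq> H" "finite H"
    have J: "finite J" using JH finite_subset by blast
    have rm: "(\<lambda>f. restrict f J) \<in> measurable (P H) (PiM J (\<lambda>_. borel))"
      using JH by (simp add: measurable_restrict_subset measurable_cong_sets[OF sP refl])
    show "P J = distr (P H) (PiM J (\<lambda>_. borel)) (\<lambda>f. restrict f J)"
    proof (rule measure_eqI)
      fix A assume "A \<in> sets (P J)"
      then have A: "A \<in> sets (PiM J (\<lambda>_. borel))" by simp
      define A' where "A' = (\<lambda>f. restrict f J) -` A \<inter> space (PiM H (\<lambda>_. borel :: 'a measure))"
      have spH: "space (P H) = space (PiM H (\<lambda>_. borel))" by (rule sets_eq_imp_space_eq) simp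
      have A': "A' \<in> sets (PiM H (\<lambda>_. borel))"
        using measurable_sets[OF rm A] by (simp add: A'_def spH)
      \<comment> \<open>Before the limit, the event for the coordinates in \<open>H\<close> and its
        restriction to \<open>J\<close> coincide, so both limiting laws give it the same
        probability.\<close>
      have "{x \<in> space (N i). (\<lambda>j\<in>H. q j x) \<in> A'} = {x \<in> space (N i). (\<lambda>j\<in>J. q j x) \<in> A}" for i
        using JH by (auto simp: A'_def space_PiM restrict_restrict Int_absorb1)
      then have "(\<lambda>i. measure (N (r i)) {x \<in> space (N (r i)). (\<lambda>j\<in>J. q j x) \<in> A}) \<longlonglongrightarrow> measure (P H) A'"
        using Q[OF JH(2) A'] by simp
      then have "measure (P H) A' = measure (P J) A"
        using Q[OF J A] LIMSEQ_unique by blast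
      then have "emeasure (P H) A' = emeasure (P J) A"
        using finite_measure.emeasure_eq_measure[OF prob_space.finite_measure[OF pP]] J JH by simp
      then show "emeasure (P J) A = emeasure (distr (P H) (PiM J (\<lambda>_. borel)) (\<lambda>f. restrict f J)) A"
        using A by (simp add: emeasure_distr[OF rm] A'_def spH)
    qed simp
  next
    show "prob_space (P J)" if "finite J" for J using that by (rule pP)
  qed
  then interpret K: polish_projective UNIV P by (rule polish_projective.intro)
  have "prod_emb UNIV (\<lambda>_. borel) J A = {\<omega> :: nat \<Rightarrow> 'a. restrict \<omega> J \<in> A}" for J A
    by (auto simp: prod_emb_def)
  then have "measure K.lim {\<omega>. restrict \<omega> J \<in> A} = measure (P J) A"
    if "finite J" "A \<in> sets (PiM J (\<lambda>_. borel))" for J A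
    using K.measure_lim_emb[of J A] that by simp
  then show ?thesis
    using r(1) Q K.P.prob_space_axioms by (intro exI[of _ r] exI[of _ K.lim]) simp
qed

text \<open>Rounding down to the lattice of mesh \<open>1 / (k + 1)\<close>; sending the outside of
  the ball to 0 keeps the range finite.\<close>

definition grid :: "nat \<Rightarrow> real^'n \<Rightarrow> real^'n" where
  "grid k x = (if norm x \<le> 1 then \<chi> i. of_int \<lfloor>real (Suc k) * x $ i\<rfloor> / real (Suc k) else 0)"

lemma grid_measurable [measurable]: "grid k \<in> borel_measurable borel"
proof -
  have "(\<lambda>x::real^'n. \<chi> i. real_of_int \<lfloor>real (Suc k) * x $ i\<rfloor> / real (Suc k)) \<in> borel_measurable borel"
    by (subst borel_measurable_euclidean_space) (auto simp: Basis_vec_def inner_axis)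
  then show ?thesis unfolding grid_def by measurable
qed

lemma finite_range_grid: "finite (range (grid k :: real^'n \<Rightarrow> real^'n))"
proof (rule finite_subset)
  define Z where "Z = (UNIV :: 'n set) \<rightarrow>\<^sub>E {- int (Suc k)..int (Suc k)}"
  show "range (grid k :: real^'n \<Rightarrow> real^'n) \<subseteq> insert 0 ((\<lambda>z. \<chi> i. of_int (z i) / real (Suc k)) ` Z)"
  proof
    fix w :: "real^'n" assume "w \<in> range (grid k)"
    then obtain x where x: "w = grid k x" by auto
    show "w \<in> insert 0 ((\<lambda>z. \<chi> i. of_int (z i) / real (Suc k)) ` Z)"
    proof (cases "norm x \<le> 1")
      case True
      have "\<lfloor>real (Suc k) * x $ i\<rfloor> \<in> {- int (Suc k)..int (Suc k)}" for i
      proof -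
        have "\<bar>x $ i\<bar> \<le> 1" using component_le_norm_cart[of x i] True by linarith
        then have "- real (Suc k) \<le> real (Suc k) * x $ i" "real (Suc k) * x $ i \<le> real (Suc k)"
          using mult_left_mono[of "-1" "x $ i" "real (Suc k)"] mult_left_mono[of "x $ i" 1 "real (Suc k)"] by auto
        then show ?thesis unfolding atLeastAtMost_iff by linarith
      qed
      then show ?thesis
        unfolding x using True
        by (auto simp: grid_def Z_def intro!: image_eqI[of _ _ "\<lambda>i. \<lfloor>real (Suc k) * x $ i\<rfloor>"])
    qed (simp add: x grid_def)
  qed
  show "finite (insert 0 ((\<lambda>z. \<chi> i. of_int (z i) / real (Suc k)) ` Z) :: (real^'n) set)"
    unfolding Z_def by (intro finite.insertI finite_imageI finite_PiE) auto
qed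

lemma dist_grid: "norm x \<le> 1 \<Longrightarrow> dist (grid k x) x \<le> real CARD('n) / real (Suc k)" for x :: "real^'n"
proof -
  assume x: "norm x \<le> 1"
  have "\<bar>(grid k x - x) $ i\<bar> \<le> 1 / real (Suc k)" for i
  proof -
    have "(grid k x - x) $ i = (of_int \<lfloor>real (Suc k) * x $ i\<rfloor> - real (Suc k) * x $ i) / real (Suc k)"
      using x by (simp add: grid_def diff_divide_distrib)
    moreover have "\<bar>of_int \<lfloor>real (Suc k) * x $ i\<rfloor> - real (Suc k) * x $ i\<bar> \<le> 1" by linarith
    ultimately show ?thesis by (simp add: divide_right_mono del: of_nat_Suc)
  qed
  then have "(\<Sum>i\<in>UNIV. \<bar>(grid k x - x) $ i\<bar>) \<le> (\<Sum>i\<in>(UNIV::'n set). 1 / real (Suc k))"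
    by (intro sum_mono) auto
  then show ?thesis
    using norm_le_l1_cart[of "grid k x - x"] by (simp add: dist_norm)
qed


text \<open>Membership in \<open>W\<close> is asked only almost everywhere, because the coordinates
  of the limiting process are grid points only almost surely.\<close>

lemma integral_finite_range:
  fixes \<psi> :: "'a::t1_space \<Rightarrow> real"
  assumes M: "finite_measure M" and f: "f \<in> borel_measurable M" and W: "finite W" "AE x in M. f x \<in> W"
    and m: "(\<lambda>x. \<psi> (f x)) \<in> borel_measurable M"
  shows "(LINT x|M. \<psi> (f x)) = (\<Sum>w\<in>W. \<psi> w * measure M {x \<in> space M. f x = w})"
    and "integrable M (\<lambda>x. \<psi> (f x))"
proof -
  interpret finite_measure M by fact
  have ms[measurable]: "{x \<in> space M. f x = w} \<in> sets M" for w
    using measurable_sets[OF f, of "{w}"] by (simp add: vimage_def Int_def conj_commute)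
  have eq: "\<psi> (f x) = (\<Sum>w\<in>W. \<psi> w * indicator {x \<in> space M. f x = w} x)" if "f x \<in> W" "x \<in> space M" for x
  proof -
    have "(\<Sum>w\<in>W. \<psi> w * indicator {x \<in> space M. f x = w} x) = (\<Sum>w\<in>W. if w = f x then \<psi> w else 0)"
      using that by (intro sum.cong) (auto simp: indicator_def)
    then show ?thesis using that W(1) by simp
  qed
  have ae: "AE x in M. \<psi> (f x) = (\<Sum>w\<in>W. \<psi> w * indicator {x \<in> space M. f x = w} x)"
    using W(2) by (elim AE_mp) (intro AE_I2 impI eq)
  have int: "integrable M (\<lambda>x. \<Sum>w\<in>W. \<psi> w * indicator {x \<in> space M. f x = w} x)"
    by (intro Bochner_Integration.integrable_sum integrable_mult_right integrable_real_indicator)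
      (auto simp: less_top[symmetric])
  have "(LINT x|M. \<psi> (f x)) = (LINT x|M. (\<Sum>w\<in>W. \<psi> w * indicator {x \<in> space M. f x = w} x))"
    using ae m by (intro integral_cong_AE) auto
  also have "\<dots> = (\<Sum>w\<in>W. \<psi> w * measure M {x \<in> space M. f x = w})"
    by (subst Bochner_Integration.integral_sum)
      (auto intro!: integrable_mult_right integrable_real_indicator simp: less_top[symmetric])
  finally show "(LINT x|M. \<psi> (f x)) = (\<Sum>w\<in>W. \<psi> w * measure M {x \<in> space M. f x = w})" .
  show "integrable M (\<lambda>x. \<psi> (f x))"
    using int m ae by (subst integrable_cong_AE) auto
qed


text \<open>The joint laws of the grid approximations of a point have only finitely many values, so a
  diagonal subsequence of them converges. By Kolmogorov's extension theorem the limits are the joint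
  laws of a random sequence, which is almost surely Cauchy; \<open>\<mu>\<close> is the law of its limit.\<close>

lemma prob_measures_on_ball_compact:
  fixes N :: "nat \<Rightarrow> (real^'n) measure"
  assumes prob: "\<And>i. prob_space (N i)" and sets: "\<And>i. sets (N i) = sets borel"
    and ball: "\<And>i. AE x in N i. norm x \<le> 1"
  shows "\<exists>r \<mu>. strict_mono r \<and> prob_space \<mu> \<and> sets \<mu> = sets borel \<and>
    (\<forall>\<psi> :: real^'n \<Rightarrow> real. continuous_on UNIV \<psi> \<longrightarrow>
      (\<lambda>i. LINT x|N (r i). \<psi> x) \<longlonglongrightarrow> (LINT x|\<mu>. \<psi> x))"
proof -
  define d where "d k = real CARD('n) / real (Suc k)" for k
  have d_pos: "0 < d k" for k by (simp add: d_def)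
  have d_0: "d \<longlonglongrightarrow> 0"
    unfolding d_def by real_asymp
  have spN: "space (N i) = UNIV" for i using sets_eq_imp_space_eq[OF sets] by simp
  have mN: "borel_measurable (N i) = (borel_measurable borel :: ((real^'n) \<Rightarrow> 'z::topological_space) set)" for i
    by (rule measurable_cong_sets) (auto simp: sets)
  obtain r L where r: "strict_mono r" and L: "prob_space L" "sets L = sets (PiM UNIV (\<lambda>_::nat. borel :: (real^'n) measure))"
    and lim: "\<And>J A. finite J \<Longrightarrow> A \<in> sets (PiM J (\<lambda>_. borel)) \<Longrightarrow>
      (\<lambda>i. measure (N (r i)) {x. (\<lambda>j\<in>J. grid j x) \<in> A}) \<longlonglongrightarrow> measure L {\<omega>. restrict \<omega> J \<in> A}"
  proof -
    have q: "grid k \<in> borel_measurable (N i)" for k i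
      using grid_measurable mN by blast
    have "\<exists>r L. strict_mono r \<and> prob_space L \<and> sets L = sets (PiM UNIV (\<lambda>_. borel)) \<and>
        (\<forall>J A. finite J \<longrightarrow> A \<in> sets (PiM J (\<lambda>_. borel)) \<longrightarrow>
          (\<lambda>i. measure (N (r i)) {x \<in> space (N (r i)). (\<lambda>j\<in>J. grid j x) \<in> A}) \<longlonglongrightarrow> measure L {\<omega>. restrict \<omega> J \<in> A})"
      by (rule finite_valued_process_limit[of N grid "\<lambda>k. range (grid k)", OF prob q finite_range_grid rangeI])
    then show ?thesis using that unfolding spN by (simp only: UNIV_I simp_thms) blast
  qed
  interpret L: prob_space L by fact
  have spL: "space L = UNIV" using sets_eq_imp_space_eq[OF L(2)] by (simp add: space_PiM)
  note [measurable_cong] = L(2)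
  have lim1: "(\<lambda>i. measure (N (r i)) {x. Q (grid k x)}) \<longlonglongrightarrow> measure L {\<omega>. Q (\<omega> k)}"
    if [measurable]: "Measurable.pred borel Q" for Q :: "real^'n \<Rightarrow> bool" and k
  proof -
    have "{f \<in> space (PiM {k} (\<lambda>_. borel)). Q (f k)} \<in> sets (PiM {k} (\<lambda>_. borel))" by measurable
    from lim[OF _ this] show ?thesis by (simp add: space_PiM)
  qed
  have lim2: "(\<lambda>i. measure (N (r i)) {x. Q (grid j x) (grid k x)}) \<longlonglongrightarrow> measure L {\<omega>. Q (\<omega> j) (\<omega> k)}"
    if [measurable]: "Measurable.pred (borel \<Otimes>\<^sub>M borel) (\<lambda>p. Q (fst p) (snd p))"
    for Q :: "real^'n \<Rightarrow> real^'n \<Rightarrow> bool" and j k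
  proof -
    have "(\<lambda>f. (f j, f k)) \<in> measurable (PiM {j, k} (\<lambda>_. borel)) (borel \<Otimes>\<^sub>M (borel :: (real^'n) measure))"
      by measurable
    from measurable_compose[OF this that]
    have "{f \<in> space (PiM {j, k} (\<lambda>_. borel)). Q (f j) (f k)} \<in> sets (PiM {j, k} (\<lambda>_. borel))"
      by (simp add: pred_def)
    from lim[OF _ this] show ?thesis by (simp add: space_PiM)
  qed
  \<comment> \<open>Outside the ball both roundings are 0, so the estimate holds at every point and
    the exceptional events are empty before the limit.\<close>
  have dg: "dist (grid j x) (grid k x) \<le> d j + d k" for j k and x :: "real^'n"
  proof (cases "norm x \<le> 1")
    case True
    then show ?thesis using dist_grid[OF True, of j] dist_grid[OF True, of k] dist_triangle2[of "grid j x" "grid k x" x]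
      by (simp add: d_def dist_commute)
  next
    case False
    then show ?thesis using d_pos[of j] d_pos[of k] by (simp add: grid_def less_imp_le)
  qed
  have AEd: "AE \<omega> in L. \<forall>j k. dist (\<omega> j) (\<omega> k) \<le> d j + d k"
  proof (intro AE_all_countable[THEN iffD2] allI)
    fix j k
    have "(\<lambda>i. measure (N (r i)) {x. d j + d k < dist (grid j x) (grid k x)}) \<longlonglongrightarrow> measure L {\<omega>. d j + d k < dist (\<omega> j) (\<omega> k)}"
      by (rule lim2) measurable
    moreover have "{x. d j + d k < dist (grid j x) (grid k x)} = ({} :: (real^'n) set)" using dg[of j _ k] by (auto simp: not_less)
    ultimately have "(\<lambda>i::nat. 0) \<longlonglongrightarrow> measure L {\<omega>. d j + d k < dist (\<omega> j) (\<omega> k)}" by simp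
    then have 0: "measure L {\<omega>. d j + d k < dist (\<omega> j) (\<omega> k)} = 0"
      by (rule LIMSEQ_unique[OF _ tendsto_const])
    have "{\<omega> \<in> space L. d j + d k < dist (\<omega> j) (\<omega> k)} \<in> sets L" by measurable
    then show "AE \<omega> in L. dist (\<omega> j) (\<omega> k) \<le> d j + d k"
      using 0 by (intro AE_I[of _ _ "{\<omega>. d j + d k < dist (\<omega> j) (\<omega> k)}"]) (auto simp: L.emeasure_eq_measure spL)
  qed
  have AE1: "AE \<omega> in L. Q (\<omega> k)" if "Measurable.pred borel Q" "\<And>x. Q (grid k x)" for Q k
  proof -
    have [measurable]: "Measurable.pred borel Q" by fact
    have "(\<lambda>i. measure (N (r i)) {x. \<not> Q (grid k x)}) \<longlonglongrightarrow> measure L {\<omega>. \<not> Q (\<omega> k)}"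
      by (rule lim1) measurable
    then have "(\<lambda>i::nat. 0) \<longlonglongrightarrow> measure L {\<omega>. \<not> Q (\<omega> k)}" using that by simp
    then have 0: "measure L {\<omega>. \<not> Q (\<omega> k)} = 0"
      by (rule LIMSEQ_unique[OF _ tendsto_const])
    have "{\<omega> \<in> space L. \<not> Q (\<omega> k)} \<in> sets L" by measurable
    then show ?thesis
      using 0 by (intro AE_I[of _ _ "{\<omega>. \<not> Q (\<omega> k)}"]) (auto simp: L.emeasure_eq_measure spL)
  qed
  \<comment> \<open>Rounding moves a point of the unit ball by at most \<open>d k\<close>, which is
    at most \<open>n\<close>; hence the radius \<open>1 + n\<close>.\<close>
  define C where "C = 1 + real CARD('n)"
  have gC: "norm (grid k x) \<le> C" for k and x :: "real^'n"
  proof (cases "norm x \<le> 1")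
    case True
    have "d k \<le> real CARD('n)" by (simp add: d_def divide_le_eq)
    then show ?thesis
      using True dist_grid[OF True, of k] norm_triangle_ineq2[of "grid k x" x] by (simp add: C_def d_def dist_norm)
  qed (simp add: grid_def C_def)
  have AEC: "AE \<omega> in L. \<forall>k. norm (\<omega> k) \<le> C"
    by (intro AE_all_countable[THEN iffD2] allI AE1 gC) measurable
  have AEW: "AE \<omega> in L. \<omega> k \<in> range (grid k)" for k
  proof (rule AE1)
    have "closed (range (grid k :: real^'n \<Rightarrow> real^'n))" using finite_range_grid by (rule finite_imp_closed)
    then show "Measurable.pred borel (\<lambda>w. w \<in> range (grid k :: real^'n \<Rightarrow> real^'n))" by (simp add: pred_def)
  qed auto
  \<comment> \<open>\<open>lim\<close> is a total function, so \<open>X\<close> is measurable as it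
    stands; almost surely the coordinates are Cauchy and \<open>X\<close> is their limit.\<close>
  define X where "X \<omega> = lim (\<lambda>k. \<omega> k)" for \<omega> :: "nat \<Rightarrow> real^'n"
  have Xm[measurable]: "X \<in> borel_measurable L" unfolding X_def[abs_def] by measurable
  have AEX: "AE \<omega> in L. (\<forall>k. norm (\<omega> k) \<le> C) \<and> norm (X \<omega>) \<le> C \<and> (\<forall>k. dist (\<omega> k) (X \<omega>) \<le> d k)"
    using AEC AEd
  proof eventually_elim
    case (elim \<omega>)
    have "Cauchy \<omega>"
      unfolding Cauchy_altdef2
    proof (intro allI impI)
      fix e :: real assume "e > 0"
      then have "\<forall>\<^sub>F k in sequentially. d k < e / 2" using order_tendstoD(2)[OF d_0, of "e / 2"] by simp
      then obtain M where M: "\<And>k. k \<ge> M \<Longrightarrow> d k < e / 2" by (auto simp: eventually_sequentially)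
      have "dist (\<omega> n) (\<omega> M) < e" if "n \<ge> M" for n
      proof -
        have "dist (\<omega> n) (\<omega> M) \<le> d n + d M" using elim by blast
        then show ?thesis using M[OF that] M[of M] by simp
      qed
      then show "\<exists>M. \<forall>n\<ge>M. dist (\<omega> n) (\<omega> M) < e" by blast
    qed
    then have X: "\<omega> \<longlonglongrightarrow> X \<omega>" unfolding X_def by (simp add: Cauchy_convergent_iff convergent_LIMSEQ_iff)
    have "norm (X \<omega>) \<le> C" by (rule LIMSEQ_le_const2[OF tendsto_norm[OF X]]) (use elim in auto)
    moreover have "dist (\<omega> k) (X \<omega>) \<le> d k" for k
    proof (rule LIMSEQ_le[OF tendsto_dist[OF tendsto_const X]])
      show "(\<lambda>j. d k + d j) \<longlonglongrightarrow> d k" using tendsto_add[OF tendsto_const d_0, of "d k"] by simp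
      show "\<exists>M. \<forall>n\<ge>M. dist (\<omega> k) (\<omega> n) \<le> d k + d n" using elim by blast
    qed
    ultimately show ?case using elim by blast
  qed
  have close: "\<bar>(LINT x|M. f x) - (LINT x|M. g x)\<bar> \<le> e"
    if "prob_space M" "integrable M f" "integrable M g" "AE x in M. \<bar>f x - g x\<bar> \<le> e" for M :: "'z measure" and f g :: "'z \<Rightarrow> real" and e
  proof -
    interpret prob_space M by fact
    have "\<bar>(LINT x|M. f x) - (LINT x|M. g x)\<bar> = \<bar>LINT x|M. f x - g x\<bar>" using that by simp
    also have "\<dots> \<le> (LINT x|M. \<bar>f x - g x\<bar>)" by (rule integral_abs_bound)
    also have "\<dots> \<le> (LINT x|M. e)" by (rule integral_mono_AE) (use that in auto)
    also have "\<dots> = e" by (simp add: prob_space)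
    finally show ?thesis .
  qed
  have conv: "(\<lambda>i. LINT x|N (r i). \<psi> x) \<longlonglongrightarrow> (LINT x|distr L borel X. \<psi> x)"
    if \<psi>: "continuous_on UNIV \<psi>" for \<psi> :: "real^'n \<Rightarrow> real"
  \<comment> \<open>Three errors of size \<open>e / 3\<close>: rounding under \<open>N (r i)\<close>
    and passing from \<open>\<omega> k\<close> to \<open>X\<close> are controlled by uniform
    continuity, and for fixed \<open>k\<close> only finitely many point probabilities have to
    converge.\<close>
  proof (rule tendstoI)
    fix e :: real assume "e > 0"
    have \<psi>m[measurable]: "\<psi> \<in> borel_measurable borel" using \<psi> by (rule borel_measurable_continuous_onI)
    have cC: "continuous_on (cball 0 C) \<psi>" using continuous_on_subset[OF \<psi>] by simp
    then have "compact (\<psi> ` cball 0 C)" by (intro compact_continuous_image) auto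
    then have "bounded (\<psi> ` cball 0 C)" by (rule compact_imp_bounded)
    then obtain B where "\<forall>y\<in>\<psi> ` cball 0 C. norm y \<le> B" unfolding bounded_iff by blast
    then have B: "norm x \<le> C \<Longrightarrow> \<bar>\<psi> x\<bar> \<le> B" for x by simp
    have "uniformly_continuous_on (cball 0 C) \<psi>"
      using cC by (intro compact_uniformly_continuous) auto
    then obtain \<delta> where \<delta>: "\<delta> > 0" "\<And>x y. norm x \<le> C \<Longrightarrow> norm y \<le> C \<Longrightarrow> dist x y < \<delta> \<Longrightarrow> dist (\<psi> x) (\<psi> y) < e / 3"
      unfolding uniformly_continuous_on_def using \<open>e > 0\<close> by (auto simp: dist_commute dest!: spec[of _ "e / 3"])
    obtain k where k: "d k < \<delta>"
      using order_tendstoD(2)[OF d_0 \<delta>(1)] by (auto simp: eventually_sequentially)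
    have C1: "norm x \<le> 1 \<Longrightarrow> norm x \<le> C" for x :: "real^'n" by (simp add: C_def add_increasing2)
    have iN: "integrable (N i) (\<lambda>x. \<psi> (f x))" if "f \<in> borel_measurable borel" "AE x in N i. norm (f x) \<le> C" for f i
    proof -
      interpret prob_space "N i" by (rule prob)
      show ?thesis
        using that by (intro integrable_const_bound[of _ B]) (auto simp: mN intro: B)
    qed
    have iL: "integrable L (\<lambda>x. \<psi> (f x))" if "f \<in> borel_measurable L" "AE x in L. norm (f x) \<le> C" for f
      using that by (intro L.integrable_const_bound[of _ B]) (auto intro: B)
    have 1: "\<bar>(LINT x|N i. \<psi> x) - (LINT x|N i. \<psi> (grid k x))\<bar> \<le> e / 3" for i
    proof (rule close[OF prob])
      have "AE x in N i. norm x \<le> C" using ball by eventually_elim (rule C1)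
      then show "integrable (N i) \<psi>" using iN[of "\<lambda>x. x" i] by simp
      show "integrable (N i) (\<lambda>x. \<psi> (grid k x))" by (rule iN) (auto simp: gC)
      show "AE x in N i. \<bar>\<psi> x - \<psi> (grid k x)\<bar> \<le> e / 3"
        using ball
      proof eventually_elim
        case (elim x)
        show ?case using \<delta>(2)[OF C1[OF elim] gC, of k x] dist_grid[OF elim, of k] k
          by (simp add: d_def dist_commute dist_real_def)
      qed
    qed
    have 2: "\<bar>(LINT \<omega>|L. \<psi> (\<omega> k)) - (LINT \<omega>|L. \<psi> (X \<omega>))\<bar> \<le> e / 3"
    proof (rule close[OF L(1)])
      show "integrable L (\<lambda>\<omega>. \<psi> (\<omega> k))" using AEC by (intro iL) auto
      show "integrable L (\<lambda>\<omega>. \<psi> (X \<omega>))" using AEX by (intro iL) auto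
      show "AE \<omega> in L. \<bar>\<psi> (\<omega> k) - \<psi> (X \<omega>)\<bar> \<le> e / 3"
        using AEX
      proof eventually_elim
        case (elim \<omega>)
        then have "dist (\<omega> k) (X \<omega>) < \<delta>" using k by (meson le_less_trans)
        then show ?case using \<delta>(2)[of "\<omega> k" "X \<omega>"] elim by (simp add: dist_real_def)
      qed
    qed
    have "(LINT x|N i. \<psi> (grid k x)) = (\<Sum>w\<in>range (grid k). \<psi> w * measure (N i) {x. grid k x = w})" for i
      using integral_finite_range(1)[of "N i" "grid k" "range (grid k)" \<psi>] prob_space.finite_measure[OF prob]
      by (simp add: mN spN finite_range_grid)
    moreover have "(LINT \<omega>|L. \<psi> (\<omega> k)) = (\<Sum>w\<in>range (grid k). \<psi> w * measure L {\<omega>. \<omega> k = w})"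
      using integral_finite_range(1)[of L "\<lambda>\<omega>. \<omega> k" "range (grid k)" \<psi>] L.finite_measure_axioms AEW
      by (simp add: spL finite_range_grid)
    moreover have "(\<lambda>i. \<Sum>w\<in>range (grid k). \<psi> w * measure (N (r i)) {x. grid k x = w}) \<longlonglongrightarrow>
       (\<Sum>w\<in>range (grid k). \<psi> w * measure L {\<omega>. \<omega> k = w})"
      by (intro tendsto_sum tendsto_mult tendsto_const lim1) measurable
    ultimately have "(\<lambda>i. LINT x|N (r i). \<psi> (grid k x)) \<longlonglongrightarrow> (LINT \<omega>|L. \<psi> (\<omega> k))" by simp
    then have "\<forall>\<^sub>F i in sequentially. dist (LINT x|N (r i). \<psi> (grid k x)) (LINT \<omega>|L. \<psi> (\<omega> k)) < e / 3"
      using \<open>e > 0\<close> by (intro tendstoD) auto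
    then show "\<forall>\<^sub>F i in sequentially. dist (LINT x|N (r i). \<psi> x) (LINT x|distr L borel X. \<psi> x) < e"
    proof eventually_elim
      case (elim i)
      have "(LINT x|distr L borel X. \<psi> x) = (LINT \<omega>|L. \<psi> (X \<omega>))"
        by (rule integral_distr) measurable
      then show ?case using elim 1[of "r i"] 2 unfolding dist_real_def by linarith
    qed
  qed
  have "prob_space (distr L borel X)" by (rule L.prob_space_distr) measurable
  then show ?thesis using r conv by (intro exI[of _ r] exI[of _ "distr L borel X"]) auto
qed


text \<open>\<open>z / (1 - |z|)\<close> inverts \<open>x / (1 + |x|)\<close>; approaching the
  sphere from inside means that the preimage tends to infinity, where \<open>\<psi>\<close> is
  small.\<close>

lemma continuous_extend_by_zero_from_ball:
  fixes \<psi> :: "real^'n \<Rightarrow> real"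
  assumes \<psi>: "continuous_on UNIV \<psi>" "(\<psi> \<longlongrightarrow> 0) at_infinity"
  shows "continuous_on UNIV (\<lambda>z. if norm z < 1 then \<psi> (z /\<^sub>R (1 - norm z)) else 0)"
proof -
  let ?f = "\<lambda>z. if norm z < 1 then \<psi> (z /\<^sub>R (1 - norm z)) else 0"
  have "isCont ?f z" for z
  proof (cases "norm z < 1")
    case True
    have "continuous_on (ball 0 1) (\<lambda>z. \<psi> (z /\<^sub>R (1 - norm z)))"
      by (rule continuous_on_compose2[OF \<psi>(1)]) (auto intro!: continuous_intros)
    then have "continuous_on (ball 0 1) ?f"
      by (rule continuous_on_eq) auto
    then show ?thesis
      using True by (simp add: continuous_on_eq_continuous_at)
  next
    case False
    have "(?f \<longlongrightarrow> 0) (at z)"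
    proof (rule tendstoI)
      fix e :: real assume "e > 0"
      then obtain b where b: "\<And>x. b \<le> norm x \<Longrightarrow> dist (\<psi> x) 0 < e"
        using \<psi>(2) unfolding Lim_at_infinity by blast
      define b' where "b' = max b 0"
      \<comment> \<open>As \<open>|z| \<ge> 1\<close>, this distance gives
        \<open>1 - |w| < 1 / (1 + b')\<close>, which for \<open>|w| < 1\<close> says that
        \<open>|w| / (1 - |w|)\<close> exceeds \<open>b'\<close>.\<close>
      have "dist (?f w) 0 < e" if "dist w z < 1 / (1 + b')" for w
      proof (cases "norm w < 1")
        case True
        have "norm z - norm w \<le> dist w z" by (metis dist_commute dist_norm norm_triangle_ineq2)
        then have "1 - norm w < 1 / (1 + b')" using that False by linarith
        then have "(1 - norm w) * (1 + b') < 1" by (simp add: b'_def less_divide_eq)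
        then have "b' * (1 - norm w) \<le> norm w" by (simp add: algebra_simps)
        then have "b' \<le> norm (w /\<^sub>R (1 - norm w))" using True by (simp add: field_simps)
        then show ?thesis using b[of "w /\<^sub>R (1 - norm w)"] True by (simp add: b'_def)
      qed (use \<open>e > 0\<close> in simp)
      moreover have "0 < 1 / (1 + b')" by (simp add: b'_def)
      ultimately show "\<forall>\<^sub>F w in at z. dist (?f w) 0 < e"
        unfolding eventually_at by blast
    qed
    then show ?thesis using False by (simp add: isCont_def)
  qed
  then show ?thesis by (simp add: continuous_on_eq_continuous_at)
qed

text \<open>After normalization, the homeomorphism \<open>x \<mapsto> x / (1 + |x|)\<close> onto the unit ball reduces this to
  measures on the ball; mass that escapes to infinity ends up on the sphere, where the extended test
  functions vanish.\<close>

lemma finite_measures_vaguely_compact: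
  fixes N :: "nat \<Rightarrow> (real^'n) measure"
  assumes fin: "\<And>i. finite_measure (N i)" and sets: "\<And>i. sets (N i) = sets borel"
    and B: "\<And>i. measure (N i) UNIV \<le> B"
  shows "\<exists>r \<mu>. strict_mono r \<and> finite_measure \<mu> \<and> sets \<mu> = sets borel \<and>
    (\<forall>\<psi> :: real^'n \<Rightarrow> real. continuous_on UNIV \<psi> \<longrightarrow> (\<psi> \<longlongrightarrow> 0) at_infinity \<longrightarrow>
      (\<lambda>i. LINT x|N (r i). \<psi> x) \<longlonglongrightarrow> (LINT x|\<mu>. \<psi> x))"
proof -
  have spN: "space (N i) = UNIV" for i using sets_eq_imp_space_eq[OF sets] by simp
  have mN: "borel_measurable (N i) = (borel_measurable borel :: ((real^'n) \<Rightarrow> 'z::topological_space) set)" for i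
    by (rule measurable_cong_sets) (auto simp: sets)
  have U: "UNIV \<in> sets (N i)" for i by (simp add: sets)
  have "bounded (range (\<lambda>i. measure (N i) UNIV))"
    by (rule boundedI[of _ B]) (use B in auto)
  then obtain m r1 where r1': "strict_mono r1" "((\<lambda>i. measure (N i) UNIV) \<circ> r1) \<longlonglongrightarrow> m"
    using bounded_imp_convergent_subsequence by blast
  then have r1: "strict_mono r1" "(\<lambda>i. measure (N (r1 i)) UNIV) \<longlonglongrightarrow> m"
    by (simp_all add: o_def)
  have "0 \<le> m" by (rule LIMSEQ_le_const[OF r1(2)]) auto
  have iN: "integrable (N i) \<psi>" if "continuous_on UNIV \<psi>" "\<And>x. \<bar>\<psi> x\<bar> \<le> C" for \<psi> :: "real^'n \<Rightarrow> real" and C i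
  proof -
    interpret finite_measure "N i" by (rule fin)
    show ?thesis
      using that borel_measurable_continuous_onI[OF that(1)] by (intro integrable_const_bound[of _ C]) (auto simp: mN)
  qed
  have bnd: "\<exists>C. \<forall>x. \<bar>\<psi> x\<bar> \<le> C" if \<psi>: "continuous_on UNIV \<psi>" "(\<psi> \<longlongrightarrow> 0) at_infinity" for \<psi> :: "real^'n \<Rightarrow> real"
  proof -
    obtain b where b: "\<And>x. b \<le> norm x \<Longrightarrow> dist (\<psi> x) 0 < 1"
      using \<psi>(2) unfolding Lim_at_infinity by (meson zero_less_one)
    have "continuous_on (cball 0 b) \<psi>" using continuous_on_subset[OF \<psi>(1)] by simp
    then have "compact (\<psi> ` cball 0 b)" by (intro compact_continuous_image) auto
    then have "bounded (\<psi> ` cball 0 b)" by (rule compact_imp_bounded)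
    then obtain C where C: "\<forall>y\<in>\<psi> ` cball 0 b. norm y \<le> C" unfolding bounded_iff by blast
    have "\<bar>\<psi> x\<bar> \<le> max C 1" for x
      using b[of x] C by (cases "b \<le> norm x") (auto simp: le_max_iff_disj)
    then show ?thesis by blast
  qed
  show ?thesis
  proof (cases "m = 0")
    \<comment> \<open>Vanishing masses cannot be normalised, but then bounded integrands have
      integrals tending to 0 and the null measure is the limit.\<close>
    case True
    have "(\<lambda>i. LINT x|N (r1 i). \<psi> x) \<longlonglongrightarrow> (LINT x|null_measure borel. \<psi> x)"
      if \<psi>: "continuous_on UNIV \<psi>" "(\<psi> \<longlongrightarrow> 0) at_infinity" for \<psi> :: "real^'n \<Rightarrow> real"
    proof -
      obtain C where C: "\<And>x. \<bar>\<psi> x\<bar> \<le> C" using bnd[OF \<psi>] by blast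
      have le: "\<bar>LINT x|N i. \<psi> x\<bar> \<le> C * measure (N i) UNIV" for i
      proof -
        interpret finite_measure "N i" by (rule fin)
        have "\<bar>LINT x|N i. \<psi> x\<bar> \<le> (LINT x|N i. \<bar>\<psi> x\<bar>)" by (rule integral_abs_bound)
        also have "\<dots> \<le> (LINT x|N i. C)" using iN[OF \<psi>(1) C] C by (intro integral_mono) auto
        finally show ?thesis by (simp add: spN mult.commute)
      qed
      have "(\<lambda>i. C * measure (N (r1 i)) UNIV) \<longlonglongrightarrow> 0" using tendsto_mult[OF tendsto_const r1(2), of C] True by simp
      then have "(\<lambda>i. LINT x|N (r1 i). \<psi> x) \<longlonglongrightarrow> 0"
        by (rule Lim_null_comparison[rotated]) (use le in \<open>auto intro!: always_eventually\<close>)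
      then show ?thesis by (simp add: integral_null_measure)
    qed
    then show ?thesis
      using r1(1) by (intro exI[of _ r1] exI[of _ "null_measure borel"]) (auto intro!: finite_measureI)
  next
    case False
    then have m: "m > 0" using \<open>0 \<le> m\<close> by simp
    \<comment> \<open>Dropping finitely many terms makes every remaining mass positive, so that
      division by it is legitimate.\<close>
    obtain i0 where i0: "\<And>i. i \<ge> i0 \<Longrightarrow> measure (N (r1 i)) UNIV > 0"
      using order_tendstoD(1)[OF r1(2) m] by (auto simp: eventually_sequentially)
    define c where "c i = measure (N (r1 (i + i0))) UNIV" for i
    have c: "c i > 0" for i using i0 by (simp add: c_def)
    have cm: "c \<longlonglongrightarrow> m" unfolding c_def[abs_def] by (rule LIMSEQ_ignore_initial_segment[OF r1(2)])
    define \<Theta> where "\<Theta> x = x /\<^sub>R (1 + norm x)" for x :: "real^'n"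
    define \<Theta>' where "\<Theta>' z = z /\<^sub>R (1 - norm z)" for z :: "real^'n"
    have n\<Theta>: "norm (\<Theta> x) = norm x / (1 + norm x)" for x by (simp add: \<Theta>_def divide_inverse mult.commute)
    have n\<Theta>1: "norm (\<Theta> x) < 1" for x unfolding n\<Theta> by (simp add: divide_less_eq add_pos_nonneg)
    have inv: "\<Theta>' (\<Theta> x) = x" for x
    proof -
      have "1 - norm (\<Theta> x) = 1 / (1 + norm x)"
        unfolding n\<Theta> by (simp add: field_simps add_nonneg_eq_0_iff)
      moreover have "1 + norm x \<noteq> 0" by (smt (verit) norm_ge_zero)
      ultimately show ?thesis by (simp add: \<Theta>'_def \<Theta>_def)
    qed
    have \<Theta>m[measurable]: "\<Theta> \<in> borel_measurable borel" unfolding \<Theta>_def[abs_def] by measurable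
    have \<Theta>'m[measurable]: "\<Theta>' \<in> borel_measurable borel" unfolding \<Theta>'_def[abs_def] by measurable
    define P where "P i = distr (density (N (r1 (i + i0))) (\<lambda>_. ennreal (1 / c i))) borel \<Theta>" for i
    have \<Theta>mi: "\<Theta> \<in> measurable (density (N i) f) borel" for i f using \<Theta>m by (simp add: mN)
    have intP: "(LINT z|P i. f z) = (LINT x|N (r1 (i + i0)). f (\<Theta> x)) / c i"
      if f[measurable]: "f \<in> borel_measurable borel" for f :: "real^'n \<Rightarrow> real" and i
    proof -
      have "(LINT z|P i. f z) = (LINT x|density (N (r1 (i + i0))) (\<lambda>_. ennreal (1 / c i)). f (\<Theta> x))"
        unfolding P_def by (rule integral_distr[OF \<Theta>mi f])
      also have "\<dots> = (LINT x|N (r1 (i + i0)). (1 / c i) *\<^sub>R f (\<Theta> x))"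
        using c[of i] measurable_compose[OF \<Theta>m f] by (intro integral_density) (auto simp: mN)
      finally show ?thesis by simp
    qed
    have prob: "prob_space (P i)" for i
      unfolding P_def
    proof (rule prob_space.prob_space_distr)
      interpret finite_measure "N (r1 (i + i0))" by (rule fin)
      show "prob_space (density (N (r1 (i + i0))) (\<lambda>_. ennreal (1 / c i)))"
        using c[of i] by (intro prob_spaceI)
          (simp add: emeasure_density_const spN U emeasure_eq_measure c_def[symmetric] ennreal_mult[symmetric])
      show "\<Theta> \<in> measurable (density (N (r1 (i + i0))) (\<lambda>_. ennreal (1 / c i))) borel" by (rule \<Theta>mi)
    qed
    have "AE z in P i. norm z \<le> 1" for i
      unfolding P_def by (subst AE_distr_iff[OF \<Theta>mi]) (use n\<Theta>1 in \<open>auto simp: less_imp_le\<close>)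
    then obtain r \<mu> where r: "strict_mono r" and \<mu>: "prob_space \<mu>" "sets \<mu> = sets borel"
      and conv: "\<And>\<psi> :: real^'n \<Rightarrow> real. continuous_on UNIV \<psi> \<Longrightarrow> (\<lambda>i. LINT x|P (r i). \<psi> x) \<longlonglongrightarrow> (LINT x|\<mu>. \<psi> x)"
      using prob_measures_on_ball_compact[of P, OF prob] by (auto simp: P_def)
    interpret \<mu>: prob_space \<mu> by fact
    note [measurable_cong] = \<mu>(2)
    have [measurable]: "(ball 0 1 :: (real^'n) set) \<in> sets borel" by simp
    \<comment> \<open>Restricting to the open ball discards the mass that reached the sphere, and
      the factor \<open>m\<close> undoes the normalisation.\<close>
    define \<nu> where "\<nu> = distr (density \<mu> (\<lambda>z. ennreal (m * indicator (ball 0 1) z))) borel \<Theta>'"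
    have \<Theta>'m': "\<Theta>' \<in> measurable (density \<mu> f) borel" for f by measurable
    have "finite_measure \<nu>"
      unfolding \<nu>_def
    proof (intro finite_measure.finite_measure_distr[OF _ \<Theta>'m'] finite_measureI)
      have "emeasure (density \<mu> (\<lambda>z. ennreal (m * indicator (ball 0 1) z))) (space \<mu>)
         = (\<integral>\<^sup>+ z. ennreal (m * indicator (ball 0 1) z) \<partial>\<mu>)"
        by (subst emeasure_density) (auto intro!: nn_integral_cong)
      also have "\<dots> \<le> (\<integral>\<^sup>+ z. ennreal m \<partial>\<mu>)"
        using m by (intro nn_integral_mono) (auto simp: indicator_def)
      also have "\<dots> < \<infinity>" by (simp add: \<mu>.emeasure_space_1)
      finally show "emeasure (density \<mu> (\<lambda>z. ennreal (m * indicator (ball 0 1) z)))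
         (space (density \<mu> (\<lambda>z. ennreal (m * indicator (ball 0 1) z)))) \<noteq> \<infinity>" by simp
    qed
    moreover have "sets \<nu> = sets borel" by (simp add: \<nu>_def)
    moreover have "(\<lambda>i. LINT x|N (r1 (r i + i0)). \<psi> x) \<longlonglongrightarrow> (LINT x|\<nu>. \<psi> x)"
      if \<psi>: "continuous_on UNIV \<psi>" "(\<psi> \<longlongrightarrow> 0) at_infinity" for \<psi> :: "real^'n \<Rightarrow> real"
    proof -
      have \<psi>m[measurable]: "\<psi> \<in> borel_measurable borel" using \<psi>(1) by (rule borel_measurable_continuous_onI)
      define f where "f z = (if norm z < 1 then \<psi> (\<Theta>' z) else 0)" for z
      have f: "continuous_on UNIV f"
        unfolding f_def \<Theta>'_def by (rule continuous_extend_by_zero_from_ball[OF \<psi>])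
      have fm[measurable]: "f \<in> borel_measurable borel" using f by (rule borel_measurable_continuous_onI)
      have f\<Theta>: "f (\<Theta> x) = \<psi> x" for x using n\<Theta>1 by (simp add: f_def inv)
      have "(\<lambda>i. c (r i) * (LINT z|P (r i). f z)) \<longlonglongrightarrow> m * (LINT z|\<mu>. f z)"
        by (intro tendsto_mult conv f LIMSEQ_subseq_LIMSEQ[OF cm r, unfolded o_def])
      moreover have "c i * (LINT z|P i. f z) = (LINT x|N (r1 (i + i0)). \<psi> x)" for i
        using c[of i] by (simp add: intP f\<Theta>)
      moreover have "(LINT x|\<nu>. \<psi> x) = m * (LINT z|\<mu>. f z)"
      proof -
        have "(LINT x|\<nu>. \<psi> x) = (LINT z|density \<mu> (\<lambda>z. ennreal (m * indicator (ball 0 1) z)). \<psi> (\<Theta>' z))"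
          unfolding \<nu>_def by (rule integral_distr[OF \<Theta>'m' \<psi>m])
        also have "\<dots> = (LINT z|\<mu>. (m * indicator (ball 0 1) z) *\<^sub>R \<psi> (\<Theta>' z))"
          using m by (intro integral_density) auto
        also have "\<dots> = (LINT z|\<mu>. m * f z)"
          by (intro Bochner_Integration.integral_cong) (auto simp: f_def indicator_def)
        finally show ?thesis by simp
      qed
      ultimately show ?thesis by simp
    qed
    moreover have "strict_mono (\<lambda>i. r1 (r i + i0))"
      using r r1(1) by (simp add: strict_mono_def)
    ultimately show ?thesis by (intro exI[of _ "\<lambda>i. r1 (r i + i0)"] exI[of _ \<nu>]) auto
  qed
qed

section \<open>Convolution with a complex measure\<close>

lemma AE_eq_0_if_integral_norm_0:
  fixes f :: "'a \<Rightarrow> complex"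
  assumes "integrable M f" "(LINT x|M. cmod (f x)) = 0"
  shows "AE x in M. f x = 0"
  using assms integral_nonneg_eq_0_iff_AE[of M "\<lambda>x. cmod (f x)"] by simp

lemma cnj_borel_measurable [measurable]: "cnj \<in> borel_measurable borel"
  by (intro borel_measurable_continuous_onI continuous_intros)

text \<open>The convolution of \<open>f\<close> with the complex measure
  \<open>s dM\<close>.\<close>

definition conv :: "(real^'n) measure \<Rightarrow> (real^'n \<Rightarrow> complex) \<Rightarrow> (real^'n \<Rightarrow> complex) \<Rightarrow> real^'n \<Rightarrow> complex" where
  "conv M s f x = (LINT \<xi>|M. f (x - \<xi>) * s \<xi>)"

locale vec_polar_decomposition = polar_decomposition \<nu> M s
  for \<nu> :: "(real^'n) set \<Rightarrow> complex" and M and s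
begin

definition fhat :: "real^'n \<Rightarrow> complex" where
  "fhat y = (LINT \<xi>|M. cis (- (y \<bullet> \<xi>)) * s \<xi>)"

lemma integrable_conv_pair:
  assumes f: "integrable lborel f"
  shows "integrable (M \<Otimes>\<^sub>M lborel) (\<lambda>(\<xi>, x). f (x - \<xi>) * s \<xi>)"
    and "(LINT \<xi>|M. LINT x|lborel. norm (f (x - \<xi>) * s \<xi>)) = (LINT x|lborel. cmod (f x)) * measure M UNIV"
proof -
  have fm[measurable]: "f \<in> borel_measurable borel" using borel_measurable_integrable[OF f] by simp
  interpret P: pair_sigma_finite M lborel
    by (simp add: pair_sigma_finite_def sigma_finite_measure_axioms lborel.sigma_finite_measure_axioms)
  have t: "integrable lborel (\<lambda>x. f (x - \<xi>))" for \<xi>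
    using lborel_integrable_translation[OF f, of "- \<xi>"] by simp
  have e: "(LINT x|lborel. cmod (f (x - \<xi>))) = (LINT x|lborel. cmod (f x))" for \<xi>
    using lborel_integral_translation[of "\<lambda>x. cmod (f x)" "- \<xi>"] by simp
  show "integrable (M \<Otimes>\<^sub>M lborel) (\<lambda>(\<xi>, x). f (x - \<xi>) * s \<xi>)"
  proof (rule P.Fubini_integrable)
    show "(\<lambda>(\<xi>, x). f (x - \<xi>) * s \<xi>) \<in> borel_measurable (M \<Otimes>\<^sub>M lborel)" by measurable
    show "integrable M (\<lambda>\<xi>. LINT x|lborel. norm (case (\<xi>, x) of (\<xi>, x) \<Rightarrow> f (x - \<xi>) * s \<xi>))"
      by (simp add: norm_mult e)
    show "AE \<xi> in M. integrable lborel (\<lambda>x. case (\<xi>, x) of (\<xi>, x) \<Rightarrow> f (x - \<xi>) * s \<xi>)"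
      using t by auto
  qed
  show "(LINT \<xi>|M. LINT x|lborel. norm (f (x - \<xi>) * s \<xi>)) = (LINT x|lborel. cmod (f x)) * measure M UNIV"
    by (simp add: norm_mult e mult.commute)
qed

text \<open>Young's inequality for a finite measure: when \<open>x\<close> is integrated first,
  translation invariance makes the inner integral independent of \<open>\<xi>\<close>.\<close>

lemma
  assumes f: "integrable lborel f"
  shows integrable_conv: "integrable lborel (conv M s f)"
    and conv_norm_le: "(LINT x|lborel. cmod (conv M s f x)) \<le> (LINT x|lborel. cmod (f x)) * measure M UNIV"
    and AE_integrable_conv: "AE x in lborel. integrable M (\<lambda>\<xi>. f (x - \<xi>) * s \<xi>)"
proof -
  interpret P: pair_sigma_finite M lborel
    by (simp add: pair_sigma_finite_def sigma_finite_measure_axioms lborel.sigma_finite_measure_axioms)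
  note i = integrable_conv_pair(1)[OF f]
  have i': "integrable (M \<Otimes>\<^sub>M lborel) (\<lambda>(\<xi>, x). norm (f (x - \<xi>) * s \<xi>))"
    using integrable_norm[OF i] by (simp add: split_beta')
  show 1: "integrable lborel (conv M s f)"
    unfolding conv_def using P.integrable_snd[OF i] by simp
  show "AE x in lborel. integrable M (\<lambda>\<xi>. f (x - \<xi>) * s \<xi>)"
    using P.AE_integrable_snd[OF i] by simp
  have "(LINT x|lborel. cmod (conv M s f x)) \<le> (LINT x|lborel. LINT \<xi>|M. norm (f (x - \<xi>) * s \<xi>))"
    unfolding conv_def
  proof (rule integral_mono)
    show "integrable lborel (\<lambda>x. cmod (LINT \<xi>|M. f (x - \<xi>) * s \<xi>))" using 1 unfolding conv_def by (rule integrable_norm)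
    show "integrable lborel (\<lambda>x. LINT \<xi>|M. norm (f (x - \<xi>) * s \<xi>))" using P.integrable_snd[OF i'] by simp
  qed (rule integral_norm_bound)
  also have "\<dots> = (LINT \<xi>|M. LINT x|lborel. norm (f (x - \<xi>) * s \<xi>))"
    by (rule P.Fubini_integral[OF i'])
  finally show "(LINT x|lborel. cmod (conv M s f x)) \<le> (LINT x|lborel. cmod (f x)) * measure M UNIV"
    unfolding integrable_conv_pair(2)[OF f] .
qed

lemma conv_add:
  assumes f: "integrable lborel f" and g: "integrable lborel g"
  shows "AE x in lborel. conv M s (\<lambda>x. f x + g x) x = conv M s f x + conv M s g x"
  using AE_integrable_conv[OF f] AE_integrable_conv[OF g]
  by eventually_elim (simp add: conv_def distrib_right)

lemma conv_cmult: "conv M s (\<lambda>x. c * f x) x = c * conv M s f x"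
  by (simp add: conv_def mult.assoc)

text \<open>For a single \<open>x\<close> the measure may charge the points \<open>\<xi>\<close>
  with \<open>f (x - \<xi>) \<noteq> g (x - \<xi>)\<close>, so equality can fail there; the norm
  bound applied to the difference shows that such \<open>x\<close> form a null set.\<close>

lemma conv_cong_AE:
  assumes f: "integrable lborel f" and g: "integrable lborel g" and eq: "AE x in lborel. f x = g x"
  shows "AE x in lborel. conv M s f x = conv M s g x"
proof -
  have [measurable]: "f \<in> borel_measurable borel" "g \<in> borel_measurable borel"
    using borel_measurable_integrable[OF f] borel_measurable_integrable[OF g] by simp_all
  define d where "d x = f x + (-1) * g x" for x
  have d: "integrable lborel d" unfolding d_def using f g by auto
  have "(LINT x|lborel. cmod (d x)) = 0"
    by (rule integral_eq_zero_AE) (use eq in \<open>auto simp: d_def\<close>)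
  then have "(LINT x|lborel. cmod (conv M s d x)) \<le> 0" using conv_norm_le[OF d] by simp
  then have "(LINT x|lborel. cmod (conv M s d x)) = 0"
    by (intro antisym Bochner_Integration.integral_nonneg) auto
  then have "AE x in lborel. conv M s d x = 0" by (rule AE_eq_0_if_integral_norm_0[OF integrable_conv[OF d]])
  moreover have "AE x in lborel. conv M s d x = conv M s f x + conv M s (\<lambda>x. (-1) * g x) x"
    unfolding d_def by (rule conv_add[OF f]) (use g in auto)
  ultimately show ?thesis
    by eventually_elim (simp only: conv_cmult, simp)
qed

text \<open>Convolution with \<open>\<nu>\<close> multiplies the transform by \<open>fhat\<close>:
  after exchanging the integrals, inversion is applied at the point
  \<open>x - \<xi>\<close>.\<close>

lemma conv_test_fun:
  assumes f: "test_fun f"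
  shows "(LINT y|lborel. cis (x \<bullet> y) * (ft f y * fhat y)) = complex_of_real ((2 * pi) ^ CARD('n)) * conv M s f x"
proof -
  have fm[measurable]: "ft f \<in> borel_measurable borel"
    using borel_measurable_integrable[OF ft_test_fun_integrable[OF f]] by simp
  have "(LINT y|lborel. cis (x \<bullet> y) * (ft f y * fhat y))
     = (LINT y|lborel. LINT \<xi>|M. cis ((x - \<xi>) \<bullet> y) * ft f y * s \<xi>)"
    unfolding fhat_def
  proof (intro Bochner_Integration.integral_cong refl)
    fix y
    have "cis ((x - \<xi>) \<bullet> y) = cis (x \<bullet> y) * cis (- (y \<bullet> \<xi>))" for \<xi>
      by (simp add: inner_diff_left cis_mult inner_commute[of y \<xi>])
    then have "(LINT \<xi>|M. cis ((x - \<xi>) \<bullet> y) * ft f y * s \<xi>)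
       = (LINT \<xi>|M. (cis (x \<bullet> y) * ft f y) * (cis (- (y \<bullet> \<xi>)) * s \<xi>))"
      by (simp add: mult_ac)
    also have "\<dots> = (cis (x \<bullet> y) * ft f y) * (LINT \<xi>|M. cis (- (y \<bullet> \<xi>)) * s \<xi>)"
      by (rule integral_mult_right_zero)
    finally show "cis (x \<bullet> y) * (ft f y * (LINT \<xi>|M. cis (- (y \<bullet> \<xi>)) * s \<xi>)) = (LINT \<xi>|M. cis ((x - \<xi>) \<bullet> y) * ft f y * s \<xi>)"
      by (simp add: mult.assoc)
  qed
  also have "\<dots> = (LINT \<xi>|M. LINT y|lborel. cis ((x - \<xi>) \<bullet> y) * ft f y * s \<xi>)"
  proof (rule Fubini_product_bound(1)[OF lborel.sigma_finite_measure_axioms sigma_finite_measure_axioms _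
        integrable_norm[OF ft_test_fun_integrable[OF f]] integrable_bounded[of "\<lambda>_. 1::real" 1]])
    show "(\<lambda>(y, \<xi>). cis ((x - \<xi>) \<bullet> y) * ft f y * s \<xi>) \<in> borel_measurable (lborel \<Otimes>\<^sub>M M)" by measurable
  qed (auto simp: norm_mult)
  also have "\<dots> = (LINT \<xi>|M. complex_of_real ((2 * pi) ^ CARD('n)) * (f (x - \<xi>) * s \<xi>))"
    unfolding integral_mult_left_zero test_fun_inversion[OF f] by (simp only: mult.assoc)
  also have "\<dots> = complex_of_real ((2 * pi) ^ CARD('n)) * conv M s f x"
    unfolding conv_def by (rule integral_mult_right_zero)
  finally show ?thesis .
qed

end

section \<open>Mollifiers\<close>

lemma test_fun_bump: "test_fun (\<lambda>x. bump k a b x *\<^sub>R c)"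
  for a b :: "real^'n"
proof -
  obtain R where R: "\<And>x. x \<in> cbox a b \<Longrightarrow> norm x \<le> R" using bounded_cbox[of a b] unfolding bounded_iff by blast
  show ?thesis
  proof (rule test_funI[of _ R])
    show "C_k l (\<lambda>x. bump k a b x *\<^sub>R c)" for l by (rule C_k_bump)
    show "bump k a b x *\<^sub>R c = 0" if "R < norm x" for x
      using bump_eq_0[of x a b k] R[of x] that by auto
  qed
qed

definition mollifier :: "nat \<Rightarrow> real^'n \<Rightarrow> real" where
  "mollifier i x = bump 1 (\<chi> _. - (1 / real (Suc i))) (\<chi> _. 1 / real (Suc i)) x
     / (LINT z|lborel. bump 1 (\<chi> _. - (1 / real (Suc i))) (\<chi> _. 1 / real (Suc i)) (z :: real^'n))"

lemma integrable_bump: "integrable lborel (bump k a b)" for a b :: "real^'n"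
proof -
  have "integrable lborel (\<lambda>x. Re (bump k a b x *\<^sub>R 1))"
    by (intro integrable_Re test_fun_integrable test_fun_bump)
  then show ?thesis by simp
qed

lemma integral_bump_pos:
  fixes a b :: "real^'n"
  assumes "k > 0" "box a b \<noteq> {}"
  shows "0 < (LINT x|lborel. bump k a b x)"
proof (rule ccontr)
  assume "\<not> 0 < (LINT x|lborel. bump k a b x)"
  moreover have "0 \<le> (LINT x|lborel. bump k a b x)" by (simp add: bump_nonneg)
  ultimately have "(LINT x|lborel. bump k a b x) = 0" by simp
  then have "AE x in lborel. bump k a b x = 0"
    using integral_nonneg_eq_0_iff_AE[OF integrable_bump, of k a b] by (simp add: bump_nonneg)
  then have "AE x in lborel. x \<notin> box a b"
    by eventually_elim (use bump_pos[OF assms(1)] in fastforce)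
  then have ae: "AE x in lebesgue. x \<notin> box a b" by (rule AE_completion)
  have "box a b \<in> sets lebesgue" by simp
  from AE_iff_null_sets[OF this] ae have "box a b \<in> null_sets lebesgue" by (rule iffD2)
  then have "negligible (box a b)" by (simp add: negligible_iff_null_sets)
  then show False using open_not_negligible[OF open_box assms(2)] by simp
qed

lemma
  fixes x :: "real^'n"
  shows mollifier_nonneg: "0 \<le> mollifier i x"
    and integrable_mollifier: "integrable lborel (mollifier i :: real^'n \<Rightarrow> real)"
    and integral_mollifier: "(LINT x|lborel. mollifier i (x :: real^'n)) = 1"
    and norm_le_of_mollifier: "mollifier i x \<noteq> 0 \<Longrightarrow> norm x \<le> real CARD('n) / real (Suc i)"
    and continuous_mollifier: "continuous_on UNIV (mollifier i :: real^'n \<Rightarrow> real)"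
    and mollifier_eq_bump: "\<exists>r\<ge>0. \<exists>k a b. k > 0 \<and> (mollifier i :: real^'n \<Rightarrow> real) = (\<lambda>x. r * bump k a b x)"
proof -
  define a b where "a = (\<chi> _. - (1 / real (Suc i)) :: real^'n)" and "b = (\<chi> _. 1 / real (Suc i) :: real^'n)"
  define J where "J = (LINT z|lborel. bump 1 a b z)"
  have "0 \<in> box a b" by (simp add: mem_box_cart a_def b_def)
  then have J: "J > 0" unfolding J_def by (intro integral_bump_pos) auto
  have m: "mollifier i = (\<lambda>x. (1 / J) * bump 1 a b x)"
    by (auto simp: mollifier_def[abs_def] J_def a_def b_def)
  show "0 \<le> mollifier i x" using J by (simp add: m bump_nonneg)
  show "integrable lborel (mollifier i :: real^'n \<Rightarrow> real)"
    unfolding m by (intro integrable_mult_right integrable_bump)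
  show "(LINT x|lborel. mollifier i (x :: real^'n)) = 1"
    using J unfolding m integral_mult_right_zero by (simp add: J_def)
  show "continuous_on UNIV (mollifier i :: real^'n \<Rightarrow> real)"
    unfolding m by (intro continuous_intros continuous_bump)
  show "\<exists>r\<ge>0. \<exists>k a b. k > 0 \<and> (mollifier i :: real^'n \<Rightarrow> real) = (\<lambda>x. r * bump k a b x)"
    using J by (intro exI[of _ "1 / J"] conjI exI[of _ "1::nat"] exI[of _ a] exI[of _ b]) (auto simp: m)
  show "norm x \<le> real CARD('n) / real (Suc i)" if "mollifier i x \<noteq> 0"
  proof -
    have "x \<in> cbox a b" using that bump_eq_0[of x a b 1] by (auto simp: m)
    \<comment> \<open>The support is a cube; the Euclidean norm is bounded by the sum of the
      coordinates, hence the factor \<open>n\<close>.\<close>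
    then have "\<bar>x $ j\<bar> \<le> 1 / real (Suc i)" for j by (auto simp: mem_box_cart a_def b_def abs_le_iff minus_le_iff)
    then have "(\<Sum>j\<in>UNIV. \<bar>x $ j\<bar>) \<le> (\<Sum>j\<in>(UNIV::'n set). 1 / real (Suc i))" by (intro sum_mono)
    then show ?thesis using norm_le_l1_cart[of x] by simp
  qed
qed

lemma test_fun_mollifier: "test_fun (\<lambda>x::real^'n. complex_of_real (mollifier i x))"
proof -
  obtain r k a b where "(mollifier i :: real^'n \<Rightarrow> real) = (\<lambda>x. r * bump k a b x)"
    using mollifier_eq_bump[where ?'n='n] by blast
  then have "(\<lambda>x::real^'n. complex_of_real (mollifier i x)) = (\<lambda>x. bump k a b x *\<^sub>R complex_of_real r)"
    by (auto simp: scaleR_conv_of_real mult.commute)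
  then show ?thesis using test_fun_bump by metis
qed

lemma mollifier_tendsto:
  fixes \<psi> :: "real^'n \<Rightarrow> complex"
  assumes \<psi>: "continuous_on UNIV \<psi>" and B: "\<And>x. cmod (\<psi> x) \<le> B"
  shows "(\<lambda>i. LINT z|lborel. \<psi> z * complex_of_real (mollifier i z)) \<longlonglongrightarrow> \<psi> 0"
proof (rule tendstoI)
  fix e :: real assume "e > 0"
  have [measurable]: "\<psi> \<in> borel_measurable borel" using \<psi> by (rule borel_measurable_continuous_onI)
  have [measurable]: "mollifier i \<in> borel_measurable (borel :: (real^'n) measure)" for i
    by (rule borel_measurable_continuous_onI[OF continuous_mollifier])
  have "isCont \<psi> 0" using \<psi> by (simp add: continuous_on_eq_continuous_at)
  then obtain \<delta> where \<delta>: "\<delta> > 0" "\<And>x. dist x 0 < \<delta> \<Longrightarrow> dist (\<psi> x) (\<psi> 0) < e / 2"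
    using \<open>e > 0\<close> unfolding continuous_at_eps_delta by (metis half_gt_zero)
  have im: "integrable lborel (\<lambda>z::real^'n. c * mollifier i z)" for c i
    by (intro integrable_mult_right integrable_mollifier)
  have ic: "integrable lborel (\<lambda>z. f z * complex_of_real (mollifier i z))"
    if "f \<in> borel_measurable borel" "\<And>z. cmod (f z) \<le> C" for f :: "real^'n \<Rightarrow> complex" and C i
  proof (rule Bochner_Integration.integrable_bound[OF im[of C i]])
    show "(\<lambda>z. f z * complex_of_real (mollifier i z)) \<in> borel_measurable lborel" using that by measurable
    have "cmod (f z * complex_of_real (mollifier i z)) \<le> C * mollifier i z" for z
      by (simp add: norm_mult mollifier_nonneg mult_right_mono that)
    then show "AE z in lborel. norm (f z * complex_of_real (mollifier i z)) \<le> norm (C * mollifier i z)"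
      by (intro AE_I2) (metis abs_ge_self order.trans real_norm_def)
  qed
  have "(\<lambda>i. real CARD('n) / real (Suc i)) \<longlonglongrightarrow> 0" by real_asymp
  then have "\<forall>\<^sub>F i in sequentially. real CARD('n) / real (Suc i) < \<delta>"
    using \<delta>(1) by (rule order_tendstoD)
  then show "\<forall>\<^sub>F i in sequentially. dist (LINT z|lborel. \<psi> z * complex_of_real (mollifier i z)) (\<psi> 0) < e"
  proof eventually_elim
    case (elim i)
    have "(LINT z|lborel. \<psi> 0 * complex_of_real (mollifier i (z :: real^'n))) = \<psi> 0 * complex_of_real (LINT z|lborel. mollifier i (z :: real^'n))"
      unfolding integral_mult_right_zero integral_complex_of_real ..
    then have 1: "(LINT z|lborel. \<psi> 0 * complex_of_real (mollifier i (z :: real^'n))) = \<psi> 0"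
      unfolding integral_mollifier[where ?'n='n and i=i] by simp
    have "(LINT z|lborel. \<psi> z * complex_of_real (mollifier i z)) - \<psi> 0
       = (LINT z|lborel. (\<psi> z - \<psi> 0) * complex_of_real (mollifier i z))"
      unfolding left_diff_distrib
      by (subst Bochner_Integration.integral_diff[OF ic[OF _ B] ic[of "\<lambda>_. \<psi> 0" "cmod (\<psi> 0)"]]) (auto simp: 1 integral_mollifier)
    also have "cmod \<dots> \<le> (LINT z|lborel. cmod ((\<psi> z - \<psi> 0) * complex_of_real (mollifier i z)))"
      by (rule integral_norm_bound)
    also have "\<dots> \<le> (LINT z|lborel. e / 2 * mollifier i (z :: real^'n))"
    proof (rule integral_mono[OF integrable_norm im])
      have "cmod (\<psi> z - \<psi> 0) \<le> B + B" for z using norm_triangle_ineq4[of "\<psi> z" "\<psi> 0"] B[of z] B[of 0] by linarith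
      then show "integrable lborel (\<lambda>z. (\<psi> z - \<psi> 0) * complex_of_real (mollifier i z))"
        by (intro ic) auto
      fix z :: "real^'n"
      show "cmod ((\<psi> z - \<psi> 0) * complex_of_real (mollifier i z)) \<le> e / 2 * mollifier i z"
      proof (cases "mollifier i z = 0")
        case False
        then have "dist z 0 < \<delta>" using norm_le_of_mollifier[of i z] elim by simp
        then have "cmod (\<psi> z - \<psi> 0) \<le> e / 2" using \<delta>(2)[of z] by (simp add: dist_norm)
        from mult_right_mono[OF this mollifier_nonneg[of i z]] show ?thesis
          by (simp add: norm_mult mollifier_nonneg)
      qed simp
    qed
    also have "\<dots> = e / 2" unfolding integral_mult_right_zero by (simp add: integral_mollifier)
    finally show ?case using \<open>e > 0\<close> by (simp add: dist_norm)
  qed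
qed

context vec_polar_decomposition
begin

text \<open>By Fubini the mollifier moves from the measure onto \<open>\<psi>\<close>: the averages
  \<open>A i\<close> are bounded by 1 and tend to \<open>\<psi>\<close> pointwise, and
  \<open>M\<close> is finite.\<close>

lemma conv_mollifier_tendsto:
  assumes \<psi>: "continuous_on UNIV \<psi>" and 1: "\<And>x. cmod (\<psi> x) \<le> 1"
  shows "(\<lambda>i. LINT x|lborel. \<psi> x * conv M s (\<lambda>x. complex_of_real (mollifier i x)) x) \<longlonglongrightarrow> (LINT \<xi>|M. \<psi> \<xi> * s \<xi>)"
proof -
  have \<psi>m[measurable]: "\<psi> \<in> borel_measurable borel" using \<psi> by (rule borel_measurable_continuous_onI)
  have [measurable]: "mollifier i \<in> borel_measurable (borel :: (real^'n) measure)" for i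
    by (rule borel_measurable_continuous_onI[OF continuous_mollifier])
  define m where "m i x = complex_of_real (mollifier i x)" for i and x :: "real^'n"
  have mm[measurable]: "m i \<in> borel_measurable borel" for i unfolding m_def[abs_def] by measurable
  have mi: "integrable lborel (m i)" for i unfolding m_def by (intro integrable_of_real integrable_mollifier)
  interpret P: pair_sigma_finite M lborel
    by (simp add: pair_sigma_finite_def sigma_finite_measure_axioms lborel.sigma_finite_measure_axioms)
  define A where "A i \<xi> = (LINT z|lborel. \<psi> (\<xi> + z) * m i z)" for i \<xi>
  have "(LINT x|lborel. \<psi> x * conv M s (m i) x) = (LINT \<xi>|M. A i \<xi> * s \<xi>)" for i
  proof -
    have le: "cmod (\<psi> x * (m i (x - \<xi>) * s \<xi>)) \<le> cmod (m i (x - \<xi>) * s \<xi>)" for x \<xi>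
      by (simp add: norm_mult mult_left_le_one_le 1)
    have i: "integrable (M \<Otimes>\<^sub>M lborel) (\<lambda>(\<xi>, x). \<psi> x * (m i (x - \<xi>) * s \<xi>))"
    proof (rule Bochner_Integration.integrable_bound[OF integrable_conv_pair(1)[OF mi[of i]]])
      show "(\<lambda>(\<xi>, x). \<psi> x * (m i (x - \<xi>) * s \<xi>)) \<in> borel_measurable (M \<Otimes>\<^sub>M lborel)" by measurable
    qed (use le in \<open>auto split: prod.split\<close>)
    have "(LINT x|lborel. \<psi> x * conv M s (m i) x) = (LINT x|lborel. LINT \<xi>|M. \<psi> x * (m i (x - \<xi>) * s \<xi>))"
      unfolding conv_def integral_mult_right_zero ..
    also have "\<dots> = (LINT \<xi>|M. LINT x|lborel. \<psi> x * (m i (x - \<xi>) * s \<xi>))"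
      by (rule P.Fubini_integral[OF i])
    also have "\<dots> = (LINT \<xi>|M. A i \<xi> * s \<xi>)"
    proof (intro Bochner_Integration.integral_cong refl)
      fix \<xi>
      have "(LINT x|lborel. \<psi> x * (m i (x - \<xi>) * s \<xi>)) = (LINT x|lborel. \<psi> x * m i (x - \<xi>)) * s \<xi>"
        unfolding mult.assoc[symmetric] by (rule integral_mult_left_zero)
      also have "(LINT x|lborel. \<psi> x * m i (x - \<xi>)) = (LINT x|lborel. \<psi> (\<xi> + x) * m i ((\<xi> + x) - \<xi>))"
        by (rule lborel_integral_translation[symmetric]) measurable
      finally show "(LINT x|lborel. \<psi> x * (m i (x - \<xi>) * s \<xi>)) = A i \<xi> * s \<xi>" by (simp add: A_def)
    qed
    finally show ?thesis .
  qed
  moreover have "(\<lambda>i. LINT \<xi>|M. A i \<xi> * s \<xi>) \<longlonglongrightarrow> (LINT \<xi>|M. \<psi> \<xi> * s \<xi>)"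
  proof (rule integral_dominated_convergence[where w = "\<lambda>_. 1"])
    show "integrable M (\<lambda>_. 1::real)" by (rule integrable_bounded[of _ 1]) auto
    have "(\<lambda>i. A i \<xi>) \<longlonglongrightarrow> \<psi> \<xi>" for \<xi>
    proof -
      have "continuous_on UNIV (\<lambda>z. \<psi> (\<xi> + z))"
        by (rule continuous_on_compose2[OF \<psi>]) (auto intro!: continuous_intros)
      from mollifier_tendsto[OF this 1] show ?thesis by (simp add: A_def m_def)
    qed
    then show "AE \<xi> in M. (\<lambda>i. A i \<xi> * s \<xi>) \<longlonglongrightarrow> \<psi> \<xi> * s \<xi>" by (intro AE_I2 tendsto_intros)
    have "cmod (A i \<xi>) \<le> 1" for i \<xi>
    proof -
      have "cmod (A i \<xi>) \<le> (LINT z|lborel. cmod (\<psi> (\<xi> + z) * m i z))"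
        unfolding A_def by (rule integral_norm_bound)
      also have "\<dots> \<le> (LINT z|lborel. mollifier i (z :: real^'n))"
      proof (rule integral_mono)
        show "integrable lborel (\<lambda>z. cmod (\<psi> (\<xi> + z) * m i z))"
          by (rule Bochner_Integration.integrable_bound[OF integrable_norm[OF mi[of i]]])
            (auto simp: norm_mult intro!: mult_left_le_one_le 1)
        show "cmod (\<psi> (\<xi> + z) * m i z) \<le> mollifier i z" for z
          by (simp add: m_def norm_mult mollifier_nonneg mult_left_le_one_le 1)
      qed (rule integrable_mollifier)
      finally show ?thesis by (simp add: integral_mollifier)
    qed
    then show "AE \<xi> in M. norm (A i \<xi> * s \<xi>) \<le> 1" for i by (intro AE_I2) (simp add: norm_mult)
    show "(\<lambda>\<xi>. A i \<xi> * s \<xi>) \<in> borel_measurable M" for i unfolding A_def by measurable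
  qed measurable
  ultimately have "(\<lambda>i. LINT x|lborel. \<psi> x * conv M s (m i) x) \<longlonglongrightarrow> (LINT \<xi>|M. \<psi> \<xi> * s \<xi>)"
    by simp
  then show ?thesis unfolding m_def[abs_def] .
qed

text \<open>Pairing \<open>s dM\<close> with \<open>cnj s\<close> yields the total mass of
  \<open>M\<close>, but \<open>cnj s\<close> is only measurable. The bump induction approximates it
  in mean by continuous functions, which are then pushed into the unit disc.\<close>

lemma ex_continuous_approx_cnj_s:
  assumes e: "e > 0"
  shows "\<exists>\<psi>. continuous_on UNIV \<psi> \<and> (\<forall>x. cmod (\<psi> x) \<le> 1) \<and> (LINT x|M. cmod (cnj (s x) - \<psi> x)) < e"
proof -
  have ci: "integrable M (\<lambda>x. cnj (s x))" by (rule integrable_bounded[of _ 1]) auto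
  have "\<exists>\<psi>. continuous_on UNIV \<psi> \<and> integrable M \<psi> \<and> (LINT x|M. cmod (cnj (s x) - \<psi> x)) < e" if "e > 0" for e
    using sets_eq ci that
  proof (induction arbitrary: e rule: integrable_induct_bump)
    case (bump k a b)
    have c: "continuous_on UNIV (\<lambda>x. complex_of_real (bump k a b x))"
      by (intro continuous_on_of_real continuous_bump)
    have "bump k a b x \<le> 1" for x using bump_le[of k a b x] by (cases "x \<in> box a b") auto
    then have "integrable M (\<lambda>x. complex_of_real (bump k a b x))"
      by (intro integrable_bounded[of _ 1] borel_measurable_continuous_onI c) (auto simp: bump_nonneg)
    then show ?case using c bump by (intro exI[of _ "\<lambda>x. complex_of_real (bump k a b x)"]) auto
  next
    case (add f g)
    obtain \<psi> where \<psi>: "continuous_on UNIV \<psi>" "integrable M \<psi>" "(LINT x|M. cmod (f x - \<psi> x)) < e / 2"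
      using add.IH(1)[OF half_gt_zero[OF add.prems]] by blast
    obtain \<phi> where \<phi>: "continuous_on UNIV \<phi>" "integrable M \<phi>" "(LINT x|M. cmod (g x - \<phi> x)) < e / 2"
      using add.IH(2)[OF half_gt_zero[OF add.prems]] by blast
    have "(LINT x|M. cmod ((f x + g x) - (\<psi> x + \<phi> x))) \<le> (LINT x|M. cmod (f x - \<psi> x) + cmod (g x - \<phi> x))"
      using add.hyps \<psi>(2) \<phi>(2) by (intro integral_mono) (auto simp: add_diff_add norm_triangle_ineq)
    also have "\<dots> < e" using add.hyps \<psi> \<phi> by simp
    finally show ?case using \<psi> \<phi> by (intro exI[of _ "\<lambda>x. \<psi> x + \<phi> x"]) (auto intro!: continuous_intros)
  next
    case (mult c f)
    have "e / (1 + cmod c) > 0" using mult.prems by (simp add: add_pos_nonneg)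
    then obtain \<psi> where \<psi>: "continuous_on UNIV \<psi>" "integrable M \<psi>" "(LINT x|M. cmod (f x - \<psi> x)) < e / (1 + cmod c)"
      using mult.IH by blast
    have "(LINT x|M. cmod (c * f x - c * \<psi> x)) = cmod c * (LINT x|M. cmod (f x - \<psi> x))"
      by (simp add: right_diff_distrib[symmetric] norm_mult)
    also have "\<dots> \<le> (1 + cmod c) * (LINT x|M. cmod (f x - \<psi> x))"
      by (intro mult_right_mono) auto
    also have "\<dots> < e" using \<psi>(3) by (simp add: less_divide_eq mult.commute add_pos_nonneg)
    finally show ?case using \<psi> by (intro exI[of _ "\<lambda>x. c * \<psi> x"]) (auto intro!: continuous_intros)
  next
    case (lim f u)
    have "\<forall>\<^sub>F i in sequentially. (LINT x|M. cmod (u i x - f x)) < e / 2"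
      using lim.prems by (intro order_tendstoD(2)[OF lim.hyps(3)]) auto
    then obtain i where i: "(LINT x|M. cmod (u i x - f x)) < e / 2" by (auto simp: eventually_sequentially)
    obtain \<psi> where \<psi>: "continuous_on UNIV \<psi>" "integrable M \<psi>" "(LINT x|M. cmod (u i x - \<psi> x)) < e / 2"
      using lim.IH[OF half_gt_zero[OF lim.prems], of i] by blast
    have "(LINT x|M. cmod (f x - \<psi> x)) \<le> (LINT x|M. cmod (u i x - f x) + cmod (u i x - \<psi> x))"
    proof (rule integral_mono)
      show "cmod (f x - \<psi> x) \<le> cmod (u i x - f x) + cmod (u i x - \<psi> x)" for x
        using norm_triangle_ineq4[of "u i x - \<psi> x" "u i x - f x"] by simp
    qed (use lim.hyps(1,2) \<psi>(2) in auto)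
    also have "\<dots> < e" using lim.hyps(1,2) \<psi> i by simp
    finally show ?case using \<psi> by blast
  next
    show "emeasure M (box a b) < \<infinity>" for a b by (simp add: less_top[symmetric])
  qed
  from this[of "e / 2"] e obtain \<psi> where \<psi>: "continuous_on UNIV \<psi>" "integrable M \<psi>"
    "(LINT x|M. cmod (cnj (s x) - \<psi> x)) < e / 2" by auto
  \<comment> \<open>The radial retraction onto the unit disc moves \<open>z\<close> by at most
    \<open>cmod (w - z)\<close> when \<open>w\<close> has modulus 1, so the error at most doubles;
    this is why \<psi> was taken within \<open>e / 2\<close>.\<close>
  define \<phi> where "\<phi> x = \<psi> x / complex_of_real (max 1 (cmod (\<psi> x)))" for x
  have "max 1 (cmod z) \<noteq> 0" for z using max.cobounded1[of 1 "cmod z"] by linarith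
  then have mx: "\<forall>x\<in>UNIV. complex_of_real (max 1 (cmod (\<psi> x))) \<noteq> 0"
    unfolding of_real_eq_0_iff by blast
  have c: "continuous_on UNIV \<phi>"
    unfolding \<phi>_def by (intro continuous_intros \<psi>(1) mx)
  have n: "cmod (\<phi> x) \<le> 1" for x by (simp add: \<phi>_def norm_divide divide_le_eq)
  have t: "cmod (w - z / complex_of_real (max 1 (cmod z))) \<le> 2 * cmod (w - z)" if "cmod w = 1" for w z
  proof (cases "cmod z \<le> 1")
    case True
    then show ?thesis by (simp add: max_def)
  next
    case False
    then have z: "max 1 (cmod z) = cmod z" "z \<noteq> 0" by auto
    have "z - z / complex_of_real (cmod z) = z * complex_of_real (1 - 1 / cmod z)"
      by (simp add: right_diff_distrib)
    then have "cmod (z - z / complex_of_real (cmod z)) = cmod z * \<bar>1 - 1 / cmod z\<bar>"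
      by (simp only: norm_mult norm_of_real)
    also have "\<dots> = cmod z - 1" using False z by (simp add: field_simps abs_if)
    also have "\<dots> \<le> cmod (w - z)" using norm_triangle_ineq3[of z w] that by (simp add: norm_minus_commute)
    finally have "cmod (z - z / complex_of_real (cmod z)) \<le> cmod (w - z)" .
    then show ?thesis
      unfolding z(1) using norm_triangle_ineq[of "w - z" "z - z / complex_of_real (cmod z)"] by simp
  qed
  have "(LINT x|M. cmod (cnj (s x) - \<phi> x)) \<le> (LINT x|M. 2 * cmod (cnj (s x) - \<psi> x))"
  proof (rule integral_mono)
    have "integrable M \<phi>" by (rule integrable_bounded[OF borel_measurable_continuous_onI[OF c] n])
    then show "integrable M (\<lambda>x. cmod (cnj (s x) - \<phi> x))" using ci by auto
    show "integrable M (\<lambda>x. 2 * cmod (cnj (s x) - \<psi> x))" using ci \<psi>(2) by auto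
    show "cmod (cnj (s x) - \<phi> x) \<le> 2 * cmod (cnj (s x) - \<psi> x)" for x
      unfolding \<phi>_def by (rule t) simp
  qed
  also have "\<dots> < e" using \<psi>(3) by simp
  finally show ?thesis using c n by blast
qed

text \<open>Together with \<open>conv_norm_le\<close> it shows that mollified measures have norms
  approaching the total mass. A continuous function bounded by 1 that nearly attains the total
  variation bounds the \<open>L^1\<close> norm from below.\<close>

lemma eventually_conv_mollifier_ge:
  assumes e: "e > 0"
  shows "\<forall>\<^sub>F i in sequentially. measure M UNIV - e < (LINT x|lborel. cmod (conv M s (\<lambda>x. complex_of_real (mollifier i x)) x))"
proof -
  obtain \<psi> where \<psi>: "continuous_on UNIV \<psi>" "\<And>x. cmod (\<psi> x) \<le> 1" "(LINT x|M. cmod (cnj (s x) - \<psi> x)) < e"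
    using ex_continuous_approx_cnj_s[OF e] by blast
  have \<psi>m[measurable]: "\<psi> \<in> borel_measurable borel" using \<psi>(1) by (rule borel_measurable_continuous_onI)
  have ii: "integrable M (\<lambda>x. cnj (s x) * s x)" "integrable M (\<lambda>x. \<psi> x * s x)" "integrable M (\<lambda>x. cnj (s x) - \<psi> x)"
  proof -
    show "integrable M (\<lambda>x. cnj (s x) * s x)" by (rule integrable_bounded[of _ 1]) (auto simp: norm_mult)
    show "integrable M (\<lambda>x. \<psi> x * s x)" by (rule integrable_bounded[of _ 1]) (auto simp: norm_mult \<psi>)
    have "integrable M (\<lambda>x. cnj (s x))" by (rule integrable_bounded[of _ 1]) auto
    moreover have "integrable M \<psi>" by (rule integrable_bounded[of _ 1]) (auto simp: \<psi>)
    ultimately show "integrable M (\<lambda>x. cnj (s x) - \<psi> x)" by auto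
  qed
  have "cnj (s x) * s x = 1" for x
    using complex_norm_square[of "s x"] by (simp add: mult.commute)
  then have "complex_of_real (measure M UNIV) = (LINT x|M. cnj (s x) * s x)" by (simp add: scaleR_conv_of_real)
  then have "complex_of_real (measure M UNIV) - (LINT x|M. \<psi> x * s x) = (LINT x|M. (cnj (s x) - \<psi> x) * s x)"
    unfolding left_diff_distrib using ii by simp
  then have "cmod (complex_of_real (measure M UNIV) - (LINT x|M. \<psi> x * s x)) \<le> (LINT x|M. cmod ((cnj (s x) - \<psi> x) * s x))"
    by (simp only: integral_norm_bound)
  also have "\<dots> < e" using \<psi>(3) by (simp add: norm_mult)
  finally have "cmod (complex_of_real (measure M UNIV)) - cmod (LINT x|M. \<psi> x * s x) < e"
    using norm_triangle_ineq2 by (rule le_less_trans[rotated])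
  then have gt: "measure M UNIV - e < cmod (LINT x|M. \<psi> x * s x)" by simp
  have "\<forall>\<^sub>F i in sequentially. measure M UNIV - e < cmod (LINT x|lborel. \<psi> x * conv M s (\<lambda>x. complex_of_real (mollifier i x)) x)"
    by (rule order_tendstoD(1)[OF tendsto_norm[OF conv_mollifier_tendsto[OF \<psi>(1,2)]] gt])
  then show ?thesis
  proof eventually_elim
    case (elim i)
    define c where "c = conv M s (\<lambda>x. complex_of_real (mollifier i x))"
    have ic: "integrable lborel c"
      unfolding c_def by (intro integrable_conv integrable_of_real integrable_mollifier)
    then have [measurable]: "c \<in> borel_measurable lborel" by simp
    have le: "cmod (\<psi> x * c x) \<le> cmod (c x)" for x
      by (simp add: norm_mult mult_left_le_one_le \<psi>)
    have ip: "integrable lborel (\<lambda>x. \<psi> x * c x)"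
      by (rule Bochner_Integration.integrable_bound[OF ic]) (use le in auto)
    have "cmod (LINT x|lborel. \<psi> x * c x) \<le> (LINT x|lborel. cmod (\<psi> x * c x))" by (rule integral_norm_bound)
    also have "\<dots> \<le> (LINT x|lborel. cmod (c x))" using ic ip le by (intro integral_mono) auto
    finally show ?case using elim by (simp add: c_def)
  qed
qed

end

section \<open>Scalar multipliers\<close>

lemma finite_measures_vaguely_compact_complex:
  fixes N :: "nat \<Rightarrow> (real^'n) measure"
  assumes fin: "\<And>i. finite_measure (N i)" and sets: "\<And>i. sets (N i) = sets borel"
    and B: "\<And>i. measure (N i) UNIV \<le> B"
  shows "\<exists>r \<mu>. strict_mono r \<and> finite_measure \<mu> \<and> sets \<mu> = sets borel \<and>
    (\<forall>(\<psi> :: real^'n \<Rightarrow> complex) C. continuous_on UNIV \<psi> \<longrightarrow> (\<psi> \<longlongrightarrow> 0) at_infinity \<longrightarrow> (\<forall>x. cmod (\<psi> x) \<le> C) \<longrightarrow>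
      (\<lambda>i. LINT x|N (r i). \<psi> x) \<longlonglongrightarrow> (LINT x|\<mu>. \<psi> x))"
proof -
  obtain r \<mu> where r: "strict_mono r" "finite_measure \<mu>" "sets \<mu> = sets borel"
    and conv: "\<And>\<psi> :: real^'n \<Rightarrow> real. continuous_on UNIV \<psi> \<Longrightarrow> (\<psi> \<longlongrightarrow> 0) at_infinity \<Longrightarrow>
      (\<lambda>i. LINT x|N (r i). \<psi> x) \<longlonglongrightarrow> (LINT x|\<mu>. \<psi> x)"
    using finite_measures_vaguely_compact[of N B, OF fin sets B] by blast
  have "(\<lambda>i. LINT x|N (r i). \<psi> x) \<longlonglongrightarrow> (LINT x|\<mu>. \<psi> x)"
    if \<psi>: "continuous_on UNIV \<psi>" "(\<psi> \<longlongrightarrow> 0) at_infinity" "\<And>x. cmod (\<psi> x) \<le> C" for \<psi> :: "real^'n \<Rightarrow> complex" and C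
  proof -
    have split: "(LINT x|M. \<psi> x) = complex_of_real (LINT x|M. Re (\<psi> x)) + \<i> * complex_of_real (LINT x|M. Im (\<psi> x))"
      if "finite_measure M" "sets M = sets borel" for M
    proof -
      interpret finite_measure M by fact
      have "\<psi> \<in> borel_measurable M"
        using borel_measurable_continuous_onI[OF \<psi>(1)] that(2) measurable_cong_sets by blast
      then have "integrable M \<psi>" by (intro integrable_const_bound[of _ C]) (auto simp: \<psi>)
      then show ?thesis by (simp add: complex_eq_iff)
    qed
    have "(\<lambda>i. LINT x|N (r i). Re (\<psi> x)) \<longlonglongrightarrow> (LINT x|\<mu>. Re (\<psi> x))"
      using tendsto_Re[OF \<psi>(2)] by (intro conv continuous_on_Re \<psi>) simp
    moreover have "(\<lambda>i. LINT x|N (r i). Im (\<psi> x)) \<longlonglongrightarrow> (LINT x|\<mu>. Im (\<psi> x))"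
      using tendsto_Im[OF \<psi>(2)] by (intro conv continuous_on_Im \<psi>) simp
    ultimately show ?thesis
      unfolding split[OF fin sets] split[OF r(2,3)] by (intro tendsto_intros)
  qed
  then show ?thesis using r by blast
qed

text \<open>\<open>ennreal\<close> truncates \<open>u\<close>, so this is the measure with density
  \<open>max 0 u\<close>; applied to plus and minus the real and imaginary parts, it splits a
  complex function into four finite measures.\<close>

lemma density_part:
  fixes u :: "real^'n \<Rightarrow> real"
  assumes u: "integrable lborel u" and C: "(LINT x|lborel. \<bar>u x\<bar>) \<le> C"
  shows "finite_measure (density lborel (\<lambda>x. ennreal (u x)))"
    and "measure (density lborel (\<lambda>x. ennreal (u x))) UNIV \<le> C"
    and "\<psi> \<in> borel_measurable borel \<Longrightarrow>
      (LINT x|density lborel (\<lambda>x. ennreal (u x)). \<psi> x) = (LINT x|lborel. max 0 (u x) *\<^sub>R (\<psi> x :: complex))"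
proof -
  have [measurable]: "u \<in> borel_measurable borel" using borel_measurable_integrable[OF u] by simp
  have "emeasure (density lborel (\<lambda>x. ennreal (u x))) UNIV = (\<integral>\<^sup>+ x. ennreal (u x) \<partial>lborel)"
    by (subst emeasure_density) auto
  also have "\<dots> \<le> (\<integral>\<^sup>+ x. ennreal \<bar>u x\<bar> \<partial>lborel)" by (intro nn_integral_mono ennreal_leI) auto
  also have "\<dots> = ennreal (LINT x|lborel. \<bar>u x\<bar>)" using u by (intro nn_integral_eq_integral) auto
  also have "\<dots> \<le> ennreal C" by (intro ennreal_leI C)
  finally have e: "emeasure (density lborel (\<lambda>x. ennreal (u x))) UNIV \<le> ennreal C" .
  then have "emeasure (density lborel (\<lambda>x. ennreal (u x))) UNIV \<noteq> \<infinity>" using neq_top_trans[OF _ e] by simp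
  then show f: "finite_measure (density lborel (\<lambda>x. ennreal (u x)))" by (intro finite_measureI) simp
  have "0 \<le> (LINT x|lborel. \<bar>u x\<bar>)" by simp
  then have "0 \<le> C" using C by linarith
  then show "measure (density lborel (\<lambda>x. ennreal (u x))) UNIV \<le> C"
    using e by (simp add: finite_measure.emeasure_eq_measure[OF f])
  show "(LINT x|density lborel (\<lambda>x. ennreal (u x)). \<psi> x) = (LINT x|lborel. max 0 (u x) *\<^sub>R (\<psi> x :: complex))"
    if [measurable]: "\<psi> \<in> borel_measurable borel"
  proof -
    have "ennreal (u x) = ennreal (max 0 (u x))" for x by (simp add: max_def ennreal_neg)
    then have "density lborel (\<lambda>x. ennreal (u x)) = density lborel (\<lambda>x. ennreal (max 0 (u x)))" by simp
    then show ?thesis by (simp only:) (rule integral_density; simp)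
  qed
qed

text \<open>The functions are split into four positive densities, and subsequences are extracted in
  turn, each from the previous one. The four vague limits are recombined into one integrand
  \<open>h\<close> against one measure.\<close>

lemma bounded_sequence_vague_limit:
  fixes g :: "nat \<Rightarrow> real^'n \<Rightarrow> complex"
  assumes g: "\<And>i. integrable lborel (g i)" and C: "\<And>i. (LINT x|lborel. cmod (g i x)) \<le> C"
  shows "\<exists>r L h. strict_mono r \<and> finite_measure L \<and> sets L = sets borel \<and> integrable L h \<and>
    (\<forall>(\<psi> :: real^'n \<Rightarrow> complex) B. continuous_on UNIV \<psi> \<longrightarrow> (\<psi> \<longlongrightarrow> 0) at_infinity \<longrightarrow> (\<forall>x. cmod (\<psi> x) \<le> B) \<longrightarrow>
      (\<lambda>i. LINT x|lborel. \<psi> x * g (r i) x) \<longlonglongrightarrow> (LINT x|L. \<psi> x * h x))"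
proof -
  define N where "N u i = density lborel (\<lambda>x. ennreal (u (g i x)))" for u :: "complex \<Rightarrow> real" and i
  define good where "good u \<longleftrightarrow> u = Re \<or> u = Im \<or> u = (\<lambda>z. - Re z) \<or> u = (\<lambda>z. - Im z)" for u
  have u: "integrable lborel (\<lambda>x. u (g i x))" "(LINT x|lborel. \<bar>u (g i x)\<bar>) \<le> C" if "good u" for u i
  proof -
    show i: "integrable lborel (\<lambda>x. u (g i x))" using that g[of i] by (auto simp: good_def)
    have "\<bar>u z\<bar> \<le> cmod z" for z using that abs_Re_le_cmod[of z] abs_Im_le_cmod[of z] by (auto simp: good_def)
    then have "(LINT x|lborel. \<bar>u (g i x)\<bar>) \<le> (LINT x|lborel. cmod (g i x))"
      using i g[of i] by (intro integral_mono) auto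
    then show "(LINT x|lborel. \<bar>u (g i x)\<bar>) \<le> C" using C[of i] by linarith
  qed
  have fin: "finite_measure (N u i)" "measure (N u i) UNIV \<le> C" "sets (N u i) = sets borel" if "good u" for u i
    unfolding N_def using density_part[OF u[OF that]] by simp_all
  have ex: "\<exists>r \<mu>. strict_mono r \<and> finite_measure \<mu> \<and> sets \<mu> = sets borel \<and>
    (\<forall>(\<psi> :: real^'n \<Rightarrow> complex) B. continuous_on UNIV \<psi> \<longrightarrow> (\<psi> \<longlongrightarrow> 0) at_infinity \<longrightarrow> (\<forall>x. cmod (\<psi> x) \<le> B) \<longrightarrow>
      (\<lambda>i. LINT x|N u (q (r i)). \<psi> x) \<longlonglongrightarrow> (LINT x|\<mu>. \<psi> x))" if "good u" for u and q :: "nat \<Rightarrow> nat"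
    by (rule finite_measures_vaguely_compact_complex[of "\<lambda>i. N u (q i)" C]) (rule fin[OF that])+
  have good: "good Re" "good Im" "good (\<lambda>z. - Re z)" "good (\<lambda>z. - Im z)" by (auto simp: good_def)
  obtain r1 P1 where 1: "strict_mono r1" "finite_measure P1" "sets P1 = sets borel"
    "\<And>(\<psi> :: real^'n \<Rightarrow> complex) B. continuous_on UNIV \<psi> \<Longrightarrow> (\<psi> \<longlongrightarrow> 0) at_infinity \<Longrightarrow> (\<forall>x. cmod (\<psi> x) \<le> B) \<Longrightarrow>
      (\<lambda>i. LINT x|N Re (r1 i). \<psi> x) \<longlonglongrightarrow> (LINT x|P1. \<psi> x)"
    using ex[OF good(1), of "\<lambda>i. i"] by blast
  obtain r2 P2 where 2: "strict_mono r2" "finite_measure P2" "sets P2 = sets borel"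
    "\<And>(\<psi> :: real^'n \<Rightarrow> complex) B. continuous_on UNIV \<psi> \<Longrightarrow> (\<psi> \<longlongrightarrow> 0) at_infinity \<Longrightarrow> (\<forall>x. cmod (\<psi> x) \<le> B) \<Longrightarrow>
      (\<lambda>i. LINT x|N (\<lambda>z. - Re z) (r1 (r2 i)). \<psi> x) \<longlonglongrightarrow> (LINT x|P2. \<psi> x)"
    using ex[OF good(3), of r1] by blast
  obtain r3 P3 where 3: "strict_mono r3" "finite_measure P3" "sets P3 = sets borel"
    "\<And>(\<psi> :: real^'n \<Rightarrow> complex) B. continuous_on UNIV \<psi> \<Longrightarrow> (\<psi> \<longlongrightarrow> 0) at_infinity \<Longrightarrow> (\<forall>x. cmod (\<psi> x) \<le> B) \<Longrightarrow>
      (\<lambda>i. LINT x|N Im (r1 (r2 (r3 i))). \<psi> x) \<longlonglongrightarrow> (LINT x|P3. \<psi> x)"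
    using ex[OF good(2), of "\<lambda>i. r1 (r2 i)"] by blast
  obtain r4 P4 where 4: "strict_mono r4" "finite_measure P4" "sets P4 = sets borel"
    "\<And>(\<psi> :: real^'n \<Rightarrow> complex) B. continuous_on UNIV \<psi> \<Longrightarrow> (\<psi> \<longlongrightarrow> 0) at_infinity \<Longrightarrow> (\<forall>x. cmod (\<psi> x) \<le> B) \<Longrightarrow>
      (\<lambda>i. LINT x|N (\<lambda>z. - Im z) (r1 (r2 (r3 (r4 i)))). \<psi> x) \<longlonglongrightarrow> (LINT x|P4. \<psi> x)"
    using ex[OF good(4), of "\<lambda>i. r1 (r2 (r3 i))"] by blast
  obtain L h where L: "finite_measure L" "sets L = sets borel" "integrable L h"
    and eq: "\<And>(\<psi> :: real^'n \<Rightarrow> complex) B. \<psi> \<in> borel_measurable borel \<Longrightarrow> (\<forall>x. cmod (\<psi> x) \<le> B) \<Longrightarrow>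
      (LINT x|L. \<psi> x * h x) = ((LINT x|P1. \<psi> x) - (LINT x|P2. \<psi> x)) + \<i> * ((LINT x|P3. \<psi> x) - (LINT x|P4. \<psi> x))"
    using combine_finite_measures[OF 1(2) 2(2) 3(2) 4(2) 1(3) 2(3) 3(3) 4(3)] by blast
  define r where "r i = r1 (r2 (r3 (r4 i)))" for i
  have r: "strict_mono r" using 1(1) 2(1) 3(1) 4(1) by (simp add: strict_mono_def r_def)
  have "(\<lambda>i. LINT x|lborel. \<psi> x * g (r i) x) \<longlonglongrightarrow> (LINT x|L. \<psi> x * h x)"
    if \<psi>: "continuous_on UNIV \<psi>" "(\<psi> \<longlongrightarrow> 0) at_infinity" "\<forall>x. cmod (\<psi> x) \<le> B" for \<psi> :: "real^'n \<Rightarrow> complex" and B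
  proof -
    have \<psi>m[measurable]: "\<psi> \<in> borel_measurable borel" using \<psi>(1) by (rule borel_measurable_continuous_onI)
    have d: "(LINT x|N u i. \<psi> x) = (LINT x|lborel. max 0 (u (g i x)) *\<^sub>R \<psi> x)" if "good u" for u i
      unfolding N_def by (rule density_part(3)[OF u[OF that] \<psi>m])
    have int: "integrable lborel (\<lambda>x. max 0 (u (g i x)) *\<^sub>R \<psi> x)" if "good u" for u i
    proof (rule Bochner_Integration.integrable_bound[OF integrable_mult_right[OF u(1)[OF that], of B i]])
      have [measurable]: "(\<lambda>x. u (g i x)) \<in> borel_measurable lborel" using u(1)[OF that] by simp
      show "(\<lambda>x. max 0 (u (g i x)) *\<^sub>R \<psi> x) \<in> borel_measurable lborel" by measurable
      show "AE x in lborel. norm (max 0 (u (g i x)) *\<^sub>R \<psi> x) \<le> norm (B * u (g i x))"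
      proof (rule AE_I2)
        fix x
        have "0 \<le> B" using \<psi>(3) norm_ge_zero order.trans by blast
        have "\<bar>max 0 (u (g i x))\<bar> * cmod (\<psi> x) \<le> \<bar>u (g i x)\<bar> * B"
          using \<psi>(3) by (intro mult_mono) auto
        then show "norm (max 0 (u (g i x)) *\<^sub>R \<psi> x) \<le> norm (B * u (g i x))"
          using \<open>0 \<le> B\<close> by (simp add: abs_mult mult.commute)
      qed
    qed
    have "(LINT x|lborel. \<psi> x * g i x) = ((LINT x|N Re i. \<psi> x) - (LINT x|N (\<lambda>z. - Re z) i. \<psi> x))
       + \<i> * ((LINT x|N Im i. \<psi> x) - (LINT x|N (\<lambda>z. - Im z) i. \<psi> x))" for i
    proof -
      note ii = int[OF good(1), of i] int[OF good(3), of i] int[OF good(2), of i] int[OF good(4), of i]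
      have "(LINT x|lborel. \<psi> x * g i x) = (LINT x|lborel.
         (max 0 (Re (g i x)) *\<^sub>R \<psi> x - max 0 (- Re (g i x)) *\<^sub>R \<psi> x)
         + \<i> * (max 0 (Im (g i x)) *\<^sub>R \<psi> x - max 0 (- Im (g i x)) *\<^sub>R \<psi> x))"
        by (intro Bochner_Integration.integral_cong) (auto simp: complex_eq_iff max_def algebra_simps)
      also have "\<dots> = ((LINT x|N Re i. \<psi> x) - (LINT x|N (\<lambda>z. - Re z) i. \<psi> x))
         + \<i> * ((LINT x|N Im i. \<psi> x) - (LINT x|N (\<lambda>z. - Im z) i. \<psi> x))"
        unfolding d[OF good(1)] d[OF good(2)] d[OF good(3)] d[OF good(4)] integral_mult_right_zero[symmetric]
          Bochner_Integration.integral_diff[OF ii(1,2), symmetric] Bochner_Integration.integral_diff[OF ii(3,4), symmetric]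
        using ii by (intro Bochner_Integration.integral_add Bochner_Integration.integrable_diff integrable_mult_right)
      finally show ?thesis .
    qed
    moreover have "(\<lambda>i. LINT x|N Re (r i). \<psi> x) \<longlonglongrightarrow> (LINT x|P1. \<psi> x)"
    proof -
      have "strict_mono (\<lambda>i. r2 (r3 (r4 i)))" using 2(1) 3(1) 4(1) by (simp add: strict_mono_def)
      from LIMSEQ_subseq_LIMSEQ[OF 1(4)[OF \<psi>] this] show ?thesis by (simp add: o_def r_def)
    qed
    moreover have "(\<lambda>i. LINT x|N (\<lambda>z. - Re z) (r i). \<psi> x) \<longlonglongrightarrow> (LINT x|P2. \<psi> x)"
    proof -
      have "strict_mono (\<lambda>i. r3 (r4 i))" using 3(1) 4(1) by (simp add: strict_mono_def)
      from LIMSEQ_subseq_LIMSEQ[OF 2(4)[OF \<psi>] this] show ?thesis by (simp add: o_def r_def)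
    qed
    moreover have "(\<lambda>i. LINT x|N Im (r i). \<psi> x) \<longlonglongrightarrow> (LINT x|P3. \<psi> x)"
      using LIMSEQ_subseq_LIMSEQ[OF 3(4)[OF \<psi>] 4(1)] by (simp add: o_def r_def)
    moreover have "(\<lambda>i. LINT x|N (\<lambda>z. - Im z) (r i). \<psi> x) \<longlonglongrightarrow> (LINT x|P4. \<psi> x)"
      using 4(4)[OF \<psi>] by (simp add: r_def)
    ultimately show ?thesis
      unfolding eq[OF \<psi>m \<psi>(3)] by (simp only:) (intro tendsto_intros)
  qed
  then show ?thesis using r L by blast
qed

text \<open>The bump induction extends the hypothesis to all integrable test functions. Since
  \<open>D\<close> is merely bounded, \<open>cnj D\<close> is multiplied by a Gaussian to become
  such a function, which leaves the integral of the squared modulus of \<open>D\<close> against a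
  positive weight.\<close>

lemma AE_eq_0_if_integral_bump_0:
  fixes D :: "real^'n \<Rightarrow> complex"
  assumes D[measurable]: "D \<in> borel_measurable borel" and K: "\<And>y. cmod (D y) \<le> K"
    and bump: "\<And>k a b. (LINT y|lborel. complex_of_real (bump k a b y) * D y) = 0"
  shows "AE y in lborel. D y = 0"
proof -
  have int: "integrable lborel (\<lambda>y. f y * D y)" if "integrable lborel f" for f
  proof (rule Bochner_Integration.integrable_bound[OF integrable_mult_right[OF integrable_norm[OF that], of K]])
    show "(\<lambda>y. f y * D y) \<in> borel_measurable lborel" using that by measurable
    have "cmod (f y * D y) \<le> K * cmod (f y)" for y
      using mult_left_mono[OF K[of y], of "cmod (f y)"] by (simp add: norm_mult mult.commute)
    then show "AE y in lborel. norm (f y * D y) \<le> norm (K * cmod (f y))"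
      by (intro AE_I2) (metis abs_ge_self order.trans real_norm_def)
  qed
  have 0: "(LINT y|lborel. f y * D y) = 0" if f: "integrable lborel f" for f
    using sets_lborel f
  proof (induction rule: integrable_induct_bump)
    case (add f g)
    then show ?case using int[of f] int[of g] by (simp add: distrib_right)
  next
    case (mult c f)
    then show ?case by (simp add: mult.assoc)
  next
    case (lim f u)
    have "cmod (LINT y|lborel. f y * D y) \<le> K * (LINT y|lborel. cmod (u i y - f y))" for i
    proof -
      have "(LINT y|lborel. f y * D y) = - (LINT y|lborel. (u i y - f y) * D y)"
        using int[OF lim.hyps(1)] int[OF lim.hyps(2)[of i]] lim.IH[of i] by (simp add: left_diff_distrib)
      then have "cmod (LINT y|lborel. f y * D y) \<le> (LINT y|lborel. cmod ((u i y - f y) * D y))"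
        by (simp only: norm_minus_cancel integral_norm_bound)
      also have "\<dots> \<le> (LINT y|lborel. K * cmod (u i y - f y))"
      proof (rule integral_mono)
        show "integrable lborel (\<lambda>y. cmod ((u i y - f y) * D y))"
          using lim.hyps(1,2) by (intro integrable_norm int) auto
        show "integrable lborel (\<lambda>y. K * cmod (u i y - f y))" using lim.hyps(1,2) by auto
        show "cmod ((u i y - f y) * D y) \<le> K * cmod (u i y - f y)" for y
          using mult_left_mono[OF K[of y], of "cmod (u i y - f y)"] by (simp add: norm_mult mult.commute)
      qed
      finally show ?thesis by simp
    qed
    then have "cmod (LINT y|lborel. f y * D y) \<le> K * 0"
      by (intro LIMSEQ_le_const[OF tendsto_mult[OF tendsto_const lim.hyps(3)]]) auto
    then show ?case by simp
  next
    show "(LINT y|lborel. complex_of_real (bump k a b y) * D y) = 0" for k a b by (rule bump)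
    show "emeasure lborel (box a b) < \<infinity>" for a b :: "real^'n" using emeasure_bounded_finite[OF bounded_box[of a b]] by simp
  qed
  define G where "G y = exp (- (norm y / 1)\<^sup>2 / 2)" for y :: "real^'n"
  have G: "integrable lborel G" unfolding G_def[abs_def] by (rule gaussian_integral_vec) simp
  have Gm[measurable]: "G \<in> borel_measurable borel" using borel_measurable_integrable[OF G] by simp
  have iG: "integrable lborel (\<lambda>y. cnj (D y) * complex_of_real (G y))"
  proof (rule Bochner_Integration.integrable_bound[OF integrable_mult_right[OF G, of K]])
    show "AE y in lborel. norm (cnj (D y) * complex_of_real (G y)) \<le> norm (K * G y)"
    proof (rule AE_I2)
      fix y
      have "0 \<le> K" using K[of y] norm_ge_zero[of "D y"] by linarith
      then show "norm (cnj (D y) * complex_of_real (G y)) \<le> norm (K * G y)"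
        using mult_right_mono[OF K[of y], of "G y"] by (simp add: norm_mult abs_mult G_def)
    qed
  qed measurable
  have eq: "cnj (D y) * complex_of_real (G y) * D y = complex_of_real ((cmod (D y))\<^sup>2 * G y)" for y
    using complex_norm_square[of "D y"] by (simp add: mult_ac)
  have "integrable lborel (\<lambda>y. Re (cnj (D y) * complex_of_real (G y) * D y))"
    by (intro integrable_Re int iG)
  then have ii: "integrable lborel (\<lambda>y. (cmod (D y))\<^sup>2 * G y)" unfolding eq by simp
  have "complex_of_real (LINT y|lborel. (cmod (D y))\<^sup>2 * G y) = 0"
    using 0[OF iG] unfolding eq integral_complex_of_real .
  then have "(LINT y|lborel. (cmod (D y))\<^sup>2 * G y) = 0" by simp
  then have "AE y in lborel. (cmod (D y))\<^sup>2 * G y = 0"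
    using integral_nonneg_eq_0_iff_AE[OF ii] by (simp add: G_def)
  then show ?thesis by eventually_elim (simp add: G_def)
qed

text \<open>The functions bounded in \<open>L^1\<close> by hypothesis have a subsequence converging
  vaguely to a measure \<open>h dL\<close>. Tested with \<open>ft H\<close> for a test function
  \<open>H\<close>, the limit is computed twice: by inversion as \<open>c\<close> times the integral
  of \<open>G H\<close>, and by Fubini as the integral of \<open>H\<close> against the transform of
  \<open>h dL\<close>.\<close>

lemma multiplier_ex_measure:
  fixes G :: "real^'n \<Rightarrow> complex"
  assumes G[measurable]: "G \<in> borel_measurable borel" and K: "\<And>y. cmod (G y) \<le> K"
    and g: "\<And>i. integrable lborel (\<lambda>x. LINT y|lborel. cis (x \<bullet> y) * (ft (\<lambda>x. complex_of_real (mollifier i x)) y * G y))"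
    and C: "\<And>i. (LINT x|lborel. cmod (LINT y|lborel. cis (x \<bullet> y) * (ft (\<lambda>x. complex_of_real (mollifier i x)) y * G y))) \<le> C"
  shows "\<exists>L h. finite_measure L \<and> sets L = sets borel \<and> integrable L h \<and>
    (AE y in lborel. G y = (LINT \<xi>|L. cis (- (y \<bullet> \<xi>)) * h \<xi>))"
proof -
  define m where "m i x = complex_of_real (mollifier i x)" for i and x :: "real^'n"
  define c where "c = complex_of_real ((2 * pi) ^ CARD('n))"
  have c: "c \<noteq> 0" by (simp add: c_def)
  have tm: "test_fun (m i)" for i unfolding m_def[abs_def] by (rule test_fun_mollifier)
  have ftm[measurable]: "ft f \<in> borel_measurable borel" if "test_fun f" for f :: "real^'n \<Rightarrow> complex"
    using borel_measurable_integrable[OF ft_test_fun_integrable[OF that]] by simp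
  note [measurable] = ftm[OF tm]
  define g' where "g' i x = (LINT y|lborel. cis (x \<bullet> y) * (ft (m i) y * G y))" for i x
  obtain r L h where r: "strict_mono r" and L: "finite_measure L" "sets L = sets borel" "integrable L h"
    and conv: "\<And>(\<psi> :: real^'n \<Rightarrow> complex) B. continuous_on UNIV \<psi> \<Longrightarrow> (\<psi> \<longlongrightarrow> 0) at_infinity \<Longrightarrow> (\<forall>x. cmod (\<psi> x) \<le> B) \<Longrightarrow>
      (\<lambda>i. LINT x|lborel. \<psi> x * g' (r i) x) \<longlonglongrightarrow> (LINT x|L. \<psi> x * h x)"
    using bounded_sequence_vague_limit[of g' C] g C unfolding g'_def m_def[abs_def] by blast
  interpret L: finite_measure L by fact
  note [measurable_cong] = L(2)
  have hm[measurable]: "h \<in> borel_measurable L" using L(3) by simp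
  have hb[measurable]: "h \<in> borel_measurable borel" using hm L(2) measurable_cong_sets by blast
  define hat where "hat y = (LINT \<xi>|L. cis (- (y \<bullet> \<xi>)) * h \<xi>)" for y
  have hatm[measurable]: "hat \<in> borel_measurable borel" unfolding hat_def by measurable
  have hat_le: "cmod (hat y) \<le> (LINT \<xi>|L. cmod (h \<xi>))" for y
  proof -
    have "cmod (hat y) \<le> (LINT \<xi>|L. cmod (cis (- (y \<bullet> \<xi>)) * h \<xi>))" unfolding hat_def by (rule integral_norm_bound)
    then show ?thesis by (simp add: norm_mult)
  qed
  have key: "(LINT y|lborel. H y * (c * G y - hat y)) = 0" if H: "test_fun H" for H
  proof -
    note Hi = test_fun_integrable[OF H] and fHi = ft_test_fun_integrable[OF H]
    have [measurable]: "H \<in> borel_measurable borel" using borel_measurable_integrable[OF Hi] by simp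
    note [measurable] = ftm[OF H]
    have 1: "(LINT x|lborel. ft H x * g' i x) = c * (LINT y|lborel. ft (m i) y * G y * H y)" for i
    proof -
      have "(LINT x|lborel. ft H x * g' i x) = (LINT x|lborel. LINT y|lborel. ft H x * (cis (x \<bullet> y) * (ft (m i) y * G y)))"
        unfolding g'_def integral_mult_right_zero ..
      also have "\<dots> = (LINT y|lborel. LINT x|lborel. ft H x * (cis (x \<bullet> y) * (ft (m i) y * G y)))"
      proof (rule Fubini_product_bound(1)[OF lborel.sigma_finite_measure_axioms lborel.sigma_finite_measure_axioms _
            integrable_norm[OF fHi] integrable_mult_right[OF integrable_norm[OF ft_test_fun_integrable[OF tm]], of K i]])
        show "cmod (ft H x * (cis (x \<bullet> y) * (ft (m i) y * G y))) \<le> cmod (ft H x) * (K * cmod (ft (m i) y))" for x y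
          using mult_left_mono[OF K[of y], of "cmod (ft (m i) y)"]
          by (simp add: norm_mult mult.commute[of K] mult_left_mono)
      qed measurable
      also have "\<dots> = (LINT y|lborel. c * (ft (m i) y * G y * H y))"
      proof (intro Bochner_Integration.integral_cong refl)
        fix y
        have "(LINT x|lborel. ft H x * (cis (x \<bullet> y) * (ft (m i) y * G y)))
          = (LINT x|lborel. cis (y \<bullet> x) * ft H x * (ft (m i) y * G y))"
          by (simp add: mult_ac inner_commute)
        also have "\<dots> = (LINT x|lborel. cis (y \<bullet> x) * ft H x) * (ft (m i) y * G y)"
          by (rule integral_mult_left_zero)
        also have "\<dots> = c * (ft (m i) y * G y * H y)"
          unfolding test_fun_inversion[OF H] c_def by (simp add: mult_ac)
        finally show "(LINT x|lborel. ft H x * (cis (x \<bullet> y) * (ft (m i) y * G y))) = c * (ft (m i) y * G y * H y)" .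
      qed
      finally show ?thesis by simp
    qed
    have GH: "integrable lborel (\<lambda>y. G y * H y)"
    proof (rule Bochner_Integration.integrable_bound[OF integrable_mult_right[OF integrable_norm[OF Hi], of K]])
      have "cmod (G y * H y) \<le> K * cmod (H y)" for y
        using mult_right_mono[OF K[of y], of "cmod (H y)"] by (simp add: norm_mult)
      then show "AE y in lborel. norm (G y * H y) \<le> norm (K * cmod (H y))"
        by (intro AE_I2) (metis abs_ge_self order.trans real_norm_def)
    qed measurable
    have "(\<lambda>i. LINT y|lborel. ft (m i) y * G y * H y) \<longlonglongrightarrow> (LINT y|lborel. G y * H y)"
    proof (rule integral_dominated_convergence[OF _ _ integrable_norm[OF GH]])
      \<comment> \<open>Mollifiers approximate the point mass at 0, whose transform is 1; being
        nonnegative with integral 1, they have transforms bounded by 1.\<close>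
      have "(\<lambda>i. ft (m i) y) \<longlonglongrightarrow> 1" for y
      proof -
        have "(\<lambda>i. LINT z|lborel. cis (- (y \<bullet> z)) * complex_of_real (mollifier i z)) \<longlonglongrightarrow> cis (- (y \<bullet> 0))"
          by (rule mollifier_tendsto[where B = 1]) (auto intro!: continuous_intros)
        then show ?thesis by (simp add: ft_def m_def)
      qed
      then have "(\<lambda>i. ft (m i) y * G y * H y) \<longlonglongrightarrow> 1 * G y * H y" for y by (intro tendsto_intros)
      then show "AE y in lborel. (\<lambda>i. ft (m i) y * G y * H y) \<longlonglongrightarrow> G y * H y" by simp
      have "cmod (ft (m i) y) \<le> 1" for i y
        using norm_ft_le[of "m i" y] by (simp add: m_def mollifier_nonneg integral_mollifier)
      then show "AE y in lborel. norm (ft (m i) y * G y * H y) \<le> cmod (G y * H y)" for i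
        by (intro AE_I2) (simp add: norm_mult mult.assoc mult_left_le_one_le)
    qed measurable
    from tendsto_mult[OF tendsto_const LIMSEQ_subseq_LIMSEQ[OF this r], of c]
    have "(\<lambda>i. LINT x|lborel. ft H x * g' (r i) x) \<longlonglongrightarrow> c * (LINT y|lborel. G y * H y)"
      by (simp add: 1 o_def)
    \<comment> \<open>Vague convergence applies because \<open>ft H\<close> is continuous, bounded
      and vanishes at infinity.\<close>
    moreover have "(\<lambda>i. LINT x|lborel. ft H x * g' (r i) x) \<longlonglongrightarrow> (LINT x|L. ft H x * h x)"
      using norm_ft_le[of H] by (intro conv[of _ "LINT x|lborel. cmod (H x)"] continuous_ft Hi ft_test_fun_tendsto_0 H) auto
    ultimately have 2: "c * (LINT y|lborel. G y * H y) = (LINT x|L. ft H x * h x)"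
      by (rule LIMSEQ_unique)
    have "(LINT x|L. ft H x * h x) = (LINT x|L. LINT y|lborel. cis (- (x \<bullet> y)) * H y * h x)"
      unfolding ft_def integral_mult_left_zero ..
    also have "\<dots> = (LINT y|lborel. LINT x|L. cis (- (x \<bullet> y)) * H y * h x)"
      by (rule Fubini_product_bound(1)[OF L.sigma_finite_measure_axioms lborel.sigma_finite_measure_axioms _
            integrable_norm[OF L(3)] integrable_norm[OF Hi]]) (measurable, simp add: norm_mult mult.commute)
    also have "\<dots> = (LINT y|lborel. H y * hat y)"
    proof (intro Bochner_Integration.integral_cong refl)
      fix y
      have "(LINT x|L. cis (- (x \<bullet> y)) * H y * h x) = (LINT x|L. H y * (cis (- (y \<bullet> x)) * h x))"
        by (simp add: mult_ac inner_commute)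
      then show "(LINT x|L. cis (- (x \<bullet> y)) * H y * h x) = H y * hat y" by (simp add: hat_def)
    qed
    finally have 3: "c * (LINT y|lborel. G y * H y) = (LINT y|lborel. H y * hat y)" using 2 by simp
    have iH: "integrable lborel (\<lambda>y. H y * hat y)"
    proof (rule Bochner_Integration.integrable_bound[OF integrable_mult_right[OF integrable_norm[OF Hi], of "LINT \<xi>|L. cmod (h \<xi>)"]])
      have "cmod (H y * hat y) \<le> (LINT \<xi>|L. cmod (h \<xi>)) * cmod (H y)" for y
        using mult_right_mono[OF hat_le[of y], of "cmod (H y)"] by (simp add: norm_mult mult.commute)
      then show "AE y in lborel. norm (H y * hat y) \<le> norm ((LINT \<xi>|L. cmod (h \<xi>)) * cmod (H y))"
        by (intro AE_I2) (metis abs_ge_self order.trans real_norm_def)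
    qed measurable
    have "(LINT y|lborel. H y * (c * G y - hat y)) = (LINT y|lborel. c * (G y * H y) - H y * hat y)"
      by (simp add: right_diff_distrib mult_ac)
    also have "\<dots> = c * (LINT y|lborel. G y * H y) - (LINT y|lborel. H y * hat y)"
      using GH iH by (subst Bochner_Integration.integral_diff) auto
    finally show ?thesis using 3 by simp
  qed
  have "AE y in lborel. c * G y - hat y = 0"
  proof (rule AE_eq_0_if_integral_bump_0)
    show "cmod (c * G y - hat y) \<le> cmod c * K + (LINT \<xi>|L. cmod (h \<xi>))" for y
      using norm_triangle_ineq4[of "c * G y" "hat y"] hat_le[of y] mult_left_mono[OF K[of y], of "cmod c"]
      by (simp add: norm_mult)
    show "(LINT y|lborel. complex_of_real (bump k a b y) * (c * G y - hat y)) = 0" for k a b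
    proof -
      have "test_fun (\<lambda>y. bump k a b y *\<^sub>R (1::complex))" by (rule test_fun_bump)
      then have "test_fun (\<lambda>y. complex_of_real (bump k a b y))" by (simp add: scaleR_conv_of_real)
      then show ?thesis by (rule key)
    qed
  qed measurable
  then have "AE y in lborel. G y = (LINT \<xi>|L. cis (- (y \<bullet> \<xi>)) * (h \<xi> / c))"
  proof eventually_elim
    case (elim y)
    have "(LINT \<xi>|L. cis (- (y \<bullet> \<xi>)) * (h \<xi> / c)) = hat y / c" by (simp add: hat_def)
    then show ?case using elim c by (simp add: field_simps)
  qed
  then show ?thesis using L by (intro exI[of _ L] exI[of _ "\<lambda>\<xi>. h \<xi> / c"]) auto
qed

section \<open>Matrix-valued integrable functions\<close>

lemma bounded_linear_matrix_vector: "bounded_linear ((*v) (A :: complex^'m^'m))"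
proof -
  have "linear ((*v) A)"
    by (rule linearI) (auto simp: matrix_vector_mult_def vec_eq_iff scaleR_sum_right distrib_left sum.distrib)
  then show ?thesis by (simp add: linear_conv_bounded_linear)
qed

lemma cmod_entry_le_mat_opnorm: "cmod (A $ j $ k) \<le> mat_opnorm A" for A :: "complex^'m^'m"
proof -
  have "(A *v axis k 1) $ j = (\<Sum>i\<in>UNIV. if i = k then A $ j $ i else 0)"
    unfolding matrix_vector_mult_def by (simp add: axis_def if_distrib cong: if_cong)
  then have "A $ j $ k = (A *v axis k 1) $ j" by simp
  then have "cmod (A $ j $ k) \<le> norm (A *v axis k 1)" using Finite_Cartesian_Product.norm_nth_le[of "A *v axis k 1" j] by simp
  also have "\<dots> \<le> mat_opnorm A * norm (axis k (1::complex))"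
    unfolding mat_opnorm_def by (rule onorm[OF bounded_linear_matrix_vector])
  finally show ?thesis by simp
qed

lemma mat_opnorm_nonneg: "0 \<le> mat_opnorm A"
  unfolding mat_opnorm_def by (rule onorm_pos_le[OF bounded_linear_matrix_vector])

lemma norm_le_sum_cmod: "norm (v :: complex^'m) \<le> (\<Sum>j\<in>UNIV. cmod (v $ j))"
  unfolding norm_vec_def by (rule L2_set_le_sum) simp

lemma mat_opnorm_le_sum: "mat_opnorm A \<le> (\<Sum>j\<in>UNIV. \<Sum>k\<in>UNIV. cmod (A $ j $ k))" for A :: "complex^'m^'m"
  unfolding mat_opnorm_def
proof (rule onorm_le)
  fix v :: "complex^'m"
  have "norm (A *v v) \<le> (\<Sum>j\<in>UNIV. cmod ((A *v v) $ j))" by (rule norm_le_sum_cmod)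
  also have "\<dots> \<le> (\<Sum>j\<in>UNIV. \<Sum>k\<in>UNIV. cmod (A $ j $ k) * norm v)"
  proof (rule sum_mono)
    fix j
    have "cmod ((A *v v) $ j) \<le> (\<Sum>k\<in>UNIV. cmod (A $ j $ k * v $ k))"
      unfolding matrix_vector_mult_def by (simp add: norm_sum)
    also have "\<dots> \<le> (\<Sum>k\<in>UNIV. cmod (A $ j $ k) * norm v)"
      by (intro sum_mono) (simp add: norm_mult mult_left_mono Finite_Cartesian_Product.norm_nth_le)
    finally show "cmod ((A *v v) $ j) \<le> (\<Sum>k\<in>UNIV. cmod (A $ j $ k) * norm v)" .
  qed
  finally show "norm (A *v v) \<le> (\<Sum>j\<in>UNIV. \<Sum>k\<in>UNIV. cmod (A $ j $ k)) * norm v"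
    by (simp add: sum_distrib_right)
qed

lemma mat_opnorm_add: "mat_opnorm (A + B) \<le> mat_opnorm A + mat_opnorm B"
  using onorm_triangle[OF bounded_linear_matrix_vector[of A] bounded_linear_matrix_vector[of B]]
  by (simp add: mat_opnorm_def matrix_vector_mult_add_rdistrib)

lemma mat_opnorm_eq_0: "mat_opnorm A = 0 \<longleftrightarrow> A = 0"
proof
  assume "mat_opnorm A = 0"
  then have "cmod (A $ j $ k) \<le> 0" for j k using cmod_entry_le_mat_opnorm[of A j k] by simp
  then show "A = 0" by (simp add: vec_eq_iff)
next
  assume "A = 0"
  then show "mat_opnorm A = 0" using mat_opnorm_le_sum[of A] mat_opnorm_nonneg[of A] by simp
qed

lemma Basis_vec_axis: "v \<in> Basis \<Longrightarrow> \<exists>i u. u \<in> Basis \<and> v = axis i u"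
  for v :: "'a::euclidean_space^'k"
  by (auto simp: Basis_vec_def)

lemma borel_measurable_mat_iff:
  fixes f :: "'a \<Rightarrow> complex^'m^'m"
  shows "f \<in> borel_measurable M \<longleftrightarrow> (\<forall>j k. (\<lambda>x. f x $ j $ k) \<in> borel_measurable M)"
proof
  assume f: "f \<in> borel_measurable M"
  have "continuous_on UNIV (\<lambda>A :: complex^'m^'m. A $ j $ k)" for j k by (intro continuous_intros)
  then have "(\<lambda>A :: complex^'m^'m. A $ j $ k) \<in> borel_measurable borel" for j k
    by (rule borel_measurable_continuous_onI)
  then show "\<forall>j k. (\<lambda>x. f x $ j $ k) \<in> borel_measurable M"
    using measurable_compose[OF f] by blast
next
  assume f: "\<forall>j k. (\<lambda>x. f x $ j $ k) \<in> borel_measurable M"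
  show "f \<in> borel_measurable M"
  proof (subst borel_measurable_euclidean_space, rule ballI)
    fix b :: "complex^'m^'m" assume "b \<in> Basis"
    from Basis_vec_axis[OF this] obtain j u where u: "u \<in> Basis" and bj: "b = axis j u" by blast
    from Basis_vec_axis[OF u] obtain k c where uk: "u = axis k c" by blast
    have b: "b = axis j (axis k c)" unfolding bj uk ..
    have "(\<lambda>x. f x $ j $ k \<bullet> c) \<in> borel_measurable M"
      using f by (intro borel_measurable_inner borel_measurable_const) blast
    then show "(\<lambda>x. f x \<bullet> b) \<in> borel_measurable M" by (simp add: b inner_axis)
  qed
qed

text \<open>The triangle inequality and the bound by the sum of the entries make the operator norm
  continuous.\<close>

lemma mat_opnorm_measurable [measurable]: "mat_opnorm \<in> borel_measurable (borel :: (complex^'m^'m) measure)"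
proof (rule borel_measurable_continuous_onI)
  have "isCont mat_opnorm A" for A :: "complex^'m^'m"
    unfolding isCont_def
  proof (rule LIM_I)
    have lim: "((\<lambda>B. \<Sum>j\<in>UNIV. \<Sum>k\<in>UNIV. cmod ((B - A) $ j $ k)) \<longlongrightarrow> (\<Sum>j\<in>(UNIV::'m set). \<Sum>k\<in>(UNIV::'m set). cmod ((A - A) $ j $ k))) (at A)"
      by (intro tendsto_intros)
    fix e :: real assume "e > 0"
    have "\<forall>\<^sub>F B in at A. (\<Sum>j\<in>UNIV. \<Sum>k\<in>UNIV. cmod ((B - A) $ j $ k)) < e"
      using \<open>e > 0\<close> by (intro order_tendstoD(2)[OF lim]) simp
    moreover have "norm (mat_opnorm B - mat_opnorm A) \<le> (\<Sum>j\<in>UNIV. \<Sum>k\<in>UNIV. cmod ((B - A) $ j $ k))" for B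
    proof -
      have "mat_opnorm B \<le> mat_opnorm A + mat_opnorm (B - A)" using mat_opnorm_add[of A "B - A"] by simp
      moreover have "mat_opnorm A \<le> mat_opnorm B + mat_opnorm (A - B)" using mat_opnorm_add[of B "A - B"] by simp
      moreover have "mat_opnorm (A - B) \<le> (\<Sum>j\<in>UNIV. \<Sum>k\<in>UNIV. cmod ((B - A) $ j $ k))"
        using mat_opnorm_le_sum[of "A - B"] by (simp add: norm_minus_commute)
      moreover note mat_opnorm_le_sum[of "B - A"]
      ultimately show ?thesis by simp
    qed
    ultimately have "\<forall>\<^sub>F B in at A. norm (mat_opnorm B - mat_opnorm A) < e"
      by (auto elim!: eventually_mono intro: le_less_trans)
    then show "\<exists>s>0. \<forall>x. x \<noteq> A \<and> norm (x - A) < s \<longrightarrow> norm (mat_opnorm x - mat_opnorm A) < e"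
      by (auto simp: eventually_at dist_norm)
  qed
  then show "continuous_on UNIV (mat_opnorm :: complex^'m^'m \<Rightarrow> real)" by (simp add: continuous_on_eq_continuous_at)
qed

text \<open>The operator norm lies between the modulus of each entry and the sum of all moduli, so
  integrability can be checked entrywise.\<close>

lemma L1_space_iff:
  fixes f :: "real^'n \<Rightarrow> complex^'m^'m"
  shows "f \<in> L1_space \<longleftrightarrow> (\<forall>j k. integrable lebesgue (\<lambda>x. f x $ j $ k))"
proof
  assume f: "f \<in> L1_space"
  then have m: "f \<in> borel_measurable lebesgue" "integrable lebesgue (\<lambda>x. mat_opnorm (f x))" by (auto simp: L1_space_def)
  show "\<forall>j k. integrable lebesgue (\<lambda>x. f x $ j $ k)"
  proof (intro allI)
    fix j k
    show "integrable lebesgue (\<lambda>x. f x $ j $ k)"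
    proof (rule Bochner_Integration.integrable_bound[OF m(2)])
      show "(\<lambda>x. f x $ j $ k) \<in> borel_measurable lebesgue"
        using m(1)[unfolded borel_measurable_mat_iff] by blast
      show "AE x in lebesgue. norm (f x $ j $ k) \<le> norm (mat_opnorm (f x))"
        by (intro AE_I2) (simp add: order.trans[OF cmod_entry_le_mat_opnorm abs_ge_self])
    qed
  qed
next
  assume f: "\<forall>j k. integrable lebesgue (\<lambda>x. f x $ j $ k)"
  have m: "f \<in> borel_measurable lebesgue" unfolding borel_measurable_mat_iff using f by (blast intro: borel_measurable_integrable)
  have "integrable lebesgue (\<lambda>x. mat_opnorm (f x))"
  proof (rule Bochner_Integration.integrable_bound)
    show "integrable lebesgue (\<lambda>x. \<Sum>j\<in>UNIV. \<Sum>k\<in>UNIV. cmod (f x $ j $ k))"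
      using f by (intro Bochner_Integration.integrable_sum integrable_norm) auto
    show "(\<lambda>x. mat_opnorm (f x)) \<in> borel_measurable lebesgue"
      by (rule measurable_compose[OF m mat_opnorm_measurable])
    show "AE x in lebesgue. norm (mat_opnorm (f x)) \<le> norm (\<Sum>j\<in>UNIV. \<Sum>k\<in>UNIV. cmod (f x $ j $ k))"
      by (intro AE_I2) (simp add: abs_of_nonneg[OF mat_opnorm_nonneg] mat_opnorm_le_sum sum_nonneg)
  qed
  then show "f \<in> L1_space" using m by (simp add: L1_space_def)
qed

lemma L1_norm_le_L1_entry_norm:
  assumes f: "f \<in> L1_space"
  shows "L1_norm f \<le> L1_entry_norm f"
proof -
  have i: "integrable lebesgue (\<lambda>x. f x $ j $ k)" for j k using f L1_space_iff by blast
  have "L1_norm f \<le> (LINT x|lebesgue. (\<Sum>j\<in>UNIV. \<Sum>k\<in>UNIV. cmod (f x $ j $ k)))"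
    unfolding L1_norm_def using f i
    by (intro integral_mono mat_opnorm_le_sum Bochner_Integration.integrable_sum integrable_norm) (auto simp: L1_space_def)
  also have "\<dots> = L1_entry_norm f"
    unfolding L1_entry_norm_def using i
    by (subst Bochner_Integration.integral_sum, (intro Bochner_Integration.integrable_sum integrable_norm; simp))
      (intro sum.cong refl Bochner_Integration.integral_sum integrable_norm; simp)
  finally show ?thesis .
qed

lemma L1_entry_le_L1_norm:
  assumes f: "f \<in> L1_space"
  shows "(LINT x|lebesgue. cmod (f x $ j $ k)) \<le> L1_norm f"
  unfolding L1_norm_def using f L1_space_iff[of f]
  by (intro integral_mono cmod_entry_le_mat_opnorm) (auto simp: L1_space_def)

text \<open>With \<open>L1_norm_le_L1_entry_norm\<close> this makes the two norms equivalent, so an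
  operator bound for one yields a bound for the other.\<close>

lemma L1_entry_norm_le_L1_norm:
  fixes f :: "real^'n \<Rightarrow> complex^'m^'m"
  assumes f: "f \<in> L1_space"
  shows "L1_entry_norm f \<le> (real CARD('m))\<^sup>2 * L1_norm f"
proof -
  have "L1_entry_norm f \<le> (\<Sum>j\<in>(UNIV::'m set). \<Sum>k\<in>(UNIV::'m set). L1_norm f)"
    unfolding L1_entry_norm_def by (intro sum_mono L1_entry_le_L1_norm f)
  then show ?thesis by (simp add: power2_eq_square mult.assoc)
qed

lemma L1_norm_nonneg: "0 \<le> L1_norm f"
  unfolding L1_norm_def by (intro Bochner_Integration.integral_nonneg mat_opnorm_nonneg)

lemma L1_entry_norm_nonneg: "0 \<le> L1_entry_norm f"
  unfolding L1_entry_norm_def by (intro sum_nonneg Bochner_Integration.integral_nonneg) auto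

lemma L1_space_add: "f \<in> L1_space \<Longrightarrow> g \<in> L1_space \<Longrightarrow> (\<lambda>x. f x + g x) \<in> L1_space"
  unfolding L1_space_iff by auto

lemma L1_space_scale: "f \<in> L1_space \<Longrightarrow> (\<lambda>x. \<chi> j k. c * f x $ j $ k) \<in> L1_space"
  unfolding L1_space_iff by auto

lemma L1_norm_cong_AE:
  assumes "f \<in> L1_space" "g \<in> L1_space" "AE x in lebesgue. f x = g x"
  shows "L1_norm f = L1_norm g"
  unfolding L1_norm_def
  by (rule integral_cong_AE) (use assms in \<open>auto simp: L1_space_def elim: eventually_mono\<close>)

lemma L1_entry_norm_cong_AE:
  assumes "f \<in> L1_space" "g \<in> L1_space" "AE x in lebesgue. f x = g x"
  shows "L1_entry_norm f = L1_entry_norm g"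
  unfolding L1_entry_norm_def
proof (intro sum.cong refl)
  fix j k
  have "integrable lebesgue (\<lambda>x. f x $ j $ k)" "integrable lebesgue (\<lambda>x. g x $ j $ k)"
    using assms L1_space_iff by blast+
  then show "(LINT x|lebesgue. cmod (f x $ j $ k)) = (LINT x|lebesgue. cmod (g x $ j $ k))"
    using assms(3) by (intro integral_cong_AE) (auto elim: eventually_mono)
qed

section \<open>Borel representatives\<close>

lemma integrable_lebesgue_ex_borel:
  fixes f :: "'a::euclidean_space \<Rightarrow> complex"
  assumes f: "f \<in> borel_measurable lebesgue"
  shows "\<exists>g\<in>borel_measurable borel. AE x in lborel. f x = g x"
proof -
  obtain u where u: "u \<in> borel_measurable lborel" "AE x in lborel. Re (f x) = u x"
    using completion_ex_borel_measurable_real[of "\<lambda>x. Re (f x)" lborel] f by auto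
  obtain v where v: "v \<in> borel_measurable lborel" "AE x in lborel. Im (f x) = v x"
    using completion_ex_borel_measurable_real[of "\<lambda>x. Im (f x)" lborel] f by auto
  define w where "w x = complex_of_real (u x) + \<i> * complex_of_real (v x)" for x
  have "w \<in> borel_measurable borel"
    unfolding w_def using u(1) v(1) by simp
  moreover have "AE x in lborel. f x = w x"
    using u(2) v(2) by eventually_elim (simp add: complex_eq_iff w_def)
  ultimately show ?thesis by (intro bexI[of _ w])
qed

text \<open>For a merely Lebesgue measurable \<open>f\<close>, the function
  \<open>f (x - \<xi>)\<close> of two variables need not be measurable for the product of
  \<open>M\<close> and \<open>lborel\<close>, so convolutions are formed with a Borel
  representative.\<close>

definition borel_version :: "(real^'n \<Rightarrow> complex) \<Rightarrow> real^'n \<Rightarrow> complex" where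
  "borel_version f = (SOME g. integrable lborel g \<and> (AE x in lborel. f x = g x))"

lemma borel_version:
  assumes f: "integrable lebesgue f"
  shows "integrable lborel (borel_version f) \<and> (AE x in lborel. f x = borel_version f x)"
proof -
  obtain g where g: "g \<in> borel_measurable borel" "AE x in lborel. f x = g x"
    using integrable_lebesgue_ex_borel[of f] f by auto
  have gl: "g \<in> borel_measurable lebesgue" using g(1) by (simp add: measurable_completion)
  have "integrable lebesgue g"
    using f integrable_cong_AE[of f lebesgue g] AE_completion[OF g(2)] gl by auto
  then have "integrable lborel g" using g(1) by (simp add: integrable_completion)
  then show ?thesis
    unfolding borel_version_def using g(2)
    by (intro someI[of "\<lambda>g. integrable lborel g \<and> (AE x in lborel. f x = g x)" g] conjI)
qed

definition entry_matrix :: "'m \<Rightarrow> 'm \<Rightarrow> complex \<Rightarrow> complex^'m^'m::finite" where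
  "entry_matrix j l z = (\<chi> a b. if a = j \<and> b = l then z else 0)"

lemma entry_matrix_nth: "entry_matrix j l z $ a $ b = (if a = j \<and> b = l then z else 0)"
  by (simp add: entry_matrix_def)

lemma entry_matrix_in_L1_space:
  assumes "integrable lborel g"
  shows "(\<lambda>x. entry_matrix j l (g x)) \<in> L1_space"
  unfolding L1_space_iff
proof (intro allI)
  fix a b
  have "integrable lebesgue g" using assms integrable_completion[of g lborel] by simp
  then show "integrable lebesgue (\<lambda>x. entry_matrix j l (g x) $ a $ b)"
    by (cases "a = j \<and> b = l") (auto simp: entry_matrix_nth)
qed

lemma L1_entry_norm_entry_matrix:
  fixes g :: "real^'n \<Rightarrow> complex"
  assumes "integrable lborel g"
  shows "L1_entry_norm (\<lambda>x. entry_matrix j l (g x)) = (LINT x|lborel. cmod (g x))"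
proof -
  have "(LINT x|lebesgue. cmod (entry_matrix j l (g x) $ a $ b)) = (if a = j then if b = l then (LINT x|lborel. cmod (g x)) else 0 else 0)" for a b
  proof -
    have "(LINT x|lebesgue. cmod (g x)) = (LINT x|lborel. cmod (g x))"
      using assms by (intro integral_completion) auto
    then show ?thesis by (auto simp: entry_matrix_nth)
  qed
  then have "L1_entry_norm (\<lambda>x. entry_matrix j l (g x))
      = (\<Sum>a\<in>UNIV. \<Sum>b\<in>UNIV. if a = j then if b = l then (LINT x|lborel. cmod (g x)) else 0 else 0)"
    unfolding L1_entry_norm_def by simp
  also have "\<dots> = (\<Sum>a\<in>UNIV. if a = j then (LINT x|lborel. cmod (g x)) else 0)"
    by (intro sum.cong refl) simp
  finally show ?thesis by simp
qed

text \<open>Density of test functions as an induction rule. Functions with a single nonzero entry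
  are reached by the bump induction; finitely many of them add up to a Borel version of
  \<open>f\<close>, and \<open>cong\<close> passes from there to \<open>f\<close>.\<close>

lemma L1_space_induct:
  fixes f :: "real^'n \<Rightarrow> complex^'m^'m" and Z :: "(real^'n \<Rightarrow> complex^'m^'m) \<Rightarrow> bool"
  assumes f: "f \<in> L1_space"
    and test: "\<And>f. f \<in> C0_infty \<Longrightarrow> Z f"
    and add: "\<And>f g. f \<in> L1_space \<Longrightarrow> g \<in> L1_space \<Longrightarrow> Z f \<Longrightarrow> Z g \<Longrightarrow> Z (\<lambda>x. f x + g x)"
    and scale: "\<And>f c. f \<in> L1_space \<Longrightarrow> Z f \<Longrightarrow> Z (\<lambda>x. \<chi> j k. c * f x $ j $ k)"
    and cong: "\<And>f g. f \<in> L1_space \<Longrightarrow> g \<in> L1_space \<Longrightarrow> AE x in lebesgue. f x = g x \<Longrightarrow> Z f \<Longrightarrow> Z g"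
    and lim: "\<And>f s. f \<in> L1_space \<Longrightarrow> (\<And>i. s i \<in> L1_space) \<Longrightarrow> (\<And>i. Z (s i)) \<Longrightarrow>
       (\<lambda>i. L1_norm (\<lambda>x. s i x - f x)) \<longlonglongrightarrow> 0 \<Longrightarrow> Z f"
  shows "Z f"
proof -
  have entry_matrix: "Z (\<lambda>x. entry_matrix j l (g x))" if g: "integrable lborel g" for g j l
    using sets_lborel g
  proof (induction rule: integrable_induct_bump)
    case (bump k a b)
    have "(\<lambda>x. entry_matrix j l (complex_of_real (bump k a b x))) = (\<lambda>x. bump k a b x *\<^sub>R entry_matrix j l 1)"
      by (auto simp: fun_eq_iff vec_eq_iff entry_matrix_nth of_real_def)
    then show ?case using test[OF C0_infty_bump[of k a b "entry_matrix j l 1"]] by simp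
  next
    case (add f g)
    have "(\<lambda>x. entry_matrix j l (f x + g x)) = (\<lambda>x. entry_matrix j l (f x) + entry_matrix j l (g x))"
      by (auto simp: fun_eq_iff vec_eq_iff entry_matrix_nth)
    then show ?case using assms(3)[OF entry_matrix_in_L1_space entry_matrix_in_L1_space add.IH] add.hyps by simp
  next
    case (mult c f)
    have "(\<lambda>x. entry_matrix j l (c * f x)) = (\<lambda>x. \<chi> a b. c * entry_matrix j l (f x) $ a $ b)"
      by (auto simp: fun_eq_iff vec_eq_iff entry_matrix_nth)
    then show ?case using scale[OF entry_matrix_in_L1_space mult.IH] mult.hyps by simp
  next
    case (lim f u)
    have e: "(\<lambda>x. entry_matrix j l (u i x) - entry_matrix j l (f x)) = (\<lambda>x. entry_matrix j l (u i x - f x))" for i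
      by (auto simp: fun_eq_iff vec_eq_iff entry_matrix_nth)
    have i: "integrable lborel (\<lambda>x. u i x - f x)" for i using lim.hyps by auto
    have "(\<lambda>i. L1_norm (\<lambda>x. entry_matrix j l (u i x) - entry_matrix j l (f x))) \<longlonglongrightarrow> 0"
    proof (rule Lim_null_comparison[OF _ lim.hyps(3)])
      show "\<forall>\<^sub>F i in sequentially. norm (L1_norm (\<lambda>x. entry_matrix j l (u i x) - entry_matrix j l (f x))) \<le> (LINT x|lborel. cmod (u i x - f x))"
        using L1_norm_le_L1_entry_norm[OF entry_matrix_in_L1_space[OF i]] unfolding e L1_entry_norm_entry_matrix[OF i]
        by (intro always_eventually allI) (simp add: L1_norm_nonneg)
    qed
    then show ?case
      using assms(6)[of "\<lambda>x. entry_matrix j l (f x)" "\<lambda>i x. entry_matrix j l (u i x)"] lim.IH entry_matrix_in_L1_space lim.hyps(1,2) by blast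
  next
    show "emeasure lborel (box a b) < \<infinity>" for a b :: "real^'n"
      using emeasure_bounded_finite[OF bounded_box[of a b]] by simp
  qed
  have i: "integrable lebesgue (\<lambda>x. f x $ j $ k)" for j k using f L1_space_iff by blast
  define g where "g p = borel_version (\<lambda>x. f x $ fst p $ snd p)" for p
  have g: "integrable lborel (g p)" "AE x in lborel. f x $ fst p $ snd p = g p x" for p
    using borel_version[OF i[of "fst p" "snd p"]] by (auto simp: g_def)
  have "(\<lambda>x. \<Sum>p\<in>P. entry_matrix (fst p) (snd p) (g p x)) \<in> L1_space \<and> Z (\<lambda>x. \<Sum>p\<in>P. entry_matrix (fst p) (snd p) (g p x))"
    if "finite P" for P
    using that
  proof (induction P rule: finite_induct)
    case empty
    have z: "(\<lambda>_::real^'n. 0::complex^'m^'m) = (\<lambda>x. \<chi> j k. 0 * f x $ j $ k)" by (auto simp: vec_eq_iff)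
    have "(\<lambda>x::real^'n. bump 1 0 0 x *\<^sub>R (0::complex^'m^'m)) \<in> C0_infty" by (rule C0_infty_bump)
    then have "Z (\<lambda>_. 0)" using test by force
    moreover have "(\<lambda>_::real^'n. 0::complex^'m^'m) \<in> L1_space" by (simp add: L1_space_iff)
    ultimately show ?case by simp
  next
    case (insert p P)
    then show ?case
      using add[of "\<lambda>x. entry_matrix (fst p) (snd p) (g p x)" "\<lambda>x. \<Sum>p\<in>P. entry_matrix (fst p) (snd p) (g p x)"]
        L1_space_add[of "\<lambda>x. entry_matrix (fst p) (snd p) (g p x)" "\<lambda>x. \<Sum>p\<in>P. entry_matrix (fst p) (snd p) (g p x)"]
        entry_matrix[OF g(1)] by (simp add: entry_matrix_in_L1_space[OF g(1)])
  qed
  from this[of UNIV] have S: "(\<lambda>x. \<Sum>p\<in>UNIV. entry_matrix (fst p) (snd p) (g p x)) \<in> L1_space"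
    "Z (\<lambda>x. \<Sum>p\<in>UNIV. entry_matrix (fst p) (snd p) (g p x))" by auto
  have "AE x in lborel. \<forall>p\<in>UNIV. f x $ fst p $ snd p = g p x"
    by (rule AE_finite_allI) (auto intro: g)
  then have "AE x in lborel. (\<Sum>p\<in>UNIV. entry_matrix (fst p) (snd p) (g p x)) = f x"
  proof eventually_elim
    case (elim x)
    have "(\<Sum>p\<in>UNIV. entry_matrix (fst p) (snd p) (g p x)) $ a $ b = f x $ a $ b" for a b
    proof -
      have "(\<Sum>p\<in>UNIV. entry_matrix (fst p) (snd p) (g p x)) $ a $ b = (\<Sum>p\<in>UNIV. if p = (a, b) then g p x else 0)"
      proof -
        have "(\<Sum>p\<in>UNIV. entry_matrix (fst p) (snd p) (g p x)) $ a $ b = (\<Sum>p\<in>UNIV. entry_matrix (fst p) (snd p) (g p x) $ a $ b)"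
          by simp
        also have "\<dots> = (\<Sum>p\<in>UNIV. if p = (a, b) then g p x else 0)"
          by (intro sum.cong refl) (auto simp: entry_matrix_nth)
        finally show ?thesis .
      qed
      then show ?thesis using elim[rule_format, of "(a, b)"] by simp
    qed
    then show ?case by (simp add: vec_eq_iff)
  qed
  then show ?thesis using cong[OF S(1) f AE_completion S(2)] by blast
qed

lemma L1_norm_eq_0:
  assumes f: "f \<in> L1_space" and 0: "L1_norm f = 0"
  shows "AE x in lebesgue. f x = 0"
proof -
  have i: "integrable lebesgue (\<lambda>x. mat_opnorm (f x))" using f by (simp add: L1_space_def)
  have "AE x in lebesgue. mat_opnorm (f x) = 0"
    using integral_nonneg_eq_0_iff_AE[OF i] 0 by (simp add: mat_opnorm_nonneg L1_norm_def)
  then show ?thesis by eventually_elim (simp add: mat_opnorm_eq_0)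
qed

lemma L1_norm_triangle:
  assumes f: "f \<in> L1_space" and g: "g \<in> L1_space"
  shows "L1_norm (\<lambda>x. f x + g x) \<le> L1_norm f + L1_norm g"
proof -
  have i: "integrable lebesgue (\<lambda>x. mat_opnorm (f x))" "integrable lebesgue (\<lambda>x. mat_opnorm (g x))"
    "integrable lebesgue (\<lambda>x. mat_opnorm (f x + g x))"
    using f g L1_space_add[OF f g] by (simp_all add: L1_space_def)
  have "L1_norm (\<lambda>x. f x + g x) \<le> (LINT x|lebesgue. mat_opnorm (f x) + mat_opnorm (g x))"
    unfolding L1_norm_def using i by (intro integral_mono mat_opnorm_add) auto
  then show ?thesis using i by (simp add: L1_norm_def)
qed

text \<open>\<open>bounded_operator_L1\<close> speaks of sums and scalar multiples, so differences
  are reduced to these.\<close>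

lemma diff_eq_add_scale: "(\<lambda>x. f x - g x) = (\<lambda>x. f x + (\<chi> j k. (-1) * g x $ j $ k))"
  for f g :: "'a \<Rightarrow> complex^'m^'m"
  by (auto simp: fun_eq_iff vec_eq_iff)

lemma L1_space_diff: "f \<in> L1_space \<Longrightarrow> g \<in> L1_space \<Longrightarrow> (\<lambda>x. f x - g x) \<in> L1_space"
  unfolding L1_space_iff by auto

section \<open>Bounded operators and uniqueness of the extension\<close>

context
  fixes T :: "(real^'n \<Rightarrow> complex^'m^'m) \<Rightarrow> real^'n \<Rightarrow> complex^'m^'m"
  assumes T: "bounded_operator_L1 T"
begin

lemma bounded_operator_L1_closed: "f \<in> L1_space \<Longrightarrow> T f \<in> L1_space"
  using T unfolding bounded_operator_L1_def by blast

lemma bounded_operator_L1_add: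
  "f \<in> L1_space \<Longrightarrow> g \<in> L1_space \<Longrightarrow> AE x in lebesgue. T (\<lambda>x. f x + g x) x = T f x + T g x"
  using T unfolding bounded_operator_L1_def by blast

lemma bounded_operator_L1_scale:
  "f \<in> L1_space \<Longrightarrow> AE x in lebesgue. T (\<lambda>x. \<chi> j k. c * f x $ j $ k) x = (\<chi> j k. c * T f x $ j $ k)"
  using T unfolding bounded_operator_L1_def by blast

lemma bounded_operator_L1_bound: "\<exists>B\<ge>0. \<forall>f\<in>L1_space. L1_norm (T f) \<le> B * L1_norm f"
proof -
  obtain B where B: "\<forall>f\<in>L1_space. L1_norm (T f) \<le> B * L1_norm f"
    using T unfolding bounded_operator_L1_def by blast
  have "L1_norm (T f) \<le> max B 0 * L1_norm f" if "f \<in> L1_space" for f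
    using B that mult_right_mono[of B "max B 0" "L1_norm f"] L1_norm_nonneg[of f] by fastforce
  then show ?thesis by (intro exI[of _ "max B 0"]) auto
qed

lemma bounded_operator_L1_diff:
  assumes f: "f \<in> L1_space" and g: "g \<in> L1_space"
  shows "AE x in lebesgue. T (\<lambda>x. f x - g x) x = T f x - T g x"
proof -
  have "AE x in lebesgue. T (\<lambda>x. f x + (\<chi> j k. (-1) * g x $ j $ k)) x = T f x + T (\<lambda>x. \<chi> j k. (-1) * g x $ j $ k) x"
    by (rule bounded_operator_L1_add[OF f L1_space_scale[OF g]])
  moreover have "AE x in lebesgue. T (\<lambda>x. \<chi> j k. (-1) * g x $ j $ k) x = (\<chi> j k. (-1) * T g x $ j $ k)"
    by (rule bounded_operator_L1_scale[OF g])
  ultimately show ?thesis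
    unfolding diff_eq_add_scale by eventually_elim (simp add: vec_eq_iff)
qed

text \<open>The bound applied to \<open>f - g\<close>, which has norm 0, forces the image of the
  difference to vanish almost everywhere.\<close>

lemma bounded_operator_L1_cong:
  assumes f: "f \<in> L1_space" and g: "g \<in> L1_space" and eq: "AE x in lebesgue. f x = g x"
  shows "AE x in lebesgue. T f x = T g x"
proof -
  obtain B where B: "B \<ge> 0" "\<And>f. f \<in> L1_space \<Longrightarrow> L1_norm (T f) \<le> B * L1_norm f"
    using bounded_operator_L1_bound by blast
  have "L1_norm (\<lambda>x. f x - g x) = 0"
    unfolding L1_norm_def
  proof (rule integral_eq_zero_AE)
    show "AE x in lebesgue. mat_opnorm (f x - g x) = 0"
      using eq by eventually_elim (simp add: mat_opnorm_eq_0)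
  qed
  then have "L1_norm (T (\<lambda>x. f x - g x)) \<le> 0" using B(2)[OF L1_space_diff[OF f g]] by simp
  then have "L1_norm (T (\<lambda>x. f x - g x)) = 0" using L1_norm_nonneg[of "T (\<lambda>x. f x - g x)"] by simp
  then have "AE x in lebesgue. T (\<lambda>x. f x - g x) x = 0"
    by (intro L1_norm_eq_0 bounded_operator_L1_closed L1_space_diff f g)
  with bounded_operator_L1_diff[OF f g] show ?thesis by eventually_elim simp
qed

lemma bounded_operator_L1_norm_diff_tendsto:
  assumes f: "f \<in> L1_space" and s: "\<And>i. s i \<in> L1_space"
    and lim: "(\<lambda>i. L1_norm (\<lambda>x. s i x - f x)) \<longlonglongrightarrow> 0"
  shows "(\<lambda>i. L1_norm (\<lambda>x. T (s i) x - T f x)) \<longlonglongrightarrow> 0"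
proof -
  obtain B where B: "B \<ge> 0" "\<And>f. f \<in> L1_space \<Longrightarrow> L1_norm (T f) \<le> B * L1_norm f"
    using bounded_operator_L1_bound by blast
  have le: "L1_norm (\<lambda>x. T (s i) x - T f x) \<le> B * L1_norm (\<lambda>x. s i x - f x)" for i
  proof -
    have "L1_norm (T (\<lambda>x. s i x - f x)) = L1_norm (\<lambda>x. T (s i) x - T f x)"
      by (intro L1_norm_cong_AE bounded_operator_L1_closed L1_space_diff bounded_operator_L1_diff f s)
    then show ?thesis using B(2)[OF L1_space_diff[OF s f, of i]] by simp
  qed
  have "(\<lambda>i. B * L1_norm (\<lambda>x. s i x - f x)) \<longlonglongrightarrow> B * 0" by (intro tendsto_intros lim)
  then have "(\<lambda>i. B * L1_norm (\<lambda>x. s i x - f x)) \<longlonglongrightarrow> 0" by simp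
  then show ?thesis
    by (rule Lim_null_comparison[rotated]) (simp add: le L1_norm_nonneg)
qed

end

text \<open>The functions on which two extensions agree include all test functions and are closed
  under sums, multiples and limits in mean. Norm estimates for one concrete extension therefore hold
  for all.\<close>

lemma bounded_extension_unique:
  fixes T T' :: "(real^'n \<Rightarrow> complex^'m^'m) \<Rightarrow> real^'n \<Rightarrow> complex^'m^'m"
  assumes T: "bounded_extension_L1 F T" and T': "bounded_extension_L1 F T'" and f: "f \<in> L1_space"
  shows "AE x in lebesgue. T f x = T' f x"
  using f
proof (rule L1_space_induct)
  have B: "bounded_operator_L1 T" "bounded_operator_L1 T'" using T T' by (auto simp: bounded_extension_L1_def)
  note cl = bounded_operator_L1_closed[OF B(1)] bounded_operator_L1_closed[OF B(2)]
  show "AE x in lebesgue. T f x = T' f x" if "f \<in> C0_infty" for f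
  proof -
    have "AE x in lebesgue. T f x = multiplier F f x" "AE x in lebesgue. T' f x = multiplier F f x"
      using T T' that by (auto simp: bounded_extension_L1_def)
    then show ?thesis by eventually_elim simp
  qed
  show "AE x in lebesgue. T (\<lambda>x. f x + g x) x = T' (\<lambda>x. f x + g x) x"
    if "f \<in> L1_space" "g \<in> L1_space" "AE x in lebesgue. T f x = T' f x" "AE x in lebesgue. T g x = T' g x" for f g
  proof -
    have "AE x in lebesgue. T (\<lambda>x. f x + g x) x = T f x + T g x" "AE x in lebesgue. T' (\<lambda>x. f x + g x) x = T' f x + T' g x"
      by (rule bounded_operator_L1_add[OF B(1) that(1,2)], rule bounded_operator_L1_add[OF B(2) that(1,2)])
    then show ?thesis using that(3,4) by eventually_elim simp
  qed
  show "AE x in lebesgue. T (\<lambda>x. \<chi> j k. c * f x $ j $ k) x = T' (\<lambda>x. \<chi> j k. c * f x $ j $ k) x"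
    if "f \<in> L1_space" "AE x in lebesgue. T f x = T' f x" for f c
  proof -
    have "AE x in lebesgue. T (\<lambda>x. \<chi> j k. c * f x $ j $ k) x = (\<chi> j k. c * T f x $ j $ k)"
      "AE x in lebesgue. T' (\<lambda>x. \<chi> j k. c * f x $ j $ k) x = (\<chi> j k. c * T' f x $ j $ k)"
      by (rule bounded_operator_L1_scale[OF B(1) that(1)], rule bounded_operator_L1_scale[OF B(2) that(1)])
    then show ?thesis using that(2) by eventually_elim simp
  qed
  show "AE x in lebesgue. T g x = T' g x"
    if "f \<in> L1_space" "g \<in> L1_space" "AE x in lebesgue. f x = g x" "AE x in lebesgue. T f x = T' f x" for f g
    using bounded_operator_L1_cong[OF B(1) that(1-3)] bounded_operator_L1_cong[OF B(2) that(1-3)] that(4)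
    by eventually_elim simp
  show "AE x in lebesgue. T f x = T' f x"
    if h: "f \<in> L1_space" "\<And>i. s i \<in> L1_space" "\<And>i. AE x in lebesgue. T (s i) x = T' (s i) x"
      "(\<lambda>i. L1_norm (\<lambda>x. s i x - f x)) \<longlonglongrightarrow> 0" for f s
  proof -
    \<comment> \<open>The two images of \<open>f\<close> are compared through the common image of
      \<open>s i\<close>.\<close>
    have le: "L1_norm (\<lambda>x. T f x - T' f x) \<le> L1_norm (\<lambda>x. T (s i) x - T f x) + L1_norm (\<lambda>x. T' (s i) x - T' f x)" for i
    proof -
      have d: "(\<lambda>x. T f x - T (s i) x) \<in> L1_space" "(\<lambda>x. T' (s i) x - T' f x) \<in> L1_space"
        by (intro L1_space_diff cl h)+
      have "L1_norm (\<lambda>x. T f x - T' f x) = L1_norm (\<lambda>x. (T f x - T (s i) x) + (T' (s i) x - T' f x))"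
        using h(3)[of i] by (intro L1_norm_cong_AE L1_space_add d L1_space_diff cl h(1)) (auto elim: eventually_mono)
      also have "\<dots> \<le> L1_norm (\<lambda>x. T f x - T (s i) x) + L1_norm (\<lambda>x. T' (s i) x - T' f x)"
        by (rule L1_norm_triangle[OF d])
      also have "L1_norm (\<lambda>x. T f x - T (s i) x) = L1_norm (\<lambda>x. T (s i) x - T f x)"
      proof -
        have "mat_opnorm (A - B) = mat_opnorm (B - A)" for A B :: "complex^'m^'m"
        proof -
          have "(*v) (A - B) = (\<lambda>v. - ((B - A) *v v))"
            by (auto simp: fun_eq_iff matrix_vector_mult_diff_rdistrib)
          then show ?thesis unfolding mat_opnorm_def by (simp only: onorm_neg)
        qed
        then show ?thesis unfolding L1_norm_def by simp
      qed
      finally show ?thesis .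
    qed
    have "(\<lambda>i. L1_norm (\<lambda>x. T (s i) x - T f x) + L1_norm (\<lambda>x. T' (s i) x - T' f x)) \<longlonglongrightarrow> 0 + 0"
      by (intro tendsto_add bounded_operator_L1_norm_diff_tendsto[OF B(1)] bounded_operator_L1_norm_diff_tendsto[OF B(2)] h)
    then have "L1_norm (\<lambda>x. T f x - T' f x) \<le> 0 + 0"
      by (rule LIMSEQ_le_const) (use le in auto)
    then have "L1_norm (\<lambda>x. T f x - T' f x) = 0"
      using L1_norm_nonneg[of "\<lambda>x. T f x - T' f x"] by simp
    then have "AE x in lebesgue. T f x - T' f x = 0"
      by (intro L1_norm_eq_0 L1_space_diff cl h)
    then show ?thesis by eventually_elim simp
  qed
qed

lemma L1_entry_onorm_cong:
  fixes T T' :: "(real^'n \<Rightarrow> complex^'m^'m) \<Rightarrow> real^'n \<Rightarrow> complex^'m^'m"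
  assumes T: "bounded_extension_L1 F T" and T': "bounded_extension_L1 F T'"
  shows "L1_entry_onorm T = L1_entry_onorm T'"
proof -
  have B: "bounded_operator_L1 T" "bounded_operator_L1 T'" using T T' by (auto simp: bounded_extension_L1_def)
  have "L1_entry_norm (T f) = L1_entry_norm (T' f)" if "f \<in> L1_space" for f
    using that by (intro L1_entry_norm_cong_AE bounded_operator_L1_closed[OF B(1)] bounded_operator_L1_closed[OF B(2)]
        bounded_extension_unique[OF T T'])
  then show ?thesis unfolding L1_entry_onorm_def by (intro SUP_cong) auto
qed

section \<open>The multiplier on test functions, entry by entry\<close>

lemma fourier_const_pos: "0 < fourier_const TYPE('n::finite)"
  by (simp add: fourier_const_def)

text \<open>The two normalising factors in the multiplier cancel the \<open>(2 * pi) ^ n\<close>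
  produced by inverting the unnormalised transform.\<close>

lemma fourier_const_square: "(fourier_const TYPE('n::finite))\<^sup>2 * (2 * pi) ^ CARD('n) = 1"
proof -
  have "(fourier_const TYPE('n))\<^sup>2 = (2 * pi) powr (- real CARD('n))"
    by (simp add: fourier_const_def power2_eq_square powr_add[symmetric])
  also have "\<dots> * (2 * pi) ^ CARD('n) = 1"
  proof -
    have "(2 * pi) ^ CARD('n) = (2 * pi) powr real CARD('n)" by (rule powr_realpow[symmetric]) simp
    then show ?thesis by (simp only: powr_add[symmetric]) simp
  qed
  finally show ?thesis .
qed

lemma C0_infty_entry:
  fixes f :: "real^'n \<Rightarrow> complex^'m^'m"
  assumes f: "f \<in> C0_infty"
  shows "test_fun (\<lambda>x. f x $ j $ l)"
  unfolding test_fun_def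
proof (intro conjI allI)
  have bl: "bounded_linear (\<lambda>A :: complex^'m^'m. A $ j $ l)"
    by (rule bounded_linear_compose[OF bounded_linear_vec_nth[of l] bounded_linear_vec_nth[of j]])
  have "C_k k f" for k using f unfolding C0_infty_def by blast
  then show "C_k k (\<lambda>x. f x $ j $ l)" for k
    by (rule C_k_bounded_linear[OF bl])
  have "compact (closure {x. f x \<noteq> 0})" using f unfolding C0_infty_def by blast
  then have "bounded (closure {x. f x \<noteq> 0})" by (rule compact_imp_bounded)
  moreover have "{x. f x $ j $ l \<noteq> 0} \<subseteq> closure {x. f x \<noteq> 0}"
    using closure_subset[of "{x. f x \<noteq> 0}"] by auto
  ultimately have "bounded {x. f x $ j $ l \<noteq> 0}" by (rule bounded_subset)
  then show "compact (closure {x. f x $ j $ l \<noteq> 0})" by (simp add: compact_closure)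
qed

lemma integrable_lebesgueI: "integrable lborel f \<Longrightarrow> integrable lebesgue f"
  for f :: "'a::euclidean_space \<Rightarrow> 'b::{banach, second_countable_topology}"
  using integrable_completion[of f lborel] borel_measurable_integrable[of lborel f] by blast

lemma C0_infty_in_L1_space: "f \<in> C0_infty \<Longrightarrow> f \<in> L1_space"
proof -
  assume f: "f \<in> C0_infty"
  have "integrable lebesgue (\<lambda>x. f x $ j $ k)" for j k
    by (rule integrable_lebesgueI[OF test_fun_integrable[OF C0_infty_entry[OF f]]])
  then show ?thesis by (simp add: L1_space_iff)
qed

lemma exp_eq_cis: "exp (- \<i> * complex_of_real r) = cis (- r)" "exp (\<i> * complex_of_real r) = cis r"
  by (simp_all add: cis_conv_exp)

lemma integrable_ft_mult_bounded:
  assumes f: "test_fun f" and G: "G \<in> borel_measurable borel" "\<And>y. cmod (G y) \<le> K"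
  shows "integrable lborel (\<lambda>y. cis (x \<bullet> y) * (ft f y * G y))"
proof -
  note fi = ft_test_fun_integrable[OF f]
  have [measurable]: "ft f \<in> borel_measurable borel" "G \<in> borel_measurable borel"
    using borel_measurable_integrable[OF fi] G(1) by simp_all
  show ?thesis
  proof (rule Bochner_Integration.integrable_bound[OF integrable_mult_right[OF integrable_norm[OF fi], of K]])
    have "cmod (cis (x \<bullet> y) * (ft f y * G y)) \<le> K * cmod (ft f y)" for y
      using mult_left_mono[OF G(2)[of y], of "cmod (ft f y)"] by (simp add: norm_mult mult.commute)
    then show "AE y in lborel. norm (cis (x \<bullet> y) * (ft f y * G y)) \<le> norm (K * cmod (ft f y))"
      by (intro AE_I2) (metis abs_ge_self order.trans real_norm_def)
  qed measurable
qed

text \<open>\<open>F\<close> is only Lebesgue measurable; replacing its entries by bounded Borel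
  functions makes the scalar results applicable. The constant is squared because
  \<open>fourier\<close> and \<open>inverse_fourier\<close> contribute one factor each.\<close>

lemma multiplier_entry:
  fixes F :: "real^'n \<Rightarrow> complex^'m^'m"
  assumes F: "F \<in> borel_measurable lebesgue" and f: "f \<in> C0_infty"
    and G: "\<And>l k. G l k \<in> borel_measurable borel" "\<And>l k y. cmod (G l k y) \<le> K"
    and eq: "AE y in lebesgue. \<forall>l k. F y $ l $ k = G l k y"
  shows "multiplier F f x $ j $ k = complex_of_real ((fourier_const TYPE('n))\<^sup>2) *
    (\<Sum>l\<in>UNIV. LINT y|lborel. cis (x \<bullet> y) * (ft (\<lambda>x. f x $ j $ l) y * G l k y))"
proof -
  define c where "c = complex_of_real (fourier_const TYPE('n))"
  define \<phi> where "\<phi> l x = f x $ j $ l" for l x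
  have t: "test_fun (\<phi> l)" for l unfolding \<phi>_def by (rule C0_infty_entry[OF f])
  have four: "fourier f y $ j $ l = c * ft (\<phi> l) y" for y l
  proof -
    have m: "(\<lambda>x. cis (- (y \<bullet> x)) * \<phi> l x) \<in> borel_measurable lborel"
      using borel_measurable_integrable[OF test_fun_integrable[OF t[of l]]] by measurable
    show ?thesis
      unfolding fourier_def ft_def c_def exp_eq_cis \<phi>_def
      by (simp only: vec_lambda_beta integral_completion[OF m[unfolded \<phi>_def]])
  qed
  have ftm[measurable]: "ft (\<phi> l) \<in> borel_measurable borel" for l
    using borel_measurable_integrable[OF ft_test_fun_integrable[OF t]] by simp
  note [measurable] = G(1)
  define R where "R y = (\<Sum>l\<in>UNIV. c * (cis (x \<bullet> y) * (ft (\<phi> l) y * G l k y)))" for y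
  have Rm: "R \<in> borel_measurable lborel" unfolding R_def by measurable
  have entry_matrix: "(fourier f y ** F y) $ j $ k = (\<Sum>l\<in>UNIV. c * ft (\<phi> l) y * F y $ l $ k)" for y
    by (simp add: matrix_matrix_mult_def four)
  have "(LINT y|lebesgue. exp (\<i> * complex_of_real (x \<bullet> y)) * (fourier f y ** F y) $ j $ k) = (LINT y|lebesgue. R y)"
  proof (rule integral_cong_AE)
    have "(\<lambda>y. F y $ l $ k) \<in> borel_measurable lebesgue" for l
      using F borel_measurable_mat_iff by blast
    moreover have "ft (\<phi> l) \<in> borel_measurable lebesgue" for l
      by (intro measurable_completion) simp
    moreover have "(\<lambda>y. exp (\<i> * complex_of_real (x \<bullet> y))) \<in> borel_measurable lebesgue"
      by (intro measurable_completion) simp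
    ultimately show "(\<lambda>y. exp (\<i> * complex_of_real (x \<bullet> y)) * (fourier f y ** F y) $ j $ k) \<in> borel_measurable lebesgue"
      unfolding entry_matrix by (intro borel_measurable_times borel_measurable_sum borel_measurable_const)
    show "R \<in> borel_measurable lebesgue" by (rule measurable_completion[OF Rm])
    show "AE y in lebesgue. exp (\<i> * complex_of_real (x \<bullet> y)) * (fourier f y ** F y) $ j $ k = R y"
      using eq by eventually_elim (simp add: entry_matrix R_def exp_eq_cis sum_distrib_left mult_ac)
  qed
  also have "\<dots> = (LINT y|lborel. R y)" by (rule integral_completion[OF Rm])
  also have "\<dots> = (\<Sum>l\<in>UNIV. c * (LINT y|lborel. cis (x \<bullet> y) * (ft (\<phi> l) y * G l k y)))"
    unfolding R_def using integrable_ft_mult_bounded[OF t G(1) G(2)]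
    by (subst Bochner_Integration.integral_sum) auto
  finally show ?thesis
    unfolding multiplier_def inverse_fourier_def
    by (simp add: c_def \<phi>_def[abs_def] sum_distrib_left power2_eq_square mult.assoc)
qed

section \<open>Convolution with a matrix of measures\<close>

locale matrix_polar_decomposition =
  fixes \<mu> :: "(real^'n) set \<Rightarrow> complex^'m^'m" and M s
  assumes polar: "\<And>l k. polar_decomposition (\<lambda>E. \<mu> E $ l $ k) (M l k) (s l k)"
begin

lemma vec_polar: "vec_polar_decomposition (\<lambda>E. \<mu> E $ l $ k) (M l k) (s l k)"
  using polar by (simp add: vec_polar_decomposition_def)

definition V :: "'m \<Rightarrow> 'm \<Rightarrow> real" where "V l k = measure (M l k) UNIV"

lemma V_nonneg: "0 \<le> V l k" by (simp add: V_def)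

lemma total_variation_V: "enn2real (total_variation (\<lambda>E. \<mu> E $ l $ k) UNIV) = V l k"
proof -
  interpret polar_decomposition "\<lambda>E. \<mu> E $ l $ k" "M l k" "s l k" by (rule polar)
  show ?thesis unfolding total_variation_eq by (simp add: V_def emeasure_eq_measure)
qed

lemma measure_N_eq: "measure_N \<mu> = Max (range (\<lambda>(l, k). V l k))"
  unfolding measure_N_def total_variation_V ..

lemma V_le_N: "V l k \<le> measure_N \<mu>"
  unfolding measure_N_eq by (rule Max_ge) (auto intro: range_eqI[of _ _ "(l, k)"])

lemma N_attained: "\<exists>l k. measure_N \<mu> = V l k"
proof -
  have "Max (range (\<lambda>(l, k). V l k)) \<in> range (\<lambda>(l, k). V l k)" by (rule Max_in) auto
  then obtain p where "Max (range (\<lambda>(l, k). V l k)) = (\<lambda>(l, k). V l k) p" by (rule rangeE)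
  then show ?thesis unfolding measure_N_eq by (cases p) auto
qed

definition hat :: "'m \<Rightarrow> 'm \<Rightarrow> real^'n \<Rightarrow> complex" where
  "hat l k y = (LINT \<xi>|M l k. cis (- (y \<bullet> \<xi>)) * s l k \<xi>)"

lemma hat_eq: "hat l k = vec_polar_decomposition.fhat (M l k) (s l k)"
  by (auto simp: fun_eq_iff hat_def vec_polar_decomposition.fhat_def[OF vec_polar])

lemma hat_measurable: "hat l k \<in> borel_measurable borel"
proof -
  interpret polar_decomposition "\<lambda>E. \<mu> E $ l $ k" "M l k" "s l k" by (rule polar)
  show ?thesis unfolding hat_def by measurable
qed

lemma hat_bound: "cmod (hat l k y) \<le> V l k"
proof -
  interpret polar_decomposition "\<lambda>E. \<mu> E $ l $ k" "M l k" "s l k" by (rule polar)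
  have "cmod (hat l k y) \<le> (LINT \<xi>|M l k. cmod (cis (- (y \<bullet> \<xi>)) * s l k \<xi>))"
    unfolding hat_def by (rule integral_norm_bound)
  then show ?thesis by (simp add: norm_mult V_def)
qed

lemma measure_fourier_nth: "measure_fourier \<mu> y $ l $ k = complex_of_real (fourier_const TYPE('n)) * hat l k y"
proof -
  interpret polar_decomposition "\<lambda>E. \<mu> E $ l $ k" "M l k" "s l k" by (rule polar)
  have "complex_measure_integral (\<lambda>E. \<mu> E $ l $ k) (\<lambda>\<xi>. cis (- (y \<bullet> \<xi>))) = hat l k y"
    unfolding hat_def by (rule complex_measure_integral_eq[of _ 1]) auto
  then show ?thesis unfolding measure_fourier_def exp_eq_cis by simp
qed

text \<open>Row times column with \<open>f\<close> on the left, because the multiplier has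
  \<open>F\<close> on the right. The single constant is what remains of three normalising factors,
  two from the multiplier and one from \<open>measure_fourier\<close>, after inversion.\<close>

definition conv_op :: "(real^'n \<Rightarrow> complex^'m^'m) \<Rightarrow> real^'n \<Rightarrow> complex^'m^'m" where
  "conv_op f x = (\<chi> j k. complex_of_real (fourier_const TYPE('n)) *
     (\<Sum>l\<in>UNIV. conv (M l k) (s l k) (borel_version (\<lambda>x. f x $ j $ l)) x))"

text \<open>\<open>borel_version\<close> is an arbitrary choice; up to null sets it may be replaced
  by any integrable Borel representative that suits the computation.\<close>

lemma conv_op_nth_AE:
  assumes f: "f \<in> L1_space" and g: "\<And>l. integrable lborel (g l)" "\<And>l. AE x in lborel. f x $ j $ l = g l x"
  shows "AE x in lborel. conv_op f x $ j $ k = complex_of_real (fourier_const TYPE('n)) * (\<Sum>l\<in>UNIV. conv (M l k) (s l k) (g l) x)"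
proof -
  have "AE x in lborel. conv (M l k) (s l k) (borel_version (\<lambda>x. f x $ j $ l)) x = conv (M l k) (s l k) (g l) x" for l
  proof -
    interpret vec_polar_decomposition "\<lambda>E. \<mu> E $ l $ k" "M l k" "s l k" by (rule vec_polar)
    have b: "integrable lborel (borel_version (\<lambda>x. f x $ j $ l))" "AE x in lborel. f x $ j $ l = borel_version (\<lambda>x. f x $ j $ l) x"
      using f borel_version[of "\<lambda>x. f x $ j $ l"] by (auto simp: L1_space_iff)
    have "AE x in lborel. borel_version (\<lambda>x. f x $ j $ l) x = g l x"
      using b(2) g(2)[of l] by eventually_elim simp
    then show ?thesis by (rule conv_cong_AE[OF b(1) g(1)])
  qed
  then have "AE x in lborel. \<forall>l\<in>UNIV. conv (M l k) (s l k) (borel_version (\<lambda>x. f x $ j $ l)) x = conv (M l k) (s l k) (g l) x"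
    by (intro AE_finite_allI) auto
  then show ?thesis by eventually_elim (simp add: conv_op_def)
qed

lemma
  assumes f: "f \<in> L1_space"
  shows conv_op_in_L1_space: "conv_op f \<in> L1_space"
    and conv_op_entry_bound: "(LINT x|lebesgue. cmod (conv_op f x $ j $ k)) \<le>
      fourier_const TYPE('n) * (\<Sum>l\<in>UNIV. (LINT x|lebesgue. cmod (f x $ j $ l)) * V l k)"
proof -
  let ?b = "\<lambda>j l. borel_version (\<lambda>x. f x $ j $ l)"
  have fi: "integrable lebesgue (\<lambda>x. f x $ j $ l)" for j l using f L1_space_iff by blast
  have b: "integrable lborel (?b j l)" "AE x in lborel. f x $ j $ l = ?b j l x" for j l
    using borel_version[OF fi[of j l]] by auto
  have nb: "(LINT x|lborel. cmod (?b j l x)) = (LINT x|lebesgue. cmod (f x $ j $ l))" for j l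
  proof -
    have bm: "(\<lambda>x. cmod (?b j l x)) \<in> borel_measurable lborel" using b(1) by auto
    have "(LINT x|lborel. cmod (?b j l x)) = (LINT x|lebesgue. cmod (?b j l x))"
      by (rule integral_completion[OF bm, symmetric])
    also have "\<dots> = (LINT x|lebesgue. cmod (f x $ j $ l))"
    proof (rule integral_cong_AE)
      show "(\<lambda>x. cmod (?b j l x)) \<in> borel_measurable lebesgue" by (rule measurable_completion[OF bm])
      show "(\<lambda>x. cmod (f x $ j $ l)) \<in> borel_measurable lebesgue" using fi[of j l] by auto
      show "AE x in lebesgue. cmod (?b j l x) = cmod (f x $ j $ l)"
        using AE_completion[OF b(2)[of j l]] by eventually_elim simp
    qed
    finally show ?thesis .
  qed
  have ci: "integrable lborel (conv (M l k) (s l k) (?b j l))"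
    "(LINT x|lborel. cmod (conv (M l k) (s l k) (?b j l) x)) \<le> (LINT x|lborel. cmod (?b j l x)) * V l k" for l k j
    using vec_polar_decomposition.integrable_conv[OF vec_polar b(1)]
      vec_polar_decomposition.conv_norm_le[OF vec_polar b(1)] by (simp_all add: V_def)
  have si: "integrable lborel (\<lambda>x. conv_op f x $ j $ k)" for j k
    unfolding conv_op_def vec_lambda_beta by (intro integrable_mult_right Bochner_Integration.integrable_sum ci)
  then show "conv_op f \<in> L1_space"
    unfolding L1_space_iff by (blast intro: integrable_lebesgueI)
  have "(LINT x|lebesgue. cmod (conv_op f x $ j $ k)) = (LINT x|lborel. cmod (conv_op f x $ j $ k))"
    using si[of j k] by (intro integral_completion) auto
  also have "\<dots> \<le> (LINT x|lborel. fourier_const TYPE('n) * (\<Sum>l\<in>UNIV. cmod (conv (M l k) (s l k) (?b j l) x)))"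
  proof (rule integral_mono)
    show "integrable lborel (\<lambda>x. cmod (conv_op f x $ j $ k))" using si by auto
    show "integrable lborel (\<lambda>x. fourier_const TYPE('n) * (\<Sum>l\<in>UNIV. cmod (conv (M l k) (s l k) (?b j l) x)))"
      by (intro integrable_mult_right Bochner_Integration.integrable_sum integrable_norm ci)
    show "cmod (conv_op f x $ j $ k) \<le> fourier_const TYPE('n) * (\<Sum>l\<in>UNIV. cmod (conv (M l k) (s l k) (?b j l) x))" for x
      using fourier_const_pos[where ?'n='n]
      by (simp add: conv_op_def norm_mult) (intro mult_left_mono norm_sum; simp)
  qed
  also have "\<dots> = fourier_const TYPE('n) * (\<Sum>l\<in>UNIV. LINT x|lborel. cmod (conv (M l k) (s l k) (?b j l) x))"
    unfolding integral_mult_right_zero using ci(1) by (subst Bochner_Integration.integral_sum) auto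
  also have "\<dots> \<le> fourier_const TYPE('n) * (\<Sum>l\<in>UNIV. (LINT x|lebesgue. cmod (f x $ j $ l)) * V l k)"
    using fourier_const_pos[where ?'n='n] ci(2) by (intro mult_left_mono sum_mono) (auto simp: nb[symmetric])
  finally show "(LINT x|lebesgue. cmod (conv_op f x $ j $ k)) \<le>
      fourier_const TYPE('n) * (\<Sum>l\<in>UNIV. (LINT x|lebesgue. cmod (f x $ j $ l)) * V l k)" .
qed

text \<open>The entry \<open>(j, l)\<close> of \<open>f\<close> spreads over the entries
  \<open>(j, k)\<close> with weights \<open>V l k\<close>, so the growth of the entry norm is
  governed by the row sums of \<open>V\<close>.\<close>

lemma conv_op_entry_norm_le:
  assumes f: "f \<in> L1_space" and W: "\<And>l. (\<Sum>k\<in>UNIV. V l k) \<le> W"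
  shows "L1_entry_norm (conv_op f) \<le> fourier_const TYPE('n) * W * L1_entry_norm f"
proof -
  have "L1_entry_norm (conv_op f) \<le> (\<Sum>j\<in>UNIV. \<Sum>k\<in>UNIV. fourier_const TYPE('n) * (\<Sum>l\<in>UNIV. (LINT x|lebesgue. cmod (f x $ j $ l)) * V l k))"
    unfolding L1_entry_norm_def by (intro sum_mono conv_op_entry_bound f)
  also have "\<dots> = fourier_const TYPE('n) * (\<Sum>j\<in>UNIV. \<Sum>l\<in>UNIV. (LINT x|lebesgue. cmod (f x $ j $ l)) * (\<Sum>k\<in>UNIV. V l k))"
    unfolding sum_distrib_left[symmetric] by (subst sum.swap) (simp add: sum_distrib_left)
  also have "\<dots> \<le> fourier_const TYPE('n) * (\<Sum>j\<in>UNIV. \<Sum>l\<in>UNIV. (LINT x|lebesgue. cmod (f x $ j $ l)) * W)"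
    using fourier_const_pos[where ?'n='n] W by (intro mult_left_mono sum_mono) auto
  also have "\<dots> = fourier_const TYPE('n) * W * L1_entry_norm f"
    unfolding L1_entry_norm_def by (simp add: sum_distrib_left mult_ac)
  finally show ?thesis .
qed

lemma sum_V_le: "(\<Sum>k\<in>UNIV. V l k) \<le> real CARD('m) * measure_N \<mu>"
  using sum_mono[of UNIV "V l" "\<lambda>_. measure_N \<mu>"] V_le_N by simp

lemma conv_op_bounded: "bounded_operator_L1 conv_op"
  unfolding bounded_operator_L1_def
proof (intro conjI ballI allI)
  show "conv_op f \<in> L1_space" if "f \<in> L1_space" for f by (rule conv_op_in_L1_space[OF that])
  have br: "integrable lborel (borel_version (\<lambda>x. f x $ j $ l))" "AE x in lborel. f x $ j $ l = borel_version (\<lambda>x. f x $ j $ l) x"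
    if "f \<in> L1_space" for f :: "real^'n \<Rightarrow> complex^'m^'m" and j l
    using that borel_version[of "\<lambda>x. f x $ j $ l"] by (auto simp: L1_space_iff)
  have vecI: "AE x in lebesgue. A x = B x" if "\<And>j k. AE x in lborel. A x $ j $ k = B x $ j $ k" for A B :: "real^'n \<Rightarrow> complex^'m^'m"
  proof -
    have "AE x in lborel. \<forall>j\<in>UNIV. \<forall>k\<in>UNIV. A x $ j $ k = B x $ j $ k"
      by (intro AE_finite_allI) (auto intro: that)
    then have "AE x in lborel. A x = B x" by eventually_elim (simp add: vec_eq_iff)
    then show ?thesis by (rule AE_completion)
  qed
  show "AE x in lebesgue. conv_op (\<lambda>x. f x + g x) x = conv_op f x + conv_op g x" if f: "f \<in> L1_space" and g: "g \<in> L1_space" for f g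
  proof (rule vecI)
    fix j k
    let ?f = "\<lambda>l. borel_version (\<lambda>x. f x $ j $ l)" and ?g = "\<lambda>l. borel_version (\<lambda>x. g x $ j $ l)"
    have ae: "AE x in lborel. (f x + g x) $ j $ l = ?f l x + ?g l x" for l
      using br(2)[OF f, of j l] br(2)[OF g, of j l] by eventually_elim simp
    have 1: "AE x in lborel. conv_op (\<lambda>x. f x + g x) x $ j $ k = complex_of_real (fourier_const TYPE('n)) * (\<Sum>l\<in>UNIV. conv (M l k) (s l k) (\<lambda>x. ?f l x + ?g l x) x)"
      by (rule conv_op_nth_AE[OF L1_space_add[OF f g]]) (use br(1)[OF f] br(1)[OF g] ae in auto)
    have "AE x in lborel. conv (M l k) (s l k) (\<lambda>x. ?f l x + ?g l x) x = conv (M l k) (s l k) (?f l) x + conv (M l k) (s l k) (?g l) x" for l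
      by (rule vec_polar_decomposition.conv_add[OF vec_polar br(1)[OF f] br(1)[OF g]])
    then have "AE x in lborel. \<forall>l\<in>UNIV. conv (M l k) (s l k) (\<lambda>x. ?f l x + ?g l x) x = conv (M l k) (s l k) (?f l) x + conv (M l k) (s l k) (?g l) x"
      by (intro AE_finite_allI) auto
    with 1 show "AE x in lborel. conv_op (\<lambda>x. f x + g x) x $ j $ k = (conv_op f x + conv_op g x) $ j $ k"
      by eventually_elim (simp add: conv_op_def sum.distrib distrib_left)
  qed
  show "AE x in lebesgue. conv_op (\<lambda>x. \<chi> j k. c * f x $ j $ k) x = (\<chi> j k. c * conv_op f x $ j $ k)" if f: "f \<in> L1_space" for c f
  proof (rule vecI)
    fix j k
    let ?f = "\<lambda>l. borel_version (\<lambda>x. f x $ j $ l)"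
    have ae: "AE x in lborel. (\<chi> j k. c * f x $ j $ k) $ j $ l = c * ?f l x" for l
      using br(2)[OF f, of j l] by eventually_elim simp
    have 1: "AE x in lborel. conv_op (\<lambda>x. \<chi> j k. c * f x $ j $ k) x $ j $ k = complex_of_real (fourier_const TYPE('n)) * (\<Sum>l\<in>UNIV. conv (M l k) (s l k) (\<lambda>x. c * ?f l x) x)"
      by (rule conv_op_nth_AE[OF L1_space_scale[OF f]]) (use br(1)[OF f] ae in auto)
    then show "AE x in lborel. conv_op (\<lambda>x. \<chi> j k. c * f x $ j $ k) x $ j $ k = (\<chi> j k. c * conv_op f x $ j $ k) $ j $ k"
      by eventually_elim
        (simp add: conv_op_def vec_polar_decomposition.conv_cmult[OF vec_polar] sum_distrib_left mult_ac)
  qed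
  define W where "W = real CARD('m) * measure_N \<mu>"
  obtain l k where "measure_N \<mu> = V l k" using N_attained by blast
  then have W: "0 \<le> W" by (simp add: W_def V_nonneg)
  show "\<exists>B. \<forall>f\<in>L1_space. L1_norm (conv_op f) \<le> B * L1_norm f"
  proof (intro exI ballI)
    fix f :: "real^'n \<Rightarrow> complex^'m^'m" assume f: "f \<in> L1_space"
    have "L1_norm (conv_op f) \<le> L1_entry_norm (conv_op f)" by (intro L1_norm_le_L1_entry_norm conv_op_in_L1_space f)
    also have "\<dots> \<le> fourier_const TYPE('n) * W * L1_entry_norm f"
      unfolding W_def by (rule conv_op_entry_norm_le[OF f sum_V_le])
    also have "\<dots> \<le> fourier_const TYPE('n) * W * ((real CARD('m))\<^sup>2 * L1_norm f)"
      using W fourier_const_pos[where ?'n='n] by (intro mult_left_mono L1_entry_norm_le_L1_norm f) auto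
    finally show "L1_norm (conv_op f) \<le> (fourier_const TYPE('n) * W * (real CARD('m))\<^sup>2) * L1_norm f"
      by (simp add: mult.assoc)
  qed
qed

text \<open>On test functions, inversion turns the multiplier into convolution entry by entry, and
  test functions serve as their own Borel representatives.\<close>

lemma conv_op_extension:
  assumes F: "F \<in> borel_measurable lebesgue" and eq: "AE x in lebesgue. F x = measure_fourier \<mu> x"
  shows "bounded_extension_L1 F conv_op"
  unfolding bounded_extension_L1_def
proof (intro conjI ballI)
  show "bounded_operator_L1 conv_op" by (rule conv_op_bounded)
  fix f :: "real^'n \<Rightarrow> complex^'m^'m" assume f: "f \<in> C0_infty"
  define c where "c = complex_of_real (fourier_const TYPE('n))"
  have t: "test_fun (\<lambda>x. f x $ j $ l)" for j l by (rule C0_infty_entry[OF f])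
  have mult: "multiplier F f x $ j $ k = c * (\<Sum>l\<in>UNIV. conv (M l k) (s l k) (\<lambda>x. f x $ j $ l) x)" for x j k
  proof -
    have "multiplier F f x $ j $ k = complex_of_real ((fourier_const TYPE('n))\<^sup>2) *
      (\<Sum>l\<in>UNIV. LINT y|lborel. cis (x \<bullet> y) * (ft (\<lambda>x. f x $ j $ l) y * (c * hat l k y)))"
    proof (rule multiplier_entry[OF F f])
      show "(\<lambda>y. c * hat l k y) \<in> borel_measurable borel" for l k using hat_measurable[of l k] by measurable
      show "cmod (c * hat l k y) \<le> cmod c * measure_N \<mu>" for l k y
        using mult_left_mono[OF order.trans[OF hat_bound V_le_N], of "cmod c" l k y] by (simp add: norm_mult)
      show "AE y in lebesgue. \<forall>l k. F y $ l $ k = c * hat l k y"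
        using eq by eventually_elim (simp add: measure_fourier_nth c_def)
    qed
    also have "\<dots> = complex_of_real ((fourier_const TYPE('n))\<^sup>2) *
      (\<Sum>l\<in>UNIV. c * (complex_of_real ((2 * pi) ^ CARD('n)) * conv (M l k) (s l k) (\<lambda>x. f x $ j $ l) x))"
    proof -
      have "(LINT y|lborel. cis (x \<bullet> y) * (ft (\<lambda>x. f x $ j $ l) y * (c * hat l k y)))
        = (LINT y|lborel. c * (cis (x \<bullet> y) * (ft (\<lambda>x. f x $ j $ l) y * hat l k y)))" for l
        by (simp add: mult_ac)
      also have "\<dots> l = c * (complex_of_real ((2 * pi) ^ CARD('n)) * conv (M l k) (s l k) (\<lambda>x. f x $ j $ l) x)" for l
        unfolding integral_mult_right_zero hat_eq vec_polar_decomposition.conv_test_fun[OF vec_polar t] ..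
      finally show ?thesis by simp
    qed
    also have "\<dots> = complex_of_real ((fourier_const TYPE('n))\<^sup>2 * (2 * pi) ^ CARD('n)) *
       (c * (\<Sum>l\<in>UNIV. conv (M l k) (s l k) (\<lambda>x. f x $ j $ l) x))"
      by (simp add: sum_distrib_left mult_ac)
    finally show ?thesis by (simp only: fourier_const_square of_real_1 mult_1)
  qed
  have "AE x in lborel. conv_op f x $ j $ k = multiplier F f x $ j $ k" for j k
    using conv_op_nth_AE[OF C0_infty_in_L1_space[OF f], of "\<lambda>l x. f x $ j $ l" j k] test_fun_integrable[OF t]
    by (simp add: mult c_def)
  then have "AE x in lborel. \<forall>j\<in>UNIV. \<forall>k\<in>UNIV. conv_op f x $ j $ k = multiplier F f x $ j $ k"
    by (intro AE_finite_allI) auto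
  then have "AE x in lborel. conv_op f x = multiplier F f x" by eventually_elim (simp add: vec_eq_iff)
  then show "AE x in lebesgue. conv_op f x = multiplier F f x" by (rule AE_completion)
qed

text \<open>Boundedness of the quotients is recorded as well, since lower estimates of a real
  supremum require a set that is bounded above.\<close>

lemma conv_op_onorm_le:
  assumes W: "\<And>l. (\<Sum>k\<in>UNIV. V l k) \<le> W"
  shows "L1_entry_onorm conv_op \<le> fourier_const TYPE('n) * W"
    and "bdd_above ((\<lambda>f. L1_entry_norm (conv_op f) / L1_entry_norm f) ` L1_space)"
proof -
  \<comment> \<open>Any row gives \<open>0 \<le> W\<close>, which covers functions of norm 0, where
    the quotient is 0.\<close>
  have "0 \<le> (\<Sum>k\<in>UNIV. V undefined k)" by (intro sum_nonneg V_nonneg)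
  also have "\<dots> \<le> W" by (rule W)
  finally have "0 \<le> W" .
  have le: "L1_entry_norm (conv_op f) / L1_entry_norm f \<le> fourier_const TYPE('n) * W" if "f \<in> L1_space" for f
  proof (cases "L1_entry_norm f = 0")
    case True
    then show ?thesis using \<open>0 \<le> W\<close> fourier_const_pos[where ?'n='n] by simp
  next
    case False
    then have "0 < L1_entry_norm f" using L1_entry_norm_nonneg[of f] by simp
    then show ?thesis using conv_op_entry_norm_le[OF that W] by (simp add: divide_le_eq)
  qed
  show "bdd_above ((\<lambda>f. L1_entry_norm (conv_op f) / L1_entry_norm f) ` L1_space)"
    using le by (intro bdd_aboveI[of _ "fourier_const TYPE('n) * W"]) auto
  have "(\<lambda>_. 0) \<in> (L1_space :: (real^'n \<Rightarrow> complex^'m^'m) set)" by (simp add: L1_space_iff)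
  then have "(L1_space :: (real^'n \<Rightarrow> complex^'m^'m) set) \<noteq> {}" by blast
  then show "L1_entry_onorm conv_op \<le> fourier_const TYPE('n) * W"
    unfolding L1_entry_onorm_def by (intro cSUP_least le)
qed

text \<open>A mollifier in the diagonal entry \<open>(l, l)\<close> has norm 1, and row
  \<open>l\<close> of its image consists, up to the constant, of the mollified entries of row
  \<open>l\<close> of \<open>\<mu>\<close>, whose norms are eventually close to
  \<open>V l k\<close>.\<close>

lemma conv_op_onorm_ge: "fourier_const TYPE('n) * (\<Sum>k\<in>UNIV. V l k) \<le> L1_entry_onorm conv_op"
proof (rule field_le_epsilon)
  fix e :: real assume "e > 0"
  define c where "c = fourier_const TYPE('n)"
  have c: "c > 0" by (simp add: c_def fourier_const_pos)
  \<comment> \<open>The \<open>m\<close> entries of the row each lose \<open>c * e'\<close>, which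
    adds up to \<open>e\<close>.\<close>
  define e' where "e' = e / (c * real CARD('m))"
  have e': "e' > 0" using \<open>e > 0\<close> c by (simp add: e'_def)
  define m where "m i x = complex_of_real (mollifier i x)" for i and x :: "real^'n"
  have mi: "integrable lborel (m i)" for i unfolding m_def by (intro integrable_of_real integrable_mollifier)
  \<comment> \<open>There are finitely many columns, so one index \<open>i\<close> serves them
    all.\<close>
  have "\<forall>\<^sub>F i in sequentially. \<forall>k\<in>UNIV. V l k - e' < (LINT x|lborel. cmod (conv (M l k) (s l k) (m i) x))"
    unfolding m_def V_def
    by (intro eventually_ball_finite ballI vec_polar_decomposition.eventually_conv_mollifier_ge[OF vec_polar e']) simp
  then obtain i where i: "\<And>k. V l k - e' < (LINT x|lborel. cmod (conv (M l k) (s l k) (m i) x))"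
    by (auto simp: eventually_sequentially)
  define f where "f x = entry_matrix l l (m i x)" for x
  have f: "f \<in> L1_space" unfolding f_def by (rule entry_matrix_in_L1_space[OF mi])
  have nf: "L1_entry_norm f = 1"
    unfolding f_def L1_entry_norm_entry_matrix[OF mi] by (simp add: m_def mollifier_nonneg integral_mollifier)
  have "(LINT x|lebesgue. cmod (conv_op f x $ l $ k)) = c * (LINT x|lborel. cmod (conv (M l k) (s l k) (m i) x))" for k
  proof -
    have "AE x in lborel. conv_op f x $ l $ k = complex_of_real (fourier_const TYPE('n)) *
       (\<Sum>l'\<in>UNIV. conv (M l' k) (s l' k) (if l' = l then m i else (\<lambda>_. 0)) x)"
      by (rule conv_op_nth_AE[OF f]) (auto simp: f_def entry_matrix_nth mi)
    moreover have "(\<Sum>l'\<in>UNIV. conv (M l' k) (s l' k) (if l' = l then m i else (\<lambda>_. 0)) x) = conv (M l k) (s l k) (m i) x" for x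
    proof -
      have "(\<Sum>l'\<in>UNIV. conv (M l' k) (s l' k) (if l' = l then m i else (\<lambda>_. 0)) x)
        = (\<Sum>l'\<in>UNIV. if l' = l then conv (M l k) (s l k) (m i) x else 0)"
        by (intro sum.cong refl) (auto simp: conv_def)
      then show ?thesis by simp
    qed
    ultimately have ae: "AE x in lborel. conv_op f x $ l $ k = complex_of_real c * conv (M l k) (s l k) (m i) x"
      by (simp add: c_def)
    have ci: "integrable lborel (conv (M l k) (s l k) (m i))"
      by (rule vec_polar_decomposition.integrable_conv[OF vec_polar mi])
    have cm: "(\<lambda>x. cmod (complex_of_real c * conv (M l k) (s l k) (m i) x)) \<in> borel_measurable lborel"
      using borel_measurable_integrable[OF ci] by measurable
    have "(LINT x|lebesgue. cmod (conv_op f x $ l $ k)) = (LINT x|lebesgue. cmod (complex_of_real c * conv (M l k) (s l k) (m i) x))"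
    proof (rule integral_cong_AE)
      have "integrable lebesgue (\<lambda>x. conv_op f x $ l $ k)" using conv_op_in_L1_space[OF f] L1_space_iff by blast
      then show "(\<lambda>x. cmod (conv_op f x $ l $ k)) \<in> borel_measurable lebesgue" by auto
      show "(\<lambda>x. cmod (complex_of_real c * conv (M l k) (s l k) (m i) x)) \<in> borel_measurable lebesgue"
        by (rule measurable_completion[OF cm])
      show "AE x in lebesgue. cmod (conv_op f x $ l $ k) = cmod (complex_of_real c * conv (M l k) (s l k) (m i) x)"
        using AE_completion[OF ae] by eventually_elim simp
    qed
    also have "\<dots> = (LINT x|lborel. cmod (complex_of_real c * conv (M l k) (s l k) (m i) x))"
      by (rule integral_completion[OF cm])
    also have "\<dots> = c * (LINT x|lborel. cmod (conv (M l k) (s l k) (m i) x))"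
      using c by (simp add: norm_mult)
    finally show ?thesis .
  qed
  then have "(\<Sum>k\<in>UNIV. c * (V l k - e')) \<le> (\<Sum>k\<in>UNIV. LINT x|lebesgue. cmod (conv_op f x $ l $ k))"
    using i c by (intro sum_mono) (auto intro!: mult_left_mono less_imp_le)
  also have "\<dots> \<le> L1_entry_norm (conv_op f)"
    unfolding L1_entry_norm_def
    by (rule member_le_sum) (auto intro!: sum_nonneg Bochner_Integration.integral_nonneg)
  also have "\<dots> = L1_entry_norm (conv_op f) / L1_entry_norm f" using nf by simp
  also have "\<dots> \<le> L1_entry_onorm conv_op"
    unfolding L1_entry_onorm_def by (rule cSUP_upper[OF f conv_op_onorm_le(2)[OF sum_V_le]])
  finally have "(\<Sum>k\<in>UNIV. c * (V l k - e')) \<le> L1_entry_onorm conv_op" .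
  moreover have "(\<Sum>k\<in>(UNIV::'m set). c * (V l k - e')) = c * (\<Sum>k\<in>UNIV. V l k) - e"
    using c by (simp add: right_diff_distrib sum_subtractf sum_distrib_left e'_def)
  ultimately show "fourier_const TYPE('n) * (\<Sum>k\<in>UNIV. V l k) \<le> L1_entry_onorm conv_op + e"
    by (simp add: c_def)
qed

end

lemma ex_matrix_polar:
  assumes "\<mu> \<in> matrix_measures"
  shows "\<exists>M s. matrix_polar_decomposition \<mu> M s"
proof -
  have "\<forall>l k. \<exists>M s. polar_decomposition (\<lambda>E. \<mu> E $ l $ k) M s"
    using assms by (intro allI complex_measure_ex_polar) (simp add: matrix_measures_def)
  then obtain M where "\<forall>l k. \<exists>s. polar_decomposition (\<lambda>E. \<mu> E $ l $ k) (M l k) s" by metis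
  then obtain s where "\<forall>l k. polar_decomposition (\<lambda>E. \<mu> E $ l $ k) (M l k) (s l k)" by metis
  then show ?thesis by (auto simp: matrix_polar_decomposition_def)
qed

section \<open>From a bounded extension to a measure\<close>

lemma Linfty_space_entries:
  fixes F :: "real^'n \<Rightarrow> complex^'m^'m"
  assumes F: "F \<in> Linfty_space"
  shows "\<exists>G K. (\<forall>l k. G l k \<in> borel_measurable borel) \<and> (\<forall>l k y. cmod (G l k y) \<le> K) \<and>
    (AE y in lebesgue. \<forall>l k. F y $ l $ k = G l k y)"
proof -
  define E where "E = esssup lebesgue (\<lambda>x. ereal (mat_opnorm (F x)))"
  have "E < \<infinity>" using F by (simp add: Linfty_space_def E_def)
  then have "E \<le> ereal (real_of_ereal E) \<or> E = -\<infinity>" by (cases E) auto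
  then obtain K0 where K0: "E \<le> ereal K0" by (metis ereal_infty_less_eq(2) ereal_less_eq(2))
  \<comment> \<open>The maximum with 0 keeps the bound valid at the points where \<open>G\<close> is
    set to 0.\<close>
  define K where "K = max K0 0"
  have Fm: "F \<in> borel_measurable lebesgue" using F by (simp add: Linfty_space_def)
  have "AE x in lebesgue. ereal (mat_opnorm (F x)) \<le> E"
    unfolding E_def by (rule esssup_AE)
  then have aeK: "AE x in lebesgue. mat_opnorm (F x) \<le> K"
  proof eventually_elim
    case (elim x)
    then have "ereal (mat_opnorm (F x)) \<le> ereal K0" using K0 by (rule order.trans)
    then show ?case by (simp add: K_def)
  qed
  define P where "P l k H \<longleftrightarrow> H \<in> borel_measurable borel \<and> (AE x in lborel. F x $ l $ k = H x)" for l k H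
  define H where "H l k = (SOME H. P l k H)" for l k
  have PH: "P l k (H l k)" for l k
    unfolding H_def
  proof (rule someI_ex[of "P l k"])
    have "(\<lambda>x. F x $ l $ k) \<in> borel_measurable lebesgue" using Fm borel_measurable_mat_iff by blast
    from integrable_lebesgue_ex_borel[OF this]
    show "\<exists>H. P l k H" by (auto simp: P_def)
  qed
  have H: "H l k \<in> borel_measurable borel" "AE x in lborel. F x $ l $ k = H l k x" for l k
    using PH[of l k] by (auto simp: P_def)
  define G where "G l k y = (if cmod (H l k y) \<le> K then H l k y else 0)" for l k y
  have Gm: "G l k \<in> borel_measurable borel" for l k
    unfolding G_def using H(1)[of l k] by measurable
  have GK: "cmod (G l k y) \<le> K" for l k y by (simp add: G_def K_def)
  have "AE y in lborel. \<forall>l\<in>UNIV. \<forall>k\<in>UNIV. F y $ l $ k = H l k y"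
    by (intro AE_finite_allI) (auto intro: H)
  from AE_completion[OF this] aeK have "AE y in lebesgue. \<forall>l k. F y $ l $ k = G l k y"
  proof eventually_elim
    case (elim y)
    have "cmod (F y $ l $ k) \<le> K" for l k using cmod_entry_le_mat_opnorm[of "F y" l k] elim(2) by linarith
    then show ?case using elim(1) by (simp add: G_def)
  qed
  then show ?thesis using Gm GK by blast
qed

text \<open>A mollifier in entry \<open>(l, l)\<close> isolates one entry of \<open>F\<close>: entry
  \<open>(l, k)\<close> of its image is, up to \<open>c^2\<close>, the inverse transform of
  \<open>ft (m i)\<close> times \<open>G l k\<close>. Boundedness of \<open>T\<close> supplies the
  uniform \<open>L^1\<close> bound needed for \<open>multiplier_ex_measure\<close>.\<close>

lemma extension_imp_measure:
  fixes F :: "real^'n \<Rightarrow> complex^'m^'m"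
  assumes F: "F \<in> Linfty_space" and T: "bounded_extension_L1 F T"
  shows "\<exists>\<mu>\<in>matrix_measures. AE x in lebesgue. F x = measure_fourier \<mu> x"
proof -
  obtain G K where G: "\<And>l k. G l k \<in> borel_measurable borel" "\<And>l k y. cmod (G l k y) \<le> K"
    and FG: "AE y in lebesgue. \<forall>l k. F y $ l $ k = G l k y"
    using Linfty_space_entries[OF F] by blast
  have Fm: "F \<in> borel_measurable lebesgue" using F by (simp add: Linfty_space_def)
  have B: "bounded_operator_L1 T" using T by (simp add: bounded_extension_L1_def)
  obtain C where C: "C \<ge> 0" "\<And>f. f \<in> L1_space \<Longrightarrow> L1_norm (T f) \<le> C * L1_norm f"
    using bounded_operator_L1_bound[OF B] by blast
  define c where "c = fourier_const TYPE('n)"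
  have c: "c > 0" by (simp add: c_def fourier_const_pos)
  define m where "m i x = complex_of_real (mollifier i x)" for i and x :: "real^'n"
  have mi: "integrable lborel (m i)" for i unfolding m_def by (intro integrable_of_real integrable_mollifier)
  have tm: "test_fun (m i)" for i unfolding m_def[abs_def] by (rule test_fun_mollifier)
  have "\<exists>L h. finite_measure L \<and> sets L = sets borel \<and> integrable L h \<and>
    (AE y in lborel. G l k y = (LINT \<xi>|L. cis (- (y \<bullet> \<xi>)) * h \<xi>))" for l k
  proof -
    define g where "g i x = (LINT y|lborel. cis (x \<bullet> y) * (ft (m i) y * G l k y))" for i x
    \<comment> \<open>\<open>1 / c^2\<close> compensates the two normalising constants inside the
      multiplier; \<open>C\<close> is the operator bound, and the mollifier has norm at most
      1.\<close>
    have main: "integrable lborel (g i) \<and> (LINT x|lborel. cmod (g i x)) \<le> C / c\<^sup>2" for i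
    proof -
      define f where "f x = entry_matrix l l (m i x)" for x
      have "\<exists>r k a b. (mollifier i :: real^'n \<Rightarrow> real) = (\<lambda>x. r * bump k a b x)"
        using mollifier_eq_bump[where ?'n='n and i=i] by blast
      then obtain r k' a b where mb: "(mollifier i :: real^'n \<Rightarrow> real) = (\<lambda>x. r * bump k' a b x)" by blast
      have "f = (\<lambda>x. bump k' a b x *\<^sub>R entry_matrix l l (complex_of_real r))"
        by (auto simp: fun_eq_iff vec_eq_iff f_def entry_matrix_nth m_def mb scaleR_conv_of_real[where ?'a=complex])
      then have f: "f \<in> C0_infty" using C0_infty_bump by metis
      note fL = C0_infty_in_L1_space[OF f]
      have nf: "L1_norm f \<le> 1"
      proof -
        have "L1_norm f \<le> L1_entry_norm f" by (rule L1_norm_le_L1_entry_norm[OF fL])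
        also have "\<dots> = 1"
          unfolding f_def L1_entry_norm_entry_matrix[OF mi] by (simp add: m_def mollifier_nonneg integral_mollifier)
        finally show ?thesis .
      qed
      have mult: "multiplier F f x $ l $ k = complex_of_real (c\<^sup>2) * g i x" for x
      proof -
        have "(\<Sum>l'\<in>UNIV. LINT y|lborel. cis (x \<bullet> y) * (ft (\<lambda>x. f x $ l $ l') y * G l' k y))
          = (\<Sum>l'\<in>UNIV. if l' = l then g i x else 0)"
        proof (intro sum.cong refl)
          fix l'
          have "(\<lambda>x. f x $ l $ l') = (if l' = l then m i else (\<lambda>_. 0))" by (auto simp: f_def entry_matrix_nth fun_eq_iff)
          moreover have "ft (\<lambda>_::real^'n. 0) y = 0" for y by (simp add: ft_def)
          ultimately show "(LINT y|lborel. cis (x \<bullet> y) * (ft (\<lambda>x. f x $ l $ l') y * G l' k y)) = (if l' = l then g i x else 0)"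
            by (simp add: g_def)
        qed
        then show ?thesis unfolding multiplier_entry[OF Fm f G FG] by (simp add: c_def)
      qed
      have ext: "AE x in lebesgue. T f x = multiplier F f x"
        using T f unfolding bounded_extension_L1_def by blast
      have Tf: "T f \<in> L1_space" by (rule bounded_operator_L1_closed[OF B fL])
      have iT: "integrable lebesgue (\<lambda>x. T f x $ l $ k)" using Tf L1_space_iff by blast
      have ae: "AE x in lebesgue. g i x = complex_of_real (1 / c\<^sup>2) * T f x $ l $ k"
        using ext by eventually_elim (use c in \<open>simp add: mult\<close>)
      have gm: "g i \<in> borel_measurable lborel"
      proof -
        have [measurable]: "ft (m i) \<in> borel_measurable borel" "G l k \<in> borel_measurable borel"
          using borel_measurable_integrable[OF ft_test_fun_integrable[OF tm]] G(1) by simp_all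
        show ?thesis unfolding g_def by measurable
      qed
      have gml: "g i \<in> borel_measurable lebesgue" by (rule measurable_completion[OF gm])
      have i1: "integrable lebesgue (\<lambda>x. complex_of_real (1 / c\<^sup>2) * T f x $ l $ k)"
        using iT by (rule integrable_mult_right)
      have gi: "integrable lebesgue (g i)"
        using integrable_cong_AE[OF gml borel_measurable_integrable[OF i1] ae] i1 by (rule iffD2)
      have gib: "integrable lborel (g i)" using gi integrable_completion[OF gm] by blast
      have cgm: "(\<lambda>x. cmod (g i x)) \<in> borel_measurable lborel" using gib by auto
      have "(LINT x|lborel. cmod (g i x)) = (LINT x|lebesgue. cmod (g i x))"
        by (rule integral_completion[OF cgm, symmetric])
      also have "\<dots> = (LINT x|lebesgue. (1 / c\<^sup>2) * cmod (T f x $ l $ k))"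
      proof (rule integral_cong_AE)
        show "(\<lambda>x. cmod (g i x)) \<in> borel_measurable lebesgue" by (rule measurable_completion[OF cgm])
        show "(\<lambda>x. (1 / c\<^sup>2) * cmod (T f x $ l $ k)) \<in> borel_measurable lebesgue"
          using iT by auto
        show "AE x in lebesgue. cmod (g i x) = (1 / c\<^sup>2) * cmod (T f x $ l $ k)"
          using ae by eventually_elim (simp add: norm_mult norm_divide norm_power)
      qed
      also have "\<dots> = (1 / c\<^sup>2) * (LINT x|lebesgue. cmod (T f x $ l $ k))" by (rule integral_mult_right_zero)
      also have "\<dots> \<le> (1 / c\<^sup>2) * (C * 1)"
      proof (rule mult_left_mono)
        have "(LINT x|lebesgue. cmod (T f x $ l $ k)) \<le> L1_norm (T f)" by (rule L1_entry_le_L1_norm[OF Tf])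
        also have "\<dots> \<le> C * L1_norm f" by (rule C(2)[OF fL])
        also have "\<dots> \<le> C * 1" using C(1) nf by (rule mult_left_mono[rotated])
        finally show "(LINT x|lebesgue. cmod (T f x $ l $ k)) \<le> C * 1" .
      qed simp
      finally show ?thesis using gib by simp
    qed
    show ?thesis
    proof (rule multiplier_ex_measure[OF G])
      show "integrable lborel (\<lambda>x. LINT y|lborel. cis (x \<bullet> y) * (ft (\<lambda>x. complex_of_real (mollifier i x)) y * G l k y))" for i
        using main[of i] unfolding g_def m_def[abs_def] by blast
      show "(LINT x|lborel. cmod (LINT y|lborel. cis (x \<bullet> y) * (ft (\<lambda>x. complex_of_real (mollifier i x)) y * G l k y))) \<le> C / c\<^sup>2" for i
        using main[of i] unfolding g_def m_def[abs_def] by blast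
    qed
  qed
  note ex = this
  define P where "P l k q \<longleftrightarrow> finite_measure (fst q) \<and> sets (fst q) = sets borel \<and> integrable (fst q) (snd q) \<and>
    (AE y in lborel. G l k y = (LINT \<xi>|fst q. cis (- (y \<bullet> \<xi>)) * snd q \<xi>))" for l k and q :: "(real^'n) measure \<times> (real^'n \<Rightarrow> complex)"
  define L where "L l k = fst (SOME q. P l k q)" for l k
  define h where "h l k = snd (SOME q. P l k q)" for l k
  have "P l k (SOME q. P l k q)" for l k
  proof (rule someI_ex[of "P l k"])
    obtain L h where "finite_measure L \<and> sets L = sets borel \<and> integrable L h \<and>
      (AE y in lborel. G l k y = (LINT \<xi>|L. cis (- (y \<bullet> \<xi>)) * h \<xi>))"
      using ex[of l k] by (elim exE)
    then have "P l k (L, h)" by (simp add: P_def)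
    then show "\<exists>q. P l k q" by (rule exI)
  qed
  then have Lh: "\<forall>l k. finite_measure (L l k) \<and> sets (L l k) = sets borel \<and> integrable (L l k) (h l k) \<and>
    (AE y in lborel. G l k y = (LINT \<xi>|L l k. cis (- (y \<bullet> \<xi>)) * h l k \<xi>))"
    by (simp add: P_def L_def h_def)
  \<comment> \<open>Division by \<open>c\<close> anticipates the normalising constant in
    \<open>measure_fourier\<close>.\<close>
  define \<mu> :: "(real^'n) set \<Rightarrow> complex^'m^'m"
    where "\<mu> E = (\<chi> l k. LINT \<xi>:E|L l k. h l k \<xi> / complex_of_real c)" for E
  have ih: "integrable (L l k) (\<lambda>\<xi>. h l k \<xi> / complex_of_real c)" for l k using Lh by auto
  have "\<mu> \<in> matrix_measures"
    unfolding matrix_measures_def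
  proof (intro CollectI allI)
    fix l k
    show "complex_measure (\<lambda>E. \<mu> E $ l $ k)"
      by (rule complex_measureI_density[of "L l k" "\<lambda>\<xi>. h l k \<xi> / complex_of_real c"])
        (use Lh ih in \<open>auto simp: \<mu>_def\<close>)
  qed
  moreover have "AE x in lebesgue. F x = measure_fourier \<mu> x"
  proof -
    have mf: "measure_fourier \<mu> y $ l $ k = (LINT \<xi>|L l k. cis (- (y \<bullet> \<xi>)) * h l k \<xi>)" for y l k
    proof -
      have "complex_measure_integral (\<lambda>E. \<mu> E $ l $ k) (\<lambda>\<xi>. cis (- (y \<bullet> \<xi>)))
        = (LINT \<xi>|L l k. cis (- (y \<bullet> \<xi>)) * (h l k \<xi> / complex_of_real c))"
        by (rule complex_measure_integral_density[where B = 1]) (use Lh ih in \<open>auto simp: \<mu>_def\<close>)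
      also have "\<dots> = (LINT \<xi>|L l k. cis (- (y \<bullet> \<xi>)) * h l k \<xi>) / complex_of_real c" by simp
      finally have "complex_measure_integral (\<lambda>E. \<mu> E $ l $ k) (\<lambda>\<xi>. cis (- (y \<bullet> \<xi>)))
        = (LINT \<xi>|L l k. cis (- (y \<bullet> \<xi>)) * h l k \<xi>) / complex_of_real c" .
      then show ?thesis unfolding measure_fourier_def exp_eq_cis vec_lambda_beta c_def[symmetric] using c by simp
    qed
    have "AE y in lborel. \<forall>l\<in>UNIV. \<forall>k\<in>UNIV. G l k y = (LINT \<xi>|L l k. cis (- (y \<bullet> \<xi>)) * h l k \<xi>)"
      by (intro AE_finite_allI) (use Lh in auto)
    from AE_completion[OF this] FG show ?thesis
      by eventually_elim (simp add: vec_eq_iff mf)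
  qed
  ultimately show ?thesis by (intro bexI[of _ \<mu>])
qed

section \<open>Norm bounds and their sharpness\<close>

lemma measure_imp_extension_onorm:
  fixes F :: "real^'n \<Rightarrow> complex^'m^'m"
  assumes F: "F \<in> borel_measurable lebesgue" and \<mu>: "\<mu> \<in> matrix_measures"
    and eq: "AE x in lebesgue. F x = measure_fourier \<mu> x"
  shows "\<exists>T. bounded_extension_L1 F T"
    and "bounded_extension_L1 F T \<Longrightarrow> fourier_const TYPE('n) * measure_N \<mu> \<le> L1_entry_onorm T"
    and "bounded_extension_L1 F T \<Longrightarrow> L1_entry_onorm T \<le> real CARD('m) * fourier_const TYPE('n) * measure_N \<mu>"
proof -
  obtain M s where "matrix_polar_decomposition \<mu> M s" using ex_matrix_polar[OF \<mu>] by blast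
  then interpret matrix_polar_decomposition \<mu> M s .
  note ext = conv_op_extension[OF F eq]
  show "\<exists>T. bounded_extension_L1 F T" using ext by blast
  show "fourier_const TYPE('n) * measure_N \<mu> \<le> L1_entry_onorm T" if "bounded_extension_L1 F T"
  proof -
    obtain l k where N: "measure_N \<mu> = V l k" using N_attained by blast
    \<comment> \<open>The largest entry is at most its row sum, which gives the lower constant; for
      the upper one, a row has \<open>m\<close> entries, each at most
      \<open>measure_N \<mu>\<close>.\<close>
    have "V l k \<le> (\<Sum>k\<in>UNIV. V l k)" by (rule member_le_sum) (auto simp: V_nonneg)
    then have "fourier_const TYPE('n) * measure_N \<mu> \<le> fourier_const TYPE('n) * (\<Sum>k\<in>UNIV. V l k)"
      unfolding N using fourier_const_pos[where ?'n='n] by (intro mult_left_mono) auto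
    also have "\<dots> \<le> L1_entry_onorm conv_op" by (rule conv_op_onorm_ge)
    finally show ?thesis using L1_entry_onorm_cong[OF that ext] by simp
  qed
  show "L1_entry_onorm T \<le> real CARD('m) * fourier_const TYPE('n) * measure_N \<mu>" if "bounded_extension_L1 F T"
    using conv_op_onorm_le(1)[OF sum_V_le] L1_entry_onorm_cong[OF that ext] by (simp add: mult_ac)
qed

text \<open>A single entry attains the lower constant and the full matrix the upper one.\<close>

definition delta_matrix :: "('m \<times> 'm) set \<Rightarrow> (real^'n) set \<Rightarrow> complex^'m^'m" where
  "delta_matrix S E = (\<chi> l k. if (l, k) \<in> S \<and> 0 \<in> E then 1 else 0)"

definition delta_polar :: "('m \<times> 'm) set \<Rightarrow> 'm \<Rightarrow> 'm \<Rightarrow> (real^'n) measure" where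
  "delta_polar S l k = (if (l, k) \<in> S then return borel 0 else null_measure borel)"

text \<open>A unit point mass has phase 1, and for entries outside \<open>S\<close> the null measure
  admits the same constant phase.\<close>

lemma delta_matrix_polar: "matrix_polar_decomposition (delta_matrix S) (delta_polar S) (\<lambda>_ _ _. 1)"
proof (unfold matrix_polar_decomposition_def, intro allI)
  fix l k
  show "polar_decomposition (\<lambda>E. delta_matrix S E $ l $ k) (delta_polar S l k) (\<lambda>_. 1)"
  proof (cases "(l, k) \<in> S")
    case True
    interpret prob_space "return borel (0 :: real^'n)" by (rule prob_space_return) simp
    show ?thesis
      unfolding delta_polar_def using True
      by (simp, intro polar_decomposition.intro polar_decomposition_axioms.intro finite_measure_axioms)
        (auto simp: delta_matrix_def set_lebesgue_integral_def integral_return indicator_def)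
  next
    case False
    have "finite_measure (null_measure (borel :: (real^'n) measure))" by (rule finite_measureI) simp
    then show ?thesis
      unfolding delta_polar_def using False
      by (simp, intro polar_decomposition.intro polar_decomposition_axioms.intro)
        (auto simp: delta_matrix_def set_lebesgue_integral_def integral_null_measure)
  qed
qed

lemma delta_matrix_measures: "delta_matrix S \<in> matrix_measures"
  unfolding matrix_measures_def
proof (intro CollectI allI)
  fix l k
  interpret polar_decomposition "\<lambda>E. delta_matrix S E $ l $ k" "delta_polar S l k" "\<lambda>_. 1"
    using matrix_polar_decomposition.polar[OF delta_matrix_polar] .
  show "complex_measure (\<lambda>E. delta_matrix S E $ l $ k)"
    by (rule complex_measureI_density[OF finite_measure_axioms sets_eq integrable_bounded[of _ 1] eq]) auto
qed

text \<open>Row sums of the total variations are the row counts of \<open>S\<close>, so the norm is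
  \<open>fourier_const\<close> times the largest count. The quantifier over \<open>W\<close>
  expresses the upper bound without naming that maximum.\<close>

lemma delta_matrix_extension:
  fixes S :: "('m::finite \<times> 'm) set"
  assumes S: "S \<noteq> {}"
  defines "G \<equiv> measure_fourier (delta_matrix S :: (real^'n) set \<Rightarrow> complex^'m^'m)"
  shows "G \<in> Linfty_space"
    and "measure_N (delta_matrix S :: (real^'n) set \<Rightarrow> complex^'m^'m) = 1"
    and "\<exists>T. bounded_extension_L1 G T \<and>
      (\<forall>W. (\<forall>l. real (card {k. (l, k) \<in> S}) \<le> W) \<longrightarrow> L1_entry_onorm T \<le> fourier_const TYPE('n) * W) \<and>
      (\<forall>l. fourier_const TYPE('n) * real (card {k. (l, k) \<in> S}) \<le> L1_entry_onorm T)"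
proof -
  interpret matrix_polar_decomposition "delta_matrix S :: (real^'n) set \<Rightarrow> complex^'m^'m" "delta_polar S" "\<lambda>_ _ _. 1"
    by (rule delta_matrix_polar)
  have V: "V l k = (if (l, k) \<in> S then 1 else 0)" for l k
    by (simp add: V_def delta_polar_def measure_return)
  have sV: "(\<Sum>k\<in>UNIV. V l k) = real (card {k. (l, k) \<in> S})" for l
    unfolding V by (simp add: sum.If_cases)
  obtain l0 k0 where lk: "(l0, k0) \<in> S" using S by (cases "S = {}") auto
  show "measure_N (delta_matrix S :: (real^'n) set \<Rightarrow> complex^'m^'m) = 1"
  proof (rule antisym)
    obtain l k where "measure_N (delta_matrix S :: (real^'n) set \<Rightarrow> complex^'m^'m) = V l k" using N_attained by blast
    then show "measure_N (delta_matrix S :: (real^'n) set \<Rightarrow> complex^'m^'m) \<le> 1" by (simp add: V)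
    show "1 \<le> measure_N (delta_matrix S :: (real^'n) set \<Rightarrow> complex^'m^'m)" using V_le_N[of l0 k0] lk by (simp add: V)
  qed
  have "hat l k y = (if (l, k) \<in> S then 1 else 0)" for l k y
    by (simp add: hat_def delta_polar_def integral_return integral_null_measure)
  then have G: "G = (\<lambda>_. \<chi> l k. complex_of_real (fourier_const TYPE('n)) * (if (l, k) \<in> S then 1 else 0))"
    by (simp add: G_def fun_eq_iff vec_eq_iff measure_fourier_nth)
  have Gm: "G \<in> borel_measurable lebesgue" unfolding G by simp
  show "G \<in> Linfty_space"
  proof -
    define A where "A = (\<chi> l k. complex_of_real (fourier_const TYPE('n)) * (if (l, k) \<in> S then 1 else 0))"
    have "esssup lebesgue (\<lambda>x::real^'n. ereal (mat_opnorm A)) \<le> ereal (mat_opnorm A)"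
      by (rule esssup_I) auto
    then have "esssup lebesgue (\<lambda>x::real^'n. ereal (mat_opnorm A)) < \<infinity>"
      by (rule le_less_trans) simp
    then show ?thesis unfolding Linfty_space_def using Gm by (simp add: G A_def[symmetric])
  qed
  have "bounded_extension_L1 G conv_op" by (rule conv_op_extension[OF Gm]) (simp add: G_def)
  moreover have "L1_entry_onorm conv_op \<le> fourier_const TYPE('n) * W" if "\<forall>l. real (card {k. (l, k) \<in> S}) \<le> W" for W
    by (rule conv_op_onorm_le(1)) (use that in \<open>simp add: sV\<close>)
  moreover have "fourier_const TYPE('n) * real (card {k. (l, k) \<in> S}) \<le> L1_entry_onorm conv_op" for l
    using conv_op_onorm_ge[of l] unfolding sV .
  ultimately show "\<exists>T. bounded_extension_L1 G T \<and>
      (\<forall>W. (\<forall>l. real (card {k. (l, k) \<in> S}) \<le> W) \<longrightarrow> L1_entry_onorm T \<le> fourier_const TYPE('n) * W) \<and>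
      (\<forall>l. fourier_const TYPE('n) * real (card {k. (l, k) \<in> S}) \<le> L1_entry_onorm T)" by blast
qed

theorem theorem4p4:
  fixes F :: "real^'n \<Rightarrow> complex^'m^'m"
  assumes "F \<in> Linfty_space"
  shows "((\<exists>T. bounded_extension_L1 F T) \<longleftrightarrow>
            (\<exists>\<mu>\<in>matrix_measures. AE x in lebesgue. F x = measure_fourier \<mu> x))
       \<and> (\<forall>T. \<forall>\<mu>\<in>matrix_measures.
            bounded_extension_L1 F T \<longrightarrow> (AE x in lebesgue. F x = measure_fourier \<mu> x) \<longrightarrow>
              fourier_const TYPE('n) * measure_N \<mu> \<le> L1_entry_onorm T \<and>
              L1_entry_onorm T \<le> real CARD('m) * fourier_const TYPE('n) * measure_N \<mu>)
       \<and> (\<forall>c::real.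
            (\<forall>(G :: real^'n \<Rightarrow> complex^'m^'m) \<in> Linfty_space. \<forall>T. \<forall>\<mu>\<in>matrix_measures.
               bounded_extension_L1 G T \<longrightarrow> (AE x in lebesgue. G x = measure_fourier \<mu> x) \<longrightarrow>
                 c * measure_N \<mu> \<le> L1_entry_onorm T)
            \<longrightarrow> c \<le> fourier_const TYPE('n))
       \<and> (\<forall>C::real.
            (\<forall>(G :: real^'n \<Rightarrow> complex^'m^'m) \<in> Linfty_space. \<forall>T. \<forall>\<mu>\<in>matrix_measures.
               bounded_extension_L1 G T \<longrightarrow> (AE x in lebesgue. G x = measure_fourier \<mu> x) \<longrightarrow>
                 L1_entry_onorm T \<le> C * measure_N \<mu>)
            \<longrightarrow> real CARD('m) * fourier_const TYPE('n) \<le> C)"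
proof (intro conjI allI ballI impI)
  have Fm: "F \<in> borel_measurable lebesgue" using assms by (simp add: Linfty_space_def)
  show "(\<exists>T. bounded_extension_L1 F T) \<longleftrightarrow>
      (\<exists>\<mu>\<in>matrix_measures. AE x in lebesgue. F x = measure_fourier \<mu> x)"
    using extension_imp_measure[OF assms] measure_imp_extension_onorm(1)[OF Fm] by blast
  fix T and \<mu> :: "(real^'n) set \<Rightarrow> complex^'m^'m"
  assume "\<mu> \<in> matrix_measures" "bounded_extension_L1 F T" "AE x in lebesgue. F x = measure_fourier \<mu> x"
  then show "fourier_const TYPE('n) * measure_N \<mu> \<le> L1_entry_onorm T"
    "L1_entry_onorm T \<le> real CARD('m) * fourier_const TYPE('n) * measure_N \<mu>"
    using measure_imp_extension_onorm(2,3)[OF Fm] by blast+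
next
  fix c :: real
  assume c: "\<forall>(G :: real^'n \<Rightarrow> complex^'m^'m) \<in> Linfty_space. \<forall>T. \<forall>\<mu>\<in>matrix_measures.
       bounded_extension_L1 G T \<longrightarrow> (AE x in lebesgue. G x = measure_fourier \<mu> x) \<longrightarrow>
         c * measure_N \<mu> \<le> L1_entry_onorm T"
  \<comment> \<open>\<open>undefined\<close> serves as some index. Every row count is at most 1, so
    the norm is at most \<open>fourier_const\<close>, while \<open>measure_N\<close> is 1.\<close>
  define S :: "('m \<times> 'm) set" where "S = {(undefined, undefined)}"
  have S: "S \<noteq> {}" by (simp add: S_def)
  let ?\<mu> = "delta_matrix S :: (real^'n) set \<Rightarrow> complex^'m^'m"
  obtain T where T: "bounded_extension_L1 (measure_fourier ?\<mu>) T"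
    "\<And>W. (\<forall>l. real (card {k. (l, k) \<in> S}) \<le> W) \<Longrightarrow> L1_entry_onorm T \<le> fourier_const TYPE('n) * W"
    using delta_matrix_extension(3)[OF S, where ?'n='n] by blast
  have "c * measure_N ?\<mu> \<le> L1_entry_onorm T"
    using c[rule_format, OF delta_matrix_extension(1)[OF S, where ?'n='n] delta_matrix_measures T(1)] by simp
  also have "\<dots> \<le> fourier_const TYPE('n) * 1"
  proof (intro T(2) allI)
    fix l :: 'm
    have "card {k. (l, k) \<in> S} \<le> card {undefined :: 'm}" by (rule card_mono) (auto simp: S_def)
    then show "real (card {k. (l, k) \<in> S}) \<le> 1" by simp
  qed
  finally show "c \<le> fourier_const TYPE('n)" by (simp add: delta_matrix_extension(2)[OF S])
next
  fix C :: real
  assume C: "\<forall>(G :: real^'n \<Rightarrow> complex^'m^'m) \<in> Linfty_space. \<forall>T. \<forall>\<mu>\<in>matrix_measures.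
       bounded_extension_L1 G T \<longrightarrow> (AE x in lebesgue. G x = measure_fourier \<mu> x) \<longrightarrow>
         L1_entry_onorm T \<le> C * measure_N \<mu>"
  \<comment> \<open>Every row now counts \<open>m\<close> entries, so the norm reaches
    \<open>m\<close> times \<open>fourier_const\<close>, while \<open>measure_N\<close> remains
    1.\<close>
  define S :: "('m \<times> 'm) set" where "S = UNIV"
  have S: "S \<noteq> {}" by (simp add: S_def)
  let ?\<mu> = "delta_matrix S :: (real^'n) set \<Rightarrow> complex^'m^'m"
  obtain T where T: "bounded_extension_L1 (measure_fourier ?\<mu>) T"
    "\<And>l. fourier_const TYPE('n) * real (card {k. (l, k) \<in> S}) \<le> L1_entry_onorm T"
    using delta_matrix_extension(3)[OF S, where ?'n='n] by blast
  have "fourier_const TYPE('n) * real CARD('m) \<le> L1_entry_onorm T"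
    using T(2)[of undefined] by (simp add: S_def)
  also have "\<dots> \<le> C * measure_N ?\<mu>"
    using C[rule_format, OF delta_matrix_extension(1)[OF S, where ?'n='n] delta_matrix_measures T(1)] by simp
  finally show "real CARD('m) * fourier_const TYPE('n) \<le> C"
    by (simp add: delta_matrix_extension(2)[OF S] mult.commute)
qed

end
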